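(* (Implicit function theorem.) Let $U\subset R^m\times R^n$ be open and let $f=f(x,y)=(f_1,\dots,f_n)\in(C^\omega_{\mathcal M}(U))^n$. Let $(a,b)\in U$ with $f(a,b)=0$ and $\big(\frac{\partial f_j}{\partial y_k}(a,b)\big)_{1\le j,k\le n}\in\mathrm{GL}(n,R)$. Then there are definable open neighbourhoods $V$ of $a$ and $W$ of $b$ with $V\times W\subset U$ and a map $\varphi\in(C^\omega_{\mathcal M}(V))^n$ with $\varphi(V)\subset W$ such that for all $(x,y)\in V\times W$: $f(x,y)=0$ if and only if $y=\varphi(x)$.
   Context: $\mathcal M$ is an o-minimal structure expanding a real closed field $R$; "definable" means definable in $\mathcal M$ with parameters from $R$. $K=R[\sqrt{-1}]$ is identified with $R^2$, $K^p$ with $R^{2p}$ (topology from $|x+iy|=\sqrt{x^2+y^2}$), and $R^p$ is viewed as $(R\times\{0\})^p\subset K^p$. For open definable $V\subset K^p$, a definable $F:V\to K$ is $K$-differentiable if it is continuous and for each $j$ and $z\in V$ the limit $\lim_{h\to0,\,h\in K\setminus\{0\}}(F(z+he_j)-F(z))/h$ exists in $K$. For open $U\subset R^p$, a definable $f:U\to R$ is $R$-analytic if for every $a\in U$ there are an open neighbourhood $U_a$ of $a$ in $U$, an open $V_a\subset K^p$ with $U_a\subset V_a$ and a definable $K$-differentiable $F:V_a\to K$ with $F|_{U_a}=f|_{U_a}$. $C^\omega_{\mathcal M}(U)$ is the set of definable $R$-analytic functions $U\to R$. *)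

theory Defs
  imports "Jordan_Normal_Form.Matrix"
begin

text \<open>\<open>R\<^sup>n\<close> is \<open>carrier_vec n\<close>, and \<open>(x, y) \<in> R\<^sup>m \<times> R\<^sup>n\<close> is \<open>x @\<^sub>v y \<in> R\<^sup>m\<^sup>+\<^sup>n\<close>. Coordinates are numbered from 0.
  A map defined on \<open>U\<close> is a total function of which only the values on \<open>U\<close> matter.\<close>

class real_closed_field = linordered_field +
  assumes nonneg_has_sqrt: "0 \<le> a \<Longrightarrow> \<exists>b. b * b = a"
    and odd_degree_has_root: "odd n \<Longrightarrow> f n \<noteq> 0 \<Longrightarrow> \<exists>x. (\<Sum>k\<le>n. f k * x ^ k) = 0"


section \<open>O-minimal structures\<close>

text \<open>A structure expanding the ordered field \<open>R\<close>: the symbols of ordered rings are built into the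
  language and have their given meaning, the record interprets the additional symbols. A symbol
  applied to argument lists of different lengths counts as one symbol for each arity.\<close>

record ('f, 'p, 'r) expansion =
  fun_interp :: "'f \<Rightarrow> 'r list \<Rightarrow> 'r"
  rel_interp :: "'p \<Rightarrow> 'r list \<Rightarrow> bool"

datatype 'f trm =
    Var nat
  | Zero
  | One
  | Add "'f trm" "'f trm"
  | Minus "'f trm"
  | Mult "'f trm" "'f trm"
  | Fn 'f "'f trm list"

datatype ('f, 'p) fml =
    Equal "'f trm" "'f trm"
  | Less "'f trm" "'f trm"
  | Rel 'p "'f trm list"
  | Neg "('f, 'p) fml"
  | Conj "('f, 'p) fml" "('f, 'p) fml"
  | Exists nat "('f, 'p) fml"

primrec trm_val :: "('f, 'p, 'r::linordered_field) expansion \<Rightarrow> (nat \<Rightarrow> 'r) \<Rightarrow> 'f trm \<Rightarrow> 'r" where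
  "trm_val M e (Var i) = e i"
| "trm_val M e Zero = 0"
| "trm_val M e One = 1"
| "trm_val M e (Add s t) = trm_val M e s + trm_val M e t"
| "trm_val M e (Minus t) = - trm_val M e t"
| "trm_val M e (Mult s t) = trm_val M e s * trm_val M e t"
| "trm_val M e (Fn g ts) = fun_interp M g (map (trm_val M e) ts)"

primrec sat :: "('f, 'p, 'r::linordered_field) expansion \<Rightarrow> (nat \<Rightarrow> 'r) \<Rightarrow> ('f, 'p) fml \<Rightarrow> bool" where
  "sat M e (Equal s t) \<longleftrightarrow> trm_val M e s = trm_val M e t"
| "sat M e (Less s t) \<longleftrightarrow> trm_val M e s < trm_val M e t"
| "sat M e (Rel q ts) \<longleftrightarrow> rel_interp M q (map (trm_val M e) ts)"
| "sat M e (Neg \<phi>) \<longleftrightarrow> \<not> sat M e \<phi>"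
| "sat M e (Conj \<phi> \<psi>) \<longleftrightarrow> sat M e \<phi> \<and> sat M e \<psi>"
| "sat M e (Exists i \<phi>) \<longleftrightarrow> (\<exists>x. sat M (e(i := x)) \<phi>)"

text \<open>The variables \<open>0, \<dots>, n - 1\<close> are the coordinates of \<open>R\<^sup>n\<close>; the remaining free variables
  carry the parameters, whose values \<open>c\<close> are arbitrary elements of \<open>R\<close>.\<close>

definition definable :: "('f, 'p, 'r::linordered_field) expansion \<Rightarrow> nat \<Rightarrow> 'r vec set \<Rightarrow> bool" where
  "definable M n A \<longleftrightarrow>
     (\<exists>\<phi> c. A = {v \<in> carrier_vec n. sat M (\<lambda>i. if i < n then v $ i else c i) \<phi>})"

definition point_or_open_interval :: "'r::linorder set \<Rightarrow> bool" where
  "point_or_open_interval I \<longleftrightarrow>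
     (\<exists>a. I = {a}) \<or> (\<exists>a b. I = {a<..<b}) \<or> (\<exists>a. I = {a<..}) \<or> (\<exists>b. I = {..<b}) \<or> I = UNIV"

definition o_minimal :: "('f, 'p, 'r::linordered_field) expansion \<Rightarrow> bool" where
  "o_minimal M \<longleftrightarrow>
     (\<forall>A. definable M 1 A \<longrightarrow>
        (\<exists>S. finite S \<and> (\<forall>I\<in>S. point_or_open_interval I) \<and> (\<lambda>v. v $ 0) ` A = \<Union>S))"

definition graph_on :: "'a vec set \<Rightarrow> ('a vec \<Rightarrow> 'a) \<Rightarrow> 'a vec set" where
  "graph_on U f = (\<lambda>x. x @\<^sub>v vec 1 (\<lambda>_. f x)) ` U"


section \<open>The field \<open>K = R[\<surd>-1]\<close>\<close>

datatype 'r adjoin_i = Adjoin_I (re: 'r) (im: 'r)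

instantiation adjoin_i :: (linordered_field) field
begin

definition "0 = Adjoin_I 0 0"
definition "1 = Adjoin_I 1 0"
definition "z + w = Adjoin_I (re z + re w) (im z + im w)"
definition "- z = Adjoin_I (- re z) (- im z)"
definition "z - w = Adjoin_I (re z - re w) (im z - im w)"
definition "z * w = Adjoin_I (re z * re w - im z * im w) (re z * im w + im z * re w)"
definition "inverse z =
  Adjoin_I (re z / (re z * re z + im z * im z)) (- im z / (re z * re z + im z * im z))"
definition "z div w = z * inverse (w :: 'a adjoin_i)"

instance
proof
  fix z :: "'a adjoin_i"
  assume "z \<noteq> 0"
  then have "re z \<noteq> 0 \<or> im z \<noteq> 0"
    by (cases z) (simp add: zero_adjoin_i_def)
  then have "re z * re z + im z * im z \<noteq> 0"
    by (simp add: sum_squares_eq_zero_iff)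
  then show "inverse z * z = 1"
    by (simp add: times_adjoin_i_def inverse_adjoin_i_def one_adjoin_i_def
        add_divide_distrib [symmetric] mult.commute)
qed (auto simp: zero_adjoin_i_def one_adjoin_i_def plus_adjoin_i_def uminus_adjoin_i_def
    minus_adjoin_i_def times_adjoin_i_def inverse_adjoin_i_def divide_adjoin_i_def
    algebra_simps adjoin_i.expand)

end

definition of_R :: "'r::linordered_field \<Rightarrow> 'r adjoin_i" where
  "of_R x = Adjoin_I x 0"

definition absK :: "'r::real_closed_field adjoin_i \<Rightarrow> 'r" where
  "absK z = (THE r. 0 \<le> r \<and> r * r = re z * re z + im z * im z)"

lemma absK_nonneg: "0 \<le> absK z"
  and absK_square: "absK z * absK z = re z * re z + im z * im z"
proof -
  let ?s = "re z * re z + im z * im z"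
  have "0 \<le> ?s" by simp
  then obtain b where "b * b = ?s" using nonneg_has_sqrt by blast
  then have "0 \<le> \<bar>b\<bar> \<and> \<bar>b\<bar> * \<bar>b\<bar> = ?s" by simp
  moreover have "r = \<bar>b\<bar>" if "0 \<le> r \<and> r * r = ?s" for r
    using that \<open>b * b = ?s\<close> by (metis abs_of_nonneg square_eq_iff abs_minus)
  ultimately have "0 \<le> absK z \<and> absK z * absK z = ?s"
    unfolding absK_def by (rule theI)
  then show "0 \<le> absK z" "absK z * absK z = ?s" by auto
qed

text \<open>The identification of \<open>K\<^sup>p\<close> with \<open>R\<^sup>2\<^sup>p\<close>, used to speak of definable sets and functions over \<open>K\<close>.\<close>

definition realify :: "'r adjoin_i vec \<Rightarrow> 'r vec" where
  "realify z = vec (2 * dim_vec z) (\<lambda>i. (if even i then re else im) (z $ (i div 2)))"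


section \<open>Topology and derivatives\<close>

text \<open>The argument \<open>N\<close> is the absolute value: \<open>abs\<close> on \<open>R\<close> and \<open>absK\<close> on \<open>K\<close>.\<close>

definition polydisc :: "('a::field \<Rightarrow> 'r::linordered_field) \<Rightarrow> nat \<Rightarrow> 'a vec \<Rightarrow> 'r \<Rightarrow> 'a vec set" where
  "polydisc N p a \<epsilon> = {x \<in> carrier_vec p. \<forall>i<p. N (x $ i - a $ i) < \<epsilon>}"

definition openV :: "('a::field \<Rightarrow> 'r::linordered_field) \<Rightarrow> nat \<Rightarrow> 'a vec set \<Rightarrow> bool" where
  "openV N p U \<longleftrightarrow> U \<subseteq> carrier_vec p \<and> (\<forall>a\<in>U. \<exists>\<epsilon>>0. polydisc N p a \<epsilon> \<subseteq> U)"

definition continuousV ::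
    "('a::field \<Rightarrow> 'r::linordered_field) \<Rightarrow> nat \<Rightarrow> 'a vec set \<Rightarrow> ('a vec \<Rightarrow> 'a) \<Rightarrow> bool" where
  "continuousV N p U f \<longleftrightarrow>
     (\<forall>a\<in>U. \<forall>\<epsilon>>0. \<exists>\<delta>>0. \<forall>x \<in> U \<inter> polydisc N p a \<delta>. N (f x - f a) < \<epsilon>)"

text \<open>\<open>d\<close> is the limit of \<open>(f (a + h e\<^sub>j) - f a) / h\<close> for \<open>h \<rightarrow> 0\<close>, \<open>h \<noteq> 0\<close>. It is only used at interior
  points \<open>a\<close> of the domain of \<open>f\<close>, so \<open>a + h e\<^sub>j\<close> lies in the domain for small \<open>h\<close>.\<close>

definition has_partial_deriv ::
    "('a::field \<Rightarrow> 'r::linordered_field) \<Rightarrow> nat \<Rightarrow> ('a vec \<Rightarrow> 'a) \<Rightarrow> nat \<Rightarrow> 'a vec \<Rightarrow> 'a \<Rightarrow> bool" where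
  "has_partial_deriv N p f j a d \<longleftrightarrow>
     (\<forall>\<epsilon>>0. \<exists>\<delta>>0. \<forall>h. h \<noteq> 0 \<and> N h < \<delta> \<longrightarrow>
        N ((f (a + h \<cdot>\<^sub>v unit_vec p j) - f a) / h - d) < \<epsilon>)"

definition partial_deriv :: "nat \<Rightarrow> ('r::linordered_field vec \<Rightarrow> 'r) \<Rightarrow> nat \<Rightarrow> 'r vec \<Rightarrow> 'r" where
  "partial_deriv p f j a = (THE d. has_partial_deriv abs p f j a d)"


section \<open>\<open>R\<close>-analytic functions\<close>

text \<open>Definability of \<open>F : V \<rightarrow> K\<close>, i.e. of its graph in \<open>K\<^sup>p\<^sup>+\<^sup>1\<close>, includes definability of \<open>V\<close>.\<close>

definition K_differentiable ::
    "('f, 'p, 'r::real_closed_field) expansion \<Rightarrow> nat \<Rightarrow> 'r adjoin_i vec set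
     \<Rightarrow> ('r adjoin_i vec \<Rightarrow> 'r adjoin_i) \<Rightarrow> bool" where
  "K_differentiable M p V F \<longleftrightarrow>
     openV absK p V \<and> definable M (2 * (p + 1)) (realify ` graph_on V F) \<and>
     continuousV absK p V F \<and> (\<forall>j<p. \<forall>z\<in>V. \<exists>d. has_partial_deriv absK p F j z d)"

definition R_analytic ::
    "('f, 'p, 'r::real_closed_field) expansion \<Rightarrow> nat \<Rightarrow> 'r vec set \<Rightarrow> ('r vec \<Rightarrow> 'r) \<Rightarrow> bool" where
  "R_analytic M p U f \<longleftrightarrow>
     (\<forall>a\<in>U. \<exists>U\<^sub>a V\<^sub>a F. openV abs p U\<^sub>a \<and> a \<in> U\<^sub>a \<and> U\<^sub>a \<subseteq> U \<and>
        openV absK p V\<^sub>a \<and> map_vec of_R ` U\<^sub>a \<subseteq> V\<^sub>a \<and> K_differentiable M p V\<^sub>a F \<and>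
        (\<forall>x\<in>U\<^sub>a. F (map_vec of_R x) = of_R (f x)))"

definition C_omega ::
    "('f, 'p, 'r::real_closed_field) expansion \<Rightarrow> nat \<Rightarrow> 'r vec set \<Rightarrow> ('r vec \<Rightarrow> 'r) set" where
  "C_omega M p U =
     {f. openV abs p U \<and> definable M (p + 1) (graph_on U f) \<and> R_analytic M p U f}"

definition C_omega_map ::
    "('f, 'p, 'r::real_closed_field) expansion \<Rightarrow> nat \<Rightarrow> nat \<Rightarrow> 'r vec set \<Rightarrow> ('r vec \<Rightarrow> 'r vec) set" where
  "C_omega_map M p n U =
     {f. (\<forall>x\<in>U. f x \<in> carrier_vec n) \<and> (\<forall>j<n. (\<lambda>x. f x $ j) \<in> C_omega M p U)}"

end

theory Submission
  imports Defs "Jordan_Normal_Form.Determinant"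
begin

text \<open>The components of \<open>f\<close> extend near \<open>(a, b)\<close> to \<open>K\<close>-differentiable functions, so it suffices to solve the
  equation over \<open>K\<close> and to see that the solution is real at real points. Power series and integrals
  are not available over \<open>R\<close>; they are replaced by the maximum principle. Suppose \<open>Re f\<close> exceeds on the
  disc its bound \<open>\<mu>\<close> on the boundary circle, and let \<open>s\<close> be a value of \<open>Im f\<close> on \<open>{Re f > \<mu>}\<close>. Maximising
  \<open>Re f - k (Im f - s)\<^sup>2\<close> for large \<open>k\<close> yields a critical point of \<open>f\<close> at which \<open>Im f = s\<close>. By o-minimality
  a definable choice of such points is Lipschitz on an interval of \<open>s\<close>, which contradicts \<open>f' = 0\<close>;
  hence \<open>Im f\<close> takes only finitely many values there, and \<open>f\<close> would be constant up to the boundary.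

  Applied to differences of difference quotients, the maximum principle gives continuity of the partial
  derivatives, and thus strict differentiability. After multiplication by the inverse Jacobian the
  equation is a small Lipschitz perturbation of the identity in \<open>y\<close>. As \<open>R\<close> need not be complete, the
  solution is not found by iteration: it is the point of a closed polydisc at which the sum of the absolute
  values of the equations, a definable continuous function, is minimal. Minimising over the real points
  only shows that it is real at real points.\<close>

text \<open>What shapes the maximum principle is its use: the function there is a difference
  quotient, continued over its singular point by the value of the derivative. At that point it is
  known to be continuous and nothing more. Hence the centre of the disc is exempt from
  differentiability, and the alternative \<open>z = 0\<close> accompanies \<open>critical\<close>.
  It does no harm: one point contributes one level of the imaginary part, and a definable curve
  eventually either stays at it or avoids it. The theory of definable functions of one variable is
  cut down to this purpose. A vanishing derivative has to be passed along curves chosen definably,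
  and for that it suffices that such curves are continuous and one-sidedly Lipschitz off a finite
  set. Both follow once every interval contains one good point, because a definable exceptional set
  without interior is finite. The suprema behind all limits, extrema and inductions exist for
  definable sets only, so every auxiliary set has to be shown definable.\<close>

section \<open>Finite dependence and substitution for terms and formulas\<close>

lemma trm_val_finite_dep:
  "\<exists>N. \<forall>e e'. (\<forall>i<N. e i = e' i) \<longrightarrow> trm_val M e t = trm_val M e' t"
proof (induction t)
  case (Var i)
  show ?case by (intro exI[of _ "Suc i"]) auto
next
  case (Add s t)
  then obtain N1 N2 where N: "\<forall>e e'. (\<forall>i<N1. e i = e' i) \<longrightarrow> trm_val M e s = trm_val M e' s"
    "\<forall>e e'. (\<forall>i<N2. e i = e' i) \<longrightarrow> trm_val M e t = trm_val M e' t" by auto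
  have "trm_val M e (Add s t) = trm_val M e' (Add s t)" if "\<forall>i<max N1 N2. e i = e' i" for e e'
    using N[rule_format, of e e'] that by simp
  then show ?case by blast
next
  case (Mult s t)
  then obtain N1 N2 where N: "\<forall>e e'. (\<forall>i<N1. e i = e' i) \<longrightarrow> trm_val M e s = trm_val M e' s"
    "\<forall>e e'. (\<forall>i<N2. e i = e' i) \<longrightarrow> trm_val M e t = trm_val M e' t" by auto
  have "trm_val M e (Mult s t) = trm_val M e' (Mult s t)" if "\<forall>i<max N1 N2. e i = e' i" for e e'
    using N[rule_format, of e e'] that by simp
  then show ?case by blast
next
  case (Fn g ts)
  then have "\<forall>t\<in>set ts. \<exists>N. \<forall>e e'. (\<forall>i<N. e i = e' i) \<longrightarrow> trm_val M e t = trm_val M e' t" by auto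
  then obtain B where B: "\<forall>t\<in>set ts. \<forall>e e'. (\<forall>i<B t. e i = e' i) \<longrightarrow> trm_val M e t = trm_val M e' t"
    by metis
  have "trm_val M e (Fn g ts) = trm_val M e' (Fn g ts)" if "\<forall>i<sum_list (map B ts). e i = e' i" for e e'
  proof -
    have "trm_val M e t = trm_val M e' t" if "t \<in> set ts" for t
    proof -
      have "B t \<le> sum_list (map B ts)" using that by (simp add: member_le_sum_list)
      then show ?thesis using B that \<open>\<forall>i<sum_list (map B ts). e i = e' i\<close> by auto
    qed
    then show ?thesis by (simp cong: map_cong)
  qed
  then show ?case by blast
qed auto

lemma trm_list_finite_dep:
  "\<exists>N. \<forall>e e'. (\<forall>i<N. e i = e' i) \<longrightarrow> map (trm_val M e) ts = map (trm_val M e') ts"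
proof (induction ts)
  case (Cons t ts)
  then obtain N1 where N1: "\<forall>e e'. (\<forall>i<N1. e i = e' i) \<longrightarrow> map (trm_val M e) ts = map (trm_val M e') ts" by auto
  obtain N2 where N2: "\<forall>e e'. (\<forall>i<N2. e i = e' i) \<longrightarrow> trm_val M e t = trm_val M e' t"
    using trm_val_finite_dep by blast
  have "map (trm_val M e) (t # ts) = map (trm_val M e') (t # ts)" if "\<forall>i<max N1 N2. e i = e' i" for e e'
    using N1 N2 that by (simp add: less_max_iff_disj del: map_eq_conv)
  then show ?case by blast
qed auto

text \<open>Environments are infinite sequences. That a formula reads only finitely many entries
  provides fresh variables for renaming, and later lets a substitution for all variables be carried
  out as finitely many single ones.\<close>

lemma sat_finite_dep:
  "\<exists>N. \<forall>e e'. (\<forall>i<N. e i = e' i) \<longrightarrow> sat M e \<phi> = sat M e' \<phi>"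
proof (induction \<phi>)
  case (Equal s t)
  obtain N where N: "\<forall>e e'. (\<forall>i<N. e i = e' i) \<longrightarrow> map (trm_val M e) [s, t] = map (trm_val M e') [s, t]"
    using trm_list_finite_dep by blast
  have "sat M e (Equal s t) = sat M e' (Equal s t)" if "\<forall>i<N. e i = e' i" for e e'
    using N[rule_format, of e e'] that by simp
  then show ?case by blast
next
  case (Less s t)
  obtain N where N: "\<forall>e e'. (\<forall>i<N. e i = e' i) \<longrightarrow> map (trm_val M e) [s, t] = map (trm_val M e') [s, t]"
    using trm_list_finite_dep by blast
  have "sat M e (Less s t) = sat M e' (Less s t)" if "\<forall>i<N. e i = e' i" for e e'
    using N[rule_format, of e e'] that by simp
  then show ?case by blast
next
  case (Rel q ts)
  obtain N where N: "\<forall>e e'. (\<forall>i<N. e i = e' i) \<longrightarrow> map (trm_val M e) ts = map (trm_val M e') ts"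
    using trm_list_finite_dep by blast
  have "sat M e (Rel q ts) = sat M e' (Rel q ts)" if "\<forall>i<N. e i = e' i" for e e'
    using N[rule_format, of e e'] that by (simp del: map_eq_conv)
  then show ?case by blast
next
  case (Neg \<phi>)
  then show ?case by auto
next
  case (Conj \<phi> \<psi>)
  then obtain N1 N2 where N: "\<forall>e e'. (\<forall>i<N1. e i = e' i) \<longrightarrow> sat M e \<phi> = sat M e' \<phi>"
    "\<forall>e e'. (\<forall>i<N2. e i = e' i) \<longrightarrow> sat M e \<psi> = sat M e' \<psi>" by auto
  have "sat M e (Conj \<phi> \<psi>) = sat M e' (Conj \<phi> \<psi>)" if "\<forall>i<max N1 N2. e i = e' i" for e e'
    using N[rule_format, of e e'] that by simp
  then show ?case by blast
next
  case (Exists i \<phi>)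
  then obtain N where N: "\<forall>e e'. (\<forall>i<N. e i = e' i) \<longrightarrow> sat M e \<phi> = sat M e' \<phi>" by auto
  have "sat M e (Exists i \<phi>) = sat M e' (Exists i \<phi>)" if "\<forall>i<N. e i = e' i" for e e'
  proof -
    have "sat M (e(i := x)) \<phi> = sat M (e'(i := x)) \<phi>" for x using N that by auto
    then show ?thesis by simp
  qed
  then show ?case by blast
qed

lemma trm_subst:
  "\<exists>t'. \<forall>e. trm_val M e t' = trm_val M (\<lambda>i. trm_val M e (\<tau> i)) t"
proof (induction t)
  case (Var i)
  show ?case by (intro exI[of _ "\<tau> i"]) simp
next
  case Zero show ?case by (intro exI[of _ "Zero"]) simp
next
  case One show ?case by (intro exI[of _ "One"]) simp
next
  case (Add s t)
  then obtain s' t' where "\<forall>e. trm_val M e s' = trm_val M (\<lambda>i. trm_val M e (\<tau> i)) s"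
    "\<forall>e. trm_val M e t' = trm_val M (\<lambda>i. trm_val M e (\<tau> i)) t" by auto
  then show ?case by (intro exI[of _ "Add s' t'"]) simp
next
  case (Minus t)
  then obtain t' where "\<forall>e. trm_val M e t' = trm_val M (\<lambda>i. trm_val M e (\<tau> i)) t" by auto
  then show ?case by (intro exI[of _ "Minus t'"]) simp
next
  case (Mult s t)
  then obtain s' t' where "\<forall>e. trm_val M e s' = trm_val M (\<lambda>i. trm_val M e (\<tau> i)) s"
    "\<forall>e. trm_val M e t' = trm_val M (\<lambda>i. trm_val M e (\<tau> i)) t" by auto
  then show ?case by (intro exI[of _ "Mult s' t'"]) simp
next
  case (Fn g ts)
  then have "\<forall>t\<in>set ts. \<exists>t'. \<forall>e. trm_val M e t' = trm_val M (\<lambda>i. trm_val M e (\<tau> i)) t" by auto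
  then obtain G where "\<forall>t\<in>set ts. \<forall>e. trm_val M e (G t) = trm_val M (\<lambda>i. trm_val M e (\<tau> i)) t"
    by metis
  then show ?case by (intro exI[of _ "Fn g (map G ts)"]) (simp add: comp_def cong: map_cong)
qed

text \<open>Bound variables are named, so a quantified variable is renamed to one that is fresh for the
  finitely many substituted terms that matter.\<close>

lemma fml_subst:
  "\<exists>\<psi>. \<forall>e. sat M e \<psi> = sat M (\<lambda>i. trm_val M e (\<tau> i)) \<phi>"
proof (induction \<phi> arbitrary: \<tau>)
  case (Equal s t)
  obtain s' where "\<forall>e. trm_val M e s' = trm_val M (\<lambda>i. trm_val M e (\<tau> i)) s" using trm_subst by blast
  moreover obtain t' where "\<forall>e. trm_val M e t' = trm_val M (\<lambda>i. trm_val M e (\<tau> i)) t" using trm_subst by blast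
  ultimately show ?case by (intro exI[of _ "Equal s' t'"]) simp
next
  case (Less s t)
  obtain s' where "\<forall>e. trm_val M e s' = trm_val M (\<lambda>i. trm_val M e (\<tau> i)) s" using trm_subst by blast
  moreover obtain t' where "\<forall>e. trm_val M e t' = trm_val M (\<lambda>i. trm_val M e (\<tau> i)) t" using trm_subst by blast
  ultimately show ?case by (intro exI[of _ "Less s' t'"]) simp
next
  case (Rel q ts)
  obtain G where "\<forall>t e. trm_val M e (G t) = trm_val M (\<lambda>i. trm_val M e (\<tau> i)) t"
    using trm_subst by metis
  then show ?case by (intro exI[of _ "Rel q (map G ts)"]) (simp add: comp_def)
next
  case (Neg \<phi>)
  obtain \<psi> where "\<forall>e. sat M e \<psi> = sat M (\<lambda>i. trm_val M e (\<tau> i)) \<phi>" using Neg by blast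
  then show ?case by (intro exI[of _ "Neg \<psi>"]) simp
next
  case (Conj \<phi>1 \<phi>2)
  obtain \<psi>1 where "\<forall>e. sat M e \<psi>1 = sat M (\<lambda>i. trm_val M e (\<tau> i)) \<phi>1" using Conj by blast
  moreover obtain \<psi>2 where "\<forall>e. sat M e \<psi>2 = sat M (\<lambda>i. trm_val M e (\<tau> i)) \<phi>2" using Conj by blast
  ultimately show ?case by (intro exI[of _ "Conj \<psi>1 \<psi>2"]) simp
next
  case (Exists i \<phi>)
  obtain N where N: "\<forall>e e'. (\<forall>i<N. e i = e' i) \<longrightarrow> sat M e \<phi> = sat M e' \<phi>"
    using sat_finite_dep by blast
  obtain j where j: "\<forall>e e'. (\<forall>i<j. e i = e' i) \<longrightarrow>
      map (trm_val M e) (map \<tau> [0..<N]) = map (trm_val M e') (map \<tau> [0..<N])"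
    using trm_list_finite_dep by blast
  have fresh: "trm_val M (e(j := x)) (\<tau> k) = trm_val M e (\<tau> k)" if "k < N" for e x k
    using j[rule_format, of "e(j := x)" e] that by auto
  obtain \<psi> where \<psi>: "\<forall>e. sat M e \<psi> = sat M (\<lambda>k. trm_val M e ((\<tau>(i := Var j)) k)) \<phi>"
    using Exists by blast
  have "sat M (e(j := x)) \<psi> = sat M ((\<lambda>k. trm_val M e (\<tau> k))(i := x)) \<phi>" for e x
    unfolding \<psi>[rule_format] by (rule N[rule_format]) (simp add: fresh)
  then show ?case by (intro exI[of _ "Exists j \<psi>"]) simp
qed

definition interleave :: "(nat \<Rightarrow> 'r) \<Rightarrow> (nat \<Rightarrow> 'r) \<Rightarrow> nat \<Rightarrow> 'r" where
  "interleave e c i = (if even i then e (i div 2) else c (i div 2))"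

lemma interleave_simps [simp]:
  "interleave e c (2 * i) = e i" "interleave e c (Suc (2 * i)) = c i"
  "interleave e c 0 = e 0" "interleave e c (Suc 0) = c 0"
  by (simp_all add: interleave_def)

lemma absK_eqI: "0 \<le> r \<Longrightarrow> r * r = re z * re z + im z * im z \<Longrightarrow> r = absK z"
  using absK_nonneg[of z] absK_square[of z] square_eq_iff[of r "absK z"] by auto

locale o_minimal_expansion =
  fixes M :: "('f, 'p, 'r::real_closed_field) expansion"
  assumes o_minimal: "o_minimal M"
begin

section \<open>Definable predicates and functions of an environment\<close>

text \<open>In the formula the even variables carry the environment and the odd ones the parameters, so
  neither is limited in number. Quantifiers act on the environment in de Bruijn style.\<close>

definition dpred :: "((nat \<Rightarrow> 'r) \<Rightarrow> bool) \<Rightarrow> bool" where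
  "dpred P \<longleftrightarrow> (\<exists>\<phi> c. \<forall>e. P e = sat M (interleave e c) \<phi>)"

definition dfun :: "((nat \<Rightarrow> 'r) \<Rightarrow> 'r) \<Rightarrow> bool" where
  "dfun t \<longleftrightarrow> dpred (\<lambda>e. e 0 = t (\<lambda>i. e (Suc i)))"

text \<open>Formulas evaluated at terms in environment and parameters may be used directly;
  \<open>fml_subst\<close> absorbs the terms, so no substituted formula has to be written
  down.\<close>

lemma dpred_of_sat:
  assumes "\<And>e. P e = sat M (\<lambda>i. trm_val M (interleave e c) (\<tau> i)) \<phi>"
  shows "dpred P"
proof -
  obtain \<psi> where "\<forall>e. sat M e \<psi> = sat M (\<lambda>i. trm_val M e (\<tau> i)) \<phi>" using fml_subst by blast
  then have "P e = sat M (interleave e c) \<psi>" for e using assms by simp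
  then show ?thesis unfolding dpred_def by blast
qed

lemma dpred_finite_dep:
  assumes "dpred P"
  shows "\<exists>N. \<forall>e e'. (\<forall>i<N. e i = e' i) \<longrightarrow> P e = P e'"
proof -
  obtain \<phi> c where P: "\<And>e. P e = sat M (interleave e c) \<phi>" using assms by (auto simp: dpred_def)
  obtain N where N: "\<forall>e e'. (\<forall>i<N. e i = e' i) \<longrightarrow> sat M e \<phi> = sat M e' \<phi>"
    using sat_finite_dep by blast
  have "P e = P e'" if "\<forall>i<N. e i = e' i" for e e'
    unfolding P by (rule N[rule_format]) (use that in \<open>auto simp: interleave_def\<close>)
  then show ?thesis by blast
qed

lemma dpred_not: "dpred P \<Longrightarrow> dpred (\<lambda>e. \<not> P e)"
  unfolding dpred_def by (metis sat.simps(4))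

lemma dpred_ren:
  assumes "dpred P" shows "dpred (\<lambda>e. P (\<lambda>i. e (\<sigma> i)))"
proof -
  obtain \<phi> c where P: "\<And>e. P e = sat M (interleave e c) \<phi>" using assms by (auto simp: dpred_def)
  show ?thesis
  proof (rule dpred_of_sat)
    fix e :: "nat \<Rightarrow> 'r"
    have "interleave (\<lambda>i. e (\<sigma> i)) c =
       (\<lambda>i. trm_val M (interleave e c) (if even i then Var (2 * \<sigma> (i div 2)) else Var i))"
      by (auto simp: interleave_def fun_eq_iff)
    then show "P (\<lambda>i. e (\<sigma> i)) = sat M (\<lambda>i. trm_val M (interleave e c)
      (if even i then Var (2 * \<sigma> (i div 2)) else Var i)) \<phi>"
      unfolding P by simp
  qed
qed

text \<open>The two formulas come with separate parameter sequences \<open>c\<close> and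
  \<open>d\<close>. These are merged by interleaving once more, and the odd variables of each
  formula are redirected to its half of the merged sequence.\<close>

lemma dpred_conj:
  assumes "dpred P" "dpred Q" shows "dpred (\<lambda>e. P e \<and> Q e)"
proof -
  obtain \<phi> c where P: "\<And>e. P e = sat M (interleave e c) \<phi>" using assms by (auto simp: dpred_def)
  obtain \<psi> d where Q: "\<And>e. Q e = sat M (interleave e d) \<psi>" using assms by (auto simp: dpred_def)
  define \<tau>1 \<tau>2 :: "nat \<Rightarrow> 'f trm" where "\<tau>1 = (\<lambda>i. if even i then Var i else Var (Suc (2 * (2 * (i div 2)))))"
    and "\<tau>2 = (\<lambda>i. if even i then Var i else Var (Suc (2 * (Suc (2 * (i div 2))))))"
  obtain \<phi>' where 1: "\<forall>e. sat M e \<phi>' = sat M (\<lambda>i. trm_val M e (\<tau>1 i)) \<phi>" using fml_subst by blast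
  obtain \<psi>' where 2: "\<forall>e. sat M e \<psi>' = sat M (\<lambda>i. trm_val M e (\<tau>2 i)) \<psi>" using fml_subst by blast
  have "trm_val M (interleave e (interleave c d)) (\<tau>1 k) = interleave e c k \<and>
    trm_val M (interleave e (interleave c d)) (\<tau>2 k) = interleave e d k" for e k
    unfolding \<tau>1_def \<tau>2_def by (simp only: if_distrib[of "trm_val M _"] trm_val.simps interleave_simps) (simp add: interleave_def)
  then have "(\<lambda>i. trm_val M (interleave e (interleave c d)) (\<tau>1 i)) = interleave e c"
    "(\<lambda>i. trm_val M (interleave e (interleave c d)) (\<tau>2 i)) = interleave e d" for e by auto
  then have "(P e \<and> Q e) = sat M (interleave e (interleave c d)) (Conj \<phi>' \<psi>')" for e
    unfolding P Q sat.simps 1[rule_format] 2[rule_format] by simp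
  then show ?thesis unfolding dpred_def by blast
qed

text \<open>The quantified value sits at position 0 of the environment, which has to disappear,
  while a formula can only bind a named variable. Shifting the parameters by one place with
  \<open>case_nat 0 c\<close> frees variable 1, which is bound in its stead. In
  \<open>\<tau>\<close> the environment entries accordingly move down by one place and the
  parameters up by one.\<close>

lemma dpred_ex:
  assumes "dpred (\<lambda>e. P (\<lambda>i. e (Suc i)) (e 0))" shows "dpred (\<lambda>e. \<exists>x. P e x)"
proof -
  obtain \<phi> c where P: "\<And>e. P (\<lambda>i. e (Suc i)) (e 0) = sat M (interleave e c) \<phi>"
    using assms by (auto simp: dpred_def)
  define \<tau> :: "nat \<Rightarrow> 'f trm" where "\<tau> = (\<lambda>i. if i = 0 then Var 1 else if even i then Var (i - 2) else Var (i + 2))"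
  obtain \<psi> where \<psi>: "\<forall>e. sat M e \<psi> = sat M (\<lambda>i. trm_val M e (\<tau> i)) \<phi>" using fml_subst by blast
  have "P e x = sat M ((interleave e (case_nat 0 c))(1 := x)) \<psi>" for e x
  proof -
    have "interleave (case_nat x e) c k = trm_val M ((interleave e (case_nat 0 c))(1 := x)) (\<tau> k)" for k
    proof (cases "even k")
      case True
      then obtain j where j: "k = 2 * j" by blast
      show ?thesis
      proof (cases j)
        case 0
        then show ?thesis using j by (simp add: \<tau>_def)
      next
        case (Suc i)
        then have "k - 2 = 2 * i" "2 * i \<noteq> 1" "k \<noteq> 0" using j by presburger+
        moreover have "interleave (case_nat x e) c k = e i" using j Suc by (simp only: interleave_simps nat.case)
        ultimately show ?thesis using True by (simp add: \<tau>_def)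
      qed
    next
      case False
      then obtain j where j: "k = Suc (2 * j)" using oddE by fastforce
      then have "k + 2 = Suc (2 * Suc j)" by simp
      then have "interleave e (case_nat 0 c) (k + 2) = c j" by (simp only: interleave_simps nat.case)
      then show ?thesis using j by (simp add: \<tau>_def)
    qed
    then have "interleave (case_nat x e) c = (\<lambda>k. trm_val M ((interleave e (case_nat 0 c))(1 := x)) (\<tau> k))"
      by blast
    then show ?thesis using P[of "case_nat x e"] \<psi> by simp
  qed
  then have "(\<exists>x. P e x) = sat M (interleave e (case_nat 0 c)) (Exists 1 \<psi>)" for e by simp
  then show ?thesis unfolding dpred_def by blast
qed

lemma dfun_ren: "dfun t \<Longrightarrow> dfun (\<lambda>e. t (\<lambda>i. e (\<sigma> i)))"
  unfolding dfun_def
  by (drule dpred_ren[where \<sigma> = "\<lambda>i. case i of 0 \<Rightarrow> 0 | Suc j \<Rightarrow> Suc (\<sigma> j)"]) simp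

lemma dfun_var: "dfun (\<lambda>e. e i)"
  unfolding dfun_def
  by (rule dpred_of_sat[where \<tau> = Var and \<phi> = "Equal (Var 0) (Var (2 * Suc i))"])
    (simp del: mult_Suc_right)

text \<open>A definable function need not be given by a term, so its value enters through an
  existential quantifier over its graph, one coordinate at a time. Finite dependence leaves only
  finitely many coordinates to treat; the others are replaced by mere variables.\<close>

lemma dpred_subst:
  assumes "dpred P" "\<And>i. dfun (t i)"
  shows "dpred (\<lambda>e. P (\<lambda>i. t i e))"
proof -
  \<comment> \<open>\<open>N\<close> bounds the coordinates that may carry an arbitrary function.
    From \<open>N\<close> on there are only renamings, which \<open>dpred_ren\<close> handles
    without quantifiers.\<close>
  have main: "dpred (\<lambda>e. P (\<lambda>i. t i e))" if "\<And>i. dfun (t i)" "\<And>i. N \<le> i \<Longrightarrow> t i = (\<lambda>e. e (\<sigma> i))" for N t \<sigma>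
    using that
  proof (induction N arbitrary: t \<sigma>)
    case 0
    then show ?case using dpred_ren[OF assms(1)] by simp
  next
    case (Suc N)
    \<comment> \<open>The value of \<open>t N\<close> is put in front of the environment as a new
      variable, and all other coordinates read the environment shifted by one. Coordinate
      \<open>N\<close> thereby becomes a renaming, and the induction hypothesis applies.\<close>
    define t' where "t' = (\<lambda>i e. if i = N then e 0 else t i (\<lambda>k. e (Suc k)))"
    have "dfun (t' i)" for i
      by (cases "i = N") (simp_all add: t'_def dfun_var dfun_ren[OF Suc.prems(1)])
    moreover have "t' i = (\<lambda>e. e ((\<lambda>i. if i = N then 0 else Suc (\<sigma> i)) i))" if "N \<le> i" for i
      using that Suc.prems(2)[of i] by (cases "i = N") (auto simp: t'_def)
    ultimately have "dpred (\<lambda>e. P (\<lambda>i. t' i e))" by (rule Suc.IH)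
    moreover have "dpred (\<lambda>e. e 0 = t N (\<lambda>i. e (Suc i)))" using Suc.prems(1) by (simp add: dfun_def)
    ultimately have "dpred (\<lambda>e. e 0 = t N (\<lambda>i. e (Suc i)) \<and> P (\<lambda>i. t' i e))" by (rule dpred_conj[rotated])
    then have "dpred (\<lambda>e. e 0 = t N (\<lambda>i. e (Suc i)) \<and> P (\<lambda>i. if i = N then e 0 else t i (\<lambda>k. e (Suc k))))"
      by (simp only: t'_def)
    from dpred_ex[where P = "\<lambda>e x. x = t N e \<and> P (\<lambda>i. if i = N then x else t i e)", OF this]
    have "dpred (\<lambda>e. \<exists>x. x = t N e \<and> P (\<lambda>i. if i = N then x else t i e))" .
    moreover have "(\<exists>x. x = t N e \<and> P (\<lambda>i. if i = N then x else t i e)) = P (\<lambda>i. t i e)" for e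
    proof -
      have "(\<lambda>i. if i = N then t N e else t i e) = (\<lambda>i. t i e)" by auto
      then show ?thesis by simp
    qed
    ultimately show ?case by simp
  qed
  obtain N where N: "\<forall>e e'. (\<forall>i<N. e i = e' i) \<longrightarrow> P e = P e'"
    using dpred_finite_dep[OF assms(1)] by blast
  have "dpred (\<lambda>e. P (\<lambda>i. (if i < N then t i else (\<lambda>e. e i)) e))"
    by (rule main[where N = N and \<sigma> = "\<lambda>i. i"]) (auto simp: assms dfun_var)
  moreover have "P (\<lambda>i. (if i < N then t i else (\<lambda>e. e i)) e) = P (\<lambda>i. t i e)" for e
    using N by auto
  ultimately show ?thesis by simp
qed

lemma dfun_subst:
  assumes "dfun s" "\<And>i. dfun (t i)"
  shows "dfun (\<lambda>e. s (\<lambda>i. t i e))"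
proof -
  have "dfun (case_nat (\<lambda>e. e 0) (\<lambda>i e. t i (\<lambda>k. e (Suc k))) j)" for j
    by (cases j) (simp_all add: dfun_var dfun_ren[OF assms(2)])
  from dpred_subst[OF assms(1)[unfolded dfun_def], of "case_nat (\<lambda>e. e 0) (\<lambda>i e. t i (\<lambda>k. e (Suc k)))", OF this]
  show ?thesis by (simp add: dfun_def)
qed

text \<open>The way in for functions outside the language: quotients, the absolute value of
  \<open>K\<close>, canonical choices and finally the implicit function are definable because a
  definable \<open>P\<close> describes their graphs.\<close>

lemma dfunI:
  assumes "dpred (\<lambda>e. P (\<lambda>i. e (Suc i)) (e 0))" "\<And>e x. P e x \<longleftrightarrow> x = t e"
  shows "dfun t"
  using assms by (simp add: dfun_def)

named_theorems dintro

lemma dpred_const [dintro]: "dpred (\<lambda>e. B)"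
proof (cases B)
  case True
  then show ?thesis by (intro dpred_of_sat[where \<tau> = Var and \<phi> = "Equal Zero Zero"]) simp
next
  case False
  then show ?thesis by (intro dpred_of_sat[where \<tau> = Var and \<phi> = "Less Zero Zero"]) simp
qed

lemma dfun_const [dintro]: "dfun (\<lambda>e. c)"
  unfolding dfun_def
  by (rule dpred_of_sat[where \<tau> = Var and \<phi> = "Equal (Var 0) (Var 1)" and c = "\<lambda>_. c"]) simp

lemmas [dintro] = dfun_var dpred_not dpred_conj dpred_ex

lemma dpred_disj [dintro]:
  assumes "dpred P" "dpred Q" shows "dpred (\<lambda>e. P e \<or> Q e)"
proof -
  have "dpred (\<lambda>e. \<not> (\<not> P e \<and> \<not> Q e))" by (intro dpred_conj dpred_not assms)
  moreover have "(\<lambda>e. \<not> (\<not> P e \<and> \<not> Q e)) = (\<lambda>e. P e \<or> Q e)" by auto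
  ultimately show ?thesis by simp
qed

lemma dpred_imp [dintro]:
  assumes "dpred P" "dpred Q" shows "dpred (\<lambda>e. P e \<longrightarrow> Q e)"
proof -
  have "dpred (\<lambda>e. \<not> (P e \<and> \<not> Q e))" by (intro dpred_conj dpred_not assms)
  moreover have "(\<lambda>e. \<not> (P e \<and> \<not> Q e)) = (\<lambda>e. P e \<longrightarrow> Q e)" by auto
  ultimately show ?thesis by simp
qed

lemma dpred_all [dintro]:
  assumes "dpred (\<lambda>e. P (\<lambda>i. e (Suc i)) (e 0))" shows "dpred (\<lambda>e. \<forall>x. P e x)"
  using dpred_not[OF dpred_ex[where P = "\<lambda>e x. \<not> P e x", OF dpred_not[OF assms]]] by simp

lemma dpred_finite_all [dintro]:
  assumes "\<And>i. i < n \<Longrightarrow> dpred (\<lambda>e. P i e)" shows "dpred (\<lambda>e. \<forall>i<(n::nat). P i e)"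
  using assms
proof (induction n)
  case (Suc n)
  then have "dpred (\<lambda>e. (\<forall>i<n. P i e) \<and> P n e)" by (intro dpred_conj) auto
  then show ?case by (simp add: All_less_Suc conj_commute)
qed (simp add: dpred_const)

lemma dpred_eq [dintro]:
  assumes "dfun s" "dfun t" shows "dpred (\<lambda>e. s e = t e)"
proof -
  have 1: "dpred (\<lambda>e. e 0 = e 1)"
    by (rule dpred_of_sat[where \<tau> = Var and \<phi> = "Equal (Var (2 * 0)) (Var (2 * 1))"])
      (simp only: trm_val.simps sat.simps interleave_simps)
  have 2: "dfun (if i = 0 then s else t)" for i :: nat using assms by simp
  show ?thesis using dpred_subst[where t = "\<lambda>i. if i = 0 then s else t", OF 1 2] by simp
qed

lemma dpred_less [dintro]:
  assumes "dfun s" "dfun t" shows "dpred (\<lambda>e. s e < t e)"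
proof -
  have 1: "dpred (\<lambda>e. e 0 < e 1)"
    by (rule dpred_of_sat[where \<tau> = Var and \<phi> = "Less (Var (2 * 0)) (Var (2 * 1))"])
      (simp only: trm_val.simps sat.simps interleave_simps)
  have 2: "dfun (if i = 0 then s else t)" for i :: nat using assms by simp
  show ?thesis using dpred_subst[where t = "\<lambda>i. if i = 0 then s else t", OF 1 2] by simp
qed

lemma dpred_le [dintro]: "dfun s \<Longrightarrow> dfun t \<Longrightarrow> dpred (\<lambda>e. s e \<le> t e)"
  using dpred_not[OF dpred_less[of t s]] by (simp add: not_less)

lemma dfun_if [dintro]:
  assumes "dpred P" "dfun s" "dfun t" shows "dfun (\<lambda>e. if P e then s e else t e)"
proof (rule dfunI[where P = "\<lambda>e x. (P e \<and> x = s e) \<or> (\<not> P e \<and> x = t e)"])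
  show "dpred (\<lambda>e. (P (\<lambda>i. e (Suc i)) \<and> e 0 = s (\<lambda>i. e (Suc i))) \<or> (\<not> P (\<lambda>i. e (Suc i)) \<and> e 0 = t (\<lambda>i. e (Suc i))))"
    by (intro dpred_disj dpred_conj dpred_not dpred_eq dfun_var dpred_ren[OF assms(1)] dfun_ren[OF assms(2)] dfun_ren[OF assms(3)])
qed auto

lemma dfun_binop:
  assumes "dpred (\<lambda>e. e 0 = g (e 1) (e 2))" "dfun s" "dfun t"
  shows "dfun (\<lambda>e. g (s e) (t e))"
proof -
  have "dfun (\<lambda>e. g (e 0) (e 1))"
    using assms(1) by (simp add: dfun_def numeral_2_eq_2)
  moreover have "dfun (if i = 0 then s else t)" for i :: nat using assms by simp
  ultimately show ?thesis using dfun_subst[of "\<lambda>e. g (e 0) (e 1)" "\<lambda>i. if i = 0 then s else t"] by simp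
qed

lemma dfun_add [dintro]: "dfun s \<Longrightarrow> dfun t \<Longrightarrow> dfun (\<lambda>e. s e + t e)"
  by (rule dfun_binop[where g = "(+)"],
      rule dpred_of_sat[where \<tau> = Var and \<phi> = "Equal (Var (2*0)) (Add (Var (2*1)) (Var (2*2)))"])
   (simp_all only: trm_val.simps sat.simps interleave_simps)

lemma dfun_mult [dintro]: "dfun s \<Longrightarrow> dfun t \<Longrightarrow> dfun (\<lambda>e. s e * t e)"
  by (rule dfun_binop[where g = "(*)"],
      rule dpred_of_sat[where \<tau> = Var and \<phi> = "Equal (Var (2*0)) (Mult (Var (2*1)) (Var (2*2)))"])
   (simp_all only: trm_val.simps sat.simps interleave_simps)

lemma dfun_minus [dintro]: "dfun s \<Longrightarrow> dfun (\<lambda>e. - s e)"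
  using dfun_mult[OF dfun_const[of "-1"]] by simp

lemma dfun_diff [dintro]: "dfun s \<Longrightarrow> dfun t \<Longrightarrow> dfun (\<lambda>e. s e - t e)"
  using dfun_add[OF _ dfun_minus] by simp

lemma dfun_divide [dintro]:
  assumes "dfun s" "dfun t" shows "dfun (\<lambda>e. s e / t e)"
\<comment> \<open>Division is no symbol of the language. The first disjunct records the value 0 that
  HOL gives to a quotient by zero.\<close>
proof (rule dfunI[where P = "\<lambda>e x. (t e = 0 \<and> x = 0) \<or> (t e \<noteq> 0 \<and> x * t e = s e)"])
  show "dpred (\<lambda>e. (t (\<lambda>i. e (Suc i)) = 0 \<and> e 0 = 0) \<or>
     (t (\<lambda>i. e (Suc i)) \<noteq> 0 \<and> e 0 * t (\<lambda>i. e (Suc i)) = s (\<lambda>i. e (Suc i))))"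
    by (intro dpred_disj dpred_conj dpred_not dpred_eq dfun_mult dfun_var dfun_const dfun_ren[OF assms(1)] dfun_ren[OF assms(2)])
qed (metis div_by_0 nonzero_eq_divide_eq)

lemma dfun_abs [dintro]: "dfun s \<Longrightarrow> dfun (\<lambda>e. \<bar>s e\<bar>)"
  unfolding abs_if by (intro dintro)

lemma dfun_sum [dintro]:
  assumes "\<And>i. i < n \<Longrightarrow> dfun (\<lambda>e. s i e)" shows "dfun (\<lambda>e. \<Sum>i<(n::nat). s i e)"
  using assms by (induction n) (simp_all add: dfun_const dfun_add)

definition dfunK :: "((nat \<Rightarrow> 'r) \<Rightarrow> 'r adjoin_i) \<Rightarrow> bool" where
  "dfunK t \<longleftrightarrow> dfun (\<lambda>e. re (t e)) \<and> dfun (\<lambda>e. im (t e))"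

lemma dfun_re [dintro]: "dfunK t \<Longrightarrow> dfun (\<lambda>e. re (t e))"
  and dfun_im [dintro]: "dfunK t \<Longrightarrow> dfun (\<lambda>e. im (t e))"
  by (simp_all add: dfunK_def)

lemma dfunK_const [dintro]: "dfunK (\<lambda>e. c)"
  unfolding dfunK_def by (intro conjI dintro)

lemma dfunK_Adjoin_I [dintro]: "dfun s \<Longrightarrow> dfun t \<Longrightarrow> dfunK (\<lambda>e. Adjoin_I (s e) (t e))"
  by (simp add: dfunK_def)

lemma dfunK_of_R [dintro]: "dfun s \<Longrightarrow> dfunK (\<lambda>e. of_R (s e))"
  unfolding of_R_def by (intro dintro)

lemma dfunK_add [dintro]: "dfunK s \<Longrightarrow> dfunK t \<Longrightarrow> dfunK (\<lambda>e. s e + t e)"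
  unfolding plus_adjoin_i_def by (intro dintro)

lemma dfunK_diff [dintro]: "dfunK s \<Longrightarrow> dfunK t \<Longrightarrow> dfunK (\<lambda>e. s e - t e)"
  unfolding minus_adjoin_i_def by (intro dintro)

lemma dfunK_mult [dintro]: "dfunK s \<Longrightarrow> dfunK t \<Longrightarrow> dfunK (\<lambda>e. s e * t e)"
  unfolding times_adjoin_i_def by (intro dintro)

lemma dfunK_divide [dintro]: "dfunK s \<Longrightarrow> dfunK t \<Longrightarrow> dfunK (\<lambda>e. s e / t e)"
  unfolding divide_adjoin_i_def inverse_adjoin_i_def
  by (intro dintro)

lemma dfunK_if [dintro]:
  assumes "dpred P" "dfunK s" "dfunK t" shows "dfunK (\<lambda>e. if P e then s e else t e)"
  using assms unfolding dfunK_def if_distrib[of re] if_distrib[of im] by (simp add: dfun_if)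

lemma dpred_eqK [dintro]:
  assumes "dfunK s" "dfunK t" shows "dpred (\<lambda>e. s e = t e)"
proof -
  have "dpred (\<lambda>e. re (s e) = re (t e) \<and> im (s e) = im (t e))" using assms by (intro dintro)
  moreover have "(\<lambda>e. re (s e) = re (t e) \<and> im (s e) = im (t e)) = (\<lambda>e. s e = t e)"
    by (auto simp: fun_eq_iff intro: adjoin_i.expand)
  ultimately show ?thesis by simp
qed

lemma dfun_absK [dintro]:
  assumes "dfunK s" shows "dfun (\<lambda>e. absK (s e))"
proof (rule dfunI[where P = "\<lambda>e x. 0 \<le> x \<and> x * x = re (s e) * re (s e) + im (s e) * im (s e)"])
  show "dpred (\<lambda>e. 0 \<le> e 0 \<and> e 0 * e 0 = re (s (\<lambda>i. e (Suc i))) * re (s (\<lambda>i. e (Suc i))) +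
                          im (s (\<lambda>i. e (Suc i))) * im (s (\<lambda>i. e (Suc i))))"
    by (intro dpred_conj dpred_le dpred_eq dfun_add dfun_mult dfun_var dfun_const
        dfun_ren[OF dfun_re[OF assms]] dfun_ren[OF dfun_im[OF assms]])
qed (use absK_eqI absK_nonneg absK_square in blast)

lemma dpred_exK [dintro]:
  assumes "dpred (\<lambda>e. P (\<lambda>i. e (Suc (Suc i))) (Adjoin_I (e 1) (e 0)))"
  shows "dpred (\<lambda>e. \<exists>z. P e z)"
proof -
  have "dpred (\<lambda>e. \<exists>x y. P e (Adjoin_I x y))"
    by (rule dpred_ex[where P = "\<lambda>e x. \<exists>y. P e (Adjoin_I x y)"],
        rule dpred_ex[where P = "\<lambda>e y. P (\<lambda>i. e (Suc i)) (Adjoin_I (e 0) y)"]) (use assms in simp)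
  moreover have "(\<exists>z. Q z) = (\<exists>x y. Q (Adjoin_I x y))" for Q :: "'r adjoin_i \<Rightarrow> bool"
    by (metis adjoin_i.exhaust)
  ultimately show ?thesis by simp
qed

lemma dpred_allK [dintro]:
  assumes "dpred (\<lambda>e. P (\<lambda>i. e (Suc (Suc i))) (Adjoin_I (e 1) (e 0)))"
  shows "dpred (\<lambda>e. \<forall>z. P e z)"
  using dpred_not[OF dpred_exK[where P = "\<lambda>e x. \<not> P e x", OF dpred_not[OF assms]]] by simp

section \<open>Comparison with definable sets\<close>

text \<open>In \<open>definable\<close> the first \<open>n\<close> variables are coordinates and the
  others parameters; here both are sorted into even and odd variables, and back. Even variables
  beyond the \<open>n\<close> coordinates have no counterpart on the way back and become
  \<open>Zero\<close>; the odd ones are lined up behind the coordinates.\<close>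

lemma definable_iff_dpred:
  "definable M n A \<longleftrightarrow> A \<subseteq> carrier_vec n \<and> dpred (\<lambda>e. vec n e \<in> A)"
proof
  assume "definable M n A"
  then obtain \<phi> c where A: "A = {v \<in> carrier_vec n. sat M (\<lambda>i. if i < n then v $ i else c i) \<phi>}"
    by (auto simp: definable_def)
  have "dpred (\<lambda>e. vec n e \<in> A)"
  proof (rule dpred_of_sat)
    fix e :: "nat \<Rightarrow> 'r"
    have "(\<lambda>i. if i < n then vec n e $ i else c i) =
      (\<lambda>i. trm_val M (interleave e c) (if i < n then Var (2 * i) else Var (Suc (2 * i))))"
      by auto
    then show "vec n e \<in> A = sat M (\<lambda>i. trm_val M (interleave e c)
      (if i < n then Var (2 * i) else Var (Suc (2 * i)))) \<phi>"
      by (simp add: A)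
  qed
  then show "A \<subseteq> carrier_vec n \<and> dpred (\<lambda>e. vec n e \<in> A)" using A by auto
next
  assume A: "A \<subseteq> carrier_vec n \<and> dpred (\<lambda>e. vec n e \<in> A)"
  then obtain \<phi> c where P: "\<And>e. vec n e \<in> A \<longleftrightarrow> sat M (interleave e c) \<phi>" by (auto simp: dpred_def)
  define \<tau> :: "nat \<Rightarrow> 'f trm" where
    "\<tau> = (\<lambda>i. if even i then (if i div 2 < n then Var (i div 2) else Zero) else Var (n + i div 2))"
  obtain \<psi> where \<psi>: "\<forall>e. sat M e \<psi> = sat M (\<lambda>i. trm_val M e (\<tau> i)) \<phi>" using fml_subst by blast
  have "v \<in> A \<longleftrightarrow> sat M (\<lambda>i. if i < n then v $ i else c (i - n)) \<psi>" if "v \<in> carrier_vec n" for v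
  proof -
    have "interleave (\<lambda>i. if i < n then v $ i else 0) c =
      (\<lambda>i. trm_val M (\<lambda>i. if i < n then v $ i else c (i - n)) (\<tau> i))"
      by (auto simp: \<tau>_def interleave_def fun_eq_iff)
    moreover have "vec n (\<lambda>i. if i < n then v $ i else 0) = v" using that by auto
    ultimately show ?thesis using P[of "\<lambda>i. if i < n then v $ i else 0"] \<psi> by simp
  qed
  then have "A = {v \<in> carrier_vec n. sat M (\<lambda>i. if i < n then v $ i else c (i - n)) \<psi>}"
    using A by auto
  then show "definable M n A"
    unfolding definable_def by (intro exI[of _ \<psi>] exI[of _ "\<lambda>i. c (i - n)"]) simp
qed

end

section \<open>Tame subsets of the line\<close>

text \<open>For finite \<open>B\<close> this says that \<open>S\<close> is a finite union of points
  of \<open>B\<close> and of gaps between them, without a list of the pieces. In this form break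
  points can be added freely, which makes unions easy.\<close>

definition separates :: "'a::linorder set \<Rightarrow> 'a set \<Rightarrow> bool" where
  "separates B S \<longleftrightarrow> (\<forall>x y. x < y \<and> {x..y} \<inter> B = {} \<longrightarrow> (x \<in> S \<longleftrightarrow> y \<in> S))"

definition tame :: "'a::linorder set \<Rightarrow> bool" where
  "tame S \<longleftrightarrow> (\<exists>B. finite B \<and> separates B S)"

lemma separates_mono: "separates B S \<Longrightarrow> B \<subseteq> B' \<Longrightarrow> separates B' S"
  unfolding separates_def by blast

lemma separatesD:
  assumes "separates B S" "\<And>b. b \<in> B \<Longrightarrow> b < x \<and> b < y \<or> x < b \<and> y < b"
  shows "x \<in> S \<longleftrightarrow> y \<in> S"
proof (cases x y rule: linorder_cases)
  case less
  have "{x..y} \<inter> B = {}" using assms(2) less by force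
  then show ?thesis using assms(1) less unfolding separates_def by blast
next
  case greater
  have "{y..x} \<inter> B = {}" using assms(2) greater by force
  then show ?thesis using assms(1) greater unfolding separates_def by blast
qed simp

lemma tame_point_or_open_interval:
  assumes "point_or_open_interval I" shows "tame I"
proof -
  have "\<exists>B. finite B \<and> separates B {a}" for a :: 'a
    by (rule exI[of _ "{a}"]) (auto simp: separates_def)
  moreover have "\<exists>B. finite B \<and> separates B {a<..<b}" for a b :: 'a
    by (rule exI[of _ "{a, b}"]) (auto simp: separates_def)
  moreover have "\<exists>B. finite B \<and> separates B {a<..}" for a :: 'a
    by (rule exI[of _ "{a}"]) (auto simp: separates_def)
  moreover have "\<exists>B. finite B \<and> separates B {..<b}" for b :: 'a
    by (rule exI[of _ "{b}"]) (auto simp: separates_def)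
  moreover have "\<exists>B. finite B \<and> separates B (UNIV :: 'a set)"
    by (rule exI[of _ "{}"]) (auto simp: separates_def)
  ultimately show ?thesis using assms unfolding point_or_open_interval_def tame_def by auto
qed

lemma tame_Union:
  assumes "finite \<S>" "\<And>I. I \<in> \<S> \<Longrightarrow> tame I" shows "tame (\<Union>\<S>)"
proof -
  obtain B where B: "\<And>I. I \<in> \<S> \<Longrightarrow> finite (B I) \<and> separates (B I) I"
    using assms(2) unfolding tame_def by metis
  have "separates (\<Union>(B ` \<S>)) (\<Union>\<S>)"
    unfolding separates_def
  proof (intro allI impI)
    fix x y assume xy: "x < y \<and> {x..y} \<inter> \<Union>(B ` \<S>) = {}"
    have "x \<in> I \<longleftrightarrow> y \<in> I" if "I \<in> \<S>" for I
    proof -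
      have "{x..y} \<inter> B I = {}" using xy that by blast
      then show ?thesis using B[OF that] xy unfolding separates_def by blast
    qed
    then show "x \<in> \<Union>\<S> \<longleftrightarrow> y \<in> \<Union>\<S>" by blast
  qed
  then show ?thesis unfolding tame_def using assms(1) B by blast
qed

lemma finite_gap_right:
  fixes x :: "'a::linordered_field"
  assumes "finite B" shows "\<exists>\<delta>>0. \<forall>b\<in>B. b \<le> x \<or> x + \<delta> \<le> b"
  using assms
proof induction
  case empty
  show ?case by (intro exI[of _ 1]) simp
next
  case (insert b B)
  then obtain \<delta> where "\<delta> > 0" "\<forall>b\<in>B. b \<le> x \<or> x + \<delta> \<le> b" by blast
  then show ?case
    by (intro exI[of _ "if b \<le> x then \<delta> else min \<delta> (b - x)"]) (auto simp: min_def)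
qed

lemma finite_gap_left:
  fixes x :: "'a::linordered_field"
  assumes "finite B" shows "\<exists>\<delta>>0. \<forall>b\<in>B. x \<le> b \<or> b \<le> x - \<delta>"
proof -
  obtain \<delta> where "\<delta> > 0" "\<forall>b\<in>uminus ` B. b \<le> - x \<or> - x + \<delta> \<le> b"
    using finite_gap_right[of "uminus ` B" "- x"] assms by auto
  then show ?thesis by (intro exI[of _ \<delta>]) auto
qed

lemma tame_right:
  fixes x :: "'a::linordered_field"
  assumes "tame S"
  shows "\<exists>\<delta>>0. (\<forall>y. x < y \<and> y < x + \<delta> \<longrightarrow> y \<in> S) \<or> (\<forall>y. x < y \<and> y < x + \<delta> \<longrightarrow> y \<notin> S)"
proof -
  obtain B where B: "finite B" "separates B S" using assms unfolding tame_def by blast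
  obtain \<delta> where \<delta>: "\<delta> > 0" "\<forall>b\<in>B. b \<le> x \<or> x + \<delta> \<le> b" using finite_gap_right[OF B(1)] by blast
  have "y \<in> S \<longleftrightarrow> x + \<delta> / 2 \<in> S" if "x < y" "y < x + \<delta>" for y
  proof (rule separatesD[OF B(2)])
    fix b assume "b \<in> B"
    then have "b \<le> x \<or> x + \<delta> \<le> b" using \<delta>(2) by blast
    then show "b < y \<and> b < x + \<delta>/2 \<or> y < b \<and> x + \<delta>/2 < b" using that \<delta>(1) by auto
  qed
  then show ?thesis using \<delta>(1) by blast
qed

lemma tame_left:
  fixes x :: "'a::linordered_field"
  assumes "tame S"
  shows "\<exists>\<delta>>0. (\<forall>y. x - \<delta> < y \<and> y < x \<longrightarrow> y \<in> S) \<or> (\<forall>y. x - \<delta> < y \<and> y < x \<longrightarrow> y \<notin> S)"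
proof -
  obtain B where B: "finite B" "separates B S" using assms unfolding tame_def by blast
  obtain \<delta> where \<delta>: "\<delta> > 0" "\<forall>b\<in>B. x \<le> b \<or> b \<le> x - \<delta>" using finite_gap_left[OF B(1)] by blast
  have "y \<in> S \<longleftrightarrow> x - \<delta> / 2 \<in> S" if "x - \<delta> < y" "y < x" for y
  proof (rule separatesD[OF B(2)])
    fix b assume "b \<in> B"
    then have "x \<le> b \<or> b \<le> x - \<delta>" using \<delta>(2) by blast
    then show "b < y \<and> b < x - \<delta>/2 \<or> y < b \<and> x - \<delta>/2 < b" using that \<delta>(1) by auto
  qed
  then show ?thesis using \<delta>(1) by blast
qed

lemma tame_at_top:
  fixes S :: "'a::linordered_field set"
  assumes "tame S"
  shows "\<exists>k. (\<forall>y>k. y \<in> S) \<or> (\<forall>y>k. y \<notin> S)"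
proof -
  obtain B where B: "finite B" "separates B S" using assms unfolding tame_def by blast
  define k where "k = Max (insert 0 B)"
  have k: "b \<le> k" if "b \<in> B" for b using that B(1) by (simp add: k_def)
  have "y \<in> S \<longleftrightarrow> k + 1 \<in> S" if "k < y" for y
  proof (rule separatesD[OF B(2)])
    fix b assume "b \<in> B"
    then have "b \<le> k" by (rule k)
    then show "b < y \<and> b < k + 1 \<or> y < b \<and> k + 1 < b" using that by (auto intro: le_less_trans)
  qed
  then show ?thesis by blast
qed

text \<open>\<open>R\<close> need not be complete, but membership in a tame set changes only at
  finitely many points. Let \<open>b\<close> be the largest break point that some element of
  \<open>S\<close> reaches. Either \<open>b\<close> bounds \<open>S\<close>, or an element lies in
  the gap after \<open>b\<close>; then the whole gap belongs to \<open>S\<close>, and its right end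
  \<open>b'\<close> is the supremum.\<close>

lemma tame_lub:
  fixes S :: "'a::linordered_field set"
  assumes "tame S" "x0 \<in> S" "\<And>x. x \<in> S \<Longrightarrow> x \<le> u"
  shows "\<exists>s. (\<forall>x\<in>S. x \<le> s) \<and> (\<forall>y. (\<forall>x\<in>S. x \<le> y) \<longrightarrow> s \<le> y)"
proof -
  obtain B where B: "finite B" "separates B S" using assms unfolding tame_def by blast
  \<comment> \<open>With \<open>x0\<close> adjoined there is a break point that some element of
    \<open>S\<close> reaches; with \<open>u\<close> adjoined there is one beyond \<open>b\<close>
    whenever \<open>b\<close> is not an upper bound.\<close>
  define C where "C = insert x0 (insert u B) \<inter> {x0..u}"
  have C: "finite C" "x0 \<in> C" "u \<in> C" using B(1) assms(2,3) by (auto simp: C_def)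
  define b where "b = Max {b \<in> C. \<exists>x\<in>S. b \<le> x}"
  have "b \<in> {b \<in> C. \<exists>x\<in>S. b \<le> x}" unfolding b_def by (rule Max_in) (use C assms(2) in auto)
  then have b: "b \<in> C" "\<exists>x\<in>S. b \<le> x" by auto
  have bmax: "c \<le> b" if "c \<in> C" "\<exists>x\<in>S. c \<le> x" for c
    unfolding b_def by (rule Max_ge) (use C that in auto)
  show ?thesis
  proof (cases "\<forall>x\<in>S. x \<le> b")
    case True
    then show ?thesis using b(2) by (intro exI[of _ b]) force
  next
    case False
    then obtain x where x: "x \<in> S" "b < x" by force
    define b' where "b' = Min {c \<in> C. b < c}"
    have ne: "u \<in> {c \<in> C. b < c}" using C x assms(3)[of x] by force
    have "b' \<in> {c \<in> C. b < c}" unfolding b'_def by (rule Min_in) (use C ne in auto)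
    then have b': "b' \<in> C" "b < b'" by auto
    have b'min: "b' \<le> c" if "c \<in> C" "b < c" for c
      unfolding b'_def by (rule Min_le) (use C that in auto)
    have ub: "y < b'" if "y \<in> S" for y using bmax[OF b'(1)] b'(2) that by force
    have "y \<in> S" if "b < y" "y < b'" for y
    proof -
      have "x \<in> S \<longleftrightarrow> y \<in> S"
      proof (rule separatesD[OF B(2)])
        fix c assume c: "c \<in> B"
        have "x0 \<le> b" "b' \<le> u" using b(1) b'(1) by (auto simp: C_def)
        then have "c \<le> b \<or> b' \<le> c" using c b'min[of c] unfolding C_def by force
        then show "c < x \<and> c < y \<or> x < c \<and> y < c" using that x(2) ub[OF x(1)] by auto
      qed
      then show ?thesis using x(1) by simp
    qed note inS = this
    have "b' \<le> y" if "\<forall>x\<in>S. x \<le> y" for y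
    proof (rule ccontr)
      assume "\<not> b' \<le> y"
      then have "max b y < b'" using b'(2) by auto
      then obtain z where "max b y < z" "z < b'" using dense by blast
      then have "z \<in> S" "y < z" using inS by auto
      then show False using that by force
    qed
    then show ?thesis using ub by (intro exI[of _ b']) force
  qed
qed

text \<open>The form in which o-minimality is applied to functions: a definable property holds off a
  finite set as soon as every interval contains one point where it holds.\<close>

lemma tame_finite:
  fixes S :: "'a::linordered_field set"
  assumes "tame S" "\<And>x y. x < y \<Longrightarrow> \<exists>z. x < z \<and> z < y \<and> z \<notin> S"
  shows "finite S"
proof -
  obtain B where B: "finite B" "separates B S" using assms unfolding tame_def by blast
  have "S \<subseteq> B"
  proof
    fix x assume x: "x \<in> S"
    show "x \<in> B"
    proof (rule ccontr)
      assume "x \<notin> B"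
      obtain \<delta> where \<delta>: "\<delta> > 0" "\<forall>b\<in>B. b \<le> x \<or> x + \<delta> \<le> b" using finite_gap_right[OF B(1)] by blast
      obtain z where z: "x < z" "z < x + \<delta>" "z \<notin> S" using assms(2)[of x "x + \<delta>"] \<delta>(1) by auto
      have "{x..z} \<inter> B = {}" using \<delta>(2) z \<open>x \<notin> B\<close> by force
      then show False using B(2) z x unfolding separates_def by blast
    qed
  qed
  then show ?thesis using B(1) finite_subset by blast
qed

text \<open>The topological boundary. A separating set is merely known to exist, whereas this set is
  given by a first-order condition on \<open>S\<close> and so varies definably when \<open>S\<close>
  runs through a definable family.\<close>

definition boundary :: "'a::linordered_field set \<Rightarrow> 'a set" where
  "boundary S = {b. \<forall>\<delta>>0. \<exists>x y. \<bar>x - b\<bar> < \<delta> \<and> \<bar>y - b\<bar> < \<delta> \<and> x \<in> S \<and> y \<notin> S}"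

lemma separates_remove:
  assumes "separates B S" "b \<notin> boundary S" shows "separates (B - {b}) S"
  unfolding separates_def
proof (intro allI impI)
  fix x y assume xy: "x < y \<and> {x..y} \<inter> (B - {b}) = {}"
  have out: "c = b \<or> c < x \<or> y < c" if "c \<in> B" for c
    using xy that by (metis DiffI Int_iff atLeastAtMost_iff empty_iff not_less singletonD)
  obtain \<delta> where \<delta>: "\<delta> > 0" "\<And>x y. \<bar>x - b\<bar> < \<delta> \<Longrightarrow> \<bar>y - b\<bar> < \<delta> \<Longrightarrow> x \<in> S \<Longrightarrow> y \<in> S"
    using assms(2) unfolding boundary_def by blast
  show "x \<in> S \<longleftrightarrow> y \<in> S"
  proof (cases "b \<in> {x..y}")
    case False
    then show ?thesis using xy assms(1) unfolding separates_def by blast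
  next
    case True
    have "x \<in> S \<longleftrightarrow> b \<in> S"
    proof (cases "x = b")
      case False
      \<comment> \<open>Close enough to \<open>b\<close> to share its membership in
        \<open>S\<close>, yet between \<open>x\<close> and \<open>b\<close>, so that no point of
        \<open>B\<close> separates it from \<open>x\<close>.\<close>
      define x' where "x' = max x (b - \<delta>/2)"
      have x': "x \<le> x'" "x' < b" "\<bar>x' - b\<bar> < \<delta>" using \<delta>(1) True False by (auto simp: x'_def max_def)
      have "x \<in> S \<longleftrightarrow> x' \<in> S"
      proof (rule separatesD[OF assms(1)])
        fix c assume "c \<in> B"
        then have "c = b \<or> c < x \<or> y < c" by (rule out)
        then show "c < x \<and> c < x' \<or> x < c \<and> x' < c" using x'(1,2) True by auto
      qed
      moreover have "x' \<in> S \<longleftrightarrow> b \<in> S" using \<delta>(2)[OF x'(3), of b] \<delta>(2)[of b x', OF _ x'(3)] \<delta>(1) by auto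
      ultimately show ?thesis by simp
    qed simp
    moreover have "y \<in> S \<longleftrightarrow> b \<in> S"
    proof (cases "y = b")
      case False
      define x' where "x' = min y (b + \<delta>/2)"
      have x': "x' \<le> y" "b < x'" "\<bar>x' - b\<bar> < \<delta>" using \<delta>(1) True False by (auto simp: x'_def min_def)
      have "y \<in> S \<longleftrightarrow> x' \<in> S"
      proof (rule separatesD[OF assms(1)])
        fix c assume "c \<in> B"
        then have "c = b \<or> c < x \<or> y < c" by (rule out)
        then show "c < y \<and> c < x' \<or> y < c \<and> x' < c" using x'(1,2) True by auto
      qed
      moreover have "x' \<in> S \<longleftrightarrow> b \<in> S" using \<delta>(2)[OF x'(3), of b] \<delta>(2)[of b x', OF _ x'(3)] \<delta>(1) by auto
      ultimately show ?thesis by simp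
    qed simp
    ultimately show ?thesis by blast
  qed
qed

text \<open>Points outside the boundary can be discarded from a finite separating set one after the
  other, and no boundary point can be missing from it, because membership is constant near a point
  off \<open>B\<close>.\<close>

lemma tame_boundary:
  assumes "tame S" shows "finite (boundary S)" "separates (boundary S) S"
proof -
  obtain B where B: "finite B" "separates B S" using assms unfolding tame_def by blast
  have "separates (B - D) S" if "finite D" "D \<inter> boundary S = {}" for D
    using that
  proof induction
    case (insert b D)
    then have "separates (B - D - {b}) S" by (intro separates_remove) auto
    moreover have "B - D - {b} = B - insert b D" by auto
    ultimately show ?case by simp
  qed (simp add: B)
  then have "separates (B - (B - boundary S)) S" using B(1) by blast
  then show "separates (boundary S) S" by (rule separates_mono) auto
  show "finite (boundary S)"
  proof (rule finite_subset[OF _ B(1)], rule subsetI, rule ccontr)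
    fix b assume b: "b \<in> boundary S" "b \<notin> B"
    obtain \<delta>1 where \<delta>1: "\<delta>1 > 0" "\<forall>b'\<in>B. b' \<le> b \<or> b + \<delta>1 \<le> b'" using finite_gap_right[OF B(1)] by blast
    obtain \<delta>2 where \<delta>2: "\<delta>2 > 0" "\<forall>b'\<in>B. b \<le> b' \<or> b' \<le> b - \<delta>2" using finite_gap_left[OF B(1)] by blast
    obtain x y where xy: "\<bar>x - b\<bar> < min \<delta>1 \<delta>2" "\<bar>y - b\<bar> < min \<delta>1 \<delta>2" "x \<in> S" "y \<notin> S"
      using b(1) \<delta>1(1) \<delta>2(1) unfolding boundary_def by (auto dest: spec[of _ "min \<delta>1 \<delta>2"])
    have "x \<in> S \<longleftrightarrow> y \<in> S"
    proof (rule separatesD[OF B(2)])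
      fix b' assume b': "b' \<in> B"
      then have "b' \<noteq> b" "b' \<le> b \<or> b + \<delta>1 \<le> b'" "b \<le> b' \<or> b' \<le> b - \<delta>2" using \<delta>1(2) \<delta>2(2) b(2) by blast+
      then show "b' < x \<and> b' < y \<or> x < b' \<and> y < b'" using xy(1,2) by (auto simp: abs_less_iff)
    qed
    then show False using xy(3,4) by simp
  qed
qed

text \<open>A nonempty tame set contains one of these finitely many points, so their minimum
  is a canonical element.\<close>

definition candidates :: "'a::linordered_field set \<Rightarrow> 'a set" where
  "candidates S = {x \<in> S. x = 0 \<or> (\<exists>b\<in>boundary S. x = b + 1 \<or> x = b - 1) \<or>
     (\<exists>b\<in>boundary S. \<exists>c\<in>boundary S. x = (b + c) / 2)}"

lemma candidates_finite: "tame S \<Longrightarrow> finite (candidates S)"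
proof -
  assume "tame S"
  then have f: "finite (boundary S)" by (rule tame_boundary)
  have "candidates S \<subseteq> {0} \<union> (\<lambda>b. b + 1) ` boundary S \<union> (\<lambda>b. b - 1) ` boundary S \<union>
    (\<Union>b\<in>boundary S. \<Union>c\<in>boundary S. {(b + c) / 2})" (is "_ \<subseteq> ?F")
    unfolding candidates_def by blast
  moreover have "finite ?F" using f by simp
  ultimately show ?thesis by (rule finite_subset)
qed

text \<open>Off the boundary, the whole gap around \<open>x\<close> lies in \<open>S\<close>. The
  four cases tell whether that gap is bounded on the left and on the right, and each kind of gap has
  a point prescribed in \<open>candidates\<close>.\<close>

lemma candidates_nonempty:
  assumes "tame S" "x \<in> S" shows "candidates S \<noteq> {}"
proof (cases "x \<in> boundary S")
  case True
  \<comment> \<open>A boundary point is the midpoint of itself and itself.\<close>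
  then have "x \<in> candidates S" using assms(2) by (auto simp: candidates_def intro!: bexI[of _ x])
  then show ?thesis by blast
next
  case False
  let ?B = "boundary S"
  note f = tame_boundary(1)[OF assms(1)] and sep = tame_boundary(2)[OF assms(1)]
  have same: "y \<in> S" if "\<And>b. b \<in> ?B \<Longrightarrow> b < x \<and> b < y \<or> x < b \<and> y < b" for y
    using separatesD[OF sep, of x y] that assms(2) by blast
  define L where "L = {b \<in> ?B. b < x}"
  define G where "G = {b \<in> ?B. x < b}"
  have "b < x \<or> x < b" if "b \<in> ?B" for b using that False by (metis linorder_neqE)
  then have LG: "?B = L \<union> G" unfolding L_def G_def by blast
  have fLG: "finite L" "finite G" using f by (auto simp: L_def G_def)
  consider "L = {}" "G = {}" | "L = {}" "G \<noteq> {}" | "L \<noteq> {}" "G = {}" | "L \<noteq> {}" "G \<noteq> {}" by blast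
  then show ?thesis
  proof cases
    case 1
    then have "0 \<in> S" using LG by (intro same) auto
    then show ?thesis by (auto simp: candidates_def)
  next
    case 2
    have g: "Min G \<in> G" "\<And>b. b \<in> G \<Longrightarrow> Min G \<le> b" using fLG 2 by auto
    have "Min G - 1 \<in> S"
    proof (rule same)
      fix b assume "b \<in> ?B"
      then have "b \<in> G" using LG 2 by auto
      then have "x < b" "Min G \<le> b" using g by (auto simp: G_def)
      then show "b < x \<and> b < Min G - 1 \<or> x < b \<and> Min G - 1 < b" by (auto intro: less_le_trans)
    qed
    moreover have "Min G \<in> ?B" using g LG by auto
    ultimately have "Min G - 1 \<in> candidates S" unfolding candidates_def by blast
    then show ?thesis by blast
  next
    case 3
    have g: "Max L \<in> L" "\<And>b. b \<in> L \<Longrightarrow> b \<le> Max L" using fLG 3 by auto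
    have "Max L + 1 \<in> S"
    proof (rule same)
      fix b assume "b \<in> ?B"
      then have "b \<in> L" using LG 3 by auto
      then have "b < x" "b \<le> Max L" using g by (auto simp: L_def)
      then show "b < x \<and> b < Max L + 1 \<or> x < b \<and> Max L + 1 < b" by (auto intro: le_less_trans)
    qed
    moreover have "Max L \<in> ?B" using g LG by auto
    ultimately have "Max L + 1 \<in> candidates S" unfolding candidates_def by blast
    then show ?thesis by blast
  next
    case 4
    have g: "Min G \<in> G" "\<And>b. b \<in> G \<Longrightarrow> Min G \<le> b" "Max L \<in> L" "\<And>b. b \<in> L \<Longrightarrow> b \<le> Max L"
      using fLG 4 by auto
    then have lt: "Max L < x" "x < Min G" by (auto simp: L_def G_def)
    let ?m = "(Max L + Min G) / 2"
    have m: "Max L < ?m" "?m < Min G" using lt by (auto simp: field_simps)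
    have "?m \<in> S"
    proof (rule same)
      fix b assume "b \<in> ?B"
      then consider "b \<in> L" | "b \<in> G" using LG by auto
      then show "b < x \<and> b < ?m \<or> x < b \<and> ?m < b"
      proof cases
        case 1
        then have "b \<le> Max L" using g by blast
        then show ?thesis using lt m by auto
      next
        case 2
        then have "Min G \<le> b" using g by blast
        then show ?thesis using lt m by auto
      qed
    qed
    moreover have "Max L \<in> ?B" "Min G \<in> ?B" using g LG by auto
    ultimately have "?m \<in> candidates S" unfolding candidates_def by blast
    then show ?thesis by blast
  qed
qed

section \<open>Tameness of definable sets of the line, and definable choice\<close>

context o_minimal_expansion
begin

text \<open>These fixed-arity versions appear in statements about functions; the
  \<open>_comp\<close> rules lead from them back to environments, where \<open>dintro\<close> does
  the work.\<close>

definition dpred1 :: "('r \<Rightarrow> bool) \<Rightarrow> bool" where "dpred1 P \<longleftrightarrow> dpred (\<lambda>e. P (e 0))"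
definition dfun1 :: "('r \<Rightarrow> 'r) \<Rightarrow> bool" where "dfun1 f \<longleftrightarrow> dfun (\<lambda>e. f (e 0))"
definition dpred2 :: "('r \<Rightarrow> 'r \<Rightarrow> bool) \<Rightarrow> bool" where "dpred2 P \<longleftrightarrow> dpred (\<lambda>e. P (e 0) (e 1))"
definition dfunRK :: "('r \<Rightarrow> 'r adjoin_i) \<Rightarrow> bool" where "dfunRK f \<longleftrightarrow> dfunK (\<lambda>e. f (e 0))"
definition dfunKK :: "('r adjoin_i \<Rightarrow> 'r adjoin_i) \<Rightarrow> bool" where
  "dfunKK f \<longleftrightarrow> dfunK (\<lambda>e. f (Adjoin_I (e 0) (e 1)))"
definition dpredRK :: "('r \<Rightarrow> 'r adjoin_i \<Rightarrow> bool) \<Rightarrow> bool" where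
  "dpredRK P \<longleftrightarrow> dpred (\<lambda>e. P (e 0) (Adjoin_I (e 1) (e 2)))"

lemma dpred1_comp: "dpred1 P \<Longrightarrow> dfun t \<Longrightarrow> dpred (\<lambda>e. P (t e))"
  unfolding dpred1_def by (drule dpred_subst[where t = "\<lambda>_. t"]) auto

lemma dfun1_comp: "dfun1 f \<Longrightarrow> dfun t \<Longrightarrow> dfun (\<lambda>e. f (t e))"
  unfolding dfun1_def by (drule dfun_subst[where t = "\<lambda>_. t"]) auto

lemma dpred2_comp:
  assumes "dpred2 P" "dfun s" "dfun t" shows "dpred (\<lambda>e. P (s e) (t e))"
proof -
  have "dfun ((if i = 0 then s else t))" for i :: nat using assms by simp
  from dpred_subst[OF assms(1)[unfolded dpred2_def], where t = "\<lambda>i. if i = 0 then s else t", OF this]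
  show ?thesis by simp
qed

lemma dfunK_subst:
  assumes "dfunK s" "\<And>i. dfun (t i)" shows "dfunK (\<lambda>e. s (\<lambda>i. t i e))"
  using assms dfun_subst[of "\<lambda>e. re (s e)"] dfun_subst[of "\<lambda>e. im (s e)"] by (simp add: dfunK_def)

lemma dfunRK_comp: "dfunRK f \<Longrightarrow> dfun t \<Longrightarrow> dfunK (\<lambda>e. f (t e))"
  unfolding dfunRK_def by (drule dfunK_subst[where t = "\<lambda>_. t"]) auto

lemma dfunKK_comp:
  assumes "dfunKK f" "dfunK t" shows "dfunK (\<lambda>e. f (t e))"
proof -
  have "dfun (if i = 0 then \<lambda>e. re (t e) else (\<lambda>e. im (t e)))" for i :: nat
    using assms by (simp add: dfunK_def)
  from dfunK_subst[OF assms(1)[unfolded dfunKK_def], where t = "\<lambda>i. if i = 0 then \<lambda>e. re (t e) else (\<lambda>e. im (t e))", OF this]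
  show ?thesis by simp
qed

lemma dpredRK_comp:
  assumes "dpredRK P" "dfun s" "dfunK t" shows "dpred (\<lambda>e. P (s e) (t e))"
proof -
  have "dfun (if i = 0 then s else if i = 1 then \<lambda>e. re (t e) else (\<lambda>e. im (t e)))" for i :: nat
    using assms by (simp add: dfunK_def)
  from dpred_subst[OF assms(1)[unfolded dpredRK_def],
    where t = "\<lambda>i. if i = 0 then s else if i = 1 then \<lambda>e. re (t e) else (\<lambda>e. im (t e))", OF this]
  show ?thesis by simp
qed

lemma dpred1_tame:
  assumes "dpred1 P" shows "tame {x. P x}"
proof -
  let ?A = "{v \<in> carrier_vec 1. P (v $ 0)}"
  have eq: "(\<lambda>e. P (e 0)) = (\<lambda>e. vec 1 e \<in> ?A)" by simp
  have "dpred (\<lambda>e. vec 1 e \<in> ?A)" by (rule back_subst[of dpred, OF assms[unfolded dpred1_def] eq])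
  moreover have "?A \<subseteq> carrier_vec 1" by (rule Collect_restrict)
  ultimately have "definable M 1 ?A" by (intro definable_iff_dpred[THEN iffD2] conjI)
  from o_minimal[unfolded o_minimal_def, rule_format, OF this]
  obtain \<S> where \<S>: "finite \<S>" "\<forall>I\<in>\<S>. point_or_open_interval I" "(\<lambda>v. v $ 0) ` ?A = \<Union>\<S>"
    by (elim exE conjE)
  have "tame (\<Union>\<S>)" using \<S>(1,2) tame_point_or_open_interval by (intro tame_Union) blast+
  moreover have "(\<lambda>v. v $ 0) ` ?A = {x. P x}"
  proof (rule subset_antisym)
    show "{x. P x} \<subseteq> (\<lambda>v. v $ 0) ` ?A"
    proof
      fix x assume "x \<in> {x. P x}"
      then show "x \<in> (\<lambda>v. v $ 0) ` ?A" by (intro image_eqI[of _ _ "vec 1 (\<lambda>_. x)"]) auto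
    qed
  qed auto
  ultimately show ?thesis using \<S>(3) by simp
qed

text \<open>The chosen element is the least of the finitely many candidates of the fibre over
  \<open>t\<close>. Since \<open>boundary\<close>, and hence \<open>candidates\<close>, is
  first-order in the fibre, the choice is definable in \<open>t\<close>.\<close>

lemma definable_choice:
  assumes P: "dpred2 P"
  shows "\<exists>f. dfun1 f \<and> (\<forall>t. (\<exists>x. P t x) \<longrightarrow> P t (f t))"
proof -
  define f where "f t = (if \<exists>x. P t x then Min (candidates {x. P t x}) else 0)" for t
  have tame: "tame {x. P t x}" for t
    by (rule dpred1_tame) (unfold dpred1_def, intro dpred2_comp[OF P] dintro)
  have ne: "finite (candidates {x. P t x})" "candidates {x. P t x} \<noteq> {}" if "\<exists>x. P t x" for t
    using candidates_finite[OF tame] candidates_nonempty[OF tame] that by auto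
  have "P t (f t)" if "\<exists>x. P t x" for t
    using Min_in[OF ne[OF that]] that by (auto simp: f_def candidates_def)
  moreover have "dfun1 f"
    unfolding dfun1_def
  proof (rule dfunI[where P = "\<lambda>e y. (y \<in> candidates {x. P (e 0) x} \<and> (\<forall>z. z \<in> candidates {x. P (e 0) x} \<longrightarrow> y \<le> z))
     \<or> (\<not> (\<exists>x. P (e 0) x) \<and> y = 0)"])
    have b: "dpred (\<lambda>e. b e \<in> boundary {x. P (t e) x})" if "dfun b" "dfun t" for b t
      unfolding boundary_def mem_Collect_eq
      by (intro dintro dpred2_comp[OF P] dfun_ren[OF that(1)] dfun_ren[OF that(2)])
    have c: "dpred (\<lambda>e. y e \<in> candidates {x. P (t e) x})" if "dfun y" "dfun t" for y t
      unfolding candidates_def mem_Collect_eq Bex_def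
      by (intro dintro dpred2_comp[OF P] b that dfun_ren[OF that(1)] dfun_ren[OF that(2)])
    show "dpred (\<lambda>e. (e 0 \<in> candidates {x. P (e (Suc 0)) x} \<and>
        (\<forall>z. z \<in> candidates {x. P (e (Suc 0)) x} \<longrightarrow> e 0 \<le> z)) \<or> (\<not> (\<exists>x. P (e (Suc 0)) x) \<and> e 0 = 0))"
      by (intro dintro c dpred2_comp[OF P])
    fix e :: "nat \<Rightarrow> 'r" and y
    have "candidates {x. P (e 0) x} = {}" if "\<not> (\<exists>x. P (e 0) x)"
      using that by (auto simp: candidates_def)
    then show "((y \<in> candidates {x. P (e 0) x} \<and> (\<forall>z. z \<in> candidates {x. P (e 0) x} \<longrightarrow> y \<le> z))
     \<or> (\<not> (\<exists>x. P (e 0) x) \<and> y = 0)) = (y = f (e 0))"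
      using ne[of "e 0"] Min_eq_iff[of "candidates {x. P (e 0) x}" y] by (auto simp: f_def)
  qed
  ultimately show ?thesis by blast
qed

text \<open>First a real part is chosen among those that occur, then an imaginary part that
  completes it.\<close>

lemma definable_choice_K:
  assumes P: "dpredRK P"
  shows "\<exists>f. dfunRK f \<and> (\<forall>t. (\<exists>z. P t z) \<longrightarrow> P t (f t))"
proof -
  have "dpred2 (\<lambda>t x. \<exists>y. P t (Adjoin_I x y))"
    unfolding dpred2_def by (intro dintro dpredRK_comp[OF P])
  then obtain x where x: "dfun1 x" "\<forall>t. (\<exists>x y. P t (Adjoin_I x y)) \<longrightarrow> (\<exists>y. P t (Adjoin_I (x t) y))"
    using definable_choice by blast
  have "dpred2 (\<lambda>t y. P t (Adjoin_I (x t) y))"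
    unfolding dpred2_def by (intro dintro dpredRK_comp[OF P] dfun1_comp[OF x(1)])
  then obtain y where y: "dfun1 y" "\<forall>t. (\<exists>y. P t (Adjoin_I (x t) y)) \<longrightarrow> P t (Adjoin_I (x t) (y t))"
    using definable_choice by blast
  have "P t (Adjoin_I (x t) (y t))" if ex: "\<exists>z. P t z" for t
  proof -
    obtain z where "P t z" using ex by blast
    then have "\<exists>x y. P t (Adjoin_I x y)" by (cases z) blast
    then show ?thesis using x(2) y(2) by blast
  qed
  moreover have "dfunRK (\<lambda>t. Adjoin_I (x t) (y t))"
    unfolding dfunRK_def by (intro dintro dfun1_comp[OF x(1)] dfun1_comp[OF y(1)])
  ultimately show ?thesis by (intro exI[of _ "\<lambda>t. Adjoin_I (x t) (y t)"]) blast
qed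


section \<open>Definable functions of one variable\<close>

lemma dpred1_right:
  assumes "dpred1 P" "x < (\<beta>::'r)"
  shows "\<exists>\<gamma>. x < \<gamma> \<and> \<gamma> \<le> \<beta> \<and> ((\<forall>y. x < y \<and> y < \<gamma> \<longrightarrow> P y) \<or> (\<forall>y. x < y \<and> y < \<gamma> \<longrightarrow> \<not> P y))"
proof -
  obtain \<delta> where \<delta>: "\<delta> > 0"
    "(\<forall>y. x < y \<and> y < x + \<delta> \<longrightarrow> P y) \<or> (\<forall>y. x < y \<and> y < x + \<delta> \<longrightarrow> \<not> P y)"
    using tame_right[OF dpred1_tame[OF assms(1)], of x] by (auto simp only: mem_Collect_eq)
  then show ?thesis using assms(2)
    by (intro exI[of _ "min (x + \<delta>) \<beta>"] conjI) (auto simp only: min_less_iff_conj less_add_same_cancel1 min.cobounded2)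
qed

lemma dpred1_left:
  assumes "dpred1 P" "\<alpha> < (x::'r)"
  shows "\<exists>\<gamma>. \<gamma> < x \<and> \<alpha> \<le> \<gamma> \<and> ((\<forall>y. \<gamma> < y \<and> y < x \<longrightarrow> P y) \<or> (\<forall>y. \<gamma> < y \<and> y < x \<longrightarrow> \<not> P y))"
proof -
  obtain \<delta> where \<delta>: "\<delta> > 0"
    "(\<forall>y. x - \<delta> < y \<and> y < x \<longrightarrow> P y) \<or> (\<forall>y. x - \<delta> < y \<and> y < x \<longrightarrow> \<not> P y)"
    using tame_left[OF dpred1_tame[OF assms(1)], of x] by (auto simp only: mem_Collect_eq)
  have "max (x - \<delta>) \<alpha> < x" using \<delta>(1) assms(2) by simp
  moreover have "(\<forall>y. max (x - \<delta>) \<alpha> < y \<and> y < x \<longrightarrow> P y) \<or> (\<forall>y. max (x - \<delta>) \<alpha> < y \<and> y < x \<longrightarrow> \<not> P y)"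
    using \<delta>(2) by (simp only: max_less_iff_conj) blast
  ultimately show ?thesis by (intro exI[of _ "max (x - \<delta>) \<alpha>"]) (simp only: max.cobounded2)
qed

lemma dpred1_lub:
  assumes "dpred1 P" "P (x0::'r)" "\<And>x. P x \<Longrightarrow> x \<le> u"
  shows "\<exists>s. (\<forall>x. P x \<longrightarrow> x \<le> s) \<and> (\<forall>y<s. \<exists>x. P x \<and> y < x) \<and> s \<le> u"
proof -
  obtain s where s: "\<forall>x\<in>{x. P x}. x \<le> s" "\<forall>y. (\<forall>x\<in>{x. P x}. x \<le> y) \<longrightarrow> s \<le> y"
    using tame_lub[OF dpred1_tame[OF assms(1)], of x0 u] assms(2,3) by auto
  have "\<exists>x. P x \<and> y < x" if "y < s" for y using s(2)[rule_format, of y] that by force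
  then show ?thesis using s assms(3) by auto
qed

text \<open>Real induction, the substitute for compactness of a closed interval. The supremum
  \<open>s\<close> of the points up to which \<open>P\<close> holds exists because the set of them
  is definable; \<open>left\<close> gives \<open>P s\<close>, and for \<open>s < \<beta>\<close> the
  assumption \<open>right\<close> would lead beyond \<open>s\<close>.\<close>

lemma definable_induction:
  assumes P: "dpred1 P" and "\<alpha> \<le> (\<beta>::'r)" and "P \<alpha>"
    and right: "\<And>x. \<alpha> \<le> x \<Longrightarrow> x < \<beta> \<Longrightarrow> (\<And>u. \<alpha> \<le> u \<Longrightarrow> u \<le> x \<Longrightarrow> P u) \<Longrightarrow>
      \<exists>\<delta>>0. \<forall>u. x < u \<and> u < x + \<delta> \<longrightarrow> P u"
    and left: "\<And>x. \<alpha> < x \<Longrightarrow> x \<le> \<beta> \<Longrightarrow> (\<And>u. \<alpha> \<le> u \<Longrightarrow> u < x \<Longrightarrow> P u) \<Longrightarrow> P x"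
  shows "P \<beta>"
proof -
  let ?Q = "\<lambda>s. \<alpha> \<le> s \<and> s \<le> \<beta> \<and> (\<forall>u. \<alpha> \<le> u \<and> u \<le> s \<longrightarrow> P u)"
  have Q: "dpred1 ?Q" unfolding dpred1_def by (intro dintro dpred1_comp[OF P])
  have Qa: "?Q \<alpha>"
  proof (intro conjI allI impI)
    fix u assume "\<alpha> \<le> u \<and> u \<le> \<alpha>"
    then have "u = \<alpha>" by simp
    then show "P u" using assms(3) by simp
  qed (use assms(2) in simp_all)
  have Qub: "x \<le> \<beta>" if "?Q x" for x using that by blast
  obtain s where "(\<forall>x. ?Q x \<longrightarrow> x \<le> s) \<and> (\<forall>y<s. \<exists>x. ?Q x \<and> y < x) \<and> s \<le> \<beta>"
    using dpred1_lub[OF Q Qa Qub] by (rule exE)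
  then have s: "\<And>x. ?Q x \<Longrightarrow> x \<le> s" "\<And>y. y < s \<Longrightarrow> \<exists>x. ?Q x \<and> y < x" "s \<le> \<beta>" by blast+
  have s1: "\<alpha> \<le> s" "s \<le> \<beta>" using s(1)[OF Qa] s(3) .
  have below: "P u" if u: "\<alpha> \<le> u" "u < s" for u
  proof -
    obtain x where "?Q x" "u < x" using s(2)[OF u(2)] by blast
    then show ?thesis using u(1) by simp
  qed
  have "P s" using left[of s] below s1 \<open>P \<alpha>\<close> by (cases "s = \<alpha>") auto
  then have upto: "P u" if "\<alpha> \<le> u" "u \<le> s" for u using below that by (cases "u = s") auto
  show ?thesis
  proof (cases "s = \<beta>")
    case True
    then show ?thesis using \<open>P s\<close> by simp
  next
    case False
    then have "s < \<beta>" using s1 by simp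
    then obtain \<delta> where \<delta>: "\<delta> > 0" "\<forall>u. s < u \<and> u < s + \<delta> \<longrightarrow> P u" using right[of s] s1 upto by blast
    define t where "t = min \<beta> (s + \<delta>/2)"
    have t: "s < t" "t \<le> \<beta>" "t < s + \<delta>" using \<open>s < \<beta>\<close> \<delta>(1) by (auto simp: t_def min_def)
    have "?Q t"
    proof (intro conjI allI impI)
      fix u assume "\<alpha> \<le> u \<and> u \<le> t"
      then show "P u" using upto[of u] \<delta>(2) t(3) by (cases "u \<le> s") auto
    qed (use t s1 in auto)
    then show ?thesis using s(1)[of t] t(1) by simp
  qed
qed

definition cont_at :: "('r \<Rightarrow> 'r) \<Rightarrow> 'r \<Rightarrow> bool" where
  "cont_at f x \<longleftrightarrow> (\<forall>\<epsilon>>0. \<exists>\<delta>>0. \<forall>y. \<bar>y - x\<bar> < \<delta> \<longrightarrow> \<bar>f y - f x\<bar> < \<epsilon>)"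

text \<open>The growth condition at \<open>x\<close> may use the bound at \<open>x\<close> itself.\<close>

lemma growth_bound:
  assumes f: "dfun1 f" and "\<alpha> \<le> \<beta>"
    and cont: "\<And>x \<epsilon>. \<alpha> < x \<Longrightarrow> x \<le> \<beta> \<Longrightarrow> 0 < \<epsilon> \<Longrightarrow> \<exists>\<delta>>0. \<forall>y. x - \<delta> < y \<and> y < x \<and> \<alpha> \<le> y \<longrightarrow> f x < f y + \<epsilon>"
    and right: "\<And>x. \<alpha> \<le> x \<Longrightarrow> x < \<beta> \<Longrightarrow> f x \<le> f \<alpha> + C * (x - \<alpha>) \<Longrightarrow>
      \<exists>\<delta>>0. \<forall>y. x < y \<and> y < x + \<delta> \<longrightarrow> f y \<le> f x + C * (y - x)"
  shows "f \<beta> \<le> f \<alpha> + C * (\<beta> - \<alpha>)"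
proof (rule definable_induction[where P = "\<lambda>u. f u \<le> f \<alpha> + C * (u - \<alpha>)", OF _ assms(2)])
  show "dpred1 (\<lambda>u. f u \<le> f \<alpha> + C * (u - \<alpha>))" unfolding dpred1_def by (intro dintro dfun1_comp[OF f])
next
  fix x assume x: "\<alpha> \<le> x" "x < \<beta>" "\<And>u. \<alpha> \<le> u \<Longrightarrow> u \<le> x \<Longrightarrow> f u \<le> f \<alpha> + C * (u - \<alpha>)"
  have fx: "f x \<le> f \<alpha> + C * (x - \<alpha>)" using x by simp
  obtain \<delta> where \<delta>: "\<delta> > 0" "\<forall>y. x < y \<and> y < x + \<delta> \<longrightarrow> f y \<le> f x + C * (y - x)" using right[OF x(1,2) fx] by blast
  have "f u \<le> f \<alpha> + C * (u - \<alpha>)" if "x < u \<and> u < x + \<delta>" for u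
    using \<delta>(2)[rule_format, OF that] fx by (simp add: algebra_simps)
  then show "\<exists>\<delta>>0. \<forall>u. x < u \<and> u < x + \<delta> \<longrightarrow> f u \<le> f \<alpha> + C * (u - \<alpha>)" using \<delta>(1) by blast
next
  fix x assume x: "\<alpha> < x" "x \<le> \<beta>" "\<And>u. \<alpha> \<le> u \<Longrightarrow> u < x \<Longrightarrow> f u \<le> f \<alpha> + C * (u - \<alpha>)"
  show "f x \<le> f \<alpha> + C * (x - \<alpha>)"
  proof (rule ccontr)
    assume "\<not> ?thesis"
    \<comment> \<open>Half of the excess over the bound covers the rise of less than
      \<open>?e\<close> from \<open>f y\<close> to \<open>f x\<close>, the other half the slope term
      \<open>C * (y - x)\<close>, which is positive when \<open>C\<close> is negative.\<close>
    then have e: "0 < (f x - (f \<alpha> + C * (x - \<alpha>))) / 2" (is "0 < ?e") by simp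
    obtain \<delta> where \<delta>: "\<delta> > 0" "\<forall>y. x - \<delta> < y \<and> y < x \<and> \<alpha> \<le> y \<longrightarrow> f x < f y + ?e" using cont[OF x(1,2) e] by blast
    define m where "m = max (x - \<delta>) (max \<alpha> (x - ?e / (\<bar>C\<bar> + 1)))"
    have "?e / (\<bar>C\<bar> + 1) > 0" using e by (intro divide_pos_pos) auto
    then have "m < x" using \<delta>(1) x(1) by (simp add: m_def)
    then obtain y where y: "m < y" "y < x" using dense by blast
    then have y': "x - \<delta> < y" "\<alpha> < y" "x - ?e / (\<bar>C\<bar> + 1) < y" by (auto simp: m_def)
    have "(x - y) * (\<bar>C\<bar> + 1) < ?e" using y'(3) by (subst pos_less_divide_eq[symmetric]) (auto simp: algebra_simps add_pos_nonneg)
    moreover have "(x - y) * (- C) \<le> (x - y) * (\<bar>C\<bar> + 1)" by (rule mult_left_mono) (use y in auto)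
    ultimately have "C * (y - x) < ?e" by (simp add: algebra_simps)
    moreover have "f x < f y + ?e" using \<delta>(2) y y' by simp
    moreover have "f y \<le> f \<alpha> + C * (y - \<alpha>)" using x(3)[of y] y y' by simp
    moreover have "C * (y - \<alpha>) = C * (y - x) + C * (x - \<alpha>)" by (simp add: algebra_simps)
    moreover have "f x = f \<alpha> + C * (x - \<alpha>) + ?e + ?e" by (simp add: field_simps)
    ultimately show False by linarith
  qed
qed simp

text \<open>The limit is the supremum of the eventual lower bounds. Approach from below is then
  clear. From above, tameness decides that \<open>f\<close> is eventually at least
  \<open>L + \<epsilon>/2\<close> or eventually less, and the former would make
  \<open>L + \<epsilon>/2\<close> an eventual lower bound.\<close>

lemma definable_limit:
  assumes f: "dfun1 f" and bound: "\<And>t. 0 < t \<Longrightarrow> \<bar>f t\<bar> \<le> r"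
  shows "\<exists>L. \<bar>L\<bar> \<le> r \<and> (\<forall>\<epsilon>>0. \<exists>\<delta>>0. \<forall>t. 0 < t \<and> t < \<delta> \<longrightarrow> \<bar>f t - L\<bar> < \<epsilon>)"
proof -
  let ?P = "\<lambda>c. \<exists>\<delta>>0. \<forall>t. 0 < t \<and> t < \<delta> \<longrightarrow> c \<le> f t"
  have P: "dpred1 ?P" unfolding dpred1_def by (intro dintro dfun1_comp[OF f])
  have Pr: "?P (- r)"
    by (rule exI[of _ 1]) (use bound in \<open>force simp: abs_le_iff\<close>)
  have ub: "c \<le> r" if c: "?P c" for c
  proof -
    obtain \<delta> where \<delta>: "\<delta> > 0" "\<forall>t. 0 < t \<and> t < \<delta> \<longrightarrow> c \<le> f t" using c by blast
    then have "c \<le> f (\<delta>/2)" by simp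
    then show ?thesis using bound[of "\<delta>/2"] \<delta>(1) by (simp add: abs_le_iff)
  qed
  obtain L where "(\<forall>x. ?P x \<longrightarrow> x \<le> L) \<and> (\<forall>y<L. \<exists>x. ?P x \<and> y < x) \<and> L \<le> r"
    using dpred1_lub[OF P Pr ub] by (rule exE)
  then have L: "\<And>x. ?P x \<Longrightarrow> x \<le> L" "\<And>y. y < L \<Longrightarrow> \<exists>x. ?P x \<and> y < x" "L \<le> r" by blast+
  have "\<exists>\<delta>>0. \<forall>t. 0 < t \<and> t < \<delta> \<longrightarrow> \<bar>f t - L\<bar> < \<epsilon>" if e: "\<epsilon> > 0" for \<epsilon>
  proof -
    have "L - \<epsilon>/2 < L" using e by simp
    then obtain c where c: "?P c" "L - \<epsilon>/2 < c" using L(2) by blast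
    then obtain \<delta>1 where \<delta>1: "\<delta>1 > 0" "\<forall>t. 0 < t \<and> t < \<delta>1 \<longrightarrow> c \<le> f t" by blast
    have "\<not> L + \<epsilon>/2 \<le> L" using e by simp
    then have nP: "\<not> ?P (L + \<epsilon>/2)" using L(1) by blast
    have "dpred1 (\<lambda>t. L + \<epsilon>/2 \<le> f t)" unfolding dpred1_def by (intro dintro dfun1_comp[OF f])
    moreover have "(0::'r) < 1" by simp
    ultimately have "\<exists>\<gamma>. 0 < \<gamma> \<and> \<gamma> \<le> 1 \<and> ((\<forall>t. 0 < t \<and> t < \<gamma> \<longrightarrow> L + \<epsilon>/2 \<le> f t) \<or> (\<forall>t. 0 < t \<and> t < \<gamma> \<longrightarrow> \<not> L + \<epsilon>/2 \<le> f t))"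
      by (rule dpred1_right)
    then
    obtain \<delta>2 where \<delta>2: "\<delta>2 > 0" "(\<forall>t. 0 < t \<and> t < \<delta>2 \<longrightarrow> L + \<epsilon>/2 \<le> f t) \<or> (\<forall>t. 0 < t \<and> t < \<delta>2 \<longrightarrow> \<not> L + \<epsilon>/2 \<le> f t)"
      by blast
    then have \<delta>2': "\<forall>t. 0 < t \<and> t < \<delta>2 \<longrightarrow> \<not> L + \<epsilon>/2 \<le> f t" using nP by blast
    have "\<bar>f t - L\<bar> < \<epsilon>" if t: "0 < t" "t < min \<delta>1 \<delta>2" for t
    proof -
      have "c \<le> f t" using \<delta>1(2) t by simp
      moreover have "f t < L + \<epsilon>/2" using \<delta>2' t by (simp add: not_le)
      moreover have "L - \<epsilon> \<le> L - \<epsilon>/2" "L + \<epsilon>/2 \<le> L + \<epsilon>" using e by auto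
      ultimately show ?thesis using c(2) by (simp add: abs_less_iff)
    qed
    then show ?thesis using \<delta>1(1) \<delta>2(1) by (intro exI[of _ "min \<delta>1 \<delta>2"]) auto
  qed
  moreover have "\<bar>L\<bar> \<le> r" using L(1)[OF Pr] L(3) by (simp add: abs_le_iff)
  ultimately show ?thesis by blast
qed

text \<open>Where \<open>f\<close> has only strict local minima, the values just left of some points dominate the values
  just right of them; by reflection the opposite holds too.\<close>

lemma strict_local_minima_descend:
  assumes f: "dfun1 f" and "\<alpha> < \<beta>"
    and min: "\<And>x. \<alpha> < x \<Longrightarrow> x < \<beta> \<Longrightarrow> \<exists>\<delta>>0. \<forall>y. \<bar>y - x\<bar> < \<delta> \<and> y \<noteq> x \<longrightarrow> f x < f y"
  shows "\<exists>\<gamma>. \<alpha> \<le> \<gamma> \<and> \<gamma> < \<beta> \<and> (\<forall>x. \<gamma> < x \<and> x < \<beta> \<longrightarrow>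
    (\<exists>v. \<exists>\<delta>>0. (\<forall>y. x - \<delta> < y \<and> y < x \<longrightarrow> v \<le> f y) \<and> (\<forall>y. x < y \<and> y < x + \<delta> \<longrightarrow> f y < v)))"
proof -
  note d = dfun1_comp[OF f]
  \<comment> \<open>Were \<open>?B\<close> true throughout an interval, \<open>f\<close> would
    increase there, against strict minimality at any of its points. So by tameness it fails near
    \<open>\<beta>\<close>: every point has a later one whose value is no larger, which is
    \<open>nB\<close>.\<close>
  let ?B = "\<lambda>x. \<forall>y. x < y \<and> y < \<beta> \<longrightarrow> f x < f y"
  have "dpred1 ?B" unfolding dpred1_def by (intro dintro d)
  then obtain \<gamma> where \<gamma>: "\<gamma> < \<beta>" "\<alpha> \<le> \<gamma>" "(\<forall>y. \<gamma> < y \<and> y < \<beta> \<longrightarrow> ?B y) \<or> (\<forall>y. \<gamma> < y \<and> y < \<beta> \<longrightarrow> \<not> ?B y)"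
    using dpred1_left[OF _ assms(2)] by blast
  have nB: "\<exists>y. x < y \<and> y < \<beta> \<and> f y \<le> f x" if x: "\<gamma> < x" "x < \<beta>" for x
  proof -
    have "\<not> (\<forall>y. \<gamma> < y \<and> y < \<beta> \<longrightarrow> ?B y)"
    proof
      assume all: "\<forall>y. \<gamma> < y \<and> y < \<beta> \<longrightarrow> ?B y"
      obtain \<delta> where \<delta>: "\<delta> > 0" "\<forall>y. \<bar>y - x\<bar> < \<delta> \<and> y \<noteq> x \<longrightarrow> f x < f y" using min[of x] x le_less_trans[OF \<gamma>(2) x(1)] by blast
      have "max \<gamma> (x - \<delta>) < x" using \<delta>(1) x by simp
      then obtain y where y: "max \<gamma> (x - \<delta>) < y" "y < x" using dense by blast
      then have "f x < f y" using \<delta>(2)[rule_format, of y] by simp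
      moreover have "f y < f x" using all y x by auto
      ultimately show False by simp
    qed
    then have "\<not> ?B x" using \<gamma>(3) x by blast
    then show ?thesis by (meson not_less)
  qed
  \<comment> \<open>The points from \<open>c\<close> on with value at most \<open>f c\<close> reach
    up to \<open>\<beta>\<close>. At a supremum \<open>s < \<beta>\<close>, either \<open>s\<close>
    is such a point and \<open>nB\<close> yields a later one, or the values just left of
    \<open>s\<close> are at most \<open>f c\<close> and so below \<open>f s\<close>, although
    \<open>s\<close> is a strict local minimum. Hence these points fill an interval ending at
    \<open>\<beta>\<close>; equality with \<open>f c\<close> is removed because \<open>f\<close> is
    nowhere locally constant.\<close>
  have ev: "\<exists>\<eta>. c < \<eta> \<and> \<eta> < \<beta> \<and> (\<forall>y. \<eta> < y \<and> y < \<beta> \<longrightarrow> f y < f c)" if c: "\<gamma> < c" "c < \<beta>" for c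
  proof -
    let ?Z = "\<lambda>y. c \<le> y \<and> y < \<beta> \<and> f y \<le> f c"
    have Z: "dpred1 ?Z" unfolding dpred1_def by (intro dintro d)
    have next_Z: "\<exists>y'. y < y' \<and> ?Z y'" if y: "?Z y" for y
    proof -
      have "\<gamma> < y" using y c by simp
      then obtain y' where "y < y'" "y' < \<beta>" "f y' \<le> f y" using nB[of y] y by blast
      then show ?thesis using y by (intro exI[of _ y']) auto
    qed
    have Zc: "?Z c" using c by simp
    have Zub: "x \<le> \<beta>" if "?Z x" for x using that by simp
    obtain s where "(\<forall>x. ?Z x \<longrightarrow> x \<le> s) \<and> (\<forall>y<s. \<exists>x. ?Z x \<and> y < x) \<and> s \<le> \<beta>"
      using dpred1_lub[OF Z Zc Zub] by (rule exE)
    then have s: "\<And>x. ?Z x \<Longrightarrow> x \<le> s" "\<And>y. y < s \<Longrightarrow> \<exists>x. ?Z x \<and> y < x" "s \<le> \<beta>" by blast+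
    have cs: "c < s" using next_Z[OF Zc] s(1) less_le_trans by blast
    note sb = s(3)
    have "\<not> (s < \<beta>)"
    proof
      assume sb': "s < \<beta>"
      obtain \<eta> where \<eta>: "\<eta> < s" "c \<le> \<eta>" "(\<forall>y. \<eta> < y \<and> y < s \<longrightarrow> ?Z y) \<or> (\<forall>y. \<eta> < y \<and> y < s \<longrightarrow> \<not> ?Z y)"
        using dpred1_left[OF Z cs] by blast
      obtain \<delta> where \<delta>: "\<delta> > 0" "\<forall>y. \<bar>y - s\<bar> < \<delta> \<and> y \<noteq> s \<longrightarrow> f s < f y"
        using min[of s] sb' less_trans[OF le_less_trans[OF \<gamma>(2) c(1)] cs] by blast
      show False
      proof (cases "?Z s")
        case True
        then obtain y' where y': "s < y'" "?Z y'" using next_Z by blast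
        then show False using s(1)[OF y'(2)] by simp
      next
        case False
        have "\<exists>y. ?Z y \<and> \<eta> < y" using s(2)[of \<eta>] \<eta>(1) by blast
        then obtain y where y: "?Z y" "\<eta> < y" by blast
        then have "y \<noteq> s" using False by blast
        then have "y < s" using s(1)[OF y(1)] by simp
        then have all: "\<forall>y. \<eta> < y \<and> y < s \<longrightarrow> ?Z y" using \<eta>(3) y by blast
        have "max \<eta> (s - \<delta>) < s" using \<eta>(1) \<delta>(1) by simp
        then obtain w where w: "max \<eta> (s - \<delta>) < w" "w < s" using dense by blast
        then have "f s < f w" using \<delta>(2)[rule_format, of w] by simp
        moreover have "f w \<le> f c" using all[rule_format, of w] w by simp
        ultimately show False using False sb' cs by auto
      qed
    qed
    then have s_eq: "s = \<beta>" using sb by simp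
    obtain \<eta> where \<eta>: "\<eta> < \<beta>" "c \<le> \<eta>" "(\<forall>y. \<eta> < y \<and> y < \<beta> \<longrightarrow> ?Z y) \<or> (\<forall>y. \<eta> < y \<and> y < \<beta> \<longrightarrow> \<not> ?Z y)"
      using dpred1_left[OF Z c(2)] by blast
    have "\<exists>y. ?Z y \<and> \<eta> < y" using s(2)[of \<eta>] \<eta>(1) s_eq by blast
    then have allZ: "\<forall>y. \<eta> < y \<and> y < \<beta> \<longrightarrow> f y \<le> f c" using \<eta>(3) by blast
    have "dpred1 (\<lambda>y. f y = f c)" unfolding dpred1_def by (intro dintro d)
    then obtain \<eta>' where \<eta>': "\<eta>' < \<beta>" "\<eta> \<le> \<eta>'" "(\<forall>y. \<eta>' < y \<and> y < \<beta> \<longrightarrow> f y = f c) \<or> (\<forall>y. \<eta>' < y \<and> y < \<beta> \<longrightarrow> f y \<noteq> f c)"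
      using dpred1_left[OF _ \<eta>(1)] by blast
    have "\<not> (\<forall>y. \<eta>' < y \<and> y < \<beta> \<longrightarrow> f y = f c)"
    proof
      assume all: "\<forall>y. \<eta>' < y \<and> y < \<beta> \<longrightarrow> f y = f c"
      obtain x where x: "\<eta>' < x" "x < \<beta>" using dense \<eta>'(1) by blast
      obtain \<delta> where \<delta>: "\<delta> > 0" "\<forall>y. \<bar>y - x\<bar> < \<delta> \<and> y \<noteq> x \<longrightarrow> f x < f y"
        using min[of x] x(2) less_trans[OF le_less_trans[OF \<gamma>(2) c(1)] le_less_trans[OF \<eta>(2) le_less_trans[OF \<eta>'(2) x(1)]]] by blast
      have "x < min \<beta> (x + \<delta>)" using x \<delta>(1) by simp
      then obtain y where y: "x < y" "y < min \<beta> (x + \<delta>)" using dense by blast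
      then have "f x < f y" using \<delta>(2)[rule_format, of y] by simp
      moreover have "f y = f c" "f x = f c" using all x y by auto
      ultimately show False by simp
    qed
    then have ne: "\<forall>y. \<eta>' < y \<and> y < \<beta> \<longrightarrow> f y \<noteq> f c" using \<eta>'(3) by blast
    have "f y < f c" if y: "\<eta>' < y" "y < \<beta>" for y
      using ne y allZ le_less_trans[OF \<eta>'(2) y(1)] by (auto simp only: order_le_less)
    moreover obtain \<eta>'' where "\<eta>' < \<eta>''" "\<eta>'' < \<beta>" using dense \<eta>'(1) by blast
    moreover have "c < \<eta>''" using calculation \<eta>(2) \<eta>'(2) by auto
    ultimately show ?thesis by (intro exI[of _ \<eta>'']) auto
  qed
  let ?C = "\<lambda>x. \<exists>v. \<exists>\<delta>>0. (\<forall>y. x - \<delta> < y \<and> y < x \<longrightarrow> v \<le> f y) \<and> (\<forall>y. x < y \<and> y < x + \<delta> \<longrightarrow> f y < v)"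
  \<comment> \<open>\<open>s\<close> is the supremum of the points before \<open>\<beta>\<close>
    with value at least \<open>f c\<close>. To its right all values are below \<open>f c\<close>,
    and to its left tameness gives an interval of values at least \<open>f c\<close>. Such crossings
    occur arbitrarily close to \<open>\<beta>\<close>, so by tameness every point near
    \<open>\<beta>\<close> is one, at a level of its own.\<close>
  have cross: "\<exists>s. c < s \<and> s < \<beta> \<and> ?C s" if c: "\<gamma> < c" "c < \<beta>" for c
  proof -
    obtain \<eta> where \<eta>: "c < \<eta>" "\<eta> < \<beta>" "\<forall>y. \<eta> < y \<and> y < \<beta> \<longrightarrow> f y < f c" using ev[OF c] by blast
    let ?Z = "\<lambda>y. c \<le> y \<and> y < \<beta> \<and> f c \<le> f y"
    have Z: "dpred1 ?Z" unfolding dpred1_def by (intro dintro d)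
    have Zc: "?Z c" using c by simp
    have Zub: "y \<le> \<eta>" if "?Z y" for y
    proof (rule ccontr)
      assume "\<not> y \<le> \<eta>"
      then have "f y < f c" using that \<eta>(3) by simp
      then show False using that by simp
    qed
    obtain s where "(\<forall>x. ?Z x \<longrightarrow> x \<le> s) \<and> (\<forall>y<s. \<exists>x. ?Z x \<and> y < x) \<and> s \<le> \<eta>"
      using dpred1_lub[OF Z Zc Zub] by (rule exE)
    then have s: "\<And>x. ?Z x \<Longrightarrow> x \<le> s" "\<And>y. y < s \<Longrightarrow> \<exists>x. ?Z x \<and> y < x" "s \<le> \<eta>" by blast+
    have sb: "s < \<beta>" using s(3) \<eta>(2) by simp
    obtain \<delta>0 where \<delta>0: "\<delta>0 > 0" "\<forall>y. \<bar>y - c\<bar> < \<delta>0 \<and> y \<noteq> c \<longrightarrow> f c < f y" using min[of c] c(2) le_less_trans[OF \<gamma>(2) c(1)] by blast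
    have "c < min \<beta> (c + \<delta>0)" using c \<delta>0(1) by simp
    then obtain w where w: "c < w" "w < min \<beta> (c + \<delta>0)" using dense by blast
    then have "f c < f w" using \<delta>0(2)[rule_format, of w] by simp
    then have cs: "c < s" using s(1)[of w] w by auto
    obtain \<delta> where \<delta>: "\<delta> > 0" "\<forall>y. \<bar>y - s\<bar> < \<delta> \<and> y \<noteq> s \<longrightarrow> f s < f y"
      using min[of s] sb less_trans[OF le_less_trans[OF \<gamma>(2) c(1)] cs] by blast
    obtain \<zeta> where \<zeta>: "\<zeta> < s" "c \<le> \<zeta>" "(\<forall>y. \<zeta> < y \<and> y < s \<longrightarrow> ?Z y) \<or> (\<forall>y. \<zeta> < y \<and> y < s \<longrightarrow> \<not> ?Z y)"
      using dpred1_left[OF Z cs] by blast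
    have "\<forall>y. \<zeta> < y \<and> y < s \<longrightarrow> ?Z y"
    proof (cases "?Z s")
      case True
      have "max \<zeta> (s - \<delta>) < s" using \<zeta>(1) \<delta>(1) by simp
      then obtain u where u: "max \<zeta> (s - \<delta>) < u" "u < s" using dense by blast
      then have "f s < f u" using \<delta>(2)[rule_format, of u] by simp
      then have "?Z u" using True u \<zeta>(2) sb by auto
      then show ?thesis using \<zeta>(3) u by auto
    next
      case False
      obtain u where u: "?Z u" "\<zeta> < u" using s(2)[of \<zeta>] \<zeta>(1) by blast
      then have "u \<noteq> s" using False by blast
      then have "u < s" using s(1)[OF u(1)] by simp
      then show ?thesis using \<zeta>(3) u by blast
    qed
    then have l: "\<forall>y. s - min (s - \<zeta>) (\<beta> - s) < y \<and> y < s \<longrightarrow> f c \<le> f y" by (auto simp: min_def split: if_splits)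
    have "f y < f c" if "s < y" "y < s + min (s - \<zeta>) (\<beta> - s)" for y
      using s(1)[of y] that cs by (force simp: min_def split: if_splits)
    then have "?C s" using l \<zeta>(1) sb by (intro exI[of _ "f c"] exI[of _ "min (s - \<zeta>) (\<beta> - s)"]) auto
    then show ?thesis using cs sb by blast
  qed
  have "dpred1 ?C" unfolding dpred1_def by (intro dintro d)
  then obtain \<gamma>' where \<gamma>': "\<gamma>' < \<beta>" "\<gamma> \<le> \<gamma>'" "(\<forall>y. \<gamma>' < y \<and> y < \<beta> \<longrightarrow> ?C y) \<or> (\<forall>y. \<gamma>' < y \<and> y < \<beta> \<longrightarrow> \<not> ?C y)"
    using dpred1_left[OF _ \<gamma>(1)] by blast
  obtain c where "\<gamma>' < c" "c < \<beta>" using dense \<gamma>'(1) by blast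
  then obtain s where "\<gamma>' < s" "s < \<beta>" "?C s" using cross[of c] le_less_trans[OF \<gamma>'(2), of c] less_trans[of \<gamma>' c] by blast
  then have "\<forall>y. \<gamma>' < y \<and> y < \<beta> \<longrightarrow> ?C y" using \<gamma>'(3) by blast
  then show ?thesis using \<gamma>' \<gamma> by (intro exI[of _ \<gamma>']) auto
qed


lemma no_interval_of_strict_local_minima:
  assumes f: "dfun1 f" and "\<alpha> < \<beta>"
    and min: "\<And>x. \<alpha> < x \<Longrightarrow> x < \<beta> \<Longrightarrow> \<exists>\<delta>>0. \<forall>y. \<bar>y - x\<bar> < \<delta> \<and> y \<noteq> x \<longrightarrow> f x < f y"
  shows False
proof -
  obtain \<gamma> where \<gamma>: "\<alpha> \<le> \<gamma>" "\<gamma> < \<beta>" and desc: "\<forall>x. \<gamma> < x \<and> x < \<beta> \<longrightarrow>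
    (\<exists>v. \<exists>\<delta>>0. (\<forall>y. x - \<delta> < y \<and> y < x \<longrightarrow> v \<le> f y) \<and> (\<forall>y. x < y \<and> y < x + \<delta> \<longrightarrow> f y < v))"
    using strict_local_minima_descend[OF assms] by blast
  have g: "dfun1 (\<lambda>x. f (- x))" unfolding dfun1_def by (intro dintro dfun1_comp[OF f])
  have "\<exists>\<delta>>0. \<forall>y. \<bar>y - x\<bar> < \<delta> \<and> y \<noteq> x \<longrightarrow> f (- x) < f (- y)" if x: "- \<beta> < x" "x < - \<gamma>" for x
  proof -
    have "\<alpha> < - x" "- x < \<beta>" using x \<gamma>(1) by linarith+
    then obtain \<delta> where \<delta>: "\<delta> > 0" "\<forall>y. \<bar>y - - x\<bar> < \<delta> \<and> y \<noteq> - x \<longrightarrow> f (- x) < f y" using min by blast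
    have "f (- x) < f (- y)" if "\<bar>y - x\<bar> < \<delta>" "y \<noteq> x" for y
      by (rule \<delta>(2)[rule_format]) (use that in \<open>simp add: abs_minus_commute\<close>)
    then show ?thesis using \<delta>(1) by blast
  qed
  then obtain \<gamma>' where \<gamma>': "- \<beta> \<le> \<gamma>'" "\<gamma>' < - \<gamma>" and asc: "\<forall>x. \<gamma>' < x \<and> x < - \<gamma> \<longrightarrow>
    (\<exists>v. \<exists>\<delta>>0. (\<forall>y. x - \<delta> < y \<and> y < x \<longrightarrow> v \<le> f (- y)) \<and> (\<forall>y. x < y \<and> y < x + \<delta> \<longrightarrow> f (- y) < v))"
    using strict_local_minima_descend[OF g, of "- \<beta>" "- \<gamma>"] \<gamma>(2) by (auto simp only: neg_less_iff_less)
  obtain x where x: "\<gamma>' < x" "x < - \<gamma>" using dense \<gamma>'(2) by blast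
  obtain v \<delta> where v: "\<delta> > 0" "\<forall>y. x - \<delta> < y \<and> y < x \<longrightarrow> v \<le> f (- y)" "\<forall>y. x < y \<and> y < x + \<delta> \<longrightarrow> f (- y) < v"
    using asc x by blast
  have "\<gamma> < - x" "- x < \<beta>" using x \<gamma>'(1) by linarith+
  then obtain v' \<delta>' where v': "\<delta>' > 0" "\<forall>y. - x - \<delta>' < y \<and> y < - x \<longrightarrow> v' \<le> f y" "\<forall>y. - x < y \<and> y < - x + \<delta>' \<longrightarrow> f y < v'"
    using desc by blast
  \<comment> \<open>Both descriptions are read at the points \<open>- x - \<epsilon>\<close> and
    \<open>- x + \<epsilon>\<close>. They combine to \<open>v' \<le> f (- x - \<epsilon>) < v \<le>
    f (- x + \<epsilon>) < v'\<close>.\<close>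
  obtain \<epsilon> where \<epsilon>: "0 < \<epsilon>" "\<epsilon> < min \<delta> \<delta>'" using dense[of 0 "min \<delta> \<delta>'"] v(1) v'(1) by auto
  have "v' \<le> f (- x - \<epsilon>)" using v'(2)[rule_format, of "- x - \<epsilon>"] \<epsilon> by simp
  moreover have "f (- x + \<epsilon>) < v'" using v'(3)[rule_format, of "- x + \<epsilon>"] \<epsilon> by simp
  moreover have "v \<le> f (- x + \<epsilon>)" using v(2)[rule_format, of "x - \<epsilon>"] \<epsilon> by simp
  moreover have "f (- x - \<epsilon>) < v" using v(3)[rule_format, of "x + \<epsilon>"] \<epsilon> by simp
  ultimately show False by linarith
qed

section \<open>Monotonicity and continuity of definable functions\<close>

lemma locally_increasing_imp_increasing:
  assumes f: "dfun1 f"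
    and r: "\<And>x. \<alpha> < x \<Longrightarrow> x < \<beta> \<Longrightarrow> \<exists>\<delta>>0. \<forall>y. x < y \<and> y < x + \<delta> \<longrightarrow> f x < f y"
    and l: "\<And>x. \<alpha> < x \<Longrightarrow> x < \<beta> \<Longrightarrow> \<exists>\<delta>>0. \<forall>y. x - \<delta> < y \<and> y < x \<longrightarrow> f y < f x"
    and xy: "\<alpha> < x" "x < y" "y < \<beta>"
  shows "f x < f y"
proof -
  have "y = x \<or> f x < f y"
  proof (rule definable_induction[where P = "\<lambda>u. u = x \<or> f x < f u" and \<alpha> = x])
    show "dpred1 (\<lambda>u. u = x \<or> f x < f u)" unfolding dpred1_def by (intro dintro dfun1_comp[OF f])
  next
    fix u assume u: "x \<le> u" "u < y" "\<And>w. x \<le> w \<Longrightarrow> w \<le> u \<Longrightarrow> w = x \<or> f x < f w"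
    have "\<alpha> < u" "u < \<beta>" using u xy by linarith+
    then obtain \<delta> where \<delta>: "\<delta> > 0" "\<forall>y. u < y \<and> y < u + \<delta> \<longrightarrow> f u < f y" using r by blast
    have "f x < f w" if "u < w \<and> w < u + \<delta>" for w
      using \<delta>(2)[rule_format, OF that] u(3)[of u] u(1) by auto
    then show "\<exists>\<delta>>0. \<forall>w. u < w \<and> w < u + \<delta> \<longrightarrow> w = x \<or> f x < f w" using \<delta>(1) by blast
  next
    fix u assume u: "x < u" "u \<le> y" "\<And>w. x \<le> w \<Longrightarrow> w < u \<Longrightarrow> w = x \<or> f x < f w"
    have "\<alpha> < u" "u < \<beta>" using u xy by linarith+
    then obtain \<delta> where \<delta>: "\<delta> > 0" "\<forall>y. u - \<delta> < y \<and> y < u \<longrightarrow> f y < f u" using l by blast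
    have "max x (u - \<delta>) < u" using u \<delta>(1) by simp
    then obtain w where w: "max x (u - \<delta>) < w" "w < u" using dense by blast
    then have "f w < f u" using \<delta>(2) by simp
    moreover have "f x < f w" using u(3)[of w] w by auto
    ultimately show "u = x \<or> f x < f u" by simp
  qed (use xy in auto)
  then show ?thesis using xy by simp
qed

lemma two_sided_neighbourhood:
  assumes "\<exists>\<delta>>0. \<forall>y. u < y \<and> y < u + \<delta> \<longrightarrow> P y" "\<exists>\<delta>>0. \<forall>y. u - \<delta> < y \<and> y < u \<longrightarrow> P y"
  shows "\<exists>\<delta>>0. \<forall>y. \<bar>y - u\<bar> < \<delta> \<and> y \<noteq> (u::'r) \<longrightarrow> P y"
proof -
  obtain \<delta>1 \<delta>2 where \<delta>: "\<delta>1 > 0" "\<forall>y. u < y \<and> y < u + \<delta>1 \<longrightarrow> P y" "\<delta>2 > 0" "\<forall>y. u - \<delta>2 < y \<and> y < u \<longrightarrow> P y"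
    using assms by blast
  have "P y" if y: "\<bar>y - u\<bar> < min \<delta>1 \<delta>2 \<and> y \<noteq> u" for y
  proof (cases u y rule: linorder_cases)
    case less
    then have "u < y \<and> y < u + \<delta>1" using y by (auto simp: abs_less_iff)
    then show ?thesis using \<delta>(2) by blast
  next
    case greater
    then have "u - \<delta>2 < y \<and> y < u" using y by (auto simp: abs_less_iff)
    then show ?thesis using \<delta>(4) by blast
  qed (use y in blast)
  then show ?thesis using \<delta>(1,3) by (intro exI[of _ "min \<delta>1 \<delta>2"]) simp
qed

text \<open>A weak monotonicity theorem: it yields some subinterval, not a finite partition, and
  that is what \<open>tame_finite\<close> asks for. The four local behaviours, larger or smaller
  values on either side, are definable, so on a smaller interval each holds throughout or fails
  throughout. One behaviour on each side gives a monotone function or an interval of strict local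
  extrema, which is impossible. A point with neither behaviour on one of its sides has
  \<open>f\<close> constant on a short interval on that side.\<close>

lemma constant_or_monotone:
  assumes f: "dfun1 f" and "\<alpha> < \<beta>"
  shows "\<exists>\<alpha>' \<beta>'. \<alpha> \<le> \<alpha>' \<and> \<alpha>' < \<beta>' \<and> \<beta>' \<le> \<beta> \<and>
    ((\<forall>x y. \<alpha>' < x \<and> x < y \<and> y < \<beta>' \<longrightarrow> f x = f y) \<or> (\<forall>x y. \<alpha>' < x \<and> x < y \<and> y < \<beta>' \<longrightarrow> f x < f y) \<or>
     (\<forall>x y. \<alpha>' < x \<and> x < y \<and> y < \<beta>' \<longrightarrow> f y < f x))"
proof -
  note d = dfun1_comp[OF f]
  have nf: "dfun1 (\<lambda>x. - f x)" unfolding dfun1_def by (intro dintro d)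
  let ?RG = "\<lambda>x. \<exists>\<delta>>0. \<forall>y. x < y \<and> y < x + \<delta> \<longrightarrow> f x < f y"
  let ?RL = "\<lambda>x. \<exists>\<delta>>0. \<forall>y. x < y \<and> y < x + \<delta> \<longrightarrow> f y < f x"
  let ?LG = "\<lambda>x. \<exists>\<delta>>0. \<forall>y. x - \<delta> < y \<and> y < x \<longrightarrow> f x < f y"
  let ?LL = "\<lambda>x. \<exists>\<delta>>0. \<forall>y. x - \<delta> < y \<and> y < x \<longrightarrow> f y < f x"
  have "dpred1 ?RG" "dpred1 ?RL" "dpred1 ?LG" "dpred1 ?LL" unfolding dpred1_def by (intro dintro d)+
  note ds = this
  obtain \<beta>1 where 1: "\<alpha> < \<beta>1" "\<beta>1 \<le> \<beta>" "(\<forall>y. \<alpha> < y \<and> y < \<beta>1 \<longrightarrow> ?RG y) \<or> (\<forall>y. \<alpha> < y \<and> y < \<beta>1 \<longrightarrow> \<not> ?RG y)"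
    using dpred1_right[OF ds(1) assms(2)] by (elim exE conjE)
  obtain \<beta>2 where 2: "\<alpha> < \<beta>2" "\<beta>2 \<le> \<beta>1" "(\<forall>y. \<alpha> < y \<and> y < \<beta>2 \<longrightarrow> ?RL y) \<or> (\<forall>y. \<alpha> < y \<and> y < \<beta>2 \<longrightarrow> \<not> ?RL y)"
    using dpred1_right[OF ds(2) 1(1)] by (elim exE conjE)
  obtain \<beta>3 where 3: "\<alpha> < \<beta>3" "\<beta>3 \<le> \<beta>2" "(\<forall>y. \<alpha> < y \<and> y < \<beta>3 \<longrightarrow> ?LG y) \<or> (\<forall>y. \<alpha> < y \<and> y < \<beta>3 \<longrightarrow> \<not> ?LG y)"
    using dpred1_right[OF ds(3) 2(1)] by (elim exE conjE)
  obtain \<beta>4 where 4: "\<alpha> < \<beta>4" "\<beta>4 \<le> \<beta>3" "(\<forall>y. \<alpha> < y \<and> y < \<beta>4 \<longrightarrow> ?LL y) \<or> (\<forall>y. \<alpha> < y \<and> y < \<beta>4 \<longrightarrow> \<not> ?LL y)"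
    using dpred1_right[OF ds(4) 3(1)] by (elim exE conjE)
  have in1: "y < \<beta>1" and in2: "y < \<beta>2" and in3: "y < \<beta>3" and in0: "y < \<beta>" if "y < \<beta>4" for y
    using that 1(2) 2(2) 3(2) 4(2) by linarith+
  have c1: "(\<forall>y. \<alpha> < y \<and> y < \<beta>4 \<longrightarrow> ?RG y) \<or> (\<forall>y. \<alpha> < y \<and> y < \<beta>4 \<longrightarrow> \<not> ?RG y)" using 1(3) in1 by blast
  have c2: "(\<forall>y. \<alpha> < y \<and> y < \<beta>4 \<longrightarrow> ?RL y) \<or> (\<forall>y. \<alpha> < y \<and> y < \<beta>4 \<longrightarrow> \<not> ?RL y)" using 2(3) in2 by blast
  have c3: "(\<forall>y. \<alpha> < y \<and> y < \<beta>4 \<longrightarrow> ?LG y) \<or> (\<forall>y. \<alpha> < y \<and> y < \<beta>4 \<longrightarrow> \<not> ?LG y)" using 3(3) in3 by blast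
  have b4: "\<beta>4 \<le> \<beta>" using 1(2) 2(2) 3(2) 4(2) by linarith
  obtain x where x: "\<alpha> < x" "x < \<beta>4" using dense 4(1) by blast
  have "dpred1 (\<lambda>y. f x < f y)" "dpred1 (\<lambda>y. f y < f x)" unfolding dpred1_def by (intro dintro d)+
  note dx = this
  have e1: "(\<forall>y. \<alpha> < y \<and> y < \<beta>4 \<longrightarrow> ?RG y) \<or> \<not> ?RG x" using c1 x by (elim disjE) (rule disjI1, assumption, rule disjI2, blast)
  have e2: "(\<forall>y. \<alpha> < y \<and> y < \<beta>4 \<longrightarrow> ?RL y) \<or> \<not> ?RL x" using c2 x by (elim disjE) (rule disjI1, assumption, rule disjI2, blast)
  have e3: "(\<forall>y. \<alpha> < y \<and> y < \<beta>4 \<longrightarrow> ?LG y) \<or> \<not> ?LG x" using c3 x by (elim disjE) (rule disjI1, assumption, rule disjI2, blast)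
  have e4: "(\<forall>y. \<alpha> < y \<and> y < \<beta>4 \<longrightarrow> ?LL y) \<or> \<not> ?LL x" using 4(3) x by (elim disjE) (rule disjI1, assumption, rule disjI2, blast)
  have cases: "(A \<and> D) \<or> (B \<and> C) \<or> (A \<and> C) \<or> (B \<and> D) \<or> (a \<and> b) \<or> (c \<and> d)"
    if "A \<or> a" "B \<or> b" "C \<or> c" "D \<or> d" for A B C D a b c d
    using that by blast
  from cases[OF e1 e2 e3 e4] consider (inc) "\<forall>y. \<alpha> < y \<and> y < \<beta>4 \<longrightarrow> ?RG y" "\<forall>y. \<alpha> < y \<and> y < \<beta>4 \<longrightarrow> ?LL y"
    | (dec) "\<forall>y. \<alpha> < y \<and> y < \<beta>4 \<longrightarrow> ?RL y" "\<forall>y. \<alpha> < y \<and> y < \<beta>4 \<longrightarrow> ?LG y"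
    | (min) "\<forall>y. \<alpha> < y \<and> y < \<beta>4 \<longrightarrow> ?RG y" "\<forall>y. \<alpha> < y \<and> y < \<beta>4 \<longrightarrow> ?LG y"
    | (max) "\<forall>y. \<alpha> < y \<and> y < \<beta>4 \<longrightarrow> ?RL y" "\<forall>y. \<alpha> < y \<and> y < \<beta>4 \<longrightarrow> ?LL y"
    | (cr) "\<not> ?RG x" "\<not> ?RL x" | (cl) "\<not> ?LG x" "\<not> ?LL x"
    by (elim disjE conjE)
  then show ?thesis
  proof cases
    case inc
    have "f u < f w" if "\<alpha> < u \<and> u < w \<and> w < \<beta>4" for u w
      by (rule locally_increasing_imp_increasing[OF f, of \<alpha> \<beta>4]) (use inc that in blast)+
    then show ?thesis using 4(1) b4 by (intro exI[of _ \<alpha>] exI[of _ \<beta>4]) auto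
  next
    case dec
    have "f w < f u" if "\<alpha> < u \<and> u < w \<and> w < \<beta>4" for u w
      by (rule locally_increasing_imp_increasing[OF nf, of \<alpha> \<beta>4, unfolded neg_less_iff_less]) (use dec that in blast)+
    then show ?thesis using 4(1) b4 by (intro exI[of _ \<alpha>] exI[of _ \<beta>4]) auto
  next
    case min
    have "\<exists>\<delta>>0. \<forall>y. \<bar>y - u\<bar> < \<delta> \<and> y \<noteq> u \<longrightarrow> f u < f y" if u: "\<alpha> < u" "u < \<beta>4" for u
      by (rule two_sided_neighbourhood) (use min(1)[rule_format, of u] min(2)[rule_format, of u] u in \<open>simp_all\<close>)
    from no_interval_of_strict_local_minima[OF f 4(1) this] show ?thesis by (rule FalseE)
  next
    case max
    have "\<exists>\<delta>>0. \<forall>y. \<bar>y - u\<bar> < \<delta> \<and> y \<noteq> u \<longrightarrow> - f u < - f y" if u: "\<alpha> < u" "u < \<beta>4" for u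
      by (rule two_sided_neighbourhood) (use max(1)[rule_format, of u] max(2)[rule_format, of u] u in \<open>simp_all\<close>)
    from no_interval_of_strict_local_minima[OF nf 4(1) this] show ?thesis by (rule FalseE)
  next
    case cr
    obtain g1 where g1: "x < g1" "g1 \<le> \<beta>4" "(\<forall>y. x < y \<and> y < g1 \<longrightarrow> f x < f y) \<or> (\<forall>y. x < y \<and> y < g1 \<longrightarrow> \<not> f x < f y)"
      using dpred1_right[OF dx(1) x(2)] by (elim exE conjE)
    obtain g2 where g2: "x < g2" "g2 \<le> g1" "(\<forall>y. x < y \<and> y < g2 \<longrightarrow> f y < f x) \<or> (\<forall>y. x < y \<and> y < g2 \<longrightarrow> \<not> f y < f x)"
      using dpred1_right[OF dx(2) g1(1)] by (elim exE conjE)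
    have "\<not> (\<forall>y. x < y \<and> y < g1 \<longrightarrow> f x < f y)"
    proof
      assume "\<forall>y. x < y \<and> y < g1 \<longrightarrow> f x < f y"
      then have "?RG x" using g1(1) by (intro exI[of _ "g1 - x"]) simp
      then show False using cr by blast
    qed
    then have n1: "\<forall>y. x < y \<and> y < g1 \<longrightarrow> \<not> f x < f y" using g1(3) by (elim disjE) (erule notE, assumption)
    have "\<not> (\<forall>y. x < y \<and> y < g2 \<longrightarrow> f y < f x)"
    proof
      assume "\<forall>y. x < y \<and> y < g2 \<longrightarrow> f y < f x"
      then have "?RL x" using g2(1) by (intro exI[of _ "g2 - x"]) simp
      then show False using cr by blast
    qed
    then have n2: "\<forall>y. x < y \<and> y < g2 \<longrightarrow> \<not> f y < f x" using g2(3) by (elim disjE) (erule notE, assumption)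
    have e: "f y = f x" if "x < y" "y < g2" for y
    proof -
      have "\<not> f x < f y" using n1 that g2(2) by simp
      moreover have "\<not> f y < f x" using n2 that by blast
      ultimately show ?thesis by simp
    qed
    have "f u = f w" if "x < u \<and> u < w \<and> w < g2" for u w using e[of u] e[of w] that by simp
    then show ?thesis using x g1(2) g2(1,2) b4 by (intro exI[of _ x] exI[of _ g2]) auto
  next
    case cl
    obtain g1 where g1: "g1 < x" "\<alpha> \<le> g1" "(\<forall>y. g1 < y \<and> y < x \<longrightarrow> f x < f y) \<or> (\<forall>y. g1 < y \<and> y < x \<longrightarrow> \<not> f x < f y)"
      using dpred1_left[OF dx(1) x(1)] by (elim exE conjE)
    obtain g2 where g2: "g2 < x" "g1 \<le> g2" "(\<forall>y. g2 < y \<and> y < x \<longrightarrow> f y < f x) \<or> (\<forall>y. g2 < y \<and> y < x \<longrightarrow> \<not> f y < f x)"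
      using dpred1_left[OF dx(2) g1(1)] by (elim exE conjE)
    have "\<not> (\<forall>y. g1 < y \<and> y < x \<longrightarrow> f x < f y)"
    proof
      assume "\<forall>y. g1 < y \<and> y < x \<longrightarrow> f x < f y"
      then have "?LG x" using g1(1) by (intro exI[of _ "x - g1"]) simp
      then show False using cl by blast
    qed
    then have n1: "\<forall>y. g1 < y \<and> y < x \<longrightarrow> \<not> f x < f y" using g1(3) by (elim disjE) (erule notE, assumption)
    have "\<not> (\<forall>y. g2 < y \<and> y < x \<longrightarrow> f y < f x)"
    proof
      assume "\<forall>y. g2 < y \<and> y < x \<longrightarrow> f y < f x"
      then have "?LL x" using g2(1) by (intro exI[of _ "x - g2"]) simp
      then show False using cl by blast
    qed
    then have n2: "\<forall>y. g2 < y \<and> y < x \<longrightarrow> \<not> f y < f x" using g2(3) by (elim disjE) (erule notE, assumption)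
    have e: "f y = f x" if "g2 < y" "y < x" for y
    proof -
      have "\<not> f x < f y" using n1 that g2(2) by simp
      moreover have "\<not> f y < f x" using n2 that by blast
      ultimately show ?thesis by simp
    qed
    have "f u = f w" if "g2 < u \<and> u < w \<and> w < x" for u w using e[of u] e[of w] that by simp
    then show ?thesis using x g1(2) g2(1,2) b4 by (intro exI[of _ g2] exI[of _ x]) auto
  qed
qed

text \<open>The image of the interval is definable and infinite, so it contains an interval. A
  preimage of an inner point of that interval is a point of continuity: monotonicity confines nearby
  values between two attained values that may be taken arbitrarily close.\<close>

lemma increasing_imp_cont_point:
  assumes f: "dfun1 f" and "\<alpha> < \<beta>" and mono: "\<And>x y. \<alpha> < x \<Longrightarrow> x < y \<Longrightarrow> y < \<beta> \<Longrightarrow> f x < f y"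
  shows "\<exists>x. \<alpha> < x \<and> x < \<beta> \<and> cont_at f x"
proof -
  let ?I = "\<lambda>w. \<exists>x. \<alpha> < x \<and> x < \<beta> \<and> f x = w"
  have rev: "x < y" if "\<alpha> < x" "x < \<beta>" "\<alpha> < y" "y < \<beta>" "f x < f y" for x y
    using mono[of y x] that by (cases x y rule: linorder_cases) auto
  have "\<exists>p q. p < q \<and> (\<forall>z. p < z \<and> z < q \<longrightarrow> ?I z)"
  proof (rule ccontr)
    assume no: "\<not> ?thesis"
    have fin: "finite {w. ?I w}"
    proof (rule tame_finite)
      show "tame {w. ?I w}"
        by (rule dpred1_tame) (unfold dpred1_def, intro dintro dfun1_comp[OF f])
      show "\<exists>z. x < z \<and> z < y \<and> z \<notin> {w. ?I w}" if "x < y" for x y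
        unfolding mem_Collect_eq using no that by blast
    qed
    have "f ` {\<alpha><..<\<beta>} \<subseteq> {w. ?I w}" by auto
    then have fin': "finite (f ` {\<alpha><..<\<beta>})" using fin by (rule finite_subset)
    have "inj_on f {\<alpha><..<\<beta>}"
    proof (rule inj_onI)
      fix x y assume "x \<in> {\<alpha><..<\<beta>}" "y \<in> {\<alpha><..<\<beta>}" "f x = f y"
      then show "x = y" using mono[of x y] mono[of y x] by (cases x y rule: linorder_cases) auto
    qed
    with fin' have "finite {\<alpha><..<\<beta>}" by (rule finite_imageD)
    then show False using infinite_Ioo[OF assms(2)] by blast
  qed
  then obtain p q where pq: "p < q" "\<And>z. p < z \<Longrightarrow> z < q \<Longrightarrow> ?I z" by blast
  obtain w where w: "p < w" "w < q" using dense pq(1) by blast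
  obtain x where x: "\<alpha> < x" "x < \<beta>" "f x = w" using pq(2)[OF w] by blast
  have "\<exists>\<delta>>0. \<forall>y. \<bar>y - x\<bar> < \<delta> \<longrightarrow> \<bar>f y - f x\<bar> < \<epsilon>" if e: "\<epsilon> > 0" for \<epsilon>
  proof -
    have "max p (w - \<epsilon>) < w" "w < min q (w + \<epsilon>)" using w e by auto
    then obtain w1 w2 where w12: "max p (w - \<epsilon>) < w1" "w1 < w" "w < w2" "w2 < min q (w + \<epsilon>)"
      using dense[of "max p (w - \<epsilon>)" w] dense[of w "min q (w + \<epsilon>)"] by blast
    obtain x1 where x1: "\<alpha> < x1" "x1 < \<beta>" "f x1 = w1" using pq(2)[of w1] w12 w by auto
    obtain x2 where x2: "\<alpha> < x2" "x2 < \<beta>" "f x2 = w2" using pq(2)[of w2] w12 w by auto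
    have "x1 < x" "x < x2" using rev x x1 x2 w12 by auto
    moreover have "\<bar>f y - f x\<bar> < \<epsilon>" if y: "\<bar>y - x\<bar> < min (x - x1) (x2 - x)" for y
    proof -
      have "x1 < y" "y < x2" using y by (auto simp: abs_less_iff)
      then have "w1 < f y" "f y < w2" using mono[of x1 y] mono[of y x2] x1 x2 by auto
      then show ?thesis using w12 x(3) by (auto simp: abs_less_iff)
    qed
    ultimately show ?thesis by (intro exI[of _ "min (x - x1) (x2 - x)"]) auto
  qed
  then show ?thesis using x unfolding cont_at_def by blast
qed

lemma cont_at_minus: "cont_at (\<lambda>x. - f x) x \<longleftrightarrow> cont_at f x"
  unfolding cont_at_def by (simp add: abs_minus_commute)

lemma dpred1_cont_at:
  assumes "dfun1 f" shows "dpred1 (cont_at f)"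
  unfolding dpred1_def cont_at_def by (intro dintro dfun1_comp[OF assms])

lemma finite_discontinuities:
  assumes f: "dfun1 f" shows "finite {x. \<not> cont_at f x}"
proof (rule tame_finite)
  show "tame {x. \<not> cont_at f x}"
    using dpred1_cont_at[OF f] by (intro dpred1_tame) (simp add: dpred1_def dpred_not)
  fix \<alpha> \<beta> :: 'r assume "\<alpha> < \<beta>"
  from constant_or_monotone[OF f this] obtain \<alpha>' \<beta>' where ab: "\<alpha> \<le> \<alpha>'" "\<alpha>' < \<beta>'" "\<beta>' \<le> \<beta>"
    "(\<forall>x y. \<alpha>' < x \<and> x < y \<and> y < \<beta>' \<longrightarrow> f x = f y) \<or> (\<forall>x y. \<alpha>' < x \<and> x < y \<and> y < \<beta>' \<longrightarrow> f x < f y) \<or>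
     (\<forall>x y. \<alpha>' < x \<and> x < y \<and> y < \<beta>' \<longrightarrow> f y < f x)" by (elim exE conjE)
  have "\<exists>x. \<alpha>' < x \<and> x < \<beta>' \<and> cont_at f x"
  proof -
    consider (c) "\<forall>x y. \<alpha>' < x \<and> x < y \<and> y < \<beta>' \<longrightarrow> f x = f y" | (i) "\<forall>x y. \<alpha>' < x \<and> x < y \<and> y < \<beta>' \<longrightarrow> f x < f y"
      | (d) "\<forall>x y. \<alpha>' < x \<and> x < y \<and> y < \<beta>' \<longrightarrow> f y < f x" using ab(4) by (elim disjE)
    then show ?thesis
    proof cases
      case c
      obtain x where x: "\<alpha>' < x" "x < \<beta>'" using dense ab(2) by blast
      have eq: "f y = f x" if "\<bar>y - x\<bar> < min (x - \<alpha>') (\<beta>' - x)" for y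
      proof (cases x y rule: linorder_cases)
        case less
        then show ?thesis using c[rule_format, of x y] x that by (simp add: abs_less_iff)
      next
        case greater
        then show ?thesis using c[rule_format, of y x] x that by (simp add: abs_less_iff)
      qed simp
      have "cont_at f x" unfolding cont_at_def
      proof (intro allI impI)
        fix \<epsilon> :: 'r assume "0 < \<epsilon>"
        then have "\<bar>f y - f x\<bar> < \<epsilon>" if "\<bar>y - x\<bar> < min (x - \<alpha>') (\<beta>' - x)" for y
          using eq[OF that] by simp
        moreover have "0 < min (x - \<alpha>') (\<beta>' - x)" using x by simp
        ultimately show "\<exists>\<delta>>0. \<forall>y. \<bar>y - x\<bar> < \<delta> \<longrightarrow> \<bar>f y - f x\<bar> < \<epsilon>" by blast
      qed
      then show ?thesis using x by blast
    next
      case i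
      show ?thesis by (rule increasing_imp_cont_point[OF f ab(2)]) (use i in blast)
    next
      case d
      have "dfun1 (\<lambda>x. - f x)" unfolding dfun1_def by (intro dintro dfun1_comp[OF f])
      moreover have "- f x < - f y" if "\<alpha>' < x" "x < y" "y < \<beta>'" for x y using d that by simp
      ultimately have "\<exists>x. \<alpha>' < x \<and> x < \<beta>' \<and> cont_at (\<lambda>x. - f x) x" by (rule increasing_imp_cont_point[OF _ ab(2)])
      then show ?thesis unfolding cont_at_minus .
    qed
  qed
  then obtain x where "\<alpha>' < x" "x < \<beta>'" "cont_at f x" by blast
  then show "\<exists>z. \<alpha> < z \<and> z < \<beta> \<and> z \<notin> {x. \<not> cont_at f x}"
    using ab(1,3) by (intro exI[of _ x]) auto
qed

section \<open>One-sided Lipschitz estimates\<close>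

text \<open>A substitute for differentiability that is easier to obtain and still strong enough to
  pass a vanishing derivative along a curve; see \<open>critical_curve\<close>.\<close>

definition right_Lipschitz :: "('r \<Rightarrow> 'r) \<Rightarrow> 'r \<Rightarrow> bool" where
  "right_Lipschitz f x \<longleftrightarrow> (\<exists>c>0. \<exists>\<delta>>0. \<forall>t. 0 < t \<and> t < \<delta> \<longrightarrow> \<bar>f (x + t) - f x\<bar> \<le> c * t)"

lemma right_Lipschitz_minus: "right_Lipschitz (\<lambda>x. - f x) x \<longleftrightarrow> right_Lipschitz f x"
  unfolding right_Lipschitz_def by (simp add: abs_minus_commute)

lemma dpred1_right_Lipschitz:
  assumes "dfun1 f" shows "dpred1 (right_Lipschitz f)"
  unfolding dpred1_def right_Lipschitz_def by (intro dintro dfun1_comp[OF assms])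

text \<open>If \<open>f\<close> does not fall to the right of \<open>x\<close> and is not right
  Lipschitz there, then by tameness its increments exceed \<open>c * t\<close> near \<open>x\<close>
  for every \<open>c > 0\<close>. So \<open>growth_bound\<close> for \<open>- f\<close> gives
  \<open>c * (x2 - x1) \<le> f x2 - f x1\<close> for all these \<open>c\<close>; the value of
  \<open>c\<close> taken at the end turns the left side into
  \<open>\<bar>f x2 - f x1\<bar> + 1\<close>.\<close>

lemma no_vertical_ascent:
  assumes f: "dfun1 f" and "\<alpha> < \<beta>"
    and cont: "\<And>x. \<alpha> < x \<Longrightarrow> x < \<beta> \<Longrightarrow> cont_at f x"
    and nl: "\<And>x. \<alpha> < x \<Longrightarrow> x < \<beta> \<Longrightarrow> \<not> right_Lipschitz f x"
    and up: "\<And>x. \<alpha> < x \<Longrightarrow> x < \<beta> \<Longrightarrow> \<exists>\<delta>>0. \<forall>t. 0 < t \<and> t < \<delta> \<longrightarrow> f x \<le> f (x + t)"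
  shows False
proof -
  note d = dfun1_comp[OF f]
  obtain x1 where x1: "\<alpha> < x1" "x1 < \<beta>" using dense assms(2) by blast
  obtain x2 where x2: "x1 < x2" "x2 < \<beta>" using dense x1(2) by blast
  have nf: "dfun1 (\<lambda>x. - f x)" unfolding dfun1_def by (intro dintro d)
  have *: "c * (x2 - x1) \<le> f x2 - f x1" if c: "c > 0" for c
  proof -
    have "- f x2 \<le> - f x1 + (- c) * (x2 - x1)"
    proof (rule growth_bound[OF nf])
      fix x \<epsilon> :: 'r assume x: "x1 < x" "x \<le> x2" "0 < \<epsilon>"
      then have "cont_at f x" using cont[of x] x1 x2 by simp
      then obtain \<delta> where \<delta>: "\<delta> > 0" "\<forall>y. \<bar>y - x\<bar> < \<delta> \<longrightarrow> \<bar>f y - f x\<bar> < \<epsilon>" using x(3) unfolding cont_at_def by blast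
      have "- f x < - f y + \<epsilon>" if "x - \<delta> < y \<and> y < x \<and> x1 \<le> y" for y
        using \<delta>(2)[rule_format, of y] that by (simp add: abs_less_iff)
      then show "\<exists>\<delta>>0. \<forall>y. x - \<delta> < y \<and> y < x \<and> x1 \<le> y \<longrightarrow> - f x < - f y + \<epsilon>" using \<delta>(1) by blast
    next
      fix x assume x: "x1 \<le> x" "x < x2"
      then have x': "\<alpha> < x" "x < \<beta>" using x1 x2 by auto
      obtain \<delta>1 where \<delta>1: "\<delta>1 > 0" "\<forall>t. 0 < t \<and> t < \<delta>1 \<longrightarrow> f x \<le> f (x + t)" using up[OF x'] by blast
      have "dpred1 (\<lambda>t. f (x + t) - f x \<le> c * t)" unfolding dpred1_def by (intro dintro d)
      from dpred1_right[OF this \<delta>1(1)] obtain \<delta>2 where \<delta>2: "0 < \<delta>2" "\<delta>2 \<le> \<delta>1"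
        "(\<forall>t. 0 < t \<and> t < \<delta>2 \<longrightarrow> f (x + t) - f x \<le> c * t) \<or> (\<forall>t. 0 < t \<and> t < \<delta>2 \<longrightarrow> \<not> f (x + t) - f x \<le> c * t)"
        by (elim exE conjE)
      have "\<not> (\<forall>t. 0 < t \<and> t < \<delta>2 \<longrightarrow> f (x + t) - f x \<le> c * t)"
      proof
        assume "\<forall>t. 0 < t \<and> t < \<delta>2 \<longrightarrow> f (x + t) - f x \<le> c * t"
        then have "\<bar>f (x + t) - f x\<bar> \<le> c * t" if "0 < t \<and> t < \<delta>2" for t
          using \<delta>1(2)[rule_format, of t] that \<delta>2(2) by (simp add: abs_of_nonneg)
        then have "right_Lipschitz f x" unfolding right_Lipschitz_def using c \<delta>2(1) by blast
        then show False using nl[OF x'] by blast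
      qed
      then have g: "\<not> f (x + t) - f x \<le> c * t" if "0 < t \<and> t < \<delta>2" for t using \<delta>2(3) that by blast
      have "- f y \<le> - f x + (- c) * (y - x)" if "x < y \<and> y < x + \<delta>2" for y
        using g[of "y - x"] that by simp
      then show "\<exists>\<delta>>0. \<forall>y. x < y \<and> y < x + \<delta> \<longrightarrow> - f y \<le> - f x + (- c) * (y - x)" using \<delta>2(1) by blast
    qed (use x2 in simp)
    then show ?thesis by simp
  qed
  have pos: "x2 - x1 > 0" using x2 by simp
  have "(\<bar>f x2 - f x1\<bar> + 1) / (x2 - x1) > 0" using pos by (intro divide_pos_pos) auto
  from *[OF this] have "\<bar>f x2 - f x1\<bar> + 1 \<le> f x2 - f x1" using pos by simp
  then show False using abs_ge_self[of "f x2 - f x1"] by linarith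
qed

text \<open>An interval of exceptions can be shrunk until \<open>f\<close> is continuous on it and
  has the same one-sided direction at all its points. Then \<open>f\<close> or \<open>- f\<close> is
  a case for \<open>no_vertical_ascent\<close>.\<close>

lemma finite_not_right_Lipschitz:
  assumes f: "dfun1 f" shows "finite {x. \<not> right_Lipschitz f x}"
proof (rule tame_finite)
  show "tame {x. \<not> right_Lipschitz f x}"
    using dpred1_right_Lipschitz[OF f] by (intro dpred1_tame) (simp add: dpred1_def dpred_not)
  fix \<alpha> \<beta> :: 'r assume ab: "\<alpha> < \<beta>"
  note d = dfun1_comp[OF f]
  show "\<exists>z. \<alpha> < z \<and> z < \<beta> \<and> z \<notin> {x. \<not> right_Lipschitz f x}"
  proof (rule ccontr)
    assume "\<not> ?thesis"
    then have nl: "\<not> right_Lipschitz f x" if "\<alpha> < x" "x < \<beta>" for x using that by blast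
    obtain \<beta>1 where 1: "\<alpha> < \<beta>1" "\<beta>1 \<le> \<beta>" "(\<forall>y. \<alpha> < y \<and> y < \<beta>1 \<longrightarrow> cont_at f y) \<or> (\<forall>y. \<alpha> < y \<and> y < \<beta>1 \<longrightarrow> \<not> cont_at f y)"
      using dpred1_right[OF dpred1_cont_at[OF f] ab] by (elim exE conjE)
    have "\<not> (\<forall>y. \<alpha> < y \<and> y < \<beta>1 \<longrightarrow> \<not> cont_at f y)"
    proof
      assume "\<forall>y. \<alpha> < y \<and> y < \<beta>1 \<longrightarrow> \<not> cont_at f y"
      then have "{\<alpha><..<\<beta>1} \<subseteq> {x. \<not> cont_at f x}" by auto
      then show False using finite_discontinuities[OF f] infinite_Ioo[OF 1(1)] finite_subset by blast
    qed
    then have cont: "cont_at f y" if "\<alpha> < y" "y < \<beta>1" for y using 1(3) that by blast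
    let ?U = "\<lambda>x. \<exists>\<delta>>0. \<forall>t. 0 < t \<and> t < \<delta> \<longrightarrow> f x \<le> f (x + t)"
    have "dpred1 ?U" unfolding dpred1_def by (intro dintro d)
    from dpred1_right[OF this 1(1)] obtain \<beta>2 where 2: "\<alpha> < \<beta>2" "\<beta>2 \<le> \<beta>1"
      "(\<forall>y. \<alpha> < y \<and> y < \<beta>2 \<longrightarrow> ?U y) \<or> (\<forall>y. \<alpha> < y \<and> y < \<beta>2 \<longrightarrow> \<not> ?U y)" by (elim exE conjE)
    have c2: "cont_at f x" "\<not> right_Lipschitz f x" if "\<alpha> < x" "x < \<beta>2" for x
      using cont nl that 1(2) 2(2) by auto
    from 2(3) show False
    proof
      assume "\<forall>y. \<alpha> < y \<and> y < \<beta>2 \<longrightarrow> ?U y"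
      then show False using no_vertical_ascent[OF f 2(1)] c2 by blast
    next
      assume nU: "\<forall>y. \<alpha> < y \<and> y < \<beta>2 \<longrightarrow> \<not> ?U y"
      have "\<exists>\<delta>>0. \<forall>t. 0 < t \<and> t < \<delta> \<longrightarrow> - f x \<le> - f (x + t)" if x: "\<alpha> < x" "x < \<beta>2" for x
      proof -
        have "dpred1 (\<lambda>t. f x \<le> f (x + t))" unfolding dpred1_def by (intro dintro d)
        moreover have "(0::'r) < 1" by simp
        ultimately have "\<exists>\<gamma>. 0 < \<gamma> \<and> \<gamma> \<le> 1 \<and> ((\<forall>t. 0 < t \<and> t < \<gamma> \<longrightarrow> f x \<le> f (x + t)) \<or> (\<forall>t. 0 < t \<and> t < \<gamma> \<longrightarrow> \<not> f x \<le> f (x + t)))"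
          by (rule dpred1_right)
        then obtain \<delta> where \<delta>: "0 < \<delta>" "(\<forall>t. 0 < t \<and> t < \<delta> \<longrightarrow> f x \<le> f (x + t)) \<or> (\<forall>t. 0 < t \<and> t < \<delta> \<longrightarrow> \<not> f x \<le> f (x + t))"
          by (elim exE conjE)
        have "\<not> (\<forall>t. 0 < t \<and> t < \<delta> \<longrightarrow> f x \<le> f (x + t))" using nU x \<delta>(1) by blast
        then have n: "\<forall>t. 0 < t \<and> t < \<delta> \<longrightarrow> \<not> f x \<le> f (x + t)" using \<delta>(2) by blast
        have "- f x \<le> - f (x + t)" if "0 < t \<and> t < \<delta>" for t using n[rule_format, OF that] by simp
        then show ?thesis using \<delta>(1) by blast
      qed
      moreover have "dfun1 (\<lambda>x. - f x)" unfolding dfun1_def by (intro dintro d)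
      ultimately show False
        using no_vertical_ascent[of "\<lambda>x. - f x", OF _ 2(1)] c2 by (simp only: cont_at_minus right_Lipschitz_minus) blast
    qed
  qed
qed

lemma eventually_cofinite:
  assumes "finite {x. \<not> P x}" shows "\<exists>k. \<forall>x>k. P (x::'r)"
proof (intro exI allI impI)
  fix x assume x: "x > Max (insert 0 {x. \<not> P x})"
  show "P x"
  proof (rule ccontr)
    assume "\<not> P x"
    then have "x \<le> Max (insert 0 {x. \<not> P x})" using assms by (intro Max_ge) auto
    then show False using x by simp
  qed
qed

text \<open>The growth bound holds with every slope \<open>\<epsilon> > 0\<close>, for
  \<open>f\<close> and for \<open>- f\<close>, and this leaves no room for a difference. Only the
  right derivative is controlled; on the left, continuity takes its place.\<close>

lemma zero_right_derivative_imp_constant: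
  assumes f: "dfun1 f" and cont: "\<And>x. k < x \<Longrightarrow> cont_at f x"
    and der: "\<And>x \<epsilon>. k < x \<Longrightarrow> 0 < \<epsilon> \<Longrightarrow> \<exists>\<delta>>0. \<forall>t. 0 < t \<and> t < \<delta> \<longrightarrow> \<bar>f (x + t) - f x\<bar> \<le> \<epsilon> * t"
    and xy: "k < x" "x < y"
  shows "f x = f y"
proof -
  \<comment> \<open>\<open>g\<close> stands for \<open>f\<close> and for \<open>- f\<close>; its
    hypotheses record just what the two have in common.\<close>
  have bound: "g y \<le> g x + \<epsilon> * (y - x)" if e: "\<epsilon> > 0" and g: "dfun1 g" "\<And>x. \<bar>g x\<bar> = \<bar>f x\<bar>" "\<And>u w. \<bar>g u - g w\<bar> = \<bar>f u - f w\<bar>" for g \<epsilon>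
  proof (rule growth_bound[OF g(1)])
    fix u \<eta> :: 'r assume u: "x < u" "u \<le> y" "0 < \<eta>"
    then have "cont_at f u" using cont xy by simp
    then obtain \<delta> where \<delta>: "\<delta> > 0" "\<forall>w. \<bar>w - u\<bar> < \<delta> \<longrightarrow> \<bar>f w - f u\<bar> < \<eta>" using u(3) unfolding cont_at_def by blast
    have "g u < g w + \<eta>" if "u - \<delta> < w \<and> w < u \<and> x \<le> w" for w
    proof -
      have "\<bar>g w - g u\<bar> < \<eta>" using \<delta>(2)[rule_format, of w] that by (simp add: g(3))
      then show ?thesis by (simp add: abs_less_iff)
    qed
    then show "\<exists>\<delta>>0. \<forall>w. u - \<delta> < w \<and> w < u \<and> x \<le> w \<longrightarrow> g u < g w + \<eta>" using \<delta>(1) by blast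
  next
    fix u assume u: "x \<le> u" "u < y"
    obtain \<delta> where \<delta>: "\<delta> > 0" "\<forall>t. 0 < t \<and> t < \<delta> \<longrightarrow> \<bar>f (u + t) - f u\<bar> \<le> \<epsilon> * t" using der[of u \<epsilon>] u xy e by auto
    have "g w \<le> g u + \<epsilon> * (w - u)" if "u < w \<and> w < u + \<delta>" for w
    proof -
      have "\<bar>g w - g u\<bar> \<le> \<epsilon> * (w - u)" using \<delta>(2)[rule_format, of "w - u"] that by (simp add: g(3))
      then show ?thesis by (simp add: abs_le_iff)
    qed
    then show "\<exists>\<delta>>0. \<forall>w. u < w \<and> w < u + \<delta> \<longrightarrow> g w \<le> g u + \<epsilon> * (w - u)" using \<delta>(1) by blast
  qed (use xy in simp)
  have nf: "dfun1 (\<lambda>x. - f x)" unfolding dfun1_def by (intro dintro dfun1_comp[OF f])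
  have "\<bar>f y - f x\<bar> \<le> \<epsilon> * (y - x)" if "\<epsilon> > 0" for \<epsilon>
    using bound[OF that f] bound[OF that nf] by (simp add: abs_le_iff abs_minus_commute)
  note b = this
  show ?thesis
  proof (rule ccontr)
    assume "f x \<noteq> f y"
    define \<epsilon> where "\<epsilon> = \<bar>f y - f x\<bar> / 2 / (y - x)"
    have ne: "y - x \<noteq> 0" using xy by simp
    have "\<epsilon> * (y - x) = \<bar>f y - f x\<bar> / 2"
      unfolding \<epsilon>_def times_divide_eq_left[of _ "y - x"] by (rule nonzero_mult_div_cancel_right[OF ne])
    moreover have "\<epsilon> > 0" using xy \<open>f x \<noteq> f y\<close> by (simp add: \<epsilon>_def)
    ultimately have "\<bar>f y - f x\<bar> \<le> \<bar>f y - f x\<bar> / 2" using b by metis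
    then show False using \<open>f x \<noteq> f y\<close> by simp
  qed
qed

end

section \<open>The absolute value of \<open>K\<close>\<close>

lemma re_im_simps [simp]:
  "re 0 = 0" "im 0 = 0" "re 1 = 1" "im 1 = 0" "re (z + w) = re z + re w" "im (z + w) = im z + im w"
  "re (z - w) = re z - re w" "im (z - w) = im z - im w" "re (- z) = - re z" "im (- z) = - im z"
  "re (z * w) = re z * re w - im z * im w" "im (z * w) = re z * im w + im z * re w"
  "re (of_R x) = x" "im (of_R x) = 0"
  by (simp_all add: zero_adjoin_i_def one_adjoin_i_def plus_adjoin_i_def minus_adjoin_i_def
      uminus_adjoin_i_def times_adjoin_i_def of_R_def)

lemma K_eqI: "re z = re w \<Longrightarrow> im z = im w \<Longrightarrow> z = w"
  by (rule adjoin_i.expand) simp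

lemma of_R_simps [simp]: "of_R 0 = 0" "of_R 1 = 1" "of_R (x + y) = of_R x + of_R y"
  "of_R (x - y) = of_R x - of_R y" "of_R (x * y) = of_R x * of_R y" "of_R x = of_R y \<longleftrightarrow> x = y"
  by (auto intro!: K_eqI dest: arg_cong[of _ _ re])

lemma of_R_eq_0 [simp]: "of_R x = 0 \<longleftrightarrow> x = 0"
  using of_R_simps(6)[of x 0] by simp

lemma of_R_sum: "of_R (\<Sum>i\<in>A. f i) = (\<Sum>i\<in>A. of_R (f i))"
  by (induction A rule: infinite_finite_induct) auto

lemma im_sum: "im (\<Sum>i\<in>A. f i) = (\<Sum>i\<in>A. im (f i))"
  by (induction A rule: infinite_finite_induct) auto

lemma absK_mult: "absK (z * w) = absK z * absK w"
proof (rule absK_eqI[symmetric])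
  show "0 \<le> absK z * absK w" by (simp add: absK_nonneg)
  have "absK z * absK w * (absK z * absK w) = (absK z * absK z) * (absK w * absK w)" by (simp add: mult_ac)
  then show "absK z * absK w * (absK z * absK w) = re (z * w) * re (z * w) + im (z * w) * im (z * w)"
    unfolding absK_square by (simp add: algebra_simps)
qed

lemma absK_of_R [simp]: "absK (of_R x) = \<bar>x\<bar>"
  by (rule absK_eqI[symmetric]) auto

lemma absK_0 [simp]: "absK 0 = 0" and absK_1 [simp]: "absK 1 = 1"
  using absK_of_R[of 0] absK_of_R[of 1] by simp_all

lemma absK_minus [simp]: "absK (- z) = absK z"
  by (rule absK_eqI) (simp_all add: absK_nonneg absK_square)

lemma absK_minus_commute: "absK (z - w) = absK (w - z)"
  using absK_minus[of "z - w"] by simp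

lemma absK_eq_0 [simp]: "absK z = 0 \<longleftrightarrow> z = 0"
proof
  assume "absK z = 0"
  then have "re z * re z + im z * im z = 0" using absK_square[of z] by simp
  then show "z = 0" by (intro K_eqI) (simp_all add: sum_squares_eq_zero_iff)
qed simp

lemma absK_pos: "z \<noteq> 0 \<Longrightarrow> 0 < absK z"
  using absK_nonneg[of z] absK_eq_0[of z] by (simp add: order_le_less)

lemma abs_re_le: "\<bar>re z\<bar> \<le> absK z"
proof (rule power2_le_imp_le)
  show "\<bar>re z\<bar>\<^sup>2 \<le> (absK z)\<^sup>2" using absK_square[of z] by (simp add: power2_eq_square)
qed (rule absK_nonneg)

lemma abs_im_le: "\<bar>im z\<bar> \<le> absK z"
proof (rule power2_le_imp_le)
  show "\<bar>im z\<bar>\<^sup>2 \<le> (absK z)\<^sup>2" using absK_square[of z] by (simp add: power2_eq_square)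
qed (rule absK_nonneg)

lemma absK_triangle: "absK (z + w) \<le> absK z + absK w"
proof (rule power2_le_imp_le)
  \<comment> \<open>The Cauchy-Schwarz inequality for \<open>z\<close> and \<open>w\<close> as
    vectors of the real plane, by Lagrange's identity.\<close>
  have cs: "re z * re w + im z * im w \<le> absK z * absK w"
  proof (rule power2_le_imp_le)
    have "(re z * re w + im z * im w)\<^sup>2 + (re z * im w - im z * re w)\<^sup>2 = (absK z * absK z) * (absK w * absK w)"
      unfolding absK_square by (simp add: power2_eq_square algebra_simps)
    moreover have "(absK z * absK z) * (absK w * absK w) = (absK z * absK w)\<^sup>2" by (simp add: power2_eq_square mult_ac)
    ultimately show "(re z * re w + im z * im w)\<^sup>2 \<le> (absK z * absK w)\<^sup>2"
      by (metis le_add_same_cancel1 zero_le_power2)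
  qed (simp add: absK_nonneg)
  have "(absK (z + w))\<^sup>2 = absK z * absK z + absK w * absK w + 2 * (re z * re w + im z * im w)"
    unfolding power2_eq_square absK_square by (simp add: algebra_simps)
  moreover have "(absK z + absK w)\<^sup>2 = absK z * absK z + absK w * absK w + 2 * (absK z * absK w)"
    by (simp add: power2_eq_square algebra_simps)
  ultimately show "(absK (z + w))\<^sup>2 \<le> (absK z + absK w)\<^sup>2"
    using mult_left_mono[OF cs, of 2] by simp
qed (simp add: absK_nonneg)

lemma absK_triangle_diff: "absK (z - w) \<le> absK (z - u) + absK (u - w)"
  using absK_triangle[of "z - u" "u - w"] by simp

lemma absK_diff_ge: "absK z - absK w \<le> absK (z - w)"
  using absK_triangle[of "z - w" w] by (simp add: algebra_simps)

lemma absK_le_re_im: "absK z \<le> \<bar>re z\<bar> + \<bar>im z\<bar>"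
proof -
  have "absK (of_R (re z) + of_R (im z) * Adjoin_I 0 1) \<le> \<bar>re z\<bar> + \<bar>im z\<bar> * absK (Adjoin_I 0 1)"
    using absK_triangle[of "of_R (re z)" "of_R (im z) * Adjoin_I 0 1"] by (simp add: absK_mult)
  moreover have "absK (Adjoin_I 0 1 :: 'a adjoin_i) = 1" by (rule absK_eqI[symmetric]) auto
  moreover have "of_R (re z) + of_R (im z) * Adjoin_I 0 1 = z" by (rule K_eqI) auto
  ultimately show ?thesis by simp
qed

lemma absK_inverse: "absK (inverse z) = inverse (absK z)"
proof (cases "z = 0")
  case False
  then have "absK z * absK (inverse z) = 1" by (simp add: absK_mult[symmetric])
  then show ?thesis by (metis inverse_unique)
qed simp

lemma absK_divide: "absK (z / w) = absK z / absK w"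
  by (simp add: divide_inverse absK_mult absK_inverse)

lemma absK_sum: "absK (\<Sum>i\<in>A. f i) \<le> (\<Sum>i\<in>A. absK (f i))"
proof (induction A rule: infinite_finite_induct)
  case (insert x F)
  then show ?case using absK_triangle[of "f x" "sum f F"] by simp
qed auto

context o_minimal_expansion
begin

section \<open>Definable compactness\<close>

text \<open>A point of \<open>K\<^sup>p\<close> is represented by an infinite sequence of which
  \<open>p\<close> entries matter. So one notion serves all dimensions, and a single coordinate is
  changed by function update.\<close>

definition dfunVK :: "((nat \<Rightarrow> 'r adjoin_i) \<Rightarrow> 'r adjoin_i) \<Rightarrow> bool" where
  "dfunVK G \<longleftrightarrow> dfunK (\<lambda>e. G (\<lambda>i. Adjoin_I (e (2 * i)) (e (2 * i + 1))))"
definition dfunVR :: "((nat \<Rightarrow> 'r adjoin_i) \<Rightarrow> 'r) \<Rightarrow> bool" where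
  "dfunVR G \<longleftrightarrow> dfun (\<lambda>e. G (\<lambda>i. Adjoin_I (e (2 * i)) (e (2 * i + 1))))"
definition dpredV :: "((nat \<Rightarrow> 'r adjoin_i) \<Rightarrow> bool) \<Rightarrow> bool" where
  "dpredV P \<longleftrightarrow> dpred (\<lambda>e. P (\<lambda>i. Adjoin_I (e (2 * i)) (e (2 * i + 1))))"
definition dpredRV :: "('r \<Rightarrow> (nat \<Rightarrow> 'r adjoin_i) \<Rightarrow> bool) \<Rightarrow> bool" where
  "dpredRV P \<longleftrightarrow> dpred (\<lambda>e. P (e 0) (\<lambda>i. Adjoin_I (e (2 * i + 1)) (e (2 * i + 2))))"

lemma dfun_coords:
  assumes "\<And>i. dfunK (t i)"
  shows "dfun (if even k then (\<lambda>e. re (t (k div 2) e)) else (\<lambda>e. im (t (k div 2) e)))"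
  using assms by (simp add: dfunK_def)

lemma dfunVR_comp:
  assumes "dfunVR G" "\<And>i. dfunK (t i)" shows "dfun (\<lambda>e. G (\<lambda>i. t i e))"
  using dfun_subst[OF assms(1)[unfolded dfunVR_def],
      where t = "\<lambda>k. if even k then (\<lambda>e. re (t (k div 2) e)) else (\<lambda>e. im (t (k div 2) e))",
      OF dfun_coords[of t, OF assms(2)]] by simp

lemma dfunVK_comp:
  assumes "dfunVK G" "\<And>i. dfunK (t i)" shows "dfunK (\<lambda>e. G (\<lambda>i. t i e))"
  using dfunK_subst[OF assms(1)[unfolded dfunVK_def],
      where t = "\<lambda>k. if even k then (\<lambda>e. re (t (k div 2) e)) else (\<lambda>e. im (t (k div 2) e))",
      OF dfun_coords[of t, OF assms(2)]] by simp

lemma dpredV_comp: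
  assumes "dpredV P" "\<And>i. dfunK (t i)" shows "dpred (\<lambda>e. P (\<lambda>i. t i e))"
  using dpred_subst[OF assms(1)[unfolded dpredV_def],
      where t = "\<lambda>k. if even k then (\<lambda>e. re (t (k div 2) e)) else (\<lambda>e. im (t (k div 2) e))",
      OF dfun_coords[of t, OF assms(2)]] by simp

lemma dpredRV_comp:
  assumes "dpredRV P" "dfun s" "\<And>i. dfunK (t i)" shows "dpred (\<lambda>e. P (s e) (\<lambda>i. t i e))"
proof -
  let ?t = "\<lambda>k. case k of 0 \<Rightarrow> s | Suc k \<Rightarrow> if even k then (\<lambda>e. re (t (k div 2) e)) else (\<lambda>e. im (t (k div 2) e))"
  have "dfun (?t k)" for k using assms(2) dfun_coords[of t, OF assms(3)] by (cases k) auto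
  from dpred_subst[OF assms(1)[unfolded dpredRV_def], where t = ?t, OF this] show ?thesis by simp
qed

lemma dpredRV_ex_coord:
  assumes "dpredRV Q" shows "dpredRV (\<lambda>t v. \<exists>z. Q t (v(N := z)))"
  unfolding dpredRV_def
proof (rule dpred_exK)
  let ?t = "\<lambda>i e. ((\<lambda>i. Adjoin_I (e (Suc (Suc (2 * i + 1)))) (e (Suc (Suc (2 * i + 2)))))(N := Adjoin_I (e 1) (e 0))) i"
  have t: "dfunK (?t i)" for i
    by (cases "i = N") (auto intro!: dfunK_Adjoin_I dfun_var)
  show "dpred (\<lambda>e. Q (e (Suc (Suc 0))) ((\<lambda>i. Adjoin_I (e (Suc (Suc (2 * i + 1)))) (e (Suc (Suc (2 * i + 2)))))(N := Adjoin_I (e 1) (e 0))))"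
    by (rule dpredRV_comp[OF assms dfun_var, where t = ?t, OF t])
qed

text \<open>Quantifies over the first \<open>N\<close> coordinates at once. The entries of
  \<open>v\<close> from \<open>N\<close> on remain free and are the arguments of the resulting
  predicate.\<close>

lemma dpredRV_ex:
  assumes "dpredRV Q" shows "dpredRV (\<lambda>t v. \<exists>w. (\<forall>i\<ge>N. w i = v i) \<and> Q t w)"
proof (induction N)
  case 0
  have "(\<exists>w. (\<forall>i\<ge>0. w i = v i) \<and> Q t w) = Q t v" for t and v :: "nat \<Rightarrow> 'r adjoin_i"
  proof -
    have "(\<forall>i\<ge>0. w i = v i) \<longleftrightarrow> w = v" for w by auto
    then show ?thesis by simp
  qed
  then show ?case using assms by simp
next
  case (Suc N)
  have eq: "(\<exists>w. (\<forall>i\<ge>Suc N. w i = v i) \<and> Q t w) = (\<exists>z. \<exists>w. (\<forall>i\<ge>N. w i = (v(N := z)) i) \<and> Q t w)"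
    for t and v :: "nat \<Rightarrow> 'r adjoin_i"
  proof
    assume "\<exists>w. (\<forall>i\<ge>Suc N. w i = v i) \<and> Q t w"
    then obtain w where w: "\<forall>i\<ge>Suc N. w i = v i" "Q t w" by blast
    have "\<forall>i\<ge>N. w i = (v(N := w N)) i" using w(1) by (metis Suc_leI fun_upd_apply le_neq_implies_less)
    then show "\<exists>z. \<exists>w. (\<forall>i\<ge>N. w i = (v(N := z)) i) \<and> Q t w" using w(2) by blast
  next
    assume "\<exists>z. \<exists>w. (\<forall>i\<ge>N. w i = (v(N := z)) i) \<and> Q t w"
    then obtain z w where w: "\<forall>i\<ge>N. w i = (v(N := z)) i" "Q t w" by blast
    then have "\<forall>i\<ge>Suc N. w i = v i" by (simp add: Suc_le_eq)
    then show "\<exists>w. (\<forall>i\<ge>Suc N. w i = v i) \<and> Q t w" using w(2) by blast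
  qed
  show ?case unfolding eq by (rule dpredRV_ex_coord[OF Suc])
qed

text \<open>Definable choice gives a bounded curve, and its real and imaginary parts converge by
  \<open>definable_limit\<close>.\<close>

lemma curve_selection:
  assumes Q: "dpredRK Q" and ex: "\<And>t. 0 < t \<Longrightarrow> \<exists>z. absK z \<le> r \<and> Q t z"
  shows "\<exists>\<zeta> z0. dfunRK \<zeta> \<and> (\<forall>t>0. Q t (\<zeta> t) \<and> absK (\<zeta> t) \<le> r) \<and>
    (\<forall>\<epsilon>>0. \<exists>\<delta>>0. \<forall>t. 0 < t \<and> t < \<delta> \<longrightarrow> absK (\<zeta> t - z0) < \<epsilon>)"
proof -
  have "dpredRK (\<lambda>t z. absK z \<le> r \<and> Q t z)"
    unfolding dpredRK_def by (intro dintro dpredRK_comp[OF Q])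
  from definable_choice_K[OF this] obtain \<zeta> where z: "dfunRK \<zeta>"
    "\<forall>t. (\<exists>z. absK z \<le> r \<and> Q t z) \<longrightarrow> absK (\<zeta> t) \<le> r \<and> Q t (\<zeta> t)" by (elim exE conjE)
  have \<zeta>: "absK (\<zeta> t) \<le> r" "Q t (\<zeta> t)" if "0 < t" for t using z(2) ex[OF that] by blast+
  have d: "dfun1 (\<lambda>t. re (\<zeta> t))" "dfun1 (\<lambda>t. im (\<zeta> t))"
    unfolding dfun1_def by (intro dintro dfunRK_comp[OF z(1)])+
  obtain x where x: "\<forall>\<epsilon>>0. \<exists>\<delta>>0. \<forall>t. 0 < t \<and> t < \<delta> \<longrightarrow> \<bar>re (\<zeta> t) - x\<bar> < \<epsilon>"
    using definable_limit[OF d(1), of r] \<zeta>(1) abs_re_le order_trans by blast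
  obtain y where y: "\<forall>\<epsilon>>0. \<exists>\<delta>>0. \<forall>t. 0 < t \<and> t < \<delta> \<longrightarrow> \<bar>im (\<zeta> t) - y\<bar> < \<epsilon>"
    using definable_limit[OF d(2), of r] \<zeta>(1) abs_im_le order_trans by blast
  have "\<exists>\<delta>>0. \<forall>t. 0 < t \<and> t < \<delta> \<longrightarrow> absK (\<zeta> t - Adjoin_I x y) < \<epsilon>" if "\<epsilon> > 0" for \<epsilon>
  proof -
    have e2: "\<epsilon>/2 > 0" using that by simp
    obtain \<delta>1 \<delta>2 where \<delta>: "\<delta>1 > 0" "\<forall>t. 0 < t \<and> t < \<delta>1 \<longrightarrow> \<bar>re (\<zeta> t) - x\<bar> < \<epsilon>/2"
      "\<delta>2 > 0" "\<forall>t. 0 < t \<and> t < \<delta>2 \<longrightarrow> \<bar>im (\<zeta> t) - y\<bar> < \<epsilon>/2" using x[rule_format, OF e2] y[rule_format, OF e2] by blast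
    have "absK (\<zeta> t - Adjoin_I x y) < \<epsilon>" if t: "0 < t \<and> t < min \<delta>1 \<delta>2" for t
    proof -
      have "\<bar>re (\<zeta> t) - x\<bar> < \<epsilon>/2" "\<bar>im (\<zeta> t) - y\<bar> < \<epsilon>/2" using \<delta>(2,4) t by auto
      then show ?thesis using absK_le_re_im[of "\<zeta> t - Adjoin_I x y"] by simp
    qed
    then show ?thesis using \<delta>(1,3) by (intro exI[of _ "min \<delta>1 \<delta>2"]) simp
  qed
  then show ?thesis using z(1) \<zeta> by (intro exI[of _ \<zeta>] exI[of _ "Adjoin_I x y"]) simp
qed

text \<open>Definable compactness of a closed polydisc, with a definable family indexed by
  \<open>t > 0\<close> in the role of a sequence. By induction on the number of coordinates: the
  last one is chosen as a convergent curve \<open>\<zeta>\<close>, and putting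
  \<open>\<zeta> t\<close> in its place leaves a family with one coordinate less.\<close>

lemma cluster_point:
  assumes "dpredRV Q"
    and "\<And>t. 0 < t \<Longrightarrow> \<exists>v. (\<forall>i\<ge>N. v i = 0) \<and> (\<forall>i<N. absK (v i) \<le> r) \<and> Q t v"
  shows "\<exists>v0. (\<forall>i\<ge>N. v0 i = 0) \<and> (\<forall>\<delta>>0. \<exists>t v. 0 < t \<and> t < \<delta> \<and> (\<forall>i\<ge>N. v i = 0) \<and> Q t v \<and>
    (\<forall>i<N. absK (v i - v0 i) < \<delta>))"
  using assms
proof (induction N arbitrary: Q)
  case 0
  have "\<exists>t v. 0 < t \<and> t < \<delta> \<and> (\<forall>i\<ge>0. v i = 0) \<and> Q t v" if "\<delta> > 0" for \<delta>
    using 0(2)[of "\<delta>/2"] that by (intro exI[of _ "\<delta>/2"]) auto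
  then show ?case by (intro exI[of _ "\<lambda>_. 0"]) auto
next
  case (Suc N)
  let ?R = "\<lambda>t v. (\<forall>i<N. absK (v i) \<le> r) \<and> Q t v"
  \<comment> \<open>The admissible values of the last coordinate: those that can be completed to a
    bounded member of the family.\<close>
  let ?Q1 = "\<lambda>t z. \<exists>w. (\<forall>i\<ge>N. w i = ((\<lambda>_. 0)(N := z)) i) \<and> ?R t w"
  have "dpredRV ?R"
    unfolding dpredRV_def by (intro dpred_conj dpred_finite_all dpred_le dfun_absK dfunK_Adjoin_I dfun_var dfun_const Suc.prems(1)[unfolded dpredRV_def])
  then have d1: "dpredRV (\<lambda>t v. \<exists>w. (\<forall>i\<ge>N. w i = v i) \<and> ?R t w)" by (rule dpredRV_ex)
  let ?t = "\<lambda>i e. ((\<lambda>_. 0)(N := Adjoin_I (e 1) (e 2))) i"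
  have t: "dfunK (?t i)" for i
    by (cases "i = N") (auto intro!: dfunK_Adjoin_I dfun_var dfunK_const)
  have "dpredRK ?Q1" unfolding dpredRK_def
    by (rule dpredRV_comp[OF d1 dfun_var, where t = ?t, OF t])
  moreover have "\<exists>z. absK z \<le> r \<and> ?Q1 t z" if t0: "0 < t" for t
  proof -
    obtain v where v: "\<forall>i\<ge>Suc N. v i = 0" "\<forall>i<Suc N. absK (v i) \<le> r" "Q t v" using Suc.prems(2)[OF t0] by blast
    have "v i = ((\<lambda>_. 0)(N := v N)) i" if "N \<le> i" for i
      using v(1)[rule_format, of i] that by (cases "i = N") auto
    moreover have "absK (v i) \<le> r" if "i < N" for i using v(2) that by simp
    moreover have "absK (v N) \<le> r" using v(2) by simp
    ultimately show ?thesis using v(3) by (intro exI[of _ "v N"] conjI exI[of _ v] allI impI)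
  qed
  ultimately have "\<exists>\<zeta> z0. dfunRK \<zeta> \<and> (\<forall>t>0. ?Q1 t (\<zeta> t) \<and> absK (\<zeta> t) \<le> r) \<and>
    (\<forall>\<epsilon>>0. \<exists>\<delta>>0. \<forall>t. 0 < t \<and> t < \<delta> \<longrightarrow> absK (\<zeta> t - z0) < \<epsilon>)"
    by (rule curve_selection)
  then obtain \<zeta> z0 where \<zeta>: "dfunRK \<zeta>" "\<forall>t>0. ?Q1 t (\<zeta> t) \<and> absK (\<zeta> t) \<le> r"
    "\<forall>\<epsilon>>0. \<exists>\<delta>>0. \<forall>t. 0 < t \<and> t < \<delta> \<longrightarrow> absK (\<zeta> t - z0) < \<epsilon>"
    by (elim exE conjE)
  let ?Q' = "\<lambda>t v. Q t (v(N := \<zeta> t))"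
  let ?s = "\<lambda>i e. ((\<lambda>i. Adjoin_I (e (2 * i + 1)) (e (2 * i + 2)))(N := \<zeta> (e 0))) i"
  have s: "dfunK (?s i)" for i
    by (cases "i = N") (auto intro!: dfunK_Adjoin_I dfun_var dfunRK_comp[OF \<zeta>(1)])
  have "dpredRV ?Q'" unfolding dpredRV_def
    by (rule dpredRV_comp[OF Suc.prems(1) dfun_var, where t = ?s, OF s])
  moreover have "\<exists>v. (\<forall>i\<ge>N. v i = 0) \<and> (\<forall>i<N. absK (v i) \<le> r) \<and> ?Q' t v" if t: "0 < t" for t
  proof -
    have "?Q1 t (\<zeta> t)" using \<zeta>(2) t by blast
    then obtain w where w: "\<forall>i\<ge>N. w i = ((\<lambda>_. 0)(N := \<zeta> t)) i" "\<forall>i<N. absK (w i) \<le> r" "Q t w"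
      by (elim exE conjE)
    have "w N = \<zeta> t" using w(1)[rule_format, of N] by simp
    then have "(w(N := 0))(N := \<zeta> t) = w" by auto
    then have "?Q' t (w(N := 0))" using w(3) by simp
    moreover have "(w(N := 0)) i = 0" if "N \<le> i" for i using w(1)[rule_format, OF that] by simp
    moreover have "absK ((w(N := 0)) i) \<le> r" if "i < N" for i using w(2) that by simp
    ultimately show ?thesis by (intro exI[of _ "w(N := 0)"] conjI allI impI)
  qed
  ultimately have "\<exists>v0. (\<forall>i\<ge>N. v0 i = 0) \<and> (\<forall>\<delta>>0. \<exists>t v. 0 < t \<and> t < \<delta> \<and> (\<forall>i\<ge>N. v i = 0) \<and> ?Q' t v \<and>
    (\<forall>i<N. absK (v i - v0 i) < \<delta>))" by (rule Suc.IH)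
  then obtain v0 where v0: "\<forall>i\<ge>N. v0 i = 0" "\<forall>\<delta>>0. \<exists>t v. 0 < t \<and> t < \<delta> \<and> (\<forall>i\<ge>N. v i = 0) \<and> ?Q' t v \<and>
    (\<forall>i<N. absK (v i - v0 i) < \<delta>)" by (elim exE conjE)
  show ?case
  proof (intro exI[of _ "v0(N := z0)"] conjI allI impI)
    fix \<delta> :: 'r assume \<delta>: "0 < \<delta>"
    then obtain \<delta>' where \<delta>': "\<delta>' > 0" "\<forall>t. 0 < t \<and> t < \<delta>' \<longrightarrow> absK (\<zeta> t - z0) < \<delta>" using \<zeta>(3) by blast
    obtain t v where t: "0 < t" "t < min \<delta> \<delta>'" "\<forall>i\<ge>N. v i = 0" "?Q' t v" "\<forall>i<N. absK (v i - v0 i) < min \<delta> \<delta>'"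
      using v0(2)[rule_format, of "min \<delta> \<delta>'"] \<delta> \<delta>'(1) by (simp only: min_less_iff_conj) blast
    have "\<forall>i<Suc N. absK ((v(N := \<zeta> t)) i - (v0(N := z0)) i) < \<delta>"
      using t(1,2,5) \<delta>'(2) by (auto simp: less_Suc_eq)
    then show "\<exists>t v. 0 < t \<and> t < \<delta> \<and> (\<forall>i\<ge>Suc N. v i = 0) \<and> Q t v \<and>
        (\<forall>i<Suc N. absK (v i - (v0(N := z0)) i) < \<delta>)"
      using t by (intro exI[of _ t] exI[of _ "v(N := \<zeta> t)"]) auto
  qed (use v0(1) in auto)
qed

text \<open>Compactness is used twice. If \<open>g\<close> were unbounded below, points with value
  below \<open>- (1 / t)\<close> would cluster at a point where \<open>g\<close> is not continuous.
  With the infimum at hand, points with value within \<open>t\<close> of it cluster at a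
  minimum.\<close>

lemma attains_minimum:
  assumes S: "dpredV S" and g: "dfunVR g"
    and bound: "\<And>v i. S v \<Longrightarrow> i < N \<Longrightarrow> absK (v i) \<le> r"
    and ne: "\<forall>i\<ge>N. v1 i = 0" "S v1"
    and closed: "\<And>v0. \<forall>i\<ge>N. v0 i = 0 \<Longrightarrow> \<forall>\<delta>>0. \<exists>v. S v \<and> (\<forall>i<N. absK (v i - v0 i) < \<delta>) \<Longrightarrow> S v0"
    and cont: "\<And>v0 \<epsilon>. S v0 \<Longrightarrow> \<epsilon> > 0 \<Longrightarrow> \<exists>\<delta>>0. \<forall>v. S v \<and> (\<forall>i\<ge>N. v i = 0) \<and> (\<forall>i<N. absK (v i - v0 i) < \<delta>) \<longrightarrow> \<bar>g v - g v0\<bar> < \<epsilon>"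
  shows "\<exists>v. (\<forall>i\<ge>N. v i = 0) \<and> S v \<and> (\<forall>w. (\<forall>i\<ge>N. w i = 0) \<and> S w \<longrightarrow> g v \<le> g w)"
proof -
  have cluster: "\<exists>v0. (\<forall>i\<ge>N. v0 i = 0) \<and> S v0 \<and> (\<forall>\<epsilon>>0. \<exists>t v. 0 < t \<and> t < \<epsilon> \<and> S v \<and> Q t (g v) \<and> \<bar>g v - g v0\<bar> < \<epsilon>)"
    if Q: "dpred2 Q" and ex: "\<And>t. 0 < t \<Longrightarrow> \<exists>v. (\<forall>i\<ge>N. v i = 0) \<and> S v \<and> Q t (g v)" for Q
  proof -
    have "dpredRV (\<lambda>t v. S v \<and> Q t (g v))"
      unfolding dpredRV_def
      by (intro dpred_conj dpredV_comp[OF S] dpred2_comp[OF Q] dfunVR_comp[OF g] dfunK_Adjoin_I dfun_var)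
    moreover have "\<exists>v. (\<forall>i\<ge>N. v i = 0) \<and> (\<forall>i<N. absK (v i) \<le> r) \<and> S v \<and> Q t (g v)" if "0 < t" for t
      using ex[OF that] bound by blast
    ultimately have "\<exists>v0. (\<forall>i\<ge>N. v0 i = 0) \<and> (\<forall>\<delta>>0. \<exists>t v. 0 < t \<and> t < \<delta> \<and> (\<forall>i\<ge>N. v i = 0) \<and> (S v \<and> Q t (g v)) \<and>
      (\<forall>i<N. absK (v i - v0 i) < \<delta>))" by (rule cluster_point)
    then obtain v0 where v0: "\<forall>i\<ge>N. v0 i = 0" "\<forall>\<delta>>0. \<exists>t v. 0 < t \<and> t < \<delta> \<and> (\<forall>i\<ge>N. v i = 0) \<and> (S v \<and> Q t (g v)) \<and>
      (\<forall>i<N. absK (v i - v0 i) < \<delta>)" by (elim exE conjE)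
    have Sv0: "S v0" by (rule closed[OF v0(1)]) (use v0(2) in blast)
    have "\<exists>t v. 0 < t \<and> t < \<epsilon> \<and> S v \<and> Q t (g v) \<and> \<bar>g v - g v0\<bar> < \<epsilon>" if e: "\<epsilon> > 0" for \<epsilon>
    proof -
      obtain \<delta> where \<delta>: "\<delta> > 0" "\<forall>v. S v \<and> (\<forall>i\<ge>N. v i = 0) \<and> (\<forall>i<N. absK (v i - v0 i) < \<delta>) \<longrightarrow> \<bar>g v - g v0\<bar> < \<epsilon>"
        using cont[OF Sv0 e] by blast
      obtain t v where tv: "0 < t" "t < min \<delta> \<epsilon>" "\<forall>i\<ge>N. v i = 0" "S v" "Q t (g v)" "\<forall>i<N. absK (v i - v0 i) < min \<delta> \<epsilon>"
        using v0(2)[rule_format, of "min \<delta> \<epsilon>"] \<delta>(1) e by (simp only: min_less_iff_conj) blast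
      then have "\<bar>g v - g v0\<bar> < \<epsilon>" using \<delta>(2) by simp
      then show ?thesis using tv by auto
    qed
    then show ?thesis using v0(1) Sv0 by blast
  qed
  \<comment> \<open>\<open>dpred1_lub\<close> provides suprema, so the infimum of \<open>g\<close>
    is obtained as minus the supremum of \<open>?L\<close>.\<close>
  let ?L = "\<lambda>y. \<exists>v. (\<forall>i\<ge>N. v i = 0) \<and> S v \<and> g v < - y"
  have "dpredRV (\<lambda>t v. S v \<and> g v < - t)"
    unfolding dpredRV_def by (intro dpred_conj dpredV_comp[OF S] dpred_less dfun_minus dfunVR_comp[OF g] dfunK_Adjoin_I dfun_var)
  then have dL: "dpred1 ?L" unfolding dpred1_def
    by (rule dpredRV_comp[OF dpredRV_ex dfun_var, where t = "\<lambda>_ _. 0", OF _ dfunK_const])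
  have "\<exists>u. \<forall>y. ?L y \<longrightarrow> y \<le> u"
  proof (rule ccontr)
    assume "\<not> ?thesis"
    then have unb: "\<exists>y. ?L y \<and> u < y" for u by (meson not_le)
    have "\<exists>v. (\<forall>i\<ge>N. v i = 0) \<and> S v \<and> g v < - (1 / t)" for t
    proof -
      obtain y v where "\<forall>i\<ge>N. v i = 0" "S v" "g v < - y" "1 / t < y" using unb[of "1 / t"] by blast
      then show ?thesis by (intro exI[of _ v]) simp
    qed
    moreover have "dpred2 (\<lambda>t y. y < - (1 / t))" unfolding dpred2_def by (intro dintro)
    ultimately obtain v0 where v0: "\<And>\<epsilon>. \<epsilon> > 0 \<Longrightarrow> \<exists>t v. 0 < t \<and> t < \<epsilon> \<and> S v \<and> g v < - (1 / t) \<and> \<bar>g v - g v0\<bar> < \<epsilon>"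
      using cluster[of "\<lambda>t y. y < - (1 / t)"] by blast
    \<comment> \<open>For \<open>t < \<epsilon>\<close> the value \<open>g v\<close> is below
      \<open>- \<bar>g v0\<bar> - 1\<close>, hence more than 1 away from \<open>g v0\<close>,
      although the distance should be less than \<open>\<epsilon> \<le> 1\<close>.\<close>
    define \<epsilon> where "\<epsilon> = 1 / (\<bar>g v0\<bar> + 1)"
    have \<epsilon>: "\<epsilon> > 0" "\<epsilon> \<le> 1" "1 / \<epsilon> = \<bar>g v0\<bar> + 1" by (simp_all add: \<epsilon>_def add_pos_nonneg add_nonneg_pos)
    obtain t v where tv: "0 < t" "t < \<epsilon>" "g v < - (1 / t)" "\<bar>g v - g v0\<bar> < \<epsilon>" using v0[OF \<epsilon>(1)] by blast
    have "1 / \<epsilon> < 1 / t" using tv(1,2) by (simp add: frac_less2)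
    then show False using tv(3,4) \<epsilon>(2,3) by (auto simp: abs_less_iff abs_if split: if_splits)
  qed
  then obtain u where u: "\<And>y. ?L y \<Longrightarrow> y \<le> u" by blast
  have L1: "?L (- g v1 - 1)" using ne by (intro exI[of _ v1]) simp
  from dpred1_lub[OF dL L1 u] obtain s where s: "(\<forall>x. ?L x \<longrightarrow> x \<le> s) \<and> (\<forall>y<s. \<exists>x. ?L x \<and> y < x) \<and> s \<le> u" by (rule exE)
  have lower: "- s \<le> g w" if "\<forall>i\<ge>N. w i = 0" "S w" for w
  proof (rule ccontr)
    assume "\<not> - s \<le> g w"
    then have "g w < - s" by simp
    then obtain y where y: "g w < y" "y < - s" using dense by blast
    then have "?L (- y)" using that by auto
    then have "- y \<le> s" using s by blast
    then show False using y by simp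
  qed
  have "\<exists>v. (\<forall>i\<ge>N. v i = 0) \<and> S v \<and> g v < - s + t" if t0: "0 < t" for t
  proof -
    have "s - t < s" using t0 by simp
    then obtain x v where "s - t < x" "\<forall>i\<ge>N. v i = 0" "S v" "g v < - x" using s by blast
    then show ?thesis by (intro exI[of _ v]) simp
  qed
  moreover have "dpred2 (\<lambda>t y. y < - s + t)" unfolding dpred2_def by (intro dintro)
  ultimately obtain v0 where v0: "\<forall>i\<ge>N. v0 i = 0" "S v0" "\<And>\<epsilon>. \<epsilon> > 0 \<Longrightarrow> \<exists>t v. 0 < t \<and> t < \<epsilon> \<and> S v \<and> g v < - s + t \<and> \<bar>g v - g v0\<bar> < \<epsilon>"
    using cluster[of "\<lambda>t y. y < - s + t"] by blast
  have "g v0 \<le> - s"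
  proof (rule ccontr)
    assume "\<not> g v0 \<le> - s"
    then have "(g v0 + s) / 2 > 0" by simp
    from v0(3)[OF this] obtain t v where "t < (g v0 + s) / 2" "g v < - s + t" "\<bar>g v - g v0\<bar> < (g v0 + s) / 2" by blast
    moreover have "g v0 + s = (g v0 + s) / 2 + (g v0 + s) / 2" by simp
    ultimately show False unfolding abs_less_iff by linarith
  qed
  then have "g v0 \<le> g w" if "(\<forall>i\<ge>N. w i = 0) \<and> S w" for w using lower[of w] that by simp
  then show ?thesis using v0(1,2) by (intro exI[of _ v0]) blast
qed

end

text \<open>Chooses a scale against a coefficient that may vanish or be negative; adding 1 to its
  absolute value makes the division safe.\<close>

lemma ex_small:
  fixes x :: "'a::linordered_field"
  assumes "0 < x" shows "\<exists>t0>0. \<forall>t. 0 < t \<and> t \<le> t0 \<longrightarrow> t * a < x"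
proof (intro exI conjI allI impI)
  have p: "\<bar>a\<bar> + 1 > 0" by (simp add: add_nonneg_pos)
  show "0 < x / 2 / (\<bar>a\<bar> + 1)" using assms p by (intro divide_pos_pos) auto
  fix t assume t: "0 < t \<and> t \<le> x / 2 / (\<bar>a\<bar> + 1)"
  have "t * a \<le> t * (\<bar>a\<bar> + 1)" using t by (intro mult_left_mono) auto
  also have "\<dots> \<le> x / 2" using t p by (simp only: pos_le_divide_eq)
  also have "\<dots> < x" using assms by simp
  finally show "t * a < x" .
qed

lemma divide_mult_cancel: "h \<noteq> 0 \<Longrightarrow> x / h * h = (x::'a::field)"
  by simp

section \<open>The maximum principle\<close>

definition K_deriv :: "('r::real_closed_field adjoin_i \<Rightarrow> 'r adjoin_i) \<Rightarrow> 'r adjoin_i \<Rightarrow> 'r adjoin_i \<Rightarrow> bool" where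
  "K_deriv f z d \<longleftrightarrow> (\<forall>\<epsilon>>0. \<exists>\<delta>>0. \<forall>h. h \<noteq> 0 \<and> absK h < \<delta> \<longrightarrow> absK ((f (z + h) - f z) / h - d) < \<epsilon>)"

lemma K_deriv_approx:
  assumes "K_deriv f z d" "0 < \<epsilon>"
  shows "\<exists>\<delta>>0. \<forall>h. absK h < \<delta> \<longrightarrow> absK (f (z + h) - f z - d * h) \<le> \<epsilon> * absK h"
proof -
  obtain \<delta> where \<delta>: "\<delta> > 0" "\<forall>h. h \<noteq> 0 \<and> absK h < \<delta> \<longrightarrow> absK ((f (z + h) - f z) / h - d) < \<epsilon>"
    using assms unfolding K_deriv_def by blast
  have "absK (f (z + h) - f z - d * h) \<le> \<epsilon> * absK h" if "absK h < \<delta>" for h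
  proof (cases "h = 0")
    case False
    then have "(f (z + h) - f z) / h * h = f (z + h) - f z" by (rule divide_mult_cancel)
    then have "f (z + h) - f z - d * h = ((f (z + h) - f z) / h - d) * h" by (simp only: left_diff_distrib)
    moreover have "absK ((f (z + h) - f z) / h - d) \<le> \<epsilon>" using \<delta>(2)[rule_format, of h] False that by simp
    ultimately show ?thesis by (simp add: absK_mult mult_right_mono absK_nonneg)
  qed simp
  then show ?thesis using \<delta>(1) by blast
qed

text \<open>A vanishing derivative in product form. It includes \<open>h = 0\<close>, so it applies
  to two points of a curve without the question whether they differ.\<close>

definition critical :: "('r::real_closed_field adjoin_i \<Rightarrow> 'r adjoin_i) \<Rightarrow> 'r adjoin_i \<Rightarrow> bool" where
  "critical f z \<longleftrightarrow> (\<forall>\<epsilon>>0. \<exists>\<delta>>0. \<forall>h. absK h < \<delta> \<longrightarrow> absK (f (z + h) - f z) \<le> \<epsilon> * absK h)"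

lemma K_deriv_0_critical: "K_deriv f z 0 \<Longrightarrow> critical f z"
  unfolding critical_def using K_deriv_approx[of f z 0] by simp

text \<open>As a function of the value of \<open>f\<close>, the penalised real part has no critical points, so its maxima are
  critical points of \<open>f\<close>.\<close>

lemma penalised_maximum_critical:
  fixes f :: "'r::real_closed_field adjoin_i \<Rightarrow> 'r adjoin_i"
  assumes d: "K_deriv f z d" and z: "absK z < r"
    and max: "\<And>w. absK w \<le> r \<Longrightarrow> re (f w) - k * ((im (f w) - s) * (im (f w) - s)) \<le> re (f z) - k * ((im (f z) - s) * (im (f z) - s))"
    and k: "0 \<le> k"
  shows "d = 0"
proof (rule ccontr)
  assume d0: "d \<noteq> 0"
  \<comment> \<open>If \<open>f\<close> changes by \<open>D\<close>, the penalised real part changes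
    by \<open>re (c * D) - k * (im D * im D)\<close>. So \<open>c\<close> encodes its gradient at
    the value \<open>f z\<close>, and the real part 1 keeps \<open>c\<close> from vanishing.\<close>
  define \<beta> where "\<beta> = 2 * k * (im (f z) - s)"
  define c where "c = Adjoin_I 1 \<beta>"
  have "c \<noteq> 0"
  proof
    assume "c = 0"
    then have "re c = 0" by simp
    then show False by (simp add: c_def)
  qed
  \<comment> \<open>The direction in which the linear part grows at unit speed:
    \<open>h = of_R t * u\<close> makes \<open>c * d * h\<close> equal to
    \<open>of_R t\<close>.\<close>
  define u where "u = inverse (c * d)"
  have "c * d \<noteq> 0" using \<open>c \<noteq> 0\<close> d0 by (rule no_zero_divisors)
  from field_class.field_inverse[OF this] have cdu: "u * (c * d) = 1" unfolding u_def .
  \<comment> \<open>Two errors, from linearising \<open>f\<close> and from the square of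
    \<open>im D\<close>, are each kept to at most a quarter of \<open>t\<close>. A gain of at least
    \<open>t / 2\<close> over the supposed maximum remains.\<close>
  have four: "(0::'r) < 1/4" by simp
  obtain \<epsilon> where e0: "\<epsilon> > 0" "\<forall>t. 0 < t \<and> t \<le> \<epsilon> \<longrightarrow> t * (absK c * absK u) < 1/4"
    using ex_small[OF four, of "absK c * absK u"] by (elim exE conjE)
  then have e: "\<epsilon> > 0" "\<epsilon> * (absK c * absK u) < 1/4" by simp_all
  obtain \<delta> where \<delta>: "\<delta> > 0" "\<forall>h. absK h < \<delta> \<longrightarrow> absK (f (z + h) - f z - d * h) \<le> \<epsilon> * absK h"
    using K_deriv_approx[OF d e(1)] by blast
  define B where "B = (absK d + \<epsilon>) * absK u"
  have rz: "r - absK z > 0" using z by simp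
  obtain t1 where t1: "t1 > 0" "\<forall>t. 0 < t \<and> t \<le> t1 \<longrightarrow> t * absK u < \<delta>" using ex_small[OF \<delta>(1)] by blast
  obtain t2 where t2: "t2 > 0" "\<forall>t. 0 < t \<and> t \<le> t2 \<longrightarrow> t * absK u < r - absK z" using ex_small[OF rz] by blast
  obtain t3 where t3: "t3 > 0" "\<forall>t. 0 < t \<and> t \<le> t3 \<longrightarrow> t * (k * (B * B)) < 1/4" using ex_small[OF four] by blast
  define t where "t = min t1 (min t2 t3)"
  have t: "t > 0" "t * absK u < \<delta>" "t * absK u < r - absK z" "t * (k * (B * B)) < 1/4"
    using t1 t2 t3 by (auto simp: t_def)
  define h where "h = of_R t * u"
  have h: "absK h = t * absK u" using t(1) by (simp add: h_def absK_mult)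
  define D where "D = f (z + h) - f z"
  have D: "absK (D - d * h) \<le> \<epsilon> * (t * absK u)" using \<delta>(2)[rule_format, of h] t(2) h by (simp add: D_def)
  have "absK D \<le> absK (D - d * h) + absK (d * h)" using absK_triangle[of "D - d * h" "d * h"] by simp
  also have "\<dots> \<le> t * B" using D h by (simp add: absK_mult B_def algebra_simps)
  finally have DB: "absK D \<le> t * B" .
  have "re (c * D) = re (c * d * h) + re (c * (D - d * h))" by (simp add: algebra_simps)
  moreover have "re (c * d * h) = t"
  proof -
    have "c * d * h = of_R t * (u * (c * d))" by (simp only: h_def mult_ac)
    then show ?thesis by (simp only: cdu mult_1_right re_im_simps)
  qed
  moreover have "\<bar>re (c * (D - d * h))\<bar> \<le> t * (1/4)"
  proof -
    have "\<bar>re (c * (D - d * h))\<bar> \<le> absK c * absK (D - d * h)" using abs_re_le[of "c * (D - d * h)"] by (simp add: absK_mult)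
    also have "\<dots> \<le> absK c * (\<epsilon> * (t * absK u))" using D by (simp add: mult_left_mono absK_nonneg)
    also have "\<dots> = t * (\<epsilon> * (absK c * absK u))" by (simp add: mult_ac)
    also have "\<dots> \<le> t * (1/4)" using e(2) t(1) by (intro mult_left_mono) auto
    finally show ?thesis .
  qed
  ultimately have 1: "re (c * D) \<ge> t - t * (1/4)" unfolding abs_le_iff by linarith
  have "im D * im D \<le> (t * B) * (t * B)"
  proof -
    have "\<bar>im D\<bar> \<le> t * B" using abs_im_le[of D] DB by simp
    then have "\<bar>im D\<bar> * \<bar>im D\<bar> \<le> (t * B) * (t * B)" by (intro mult_mono) auto
    then show ?thesis by simp
  qed
  then have "k * (im D * im D) \<le> k * ((t * B) * (t * B))" using k by (rule mult_left_mono)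
  also have "\<dots> = t * (t * (k * (B * B)))" by (simp add: mult_ac)
  also have "\<dots> \<le> t * (1/4)" using t(1,4) by (intro mult_left_mono) auto
  finally have 2: "k * (im D * im D) \<le> t * (1/4)" .
  have "absK (z + h) \<le> r" using absK_triangle[of z h] h t(3) by simp
  from max[OF this] have "re D - k * ((im (f z) + im D - s) * (im (f z) + im D - s)) + k * ((im (f z) - s) * (im (f z) - s)) \<le> 0"
    by (simp add: D_def algebra_simps)
  moreover have "re D - k * ((im (f z) + im D - s) * (im (f z) + im D - s)) + k * ((im (f z) - s) * (im (f z) - s)) = re (c * D) - k * (im D * im D)"
    by (simp add: c_def \<beta>_def algebra_simps)
  ultimately have "t - t * (1/4) - t * (1/4) \<le> 0" using 1 2 by linarith
  then show False using t(1) by simp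
qed

context o_minimal_expansion
begin

definition dfunKR :: "('r adjoin_i \<Rightarrow> 'r) \<Rightarrow> bool" where
  "dfunKR g \<longleftrightarrow> dfun (\<lambda>e. g (Adjoin_I (e 0) (e 1)))"

definition cont_disc :: "'r \<Rightarrow> ('r adjoin_i \<Rightarrow> 'r adjoin_i) \<Rightarrow> bool" where
  "cont_disc r f \<longleftrightarrow> (\<forall>z. absK z \<le> r \<longrightarrow> (\<forall>\<epsilon>>0. \<exists>\<delta>>0. \<forall>w. absK w \<le> r \<and> absK (w - z) < \<delta> \<longrightarrow> absK (f w - f z) < \<epsilon>))"

lemma disc_maximum:
  assumes g: "dfunKR g" and r: "0 \<le> r"
    and cont: "\<And>z \<epsilon>. absK z \<le> r \<Longrightarrow> 0 < \<epsilon> \<Longrightarrow> \<exists>\<delta>>0. \<forall>w. absK w \<le> r \<and> absK (w - z) < \<delta> \<longrightarrow> \<bar>g w - g z\<bar> < \<epsilon>"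
  shows "\<exists>z. absK z \<le> r \<and> (\<forall>w. absK w \<le> r \<longrightarrow> g w \<le> g z)"
proof -
  have "\<exists>v :: nat \<Rightarrow> 'r adjoin_i. (\<forall>i\<ge>1. v i = 0) \<and> absK (v 0) \<le> r \<and> (\<forall>w :: nat \<Rightarrow> 'r adjoin_i. (\<forall>i\<ge>1. w i = 0) \<and> absK (w 0) \<le> r \<longrightarrow> - g (v 0) \<le> - g (w 0))"
  proof (rule attains_minimum[where S = "\<lambda>v. absK (v 0) \<le> r" and g = "\<lambda>v. - g (v 0)" and r = r and ?v1.0 = "\<lambda>_. 0"])
    show "dpredV (\<lambda>v. absK (v 0) \<le> r)" unfolding dpredV_def by (intro dintro)
    show "dfunVR (\<lambda>v. - g (v 0))" unfolding dfunVR_def using g[unfolded dfunKR_def] by (intro dfun_minus) simp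
    show "absK (v0 0) \<le> r" if cl: "\<forall>\<delta>>0. \<exists>v. absK (v 0) \<le> r \<and> (\<forall>i<1. absK (v i - v0 i) < \<delta>)" for v0 :: "nat \<Rightarrow> 'r adjoin_i"
    proof (rule ccontr)
      assume "\<not> absK (v0 0) \<le> r"
      then have "0 < absK (v0 0) - r" by simp
      from cl[rule_format, OF this] obtain v where "absK (v 0) \<le> r" "\<forall>i<1. absK (v i - v0 i) < absK (v0 0) - r" by (elim exE conjE)
      then have v: "absK (v 0) \<le> r" "absK (v 0 - v0 0) < absK (v0 0) - r" by simp_all
      show False using v absK_diff_ge[of "v0 0" "v 0"] by (simp add: absK_minus_commute)
    qed
    fix v0 :: "nat \<Rightarrow> 'r adjoin_i" and \<epsilon> :: 'r assume "absK (v0 0) \<le> r" "0 < \<epsilon>"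
    then obtain \<delta> where \<delta>: "\<delta> > 0" "\<forall>w. absK w \<le> r \<and> absK (w - v0 0) < \<delta> \<longrightarrow> \<bar>g w - g (v0 0)\<bar> < \<epsilon>" using cont by blast
    have "\<bar>- g (v 0) - - g (v0 0)\<bar> < \<epsilon>" if "absK (v 0) \<le> r" "\<forall>i<1. absK (v i - v0 i) < \<delta>" for v
      using \<delta>(2)[rule_format, of "v 0"] that by (simp add: abs_minus_commute)
    then show "\<exists>\<delta>>0. \<forall>v. absK (v 0) \<le> r \<and> (\<forall>i\<ge>1. v i = 0) \<and> (\<forall>i<1. absK (v i - v0 i) < \<delta>) \<longrightarrow> \<bar>- g (v 0) - - g (v0 0)\<bar> < \<epsilon>"
      using \<delta>(1) by blast
  qed (use r in auto)
  then obtain v where v: "absK (v 0) \<le> r" "\<forall>w :: nat \<Rightarrow> 'r adjoin_i. (\<forall>i\<ge>1. w i = 0) \<and> absK (w 0) \<le> r \<longrightarrow> - g (v 0) \<le> - g (w 0)" by (elim exE conjE)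
  have "g w \<le> g (v 0)" if "absK w \<le> r" for w using v(2)[THEN spec, of "\<lambda>i. if i = 0 then w else 0"] that by simp
  then show ?thesis using v(1) by blast
qed

text \<open>The chain rule that is needed: if the curve moves at most \<open>c * t\<close>, the
  tolerance \<open>\<epsilon> / c\<close> for \<open>f\<close> becomes \<open>\<epsilon>\<close> in
  the parameter.\<close>

lemma critical_curve:
  assumes "critical f (\<zeta> s)" "right_Lipschitz (\<lambda>t. re (\<zeta> t)) s" "right_Lipschitz (\<lambda>t. im (\<zeta> t)) s" "0 < \<epsilon>"
  shows "\<exists>\<delta>>0. \<forall>t. 0 < t \<and> t < \<delta> \<longrightarrow> absK (f (\<zeta> (s + t)) - f (\<zeta> s)) \<le> \<epsilon> * t"
proof -
  obtain c1 \<delta>1 where 1: "c1 > 0" "\<delta>1 > 0" "\<forall>t. 0 < t \<and> t < \<delta>1 \<longrightarrow> \<bar>re (\<zeta> (s + t)) - re (\<zeta> s)\<bar> \<le> c1 * t"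
    using assms(2) unfolding right_Lipschitz_def by blast
  obtain c2 \<delta>2 where 2: "c2 > 0" "\<delta>2 > 0" "\<forall>t. 0 < t \<and> t < \<delta>2 \<longrightarrow> \<bar>im (\<zeta> (s + t)) - im (\<zeta> s)\<bar> \<le> c2 * t"
    using assms(3) unfolding right_Lipschitz_def by blast
  define c where "c = c1 + c2"
  have c: "c > 0" using 1 2 by (simp add: c_def)
  have "\<epsilon> / c > 0" using c assms(4) by simp
  then obtain \<delta>3 where 3: "\<delta>3 > 0" "\<forall>h. absK h < \<delta>3 \<longrightarrow> absK (f (\<zeta> s + h) - f (\<zeta> s)) \<le> \<epsilon> / c * absK h"
    using assms(1) unfolding critical_def by blast
  have "absK (f (\<zeta> (s + t)) - f (\<zeta> s)) \<le> \<epsilon> * t" if t: "0 < t \<and> t < min (min \<delta>1 \<delta>2) (\<delta>3 / c)" for t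
  proof -
    have "absK (\<zeta> (s + t) - \<zeta> s) \<le> \<bar>re (\<zeta> (s + t)) - re (\<zeta> s)\<bar> + \<bar>im (\<zeta> (s + t)) - im (\<zeta> s)\<bar>"
      using absK_le_re_im[of "\<zeta> (s + t) - \<zeta> s"] by simp
    also have "\<dots> \<le> c1 * t + c2 * t" using 1(3) 2(3) t by (intro add_mono) auto
    finally have b: "absK (\<zeta> (s + t) - \<zeta> s) \<le> c * t" by (simp add: c_def algebra_simps)
    have "c * t < \<delta>3" using t c by (simp add: pos_less_divide_eq mult.commute)
    then have "absK (f (\<zeta> (s + t)) - f (\<zeta> s)) \<le> \<epsilon> / c * absK (\<zeta> (s + t) - \<zeta> s)"
      using 3(2)[rule_format, of "\<zeta> (s + t) - \<zeta> s"] b by simp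
    also have "\<dots> \<le> \<epsilon> / c * (c * t)" using b c assms(4) by (intro mult_left_mono) auto
    also have "\<dots> = \<epsilon> * t" using c by simp
    finally show ?thesis .
  qed
  moreover have "min (min \<delta>1 \<delta>2) (\<delta>3 / c) > 0" using 1 2 3 c by simp
  ultimately show ?thesis by blast
qed

text \<open>For \<open>k \<ge> 0\<close> the maximiser \<open>\<zeta> k\<close> has real part of
  \<open>f\<close> above \<open>\<mu>\<close>, so it lies inside the disc and is critical unless it
  is the centre. For large \<open>k\<close> the curve is Lipschitz, so \<open>f\<close> is constant
  along it, with value \<open>p\<close> say. The level \<open>s\<close> is then hit exactly and not
  just approached: with \<open>im p \<noteq> s\<close> the penalty would grow without bound in
  \<open>k\<close>, while the maximum never falls below \<open>re (f z1)\<close>.\<close>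

lemma critical_point_on_level:
  assumes f: "dfunKK f" and cont: "cont_disc r f"
    and der: "\<And>z. z \<noteq> 0 \<Longrightarrow> absK z < r \<Longrightarrow> \<exists>d. K_deriv f z d"
    and bd: "\<And>w. absK w = r \<Longrightarrow> re (f w) \<le> \<mu>"
    and z1: "absK z1 \<le> r" "im (f z1) = s" "re (f z1) > \<mu>"
  shows "\<exists>z. absK z < r \<and> im (f z) = s \<and> (z = 0 \<or> critical f z)"
proof -
  note d = dfunKK_comp[OF f]
  have r: "0 \<le> r" using z1(1) absK_nonneg[of z1] by simp
  let ?G = "\<lambda>k z. re (f z) - k * ((im (f z) - s) * (im (f z) - s))"
  let ?Q = "\<lambda>k z. absK z \<le> r \<and> (\<forall>w. absK w \<le> r \<longrightarrow> ?G k w \<le> ?G k z)"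
  have "dpredRK ?Q" unfolding dpredRK_def by (intro dintro d)
  from definable_choice_K[OF this] obtain \<zeta> where \<zeta>: "dfunRK \<zeta>" "\<forall>k. (\<exists>z. ?Q k z) \<longrightarrow> ?Q k (\<zeta> k)" by (elim exE conjE)
  have "\<exists>z. ?Q k z" for k
  proof (rule disc_maximum[OF _ r])
    show "dfunKR (?G k)" unfolding dfunKR_def by (intro dintro d)
    fix z and \<epsilon> :: 'r assume z: "absK z \<le> r" and e: "0 < \<epsilon>"
    \<comment> \<open>\<open>q\<close> bounds the factor \<open>2 * (im (f z) - s) + im D\<close> in
      the change of the penalty once \<open>\<bar>im D\<bar> \<le> 1\<close>; this is why
      \<open>\<eta>\<close> is cut off at 1.\<close>
    define q where "q = \<bar>2 * (im (f z) - s)\<bar> + 1"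
    obtain \<eta>0 where \<eta>0: "\<eta>0 > 0" "\<forall>t. 0 < t \<and> t \<le> \<eta>0 \<longrightarrow> t * (1 + \<bar>k\<bar> * q) < \<epsilon>" using ex_small[OF e] by blast
    define \<eta> where "\<eta> = min \<eta>0 1"
    have \<eta>: "\<eta> > 0" "\<eta> \<le> 1" "\<eta> * (1 + \<bar>k\<bar> * q) < \<epsilon>" using \<eta>0 by (auto simp: \<eta>_def)
    obtain \<delta> where \<delta>: "\<delta> > 0" "\<forall>w. absK w \<le> r \<and> absK (w - z) < \<delta> \<longrightarrow> absK (f w - f z) < \<eta>"
      using cont z \<eta>(1) unfolding cont_disc_def by blast
    have "\<bar>?G k w - ?G k z\<bar> < \<epsilon>" if w: "absK w \<le> r \<and> absK (w - z) < \<delta>" for w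
    proof -
      define D where "D = f w - f z"
      have D: "absK D < \<eta>" using \<delta>(2) w by (simp add: D_def)
      have "\<bar>re D\<bar> < \<eta>" "\<bar>im D\<bar> < \<eta>" using D abs_re_le[of D] abs_im_le[of D] by simp_all
      have eq: "?G k w - ?G k z = re D - k * (im D * (2 * (im (f z) - s) + im D))" by (simp add: D_def algebra_simps)
      have "\<bar>2 * (im (f z) - s) + im D\<bar> \<le> q"
        using abs_triangle_ineq[of "2 * (im (f z) - s)" "im D"] \<open>\<bar>im D\<bar> < \<eta>\<close> \<eta>(2) unfolding q_def by linarith
      then have "\<bar>im D\<bar> * \<bar>2 * (im (f z) - s) + im D\<bar> \<le> \<eta> * q"
        using \<open>\<bar>im D\<bar> < \<eta>\<close> \<eta>(1) by (intro mult_mono) auto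
      then have "\<bar>k * (im D * (2 * (im (f z) - s) + im D))\<bar> \<le> \<bar>k\<bar> * (\<eta> * q)"
        unfolding abs_mult by (rule mult_left_mono) simp
      then have "\<bar>?G k w - ?G k z\<bar> \<le> \<eta> + \<bar>k\<bar> * (\<eta> * q)"
        unfolding eq using abs_triangle_ineq4[of "re D" "k * (im D * (2 * (im (f z) - s) + im D))"] \<open>\<bar>re D\<bar> < \<eta>\<close> by linarith
      also have "\<dots> = \<eta> * (1 + \<bar>k\<bar> * q)" by (simp add: algebra_simps)
      finally show ?thesis using \<eta>(3) by simp
    qed
    then show "\<exists>\<delta>>0. \<forall>w. absK w \<le> r \<and> absK (w - z) < \<delta> \<longrightarrow> \<bar>?G k w - ?G k z\<bar> < \<epsilon>" using \<delta>(1) by blast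
  qed
  then have Q: "?Q k (\<zeta> k)" for k using \<zeta>(2) by blast
  have ge: "re (f z1) \<le> ?G k (\<zeta> k)" for k
  proof -
    have "?G k z1 \<le> ?G k (\<zeta> k)" using Q[of k] z1(1) by blast
    then show ?thesis using z1(2) by simp
  qed
  have ins: "absK (\<zeta> k) < r" if "0 \<le> k" for k
  proof -
    have "0 \<le> k * ((im (f (\<zeta> k)) - s) * (im (f (\<zeta> k)) - s))" using that by simp
    then have "re (f (\<zeta> k)) > \<mu>" using ge[of k] z1(3) by linarith
    then have "absK (\<zeta> k) \<noteq> r" using bd[of "\<zeta> k"] by auto
    then show ?thesis using Q[of k] by simp
  qed
  have crit: "critical f (\<zeta> k)" if k: "0 \<le> k" "\<zeta> k \<noteq> 0" for k
  proof -
    obtain d where d: "K_deriv f (\<zeta> k) d" using der[OF k(2) ins[OF k(1)]] by blast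
    have "d = 0" by (rule penalised_maximum_critical[OF d ins[OF k(1)] _ k(1), of s]) (use Q[of k] in blast)
    then show ?thesis using d K_deriv_0_critical by blast
  qed
  have dx: "dfun1 (\<lambda>t. re (\<zeta> t))" "dfun1 (\<lambda>t. im (\<zeta> t))" and du: "dfun1 (\<lambda>t. re (f (\<zeta> t)))" "dfun1 (\<lambda>t. im (f (\<zeta> t)))"
    unfolding dfun1_def by (intro dintro d dfunRK_comp[OF \<zeta>(1)])+
  obtain k1 where k1: "\<forall>k>k1. right_Lipschitz (\<lambda>t. re (\<zeta> t)) k" using eventually_cofinite[OF finite_not_right_Lipschitz[OF dx(1)]] by blast
  obtain k2 where k2: "\<forall>k>k2. right_Lipschitz (\<lambda>t. im (\<zeta> t)) k" using eventually_cofinite[OF finite_not_right_Lipschitz[OF dx(2)]] by blast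
  obtain k3 where k3: "\<forall>k>k3. cont_at (\<lambda>t. re (f (\<zeta> t))) k" using eventually_cofinite[OF finite_discontinuities[OF du(1)]] by blast
  obtain k4 where k4: "\<forall>k>k4. cont_at (\<lambda>t. im (f (\<zeta> t))) k" using eventually_cofinite[OF finite_discontinuities[OF du(2)]] by blast
  \<comment> \<open>For large \<open>k\<close> the curve either stays at the exempt centre, and
    \<open>f\<close> is trivially constant along it, or avoids it.\<close>
  have "dpred1 (\<lambda>k. \<zeta> k = 0)" unfolding dpred1_def by (intro dintro dfunRK_comp[OF \<zeta>(1)])
  from tame_at_top[OF dpred1_tame[OF this]] obtain k5 where k5: "(\<forall>k>k5. \<zeta> k = 0) \<or> (\<forall>k>k5. \<zeta> k \<noteq> 0)" by auto
  define K where "K = Max {0, k1, k2, k3, k4, k5}"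
  have K: "0 \<le> K" "k1 \<le> K" "k2 \<le> K" "k3 \<le> K" "k4 \<le> K" "k5 \<le> K" by (simp_all add: K_def)
  have const: "f (\<zeta> k) = f (\<zeta> l)" if kl: "K < k" "k < l" for k l
    using k5
  proof
    assume "\<forall>k>k5. \<zeta> k = 0"
    then have "\<zeta> k = 0" "\<zeta> l = 0" using kl K(6) by auto
    then show ?thesis by simp
  next
    assume nz: "\<forall>k>k5. \<zeta> k \<noteq> 0"
    have *: "\<exists>\<delta>>0. \<forall>t. 0 < t \<and> t < \<delta> \<longrightarrow> absK (f (\<zeta> (x + t)) - f (\<zeta> x)) \<le> \<epsilon> * t" if x: "K < x" and e: "0 < \<epsilon>" for x \<epsilon>
    proof (rule critical_curve[where f = f and \<zeta> = \<zeta>, OF _ _ _ e])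
      show "critical f (\<zeta> x)" using crit[of x] nz x K(1,6) by simp
    qed (use k1 k2 x K in auto)
    have "\<exists>\<delta>>0. \<forall>t. 0 < t \<and> t < \<delta> \<longrightarrow> \<bar>re (f (\<zeta> (x + t))) - re (f (\<zeta> x))\<bar> \<le> \<epsilon> * t" if x: "K < x" "0 < \<epsilon>" for x \<epsilon>
    proof -
      obtain \<delta> where \<delta>: "\<delta> > 0" "\<forall>t. 0 < t \<and> t < \<delta> \<longrightarrow> absK (f (\<zeta> (x + t)) - f (\<zeta> x)) \<le> \<epsilon> * t" using *[OF x] by blast
      have "\<bar>re (f (\<zeta> (x + t))) - re (f (\<zeta> x))\<bar> \<le> \<epsilon> * t" if "0 < t \<and> t < \<delta>" for t
        using \<delta>(2)[rule_format, OF that] abs_re_le[of "f (\<zeta> (x + t)) - f (\<zeta> x)"] by simp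
      then show ?thesis using \<delta>(1) by blast
    qed
    moreover have "cont_at (\<lambda>t. re (f (\<zeta> t))) x" if "K < x" for x using k3 K(4) that by simp
    ultimately have re: "re (f (\<zeta> k)) = re (f (\<zeta> l))"
      by (intro zero_right_derivative_imp_constant[OF du(1) _ _ kl])
    have "\<exists>\<delta>>0. \<forall>t. 0 < t \<and> t < \<delta> \<longrightarrow> \<bar>im (f (\<zeta> (x + t))) - im (f (\<zeta> x))\<bar> \<le> \<epsilon> * t" if x: "K < x" "0 < \<epsilon>" for x \<epsilon>
    proof -
      obtain \<delta> where \<delta>: "\<delta> > 0" "\<forall>t. 0 < t \<and> t < \<delta> \<longrightarrow> absK (f (\<zeta> (x + t)) - f (\<zeta> x)) \<le> \<epsilon> * t" using *[OF x] by blast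
      have "\<bar>im (f (\<zeta> (x + t))) - im (f (\<zeta> x))\<bar> \<le> \<epsilon> * t" if "0 < t \<and> t < \<delta>" for t
        using \<delta>(2)[rule_format, OF that] abs_im_le[of "f (\<zeta> (x + t)) - f (\<zeta> x)"] by simp
      then show ?thesis using \<delta>(1) by blast
    qed
    moreover have "cont_at (\<lambda>t. im (f (\<zeta> t))) x" if "K < x" for x using k4 K(5) that by simp
    ultimately have im: "im (f (\<zeta> k)) = im (f (\<zeta> l))"
      by (intro zero_right_derivative_imp_constant[OF du(2) _ _ kl])
    from re im show ?thesis by (rule K_eqI)
  qed
  define p where "p = f (\<zeta> (K + 1))"
  have p: "f (\<zeta> k) = p" if "K + 1 < k" for k using const[of "K + 1" k] that by (simp add: p_def)
  have "im p = s"
  proof (rule ccontr)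
    assume "im p \<noteq> s"
    define q where "q = (im p - s) * (im p - s)"
    have q: "q > 0" using \<open>im p \<noteq> s\<close> by (auto simp: q_def zero_less_mult_iff neq_iff)
    \<comment> \<open>Beyond \<open>K + 1\<close>, so that the value is still \<open>p\<close>, and
      so large that the penalty \<open>k * q\<close> exceeds
      \<open>re p - re (f z1)\<close>.\<close>
    define k where "k = max (K + 2) ((re p - re (f z1)) / q + 1)"
    have "K + 1 < k" by (simp add: k_def less_max_iff_disj)
    then have "re (f z1) \<le> re p - k * q" using ge[of k] p[of k] by (simp add: q_def)
    moreover have "(re p - re (f z1)) / q < k" by (simp add: k_def less_max_iff_disj)
    then have "re p - re (f z1) < k * q" using q by (simp add: pos_divide_less_eq)
    ultimately show False by linarith
  qed
  moreover have "0 \<le> K + 1" using K(1) by simp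
  ultimately show ?thesis using ins[of "K + 1"] crit[of "K + 1"] by (intro exI[of _ "\<zeta> (K + 1)"]) (auto simp: p_def)
qed

text \<open>An argument in the manner of Sard: \<open>im (f (\<zeta> s)) = s\<close> moves at speed
  1, while \<open>f\<close> has right derivative 0 along a Lipschitz curve of critical points.
  Together with the finitely many parameters that are not Lipschitz, the level
  \<open>im (f 0)\<close> is discarded, which keeps \<open>\<zeta> s\<close> away from the
  centre.\<close>

lemma no_interval_of_critical_levels:
  assumes f: "dfunKK f" and "\<alpha> < \<beta>"
    and ex: "\<And>s. \<alpha> < s \<Longrightarrow> s < \<beta> \<Longrightarrow> \<exists>z. im (f z) = s \<and> (z = 0 \<or> critical f z)"
  shows False
proof -
  note d = dfunKK_comp[OF f]
  let ?Q = "\<lambda>s z. im (f z) = s \<and> (z = 0 \<or> critical f z)"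
  have "dpredRK ?Q" unfolding dpredRK_def critical_def by (intro dintro d)
  from definable_choice_K[OF this] obtain \<zeta> where \<zeta>: "dfunRK \<zeta>" "\<forall>s. (\<exists>z. ?Q s z) \<longrightarrow> ?Q s (\<zeta> s)" by (elim exE conjE)
  have Q: "?Q s (\<zeta> s)" if "\<alpha> < s" "s < \<beta>" for s using \<zeta>(2) ex[OF that] by blast
  have dx: "dfun1 (\<lambda>t. re (\<zeta> t))" "dfun1 (\<lambda>t. im (\<zeta> t))"
    unfolding dfun1_def by (intro dintro dfunRK_comp[OF \<zeta>(1)])+
  let ?F = "{s. \<not> right_Lipschitz (\<lambda>t. re (\<zeta> t)) s} \<union> {s. \<not> right_Lipschitz (\<lambda>t. im (\<zeta> t)) s} \<union> {im (f 0)}"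
  have "finite ?F" using finite_not_right_Lipschitz[OF dx(1)] finite_not_right_Lipschitz[OF dx(2)] by simp
  then have "\<not> {\<alpha><..<\<beta>} \<subseteq> ?F" using infinite_Ioo[OF assms(2)] finite_subset by blast
  then obtain s where "s \<in> {\<alpha><..<\<beta>}" and sF: "s \<notin> ?F" by blast
  then have s: "\<alpha> < s" "s < \<beta>" by simp_all
  have "\<zeta> s \<noteq> 0" using Q[OF s] sF by auto
  then have "critical f (\<zeta> s)" using Q[OF s] by blast
  moreover have "right_Lipschitz (\<lambda>t. re (\<zeta> t)) s" "right_Lipschitz (\<lambda>t. im (\<zeta> t)) s" using sF by auto
  moreover have "(0::'r) < 1/2" by simp
  ultimately have "\<exists>\<delta>>0. \<forall>t. 0 < t \<and> t < \<delta> \<longrightarrow> absK (f (\<zeta> (s + t)) - f (\<zeta> s)) \<le> 1/2 * t" by (rule critical_curve)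
  then obtain \<delta> where \<delta>: "\<delta> > 0" "\<forall>t. 0 < t \<and> t < \<delta> \<longrightarrow> absK (f (\<zeta> (s + t)) - f (\<zeta> s)) \<le> 1/2 * t" by (elim exE conjE)
  obtain t where t: "0 < t" "t < min \<delta> (\<beta> - s)" using dense[of 0 "min \<delta> (\<beta> - s)"] \<delta>(1) s(2) by auto
  have "im (f (\<zeta> (s + t)) - f (\<zeta> s)) = t" using Q[of "s + t"] Q[of s] s t by simp
  then have "t \<le> 1/2 * t" using \<delta>(2)[rule_format, of t] t abs_im_le[of "f (\<zeta> (s + t)) - f (\<zeta> s)"] by simp
  then show False using t(1) by simp
qed

text \<open>As only finitely many levels of \<open>im f\<close> occur where
  \<open>re f > \<mu>\<close>, continuity makes \<open>im f\<close> locally constant there, and all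
  inner points of that part except the centre are critical. Along the ray from such a point outwards
  \<open>re f\<close> can lose only an arbitrarily small amount, so it is still above
  \<open>\<mu>\<close> on the circle.\<close>

lemma real_part_maximum_principle:
  assumes f: "dfunKK f" and cont: "cont_disc r f"
    and der: "\<And>z. z \<noteq> 0 \<Longrightarrow> absK z < r \<Longrightarrow> \<exists>d. K_deriv f z d"
    and bd: "\<And>w. absK w = r \<Longrightarrow> re (f w) \<le> \<mu>"
    and r: "0 < r" and z: "absK z \<le> r"
  shows "re (f z) \<le> \<mu>"
proof (rule ccontr)
  assume "\<not> re (f z) \<le> \<mu>"
  then have gt: "re (f z) > \<mu>" by simp
  note d = dfunKK_comp[OF f]
  have cont': "\<exists>\<delta>>0. \<forall>w. absK w \<le> r \<and> absK (w - z) < \<delta> \<longrightarrow> absK (f w - f z) < \<epsilon>" if "absK z \<le> r" "0 < \<epsilon>" for z \<epsilon>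
    using cont that unfolding cont_disc_def by blast
  let ?T = "\<lambda>s. \<exists>z. absK z \<le> r \<and> im (f z) = s \<and> re (f z) > \<mu>"
  have finT: "finite {s. ?T s}"
  proof (rule tame_finite)
    show "tame {s. ?T s}" by (rule dpred1_tame) (unfold dpred1_def, intro dintro d)
    fix x y :: 'r assume "x < y"
    show "\<exists>s. x < s \<and> s < y \<and> s \<notin> {s. ?T s}"
    proof (rule ccontr)
      assume no: "\<not> ?thesis"
      have "\<exists>z. im (f z) = s \<and> (z = 0 \<or> critical f z)" if s: "x < s" "s < y" for s
      proof -
        have "?T s" using no s by blast
        then obtain z1 where z1: "absK z1 \<le> r" "im (f z1) = s" "re (f z1) > \<mu>" by blast
        from critical_point_on_level[OF f cont der bd this] show ?thesis by blast
      qed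
      then show False by (rule no_interval_of_critical_levels[OF f \<open>x < y\<close>])
    qed
  qed
  have crit: "critical f w" if w: "w \<noteq> 0" "absK w < r" "re (f w) > \<mu>" for w
  proof -
    obtain dw where dw: "K_deriv f w dw" using der[OF w(1,2)] by blast
    obtain \<eta>1 where \<eta>1: "\<eta>1 > 0" "\<forall>b\<in>{s. ?T s}. b \<le> im (f w) \<or> im (f w) + \<eta>1 \<le> b" using finite_gap_right[OF finT] by blast
    obtain \<eta>2 where \<eta>2: "\<eta>2 > 0" "\<forall>b\<in>{s. ?T s}. im (f w) \<le> b \<or> b \<le> im (f w) - \<eta>2" using finite_gap_left[OF finT] by blast
    \<comment> \<open>Within \<open>\<eta>\<close> of \<open>f w\<close> the real part stays above
      \<open>\<mu>\<close>, and no level other than \<open>im (f w)\<close> lies there.\<close>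
    define \<eta> where "\<eta> = min (min \<eta>1 \<eta>2) (re (f w) - \<mu>)"
    have \<eta>: "\<eta> > 0" using \<eta>1 \<eta>2 w(3) by (simp add: \<eta>_def)
    obtain \<delta>1 where \<delta>1: "\<delta>1 > 0" "\<forall>v. absK v \<le> r \<and> absK (v - w) < \<delta>1 \<longrightarrow> absK (f v - f w) < \<eta>"
      using cont'[of w, OF _ \<eta>] w(2) by auto
    have same: "im (f (w + h)) = im (f w)" if h: "absK h < min \<delta>1 (r - absK w)" for h
    proof -
      have v: "absK (w + h) \<le> r" using absK_triangle[of w h] h by simp
      moreover have "absK (w + h - w) < \<delta>1" using h by simp
      ultimately have D: "absK (f (w + h) - f w) < \<eta>" using \<delta>1(2) by blast
      have re: "\<bar>re (f (w + h)) - re (f w)\<bar> < \<eta>" using D abs_re_le[of "f (w + h) - f w"] by simp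
      have im: "\<bar>im (f (w + h)) - im (f w)\<bar> < \<eta>" using D abs_im_le[of "f (w + h) - f w"] by simp
      have "re (f (w + h)) > \<mu>" using re by (simp add: \<eta>_def abs_less_iff)
      then have T: "im (f (w + h)) \<in> {s. ?T s}" using v by blast
      have "im (f (w + h)) \<le> im (f w) \<or> im (f w) + \<eta>1 \<le> im (f (w + h))" using \<eta>1(2) T by blast
      moreover have "im (f w) \<le> im (f (w + h)) \<or> im (f (w + h)) \<le> im (f w) - \<eta>2" using \<eta>2(2) T by blast
      ultimately show ?thesis using im by (auto simp: \<eta>_def abs_less_iff)
    qed
    have small: "\<bar>re dw\<bar> \<le> \<epsilon> \<and> \<bar>im dw\<bar> \<le> \<epsilon>" if e: "\<epsilon> > 0" for \<epsilon>
    proof -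
      obtain \<delta>2 where \<delta>2: "\<delta>2 > 0" "\<forall>h. absK h < \<delta>2 \<longrightarrow> absK (f (w + h) - f w - dw * h) \<le> \<epsilon> * absK h"
        using K_deriv_approx[OF dw e] by blast
      have bound: "\<bar>im (dw * h)\<bar> \<le> \<epsilon> * absK h" if h: "absK h < min \<delta>2 (min \<delta>1 (r - absK w))" for h
      proof -
        have "im (f (w + h) - f w - dw * h) = - im (dw * h)" using same[of h] h by simp
        then have "\<bar>im (dw * h)\<bar> \<le> absK (f (w + h) - f w - dw * h)" using abs_im_le[of "f (w + h) - f w - dw * h"] by simp
        also have "\<dots> \<le> \<epsilon> * absK h" using \<delta>2(2) h by simp
        finally show ?thesis .
      qed
      have "0 < min \<delta>2 (min \<delta>1 (r - absK w))" using \<delta>1(1) \<delta>2(1) w(2) by simp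
      then obtain t where t: "0 < t" "t < min \<delta>2 (min \<delta>1 (r - absK w))" using dense by blast
      \<comment> \<open>The directions 1 and i separate the two parts of \<open>dw\<close>: the
        product with \<open>of_R t\<close> has imaginary part \<open>im dw * t\<close>, the product
        with \<open>Adjoin_I 0 t\<close> has \<open>re dw * t\<close>.\<close>
      have a1: "absK (of_R t) = t" using t(1) by simp
      have "absK (Adjoin_I 0 t) = t" by (rule absK_eqI[symmetric]) (use t(1) in auto)
      note a2 = this
      have "\<bar>im dw\<bar> * t \<le> \<epsilon> * t" using bound[of "of_R t"] t a1 by (simp add: abs_mult)
      moreover have "\<bar>re dw\<bar> * t \<le> \<epsilon> * t" using bound[of "Adjoin_I 0 t"] t a2 by (simp add: abs_mult)
      ultimately show ?thesis using t(1) by simp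
    qed
    have "re dw = 0"
    proof (rule ccontr)
      assume "re dw \<noteq> 0"
      then have "0 < \<bar>re dw\<bar> / 2" by simp
      from small[OF this] \<open>re dw \<noteq> 0\<close> show False by simp
    qed
    moreover have "im dw = 0"
    proof (rule ccontr)
      assume "im dw \<noteq> 0"
      then have "0 < \<bar>im dw\<bar> / 2" by simp
      from small[OF this] \<open>im dw \<noteq> 0\<close> show False by simp
    qed
    ultimately have "dw = 0" by (intro K_eqI) simp_all
    then show ?thesis using dw K_deriv_0_critical by blast
  qed
  \<comment> \<open>If the offending point is the centre, continuity supplies another one next to
    it; the centre itself determines no ray.\<close>
  obtain z0 where z0: "z0 \<noteq> 0" "absK z0 \<le> r" "re (f z0) > \<mu>"
  proof (cases "z = 0")
    case False
    then show thesis using that z gt by blast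
  next
    case True
    have "0 < re (f z) - \<mu>" using gt by simp
    from cont'[OF z this] obtain \<delta> where \<delta>: "\<delta> > 0" "\<forall>w. absK w \<le> r \<and> absK (w - z) < \<delta> \<longrightarrow> absK (f w - f z) < re (f z) - \<mu>" by (elim exE conjE)
    have "0 < min \<delta> r" using \<delta>(1) r by simp
    then obtain t where t: "0 < t" "t < min \<delta> r" using dense by blast
    have a: "absK (of_R t) = t" using t by simp
    then have "absK (f (of_R t) - f z) < re (f z) - \<mu>" using \<delta>(2)[rule_format, of "of_R t"] t True by simp
    then have "re (f (of_R t)) > \<mu>" using abs_re_le[of "f (of_R t) - f z"] by (simp add: abs_le_iff)
    moreover have "of_R t \<noteq> 0" using a t(1) by auto
    ultimately show thesis using that[of "of_R t"] a t by simp
  qed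
  define m where "m = absK z0"
  have m: "0 < m" "m \<le> r" using absK_pos[OF z0(1)] z0(2) by (simp_all add: m_def)
  define T where "T = r / m"
  have T: "1 \<le> T" "T * m = r" using m by (simp_all add: T_def)
  define u where "u = (\<lambda>t. - re (f (of_R t * z0)))"
  have du: "dfun1 u" unfolding dfun1_def u_def by (intro dintro d)
  have absu: "absK (of_R t * z0) = t * m" if "1 \<le> t" for t using that by (simp add: absK_mult m_def)
  have "0 < - u 1 - \<mu>" using z0(3) by (simp add: u_def)
  \<comment> \<open>A loss at rate \<open>\<epsilon>\<close> along the whole ray, which meets the
    circle at parameter \<open>T\<close>, stays below the margin \<open>re (f z0) - \<mu>\<close>.
    Here \<open>growth_bound\<close> must provide the bound at the current point: it shows that
    \<open>re f\<close> is still above \<open>\<mu>\<close> there, and only then is the point known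
    to be critical.\<close>
  from ex_small[OF this, of "T - 1"] obtain \<epsilon> where e0: "\<epsilon> > 0" "\<forall>t. 0 < t \<and> t \<le> \<epsilon> \<longrightarrow> t * (T - 1) < - u 1 - \<mu>" by (elim exE conjE)
  then have e: "\<epsilon> * (T - 1) < - u 1 - \<mu>" by simp
  have "u T \<le> u 1 + \<epsilon> * (T - 1)"
  proof (rule growth_bound[OF du T(1)])
    fix x \<eta> :: 'r assume x: "1 < x" "x \<le> T" and \<eta>: "0 < \<eta>"
    have "x * m \<le> r" using mult_right_mono[OF x(2), of m] m T(2) by simp
    then have "absK (of_R x * z0) \<le> r" using absu[of x] x(1) by simp
    from cont'[OF this \<eta>] obtain \<delta> where \<delta>: "\<delta> > 0" "\<forall>w. absK w \<le> r \<and> absK (w - of_R x * z0) < \<delta> \<longrightarrow> absK (f w - f (of_R x * z0)) < \<eta>" by (elim exE conjE)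
    have "u x < u y + \<eta>" if y: "x - \<delta> / m < y \<and> y < x \<and> 1 \<le> y" for y
    proof -
      have "y * m \<le> x * m" using y m by (intro mult_right_mono) auto
      then have "y * m \<le> r" using \<open>x * m \<le> r\<close> by (rule order_trans)
      then have 1: "absK (of_R y * z0) \<le> r" using absu[of y] y by simp
      have "absK (of_R y * z0 - of_R x * z0) = absK (of_R (y - x) * z0)" by (simp add: left_diff_distrib)
      also have "\<dots> = (x - y) * m" using y by (simp add: absK_mult m_def del: of_R_simps)
      also have "\<dots> < \<delta>"
      proof -
        have "x - y < \<delta> / m" using y by simp
        then show ?thesis using m(1) by (simp only: pos_less_divide_eq)
      qed
      finally have "absK (f (of_R y * z0) - f (of_R x * z0)) < \<eta>" using \<delta>(2) 1 by blast
      then have "\<bar>re (f (of_R y * z0)) - re (f (of_R x * z0))\<bar> < \<eta>" using abs_re_le[of "f (of_R y * z0) - f (of_R x * z0)"] by simp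
      then show ?thesis unfolding u_def abs_less_iff by linarith
    qed
    moreover have "\<delta> / m > 0" using \<delta>(1) m(1) by simp
    ultimately show "\<exists>\<delta>>0. \<forall>y. x - \<delta> < y \<and> y < x \<and> 1 \<le> y \<longrightarrow> u x < u y + \<eta>" by blast
  next
    fix x assume x: "1 \<le> x" "x < T" and ux: "u x \<le> u 1 + \<epsilon> * (x - 1)"
    have "\<epsilon> * (x - 1) \<le> \<epsilon> * (T - 1)" using x(2) e0(1) by (intro mult_left_mono) auto
    then have "- u x > \<mu>" using ux e by linarith
    then have 1: "re (f (of_R x * z0)) > \<mu>" by (simp add: u_def)
    have "x * m < T * m" using mult_strict_right_mono[OF x(2) m(1)] .
    then have 2: "absK (of_R x * z0) < r" using absu[OF x(1)] T(2) by simp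
    have "of_R x \<noteq> 0" using x(1) by auto
    then have 3: "of_R x * z0 \<noteq> 0" using z0(1) by (rule no_zero_divisors)
    have "\<epsilon> / m > 0" using e0(1) m(1) by simp
    then obtain \<delta> where \<delta>: "\<delta> > 0" "\<forall>h. absK h < \<delta> \<longrightarrow> absK (f (of_R x * z0 + h) - f (of_R x * z0)) \<le> \<epsilon> / m * absK h"
      using crit[OF 3 2 1] unfolding critical_def by blast
    have "u y \<le> u x + \<epsilon> * (y - x)" if y: "x < y \<and> y < x + \<delta> / m" for y
    proof -
      define h where "h = of_R (y - x) * z0"
      have h: "absK h = (y - x) * m" using y by (simp add: h_def absK_mult m_def del: of_R_simps)
      have "y - x < \<delta> / m" using y by simp
      then have "absK h < \<delta>" unfolding h using m(1) by (simp only: pos_less_divide_eq)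
      then have "absK (f (of_R x * z0 + h) - f (of_R x * z0)) \<le> \<epsilon> / m * absK h" using \<delta>(2) by blast
      also have "\<epsilon> / m * absK h = \<epsilon> * (y - x)" unfolding h using m(1) by simp
      finally have "absK (f (of_R y * z0) - f (of_R x * z0)) \<le> \<epsilon> * (y - x)" by (simp add: h_def left_diff_distrib)
      then have "\<bar>re (f (of_R y * z0)) - re (f (of_R x * z0))\<bar> \<le> \<epsilon> * (y - x)" using abs_re_le[of "f (of_R y * z0) - f (of_R x * z0)"] by simp
      then show ?thesis unfolding u_def abs_le_iff by linarith
    qed
    moreover have "\<delta> / m > 0" using \<delta>(1) m(1) by simp
    ultimately show "\<exists>\<delta>>0. \<forall>y. x < y \<and> y < x + \<delta> \<longrightarrow> u y \<le> u x + \<epsilon> * (y - x)" by blast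
  qed
  then have "- u T > \<mu>" using e by linarith
  moreover have "re (f (of_R T * z0)) \<le> \<mu>" by (rule bd) (use absu[OF T(1)] T(2) in simp)
  ultimately show False by (simp add: u_def)
qed

text \<open>Multiplication by the unit \<open>c\<close> turns \<open>f z\<close> into its absolute
  value, and on the circle a bound for the absolute value bounds the real part.\<close>

theorem maximum_principle:
  assumes f: "dfunKK f" and cont: "cont_disc r f"
    and der: "\<And>z. z \<noteq> 0 \<Longrightarrow> absK z < r \<Longrightarrow> \<exists>d. K_deriv f z d"
    and bd: "\<And>w. absK w = r \<Longrightarrow> absK (f w) \<le> \<mu>"
    and r: "0 < r" and z: "absK z \<le> r"
  shows "absK (f z) \<le> \<mu>"
proof (cases "f z = 0")
  case True
  have "absK (of_R r) = r" using r by simp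
  from bd[OF this] absK_nonneg[of "f (of_R r)"] True show ?thesis by simp
next
  case False
  define c where "c = of_R (absK (f z)) / f z"
  have p: "absK (f z) > 0" by (rule absK_pos[OF False])
  have "c * f z = of_R (absK (f z))" unfolding c_def by (rule divide_mult_cancel[OF False])
  moreover have "absK c = 1" unfolding c_def absK_divide absK_of_R abs_of_pos[OF p] using False by (intro divide_self) simp
  ultimately have c: "absK c = 1" "c * f z = of_R (absK (f z))" by blast+
  have "re (c * f z) \<le> \<mu>"
  proof (rule real_part_maximum_principle[where f = "\<lambda>w. c * f w", OF _ _ _ _ r z])
    show "dfunKK (\<lambda>w. c * f w)" unfolding dfunKK_def by (intro dintro dfunKK_comp[OF f])
    have eq: "absK (c * x - c * y) = absK (x - y)" for x y
      using absK_mult[of c "x - y"] c(1) by (simp add: right_diff_distrib)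
    show "cont_disc r (\<lambda>w. c * f w)" using cont unfolding cont_disc_def eq .
    show "\<exists>d. K_deriv (\<lambda>w. c * f w) z d" if zr: "z \<noteq> 0" "absK z < r" for z
    proof -
      obtain d where d: "K_deriv f z d" using der[OF zr] by blast
      have "absK ((c * f (z + h) - c * f z) / h - c * d) = absK ((f (z + h) - f z) / h - d)" for h
      proof -
        have "(c * f (z + h) - c * f z) / h = c * ((f (z + h) - f z) / h)"
          by (simp only: right_diff_distrib[symmetric] times_divide_eq_right)
        then show ?thesis using eq[of "(f (z + h) - f z) / h" d] by (simp only:)
      qed
      then have "K_deriv (\<lambda>w. c * f w) z (c * d)" using d unfolding K_deriv_def by (simp only:)
      then show ?thesis by blast
    qed
    show "re (c * f w) \<le> \<mu>" if "absK w = r" for w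
      using abs_re_le[of "c * f w"] bd[OF that] c(1) by (simp add: absK_mult abs_le_iff)
  qed
  then show ?thesis unfolding c(2) by simp
qed

end

section \<open>Continuity of partial derivatives and strict differentiability\<close>

lemma K_deriv_diff:
  assumes "K_deriv f z d" "K_deriv g z e" shows "K_deriv (\<lambda>w. f w - g w) z (d - e)"
  unfolding K_deriv_def
proof (intro allI impI)
  fix \<epsilon> :: 'a assume "0 < \<epsilon>"
  then have e: "\<epsilon>/2 > 0" by simp
  obtain \<delta>1 where 1: "\<delta>1 > 0" "\<forall>h. h \<noteq> 0 \<and> absK h < \<delta>1 \<longrightarrow> absK ((f (z + h) - f z) / h - d) < \<epsilon>/2"
    using assms(1) e unfolding K_deriv_def by blast
  obtain \<delta>2 where 2: "\<delta>2 > 0" "\<forall>h. h \<noteq> 0 \<and> absK h < \<delta>2 \<longrightarrow> absK ((g (z + h) - g z) / h - e) < \<epsilon>/2"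
    using assms(2) e unfolding K_deriv_def by blast
  have "absK ((f (z + h) - g (z + h) - (f z - g z)) / h - (d - e)) < \<epsilon>" if h: "h \<noteq> 0 \<and> absK h < min \<delta>1 \<delta>2" for h
  proof -
    have eq: "(f (z + h) - g (z + h) - (f z - g z)) / h - (d - e) = ((f (z + h) - f z) / h - d) - ((g (z + h) - g z) / h - e)"
      by (simp add: diff_divide_distrib)
    have "absK (((f (z + h) - f z) / h - d) - ((g (z + h) - g z) / h - e)) \<le> absK ((f (z + h) - f z) / h - d) + absK ((g (z + h) - g z) / h - e)"
      using absK_triangle[of "(f (z + h) - f z) / h - d" "- ((g (z + h) - g z) / h - e)"] by (simp only: absK_minus diff_conv_add_uminus)
    moreover have "absK ((f (z + h) - f z) / h - d) < \<epsilon>/2" using 1(2) h by simp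
    moreover have "absK ((g (z + h) - g z) / h - e) < \<epsilon>/2" using 2(2) h by simp
    ultimately show ?thesis unfolding eq using field_sum_of_halves[of \<epsilon>] by linarith
  qed
  moreover have "min \<delta>1 \<delta>2 > 0" using 1 2 by simp
  ultimately show "\<exists>\<delta>>0. \<forall>h. h \<noteq> 0 \<and> absK h < \<delta> \<longrightarrow> absK ((f (z + h) - g (z + h) - (f z - g z)) / h - (d - e)) < \<epsilon>"
    by (intro exI[of _ "min \<delta>1 \<delta>2"]) blast
qed

lemma K_deriv_local:
  assumes "K_deriv f z d" "0 < \<eta>" "\<And>w. absK (w - z) < \<eta> \<Longrightarrow> g w = f w"
  shows "K_deriv g z d"
  unfolding K_deriv_def
proof (intro allI impI)
  fix \<epsilon> :: 'a assume "0 < \<epsilon>"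
  then obtain \<delta> where \<delta>: "\<delta> > 0" "\<forall>h. h \<noteq> 0 \<and> absK h < \<delta> \<longrightarrow> absK ((f (z + h) - f z) / h - d) < \<epsilon>"
    using assms(1) unfolding K_deriv_def by blast
  have "absK ((g (z + h) - g z) / h - d) < \<epsilon>" if "h \<noteq> 0 \<and> absK h < min \<delta> \<eta>" for h
    using \<delta>(2)[rule_format, of h] that assms(3)[of "z + h"] assms(3)[of z] assms(2) by simp
  moreover have "min \<delta> \<eta> > 0" using \<delta>(1) assms(2) by simp
  ultimately show "\<exists>\<delta>>0. \<forall>h. h \<noteq> 0 \<and> absK h < \<delta> \<longrightarrow> absK ((g (z + h) - g z) / h - d) < \<epsilon>"
    by (intro exI[of _ "min \<delta> \<eta>"]) blast
qed

lemma K_deriv_isCont: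
  assumes "K_deriv f z d" "0 < \<epsilon>"
  shows "\<exists>\<delta>>0. \<forall>w. absK (w - z) < \<delta> \<longrightarrow> absK (f w - f z) < \<epsilon>"
proof -
  have one: "(0::'a) < 1" by simp
  obtain \<delta> where \<delta>: "\<delta> > 0" "\<forall>h. absK h < \<delta> \<longrightarrow> absK (f (z + h) - f z - d * h) \<le> 1 * absK h"
    using K_deriv_approx[OF assms(1) one] by (elim exE conjE)
  define B where "B = 1 + absK d"
  have B: "B > 0" by (simp add: B_def absK_nonneg add_pos_nonneg)
  have "absK (f w - f z) < \<epsilon>" if w: "absK (w - z) < min \<delta> (\<epsilon> / B)" for w
  proof -
    have "absK (f w - f z - d * (w - z)) \<le> absK (w - z)" using \<delta>(2)[rule_format, of "w - z"] w by simp
    moreover have "absK (f w - f z) \<le> absK (f w - f z - d * (w - z)) + absK (d * (w - z))"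
      using absK_triangle[of "f w - f z - d * (w - z)" "d * (w - z)"] by (simp only: diff_add_cancel)
    moreover have "absK (w - z) * B = absK (w - z) + absK (d * (w - z))"
      by (simp only: B_def absK_mult distrib_left mult_1_right mult.commute)
    ultimately have "absK (f w - f z) \<le> absK (w - z) * B" by linarith
    also have "\<dots> < \<epsilon>"
    proof -
      have "absK (w - z) < \<epsilon> / B" using w by simp
      then show ?thesis using B by (simp only: pos_less_divide_eq)
    qed
    finally show ?thesis .
  qed
  moreover have "min \<delta> (\<epsilon> / B) > 0" using \<delta>(1) B assms(2) by simp
  ultimately show ?thesis by (intro exI[of _ "min \<delta> (\<epsilon> / B)"]) blast
qed

lemma K_deriv_shift:
  assumes "K_deriv g (a + \<zeta>) e" shows "K_deriv (\<lambda>\<zeta>. g (a + \<zeta>) - b) \<zeta> e"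
  using assms unfolding K_deriv_def by (simp add: add.assoc)

lemma K_deriv_divide_id:
  fixes N :: "'r::real_closed_field adjoin_i \<Rightarrow> 'r adjoin_i"
  assumes d: "K_deriv N \<zeta> e" and z: "\<zeta> \<noteq> 0"
  shows "K_deriv (\<lambda>w. N w / w) \<zeta> ((e - N \<zeta> / \<zeta>) / \<zeta>)"
  unfolding K_deriv_def
proof (intro allI impI)
  fix \<epsilon> :: 'r assume \<epsilon>: "0 < \<epsilon>"
  \<comment> \<open>The derivative to be established is \<open>X / \<zeta>\<close>. The difference
    quotient will be \<open>Y / (\<zeta> + h)\<close> with a \<open>Y\<close> that tends to
    \<open>X\<close>.\<close>
  define X where "X = e - N \<zeta> / \<zeta>"
  define m where "m = absK \<zeta>"
  have m: "m > 0" using absK_pos[OF z] by (simp add: m_def)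
  \<comment> \<open>\<open>absK (\<zeta> + h)\<close> stays above \<open>m / 2\<close>, so
    \<open>Y - X\<close> below \<open>(\<epsilon> / 2) * (m / 2)\<close> contributes less than
    \<open>\<epsilon> / 2\<close>. The other half is for the error of replacing
    \<open>\<zeta> + h\<close> by \<open>\<zeta>\<close>.\<close>
  have e1: "\<epsilon> * m / 4 > 0" using \<epsilon> m by simp
  then obtain \<delta>1 where 1: "\<delta>1 > 0" "\<forall>h. h \<noteq> 0 \<and> absK h < \<delta>1 \<longrightarrow> absK ((N (\<zeta> + h) - N \<zeta>) / h - e) < \<epsilon> * m / 4"
    using d unfolding K_deriv_def by blast
  have e2: "\<epsilon> / 4 > 0" using \<epsilon> by simp
  obtain \<delta>2 where 2: "\<delta>2 > 0" "\<forall>t. 0 < t \<and> t \<le> \<delta>2 \<longrightarrow> t * (absK X / (m * m)) < \<epsilon> / 4"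
    using ex_small[OF e2, of "absK X / (m * m)"] by (elim exE conjE)
  have "absK ((N (\<zeta> + h) / (\<zeta> + h) - N \<zeta> / \<zeta>) / h - X / \<zeta>) < \<epsilon>"
    if h: "h \<noteq> 0 \<and> absK h < min (min \<delta>1 \<delta>2) (m / 2)" for h
  proof -
    define Y where "Y = (N (\<zeta> + h) - N \<zeta>) / h - N \<zeta> / \<zeta>"
    have hm: "absK h < m / 2" using h by simp
    have "m - absK h \<le> absK (\<zeta> + h)" using absK_diff_ge[of \<zeta> "- h"] by (simp add: m_def)
    then have low: "m / 2 < absK (\<zeta> + h)" using hm field_sum_of_halves[of m] by linarith
    have "0 < m / 2" using m by simp
    then have p: "0 < absK (\<zeta> + h)" using low by (rule less_trans)
    then have zh: "\<zeta> + h \<noteq> 0" by auto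
    have eq1: "(N (\<zeta> + h) / (\<zeta> + h) - N \<zeta> / \<zeta>) / h = Y / (\<zeta> + h)"
      using h z zh unfolding Y_def by (simp add: field_simps)
    have eq2: "Y / (\<zeta> + h) - X / \<zeta> = (Y - X) / (\<zeta> + h) - X * h / (\<zeta> * (\<zeta> + h))"
    proof -
      have "X * (s - \<zeta>) / (\<zeta> * s) = X / \<zeta> - X / s" if "s \<noteq> 0" for s
        using that z by (simp add: field_simps)
      from this[OF zh] have "X * h / (\<zeta> * (\<zeta> + h)) = X / \<zeta> - X / (\<zeta> + h)" by simp
      then show ?thesis by (simp add: diff_divide_distrib)
    qed
    have eq: "(N (\<zeta> + h) / (\<zeta> + h) - N \<zeta> / \<zeta>) / h - X / \<zeta> = (Y - X) / (\<zeta> + h) - X * h / (\<zeta> * (\<zeta> + h))"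
      by (simp only: eq1 eq2)
    have YX: "Y - X = (N (\<zeta> + h) - N \<zeta>) / h - e" by (simp add: Y_def X_def)
    have "h \<noteq> 0 \<and> absK h < \<delta>1" using h by simp
    then have "absK (Y - X) < \<epsilon> * m / 4" unfolding YX by (rule 1(2)[rule_format])
    also have "\<epsilon> * m / 4 = (\<epsilon> / 2) * (m / 2)" by simp
    also have "\<dots> < (\<epsilon> / 2) * absK (\<zeta> + h)" using low \<epsilon> by (intro mult_strict_left_mono) auto
    finally have A: "absK ((Y - X) / (\<zeta> + h)) < \<epsilon> / 2" unfolding absK_divide using p by (simp add: pos_divide_less_eq)
    have hp: "absK h > 0" using h absK_pos by blast
    have "absK h * (absK X / (m * m)) < \<epsilon> / 4" using 2(2)[rule_format, of "absK h"] h hp by simp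
    then have "absK X * absK h < \<epsilon> / 4 * (m * m)" using m by (simp add: field_simps)
    also have "\<dots> = (\<epsilon> / 2) * (m * (m / 2))" by simp
    also have "\<dots> \<le> (\<epsilon> / 2) * (m * absK (\<zeta> + h))" using low \<epsilon> m by (intro mult_left_mono) auto
    finally have B: "absK (X * h / (\<zeta> * (\<zeta> + h))) < \<epsilon> / 2"
      unfolding absK_divide absK_mult m_def[symmetric] using p m by (subst pos_divide_less_eq) simp_all
    have "absK ((Y - X) / (\<zeta> + h) - X * h / (\<zeta> * (\<zeta> + h))) \<le> absK ((Y - X) / (\<zeta> + h)) + absK (X * h / (\<zeta> * (\<zeta> + h)))"
      using absK_triangle[of "(Y - X) / (\<zeta> + h)" "- (X * h / (\<zeta> * (\<zeta> + h)))"] by (simp only: absK_minus diff_conv_add_uminus)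
    then show ?thesis unfolding eq using A B field_sum_of_halves[of \<epsilon>] by linarith
  qed
  moreover have "min (min \<delta>1 \<delta>2) (m / 2) > 0" using 1 2 m by simp
  ultimately show "\<exists>\<delta>>0. \<forall>h. h \<noteq> 0 \<and> absK h < \<delta> \<longrightarrow>
      absK ((N (\<zeta> + h) / (\<zeta> + h) - N \<zeta> / \<zeta>) / h - (e - N \<zeta> / \<zeta>) / \<zeta>) < \<epsilon>"
    unfolding X_def by (intro exI[of _ "min (min \<delta>1 \<delta>2) (m / 2)"]) blast
qed

definition near :: "nat \<Rightarrow> (nat \<Rightarrow> 'r::real_closed_field adjoin_i) \<Rightarrow> 'r \<Rightarrow> (nat \<Rightarrow> 'r adjoin_i) \<Rightarrow> bool" where
  "near p z \<delta> w \<longleftrightarrow> (\<forall>i<p. absK (w i - z i) < \<delta>)"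

lemma near_open:
  assumes "near p c \<rho> z" "0 < \<rho>" shows "\<exists>\<eta>>0. \<forall>i<p. absK (z i - c i) + \<eta> \<le> \<rho>"
  using assms(1)
proof (induction p)
  case 0
  then show ?case using assms(2) by auto
next
  case (Suc p)
  then obtain \<eta> where \<eta>: "\<eta> > 0" "\<forall>i<p. absK (z i - c i) + \<eta> \<le> \<rho>" by (auto simp: near_def)
  have q: "absK (z p - c p) < \<rho>" using Suc.prems by (simp add: near_def)
  have "absK (z i - c i) + min \<eta> (\<rho> - absK (z p - c p)) \<le> \<rho>" if "i < Suc p" for i
  proof (cases "i = p")
    case False
    then have "absK (z i - c i) + \<eta> \<le> \<rho>" using \<eta>(2) that by simp
    then show ?thesis by (simp add: min_def)
  qed simp
  then show ?case using \<eta>(1) q by (intro exI[of _ "min \<eta> (\<rho> - absK (z p - c p))"]) simp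
qed

lemma near_trans:
  assumes "\<forall>i<p. absK (z i - c i) + \<eta> \<le> \<rho>" "near p z \<eta> w" shows "near p c \<rho> w"
  unfolding near_def
proof (intro allI impI)
  fix i assume i: "i < p"
  have "absK (w i - c i) \<le> absK (w i - z i) + absK (z i - c i)" by (rule absK_triangle_diff)
  then show "absK (w i - c i) < \<rho>" using assms i unfolding near_def by fastforce
qed

lemma near_mono: "near p z \<delta> w \<Longrightarrow> \<delta> \<le> \<delta>' \<Longrightarrow> near p z \<delta>' w"
  unfolding near_def by (meson less_le_trans)

lemma near_self: "0 < \<delta> \<Longrightarrow> near p z \<delta> z"
  by (simp add: near_def)

context o_minimal_expansion
begin

text \<open>\<open>G\<close> is total and definable everywhere and depends only on the first
  \<open>p\<close> entries, so it can be combined and updated without domain conditions. Only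
  continuity and differentiability are tied to the polydisc about \<open>c\<close>.\<close>

definition K_holo :: "nat \<Rightarrow> (nat \<Rightarrow> 'r adjoin_i) \<Rightarrow> 'r \<Rightarrow> ((nat \<Rightarrow> 'r adjoin_i) \<Rightarrow> 'r adjoin_i) \<Rightarrow> bool" where
  "K_holo p c \<rho> G \<longleftrightarrow> dfunVK G \<and> (\<forall>z w. (\<forall>i<p. z i = w i) \<longrightarrow> G z = G w) \<and>
    (\<forall>z \<epsilon>. near p c \<rho> z \<and> 0 < \<epsilon> \<longrightarrow> (\<exists>\<delta>>0. \<forall>w. near p c \<rho> w \<and> near p z \<delta> w \<longrightarrow> absK (G w - G z) < \<epsilon>)) \<and>
    (\<forall>j<p. \<forall>z. near p c \<rho> z \<longrightarrow> (\<exists>d. K_deriv (\<lambda>x. G (z(j := x))) (z j) d))"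

lemma K_holoD:
  assumes "K_holo p c \<rho> G"
  shows "dfunVK G" "\<And>z w. (\<And>i. i < p \<Longrightarrow> z i = w i) \<Longrightarrow> G z = G w"
    "\<And>z \<epsilon>. near p c \<rho> z \<Longrightarrow> 0 < \<epsilon> \<Longrightarrow> \<exists>\<delta>>0. \<forall>w. near p c \<rho> w \<and> near p z \<delta> w \<longrightarrow> absK (G w - G z) < \<epsilon>"
    "\<And>j z. j < p \<Longrightarrow> near p c \<rho> z \<Longrightarrow> \<exists>d. K_deriv (\<lambda>x. G (z(j := x))) (z j) d"
  using assms unfolding K_holo_def by blast+

text \<open>Uniformity in \<open>\<zeta>\<close> is definable compactness. Counterexamples for small
  \<open>t\<close> would cluster at \<open>z\<close> with some offset \<open>\<zeta>0\<close>, and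
  continuity at the point \<open>a\<close> so displaced brings both values of \<open>G\<close>
  within \<open>\<epsilon> / 2\<close> of \<open>G a\<close>.\<close>

lemma uniform_on_discs:
  assumes G: "K_holo p c \<rho> G" and z: "near p c \<rho> z" and j: "j < p" and r: "0 < r" "absK (z j - c j) + r < \<rho>" and \<epsilon>: "0 < \<epsilon>"
  shows "\<exists>\<delta>>0. \<forall>w \<zeta>. near p z \<delta> w \<and> absK \<zeta> \<le> r \<longrightarrow> absK (G (w(j := w j + \<zeta>)) - G (z(j := z j + \<zeta>))) < \<epsilon>"
proof (rule ccontr)
  assume neg: "\<not> ?thesis"
  \<comment> \<open>The offset is stored as coordinate \<open>p\<close>, so that point and offset
    form one sequence and \<open>cluster_point\<close> applies with \<open>Suc p\<close>
    coordinates.\<close>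
  let ?R = "\<lambda>t v. near p z t v \<and> absK (v p) \<le> r \<and> \<epsilon> \<le> absK (G (v(j := v j + v p)) - G (z(j := z j + v p)))"
  have \<rho>: "0 < \<rho>" using r absK_nonneg[of "z j - c j"] by linarith
  have d1: "dfunK (\<lambda>e. ((\<lambda>i. Adjoin_I (e (2 * i + 1)) (e (2 * i + 2)))(j := Adjoin_I (e (2 * j + 1)) (e (2 * j + 2)) + Adjoin_I (e (2 * p + 1)) (e (2 * p + 2)))) i)" for i
    by (cases "i = j") (auto intro!: dfunK_add dfunK_Adjoin_I dfun_var)
  have d2: "dfunK (\<lambda>e. (z(j := z j + Adjoin_I (e (2 * p + 1)) (e (2 * p + 2)))) i)" for i
    by (cases "i = j") (auto intro!: dfunK_add dfunK_const dfunK_Adjoin_I dfun_var)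
  have dR: "dpredRV ?R" unfolding dpredRV_def near_def
    by (intro dpred_conj dpred_finite_all dpred_less dpred_le dfun_absK dfunK_diff dfunK_const dfunK_Adjoin_I dfun_var dfun_const
        dfunVK_comp[OF K_holoD(1)[OF G], OF d1] dfunVK_comp[OF K_holoD(1)[OF G], OF d2])
  define r' where "r' = (\<Sum>i<p. absK (z i)) + 1 + r"
  have "\<exists>v. (\<forall>i\<ge>Suc p. v i = 0) \<and> (\<forall>i<Suc p. absK (v i) \<le> r') \<and> ?R t v" if t: "0 < t" for t
  proof -
    have "0 < min t 1" using t by simp
    then obtain w \<zeta> where w: "near p z (min t 1) w" "absK \<zeta> \<le> r" "\<epsilon> \<le> absK (G (w(j := w j + \<zeta>)) - G (z(j := z j + \<zeta>)))"
      using neg by (meson not_less)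
    define v where "v = (\<lambda>i. if i < p then w i else if i = p then \<zeta> else 0)"
    have "G (v(j := v j + v p)) = G (w(j := w j + \<zeta>))" by (rule K_holoD(2)[OF G]) (use j in \<open>auto simp: v_def\<close>)
    moreover have "v p = \<zeta>" by (simp add: v_def)
    moreover have "near p z t v" using w(1) by (simp add: near_def v_def)
    ultimately have "?R t v" using w by simp
    moreover have "absK (v i) \<le> r'" if "i < Suc p" for i
    proof (cases "i = p")
      case True
      have "0 \<le> (\<Sum>i<p. absK (z i))" by (simp add: sum_nonneg absK_nonneg)
      then show ?thesis using True w(2) by (simp add: v_def r'_def)
    next
      case False
      then have i: "i < p" using that by simp
      have "absK (z i) \<le> (\<Sum>i<p. absK (z i))" using i by (intro member_le_sum) (auto simp: absK_nonneg)
      moreover have "absK (w i - z i) < 1" using w(1) i by (simp add: near_def)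
      moreover have "absK (w i) \<le> absK (w i - z i) + absK (z i)" using absK_triangle[of "w i - z i" "z i"] by simp
      ultimately show ?thesis using i r(1) by (simp add: v_def r'_def)
    qed
    moreover have "v i = 0" if "Suc p \<le> i" for i using that by (simp add: v_def)
    ultimately show ?thesis by blast
  qed
  with dR have "\<exists>v0. (\<forall>i\<ge>Suc p. v0 i = 0) \<and> (\<forall>\<delta>>0. \<exists>t v. 0 < t \<and> t < \<delta> \<and> (\<forall>i\<ge>Suc p. v i = 0) \<and> ?R t v \<and>
    (\<forall>i<Suc p. absK (v i - v0 i) < \<delta>))" by (rule cluster_point)
  then obtain v0 where v0: "\<forall>\<delta>>0. \<exists>t v. 0 < t \<and> t < \<delta> \<and> (\<forall>i\<ge>Suc p. v i = 0) \<and> ?R t v \<and>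
    (\<forall>i<Suc p. absK (v i - v0 i) < \<delta>)" by (elim exE conjE)
  define \<zeta>0 where "\<zeta>0 = v0 p"
  have \<zeta>0: "absK \<zeta>0 \<le> r"
  proof (rule ccontr)
    assume "\<not> absK \<zeta>0 \<le> r"
    then have "0 < absK \<zeta>0 - r" by simp
    from v0[rule_format, OF this] obtain v where "absK (v p) \<le> r" "\<forall>i<Suc p. absK (v i - v0 i) < absK \<zeta>0 - r" by (elim exE conjE)
    then have "absK (v p) \<le> r" "absK (v p - \<zeta>0) < absK \<zeta>0 - r" by (simp_all add: \<zeta>0_def)
    then show False using absK_diff_ge[of \<zeta>0 "v p"] by (simp add: absK_minus_commute)
  qed
  define a where "a = z(j := z j + \<zeta>0)"
  have a: "near p c \<rho> a" unfolding near_def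
  proof (intro allI impI)
    fix i assume "i < p"
    show "absK (a i - c i) < \<rho>"
    proof (cases "i = j")
      case True
      have "absK (z j + \<zeta>0 - c j) \<le> absK (z j - c j) + absK \<zeta>0" using absK_triangle[of "z j - c j" \<zeta>0] by (simp add: algebra_simps)
      then show ?thesis using True \<zeta>0 r(2) by (simp add: a_def)
    qed (use z \<open>i < p\<close> in \<open>simp add: a_def near_def\<close>)
  qed
  obtain \<eta> where \<eta>: "\<eta> > 0" "\<forall>i<p. absK (a i - c i) + \<eta> \<le> \<rho>" using near_open[OF a \<rho>] by blast
  have "\<epsilon> / 2 > 0" using \<epsilon> by simp
  from K_holoD(3)[OF G a this] obtain \<delta>1 where \<delta>1: "\<delta>1 > 0" "\<forall>w. near p c \<rho> w \<and> near p a \<delta>1 w \<longrightarrow> absK (G w - G a) < \<epsilon> / 2" by (elim exE conjE)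
  \<comment> \<open>Half of the available radius, because coordinate \<open>j\<close> is displaced
    twice: with the point and with the offset.\<close>
  define \<delta> where "\<delta> = min \<eta> \<delta>1 / 2"
  have \<delta>: "0 < \<delta>" "\<delta> + \<delta> \<le> \<eta>" "\<delta> + \<delta> \<le> \<delta>1" "\<delta> \<le> \<eta>" "\<delta> \<le> \<delta>1" using \<eta>(1) \<delta>1(1) by (auto simp: \<delta>_def min_def)
  from v0[rule_format, OF \<delta>(1)] obtain t v where tv: "0 < t" "t < \<delta>" "near p z t v"
    "\<epsilon> \<le> absK (G (v(j := v j + v p)) - G (z(j := z j + v p)))" "\<forall>i<Suc p. absK (v i - v0 i) < \<delta>" by (elim exE conjE)
  have vp: "absK (v p - \<zeta>0) < \<delta>" using tv(5) by (simp add: \<zeta>0_def)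
  have n: "absK ((v(j := v j + v p)) i - a i) < \<delta> + \<delta>" "absK ((z(j := z j + v p)) i - a i) < \<delta> + \<delta>" if i: "i < p" for i
  proof -
    have vi: "absK (v i - z i) < \<delta>" using tv(2,3) i by (auto simp: near_def intro: less_trans)
    have "absK (v j + v p - (z j + \<zeta>0)) \<le> absK (v j - z j) + absK (v p - \<zeta>0)"
      using absK_triangle[of "v j - z j" "v p - \<zeta>0"] by (simp add: algebra_simps)
    then show "absK ((v(j := v j + v p)) i - a i) < \<delta> + \<delta>"
      using vi vp \<delta>(1) by (cases "i = j") (auto simp: a_def)
    show "absK ((z(j := z j + v p)) i - a i) < \<delta> + \<delta>" using vp \<delta>(1) by (cases "i = j") (auto simp: a_def)
  qed
  have close: "absK (G w - G a) < \<epsilon> / 2" if "\<And>i. i < p \<Longrightarrow> absK (w i - a i) < \<delta> + \<delta>" for w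
  proof -
    have "near p a (\<delta> + \<delta>) w" using that by (simp add: near_def)
    then have "near p a \<eta> w" "near p a \<delta>1 w" using \<delta>(2,3) near_mono by blast+
    then show ?thesis using \<delta>1(2) near_trans[OF \<eta>(2)] by blast
  qed
  have "absK (G (v(j := v j + v p)) - G (z(j := z j + v p))) \<le> absK (G (v(j := v j + v p)) - G a) + absK (G a - G (z(j := z j + v p)))"
    by (rule absK_triangle_diff)
  moreover have "absK (G (v(j := v j + v p)) - G a) < \<epsilon> / 2" by (rule close) (rule n(1))
  moreover have "absK (G (z(j := z j + v p)) - G a) < \<epsilon> / 2" by (rule close) (rule n(2))
  ultimately show False
    using tv(4) absK_minus_commute[of "G a" "G (z(j := z j + v p))"] field_sum_of_halves[of \<epsilon>] by linarith
qed

text \<open>The maximum principle does the work of Cauchy's estimate. \<open>\<phi>\<close> is the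
  difference of the difference quotients at \<open>w\<close> and at \<open>z\<close>, as a function
  of the increment. On the circle of radius \<open>r\<close> it is small because the numerators are
  uniformly close; at the centre, where the quotients are filled in by derivatives, it is
  \<open>d' - d\<close>.\<close>

lemma partial_derivative_continuous:
  assumes G: "K_holo p c \<rho> G" and z: "near p c \<rho> z" and j: "j < p" and \<epsilon>: "0 < \<epsilon>"
    and dz: "K_deriv (\<lambda>x. G (z(j := x))) (z j) d"
  shows "\<exists>\<delta>>0. \<forall>w d'. near p z \<delta> w \<and> near p c \<rho> w \<and> K_deriv (\<lambda>x. G (w(j := x))) (w j) d' \<longrightarrow> absK (d' - d) \<le> \<epsilon>"
proof -
  \<comment> \<open>A third of the room left in coordinate \<open>j\<close>: one part for the
    distance from \<open>z\<close> to \<open>w\<close>, one for the increment, one to spare.\<close>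
  define r where "r = (\<rho> - absK (z j - c j)) / 3"
  have "absK (z j - c j) < \<rho>" using z j by (simp add: near_def)
  then have "0 < r" by (simp add: r_def)
  moreover have "r * 3 = \<rho> - absK (z j - c j)" by (simp add: r_def)
  then have "absK (z j - c j) + (r + r + r) = \<rho>" by linarith
  ultimately have r: "0 < r" "absK (z j - c j) + (r + r + r) = \<rho>" by blast+
  have r2: "absK (z j - c j) + r < \<rho>" using r by linarith
  \<comment> \<open>Two numerator differences of this size, divided by an increment of absolute
    value \<open>r\<close>, give \<open>\<epsilon>\<close>.\<close>
  have "\<epsilon> * r / 2 > 0" using \<epsilon> r(1) by simp
  from uniform_on_discs[OF G z j r(1) r2 this] obtain \<delta>0 where \<delta>0: "\<delta>0 > 0"
    "\<forall>w \<zeta>. near p z \<delta>0 w \<and> absK \<zeta> \<le> r \<longrightarrow> absK (G (w(j := w j + \<zeta>)) - G (z(j := z j + \<zeta>))) < \<epsilon> * r / 2" by (elim exE conjE)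
  have "absK (d' - d) \<le> \<epsilon>" if w: "near p z (min \<delta>0 r) w" "near p c \<rho> w" and dw: "K_deriv (\<lambda>x. G (w(j := x))) (w j) d'" for w d'
  proof -
    define q where "q = (\<lambda>v b \<zeta>. if \<zeta> = 0 then b else (G (v(j := v j + \<zeta>)) - G v) / \<zeta>)"
    define \<phi> where "\<phi> = (\<lambda>\<zeta>. q w d' \<zeta> - q z d \<zeta>)"
    have dq: "dfunK (\<lambda>e. q v b (Adjoin_I (e 0) (e 1)))" for v b
    proof -
      have "dfunK (\<lambda>e. (v(j := v j + Adjoin_I (e 0) (e 1))) i)" for i
        by (cases "i = j") (auto intro!: dfunK_add dfunK_const dfunK_Adjoin_I dfun_var)
      note * = dfunVK_comp[OF K_holoD(1)[OF G], OF this]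
      show ?thesis unfolding q_def
        by (intro dfunK_if dpred_eqK dfunK_divide dfunK_diff dfunK_const dfunK_Adjoin_I dfun_var *)
    qed
    have d\<phi>: "dfunKK \<phi>" unfolding dfunKK_def \<phi>_def by (intro dfunK_diff dq)
    have wz: "absK (w j - z j) < r" using w(1) j by (simp add: near_def)
    have inP: "near p c \<rho> (v(j := v j + \<zeta>))" if "near p c \<rho> v" "absK (v j - z j) < r" "absK \<zeta> \<le> r" for v \<zeta>
      unfolding near_def
    proof (intro allI impI)
      fix i assume "i < p"
      show "absK ((v(j := v j + \<zeta>)) i - c i) < \<rho>"
      proof (cases "i = j")
        case True
        have "absK (v j + \<zeta> - c j) \<le> absK (v j - z j) + absK (z j - c j) + absK \<zeta>"
          using absK_triangle[of "v j - z j + (z j - c j)" \<zeta>] absK_triangle[of "v j - z j" "z j - c j"] by (simp add: algebra_simps)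
        then show ?thesis using True that r by simp
      qed (use that \<open>i < p\<close> in \<open>simp add: near_def\<close>)
    qed
    have dq0: "\<exists>e. K_deriv (q v b) \<zeta> e" if v: "near p c \<rho> v" "absK (v j - z j) < r" and \<zeta>: "\<zeta> \<noteq> 0" "absK \<zeta> \<le> r" for v b \<zeta>
    proof -
      from K_holoD(4)[OF G j inP[OF v \<zeta>(2)]] obtain e where e: "K_deriv (\<lambda>x. G (v(j := x))) (v j + \<zeta>) e" by auto
      have "K_deriv (\<lambda>x. (G (v(j := v j + x)) - G v) / x) \<zeta> ((e - (G (v(j := v j + \<zeta>)) - G v) / \<zeta>) / \<zeta>)"
        by (rule K_deriv_divide_id[OF K_deriv_shift[OF e] \<zeta>(1)])
      then have "K_deriv (q v b) \<zeta> ((e - (G (v(j := v j + \<zeta>)) - G v) / \<zeta>) / \<zeta>)"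
      proof (rule K_deriv_local[OF _ absK_pos[OF \<zeta>(1)]])
        fix x assume "absK (x - \<zeta>) < absK \<zeta>"
        then have "x \<noteq> 0" by auto
        then show "q v b x = (G (v(j := v j + x)) - G v) / x" by (simp add: q_def)
      qed
      then show ?thesis by blast
    qed
    have der: "\<exists>e. K_deriv \<phi> \<zeta> e" if \<zeta>: "\<zeta> \<noteq> 0" "absK \<zeta> \<le> r" for \<zeta>
    proof -
      obtain e1 where "K_deriv (q w d') \<zeta> e1" using dq0[OF w(2) wz \<zeta>] by blast
      moreover obtain e2 where "K_deriv (q z d) \<zeta> e2" using dq0[OF z _ \<zeta>] r(1) by auto
      ultimately show ?thesis unfolding \<phi>_def using K_deriv_diff by blast
    qed
    have q0: "\<exists>\<delta>>0. \<forall>x. absK x < \<delta> \<longrightarrow> absK (q v b x - b) < \<eta>" if b: "K_deriv (\<lambda>x. G (v(j := x))) (v j) b" and \<eta>: "0 < \<eta>" for v b \<eta>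
    proof -
      obtain \<delta> where \<delta>: "\<delta> > 0" "\<forall>h. h \<noteq> 0 \<and> absK h < \<delta> \<longrightarrow> absK ((G (v(j := v j + h)) - G (v(j := v j))) / h - b) < \<eta>"
        using b \<eta> unfolding K_deriv_def by blast
      have "absK (q v b x - b) < \<eta>" if "absK x < \<delta>" for x
        using \<delta>(2)[rule_format, of x] that \<eta> by (simp add: q_def)
      then show ?thesis using \<delta>(1) by blast
    qed
    have cont: "cont_disc r \<phi>" unfolding cont_disc_def
    proof (intro allI impI)
      fix \<zeta> and \<eta> :: 'r assume \<zeta>: "absK \<zeta> \<le> r" and \<eta>: "0 < \<eta>"
      show "\<exists>\<delta>>0. \<forall>x. absK x \<le> r \<and> absK (x - \<zeta>) < \<delta> \<longrightarrow> absK (\<phi> x - \<phi> \<zeta>) < \<eta>"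
      proof (cases "\<zeta> = 0")
        case False
        obtain e where "K_deriv \<phi> \<zeta> e" using der[OF False \<zeta>] by blast
        from K_deriv_isCont[OF this \<eta>] show ?thesis by blast
      next
        case True
        have \<eta>2: "0 < \<eta> / 2" using \<eta> by simp
        obtain \<delta>1 where 1: "\<delta>1 > 0" "\<forall>x. absK x < \<delta>1 \<longrightarrow> absK (q w d' x - d') < \<eta> / 2" using q0[OF dw \<eta>2] by (elim exE conjE)
        obtain \<delta>2 where 2: "\<delta>2 > 0" "\<forall>x. absK x < \<delta>2 \<longrightarrow> absK (q z d x - d) < \<eta> / 2" using q0[OF dz \<eta>2] by (elim exE conjE)
        have "absK (\<phi> x - \<phi> \<zeta>) < \<eta>" if x: "absK x \<le> r \<and> absK (x - \<zeta>) < min \<delta>1 \<delta>2" for x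
        proof -
          have "\<phi> x - \<phi> \<zeta> = (q w d' x - d') + - (q z d x - d)" by (simp add: \<phi>_def True q_def)
          then have "absK (\<phi> x - \<phi> \<zeta>) \<le> absK (q w d' x - d') + absK (q z d x - d)"
            using absK_triangle[of "q w d' x - d'" "- (q z d x - d)"] by (simp only: absK_minus)
          moreover have "absK (q w d' x - d') < \<eta> / 2" "absK (q z d x - d) < \<eta> / 2" using 1(2) 2(2) x True by simp_all
          ultimately show ?thesis using field_sum_of_halves[of \<eta>] by linarith
        qed
        moreover have "min \<delta>1 \<delta>2 > 0" using 1 2 by simp
        ultimately show ?thesis by (intro exI[of _ "min \<delta>1 \<delta>2"]) blast
      qed
    qed
    have bd: "absK (\<phi> \<zeta>) \<le> \<epsilon>" if \<zeta>: "absK \<zeta> = r" for \<zeta>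
    proof -
      have z0: "\<zeta> \<noteq> 0" using \<zeta> r(1) by auto
      have nw: "near p z \<delta>0 w" using w(1) by (simp add: near_def)
      define A where "A = G (w(j := w j + \<zeta>)) - G (z(j := z j + \<zeta>))"
      define B where "B = G w - G z"
      have "absK A < \<epsilon> * r / 2" unfolding A_def by (rule \<delta>0(2)[rule_format]) (use nw \<zeta> in auto)
      moreover have "absK (G (w(j := w j + 0)) - G (z(j := z j + 0))) < \<epsilon> * r / 2" by (rule \<delta>0(2)[rule_format]) (use nw r in auto)
      then have "absK B < \<epsilon> * r / 2" by (simp add: B_def)
      moreover have "absK (A + - B) \<le> absK A + absK B" using absK_triangle[of A "- B"] by (simp only: absK_minus)
      ultimately have "absK (A + - B) \<le> \<epsilon> * r" using field_sum_of_halves[of "\<epsilon> * r"] by linarith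
      moreover have "\<phi> \<zeta> = (A + - B) / \<zeta>"
        using z0 by (simp add: \<phi>_def q_def A_def B_def diff_divide_distrib add_divide_distrib)
      ultimately show ?thesis using r(1) \<zeta> by (simp only: absK_divide pos_divide_le_eq)
    qed
    have "absK (\<phi> 0) \<le> \<epsilon>"
      by (rule maximum_principle[OF d\<phi> cont _ bd r(1)]) (use der r(1) in auto)
    then show ?thesis by (simp add: \<phi>_def q_def)
  qed
  moreover have "min \<delta>0 r > 0" using \<delta>0(1) r(1) by simp
  ultimately show ?thesis by (intro exI[of _ "min \<delta>0 r"]) blast
qed

text \<open>The mean value inequality along the segment from \<open>v j\<close> to \<open>x\<close>,
  for \<open>G\<close> with the linear part \<open>d\<close> removed. Of the factor 2 in the rate
  \<open>C\<close>, one \<open>\<epsilon>\<close> is the distance of the derivative on the segment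
  from \<open>d\<close>, the other the linearisation error.\<close>

lemma segment_mean_value:
  assumes G: "K_holo p c \<rho> G" and v: "near p z \<delta> v" and x: "absK (x - z j) < \<delta>" and j: "j < p" and \<epsilon>: "0 < \<epsilon>"
    and sub: "\<And>w. near p z \<delta> w \<Longrightarrow> near p c \<rho> w"
    and der: "\<And>w d'. near p z \<delta> w \<Longrightarrow> K_deriv (\<lambda>x. G (w(j := x))) (w j) d' \<Longrightarrow> absK (d' - d) \<le> \<epsilon>"
  shows "absK (G (v(j := x)) - G v - d * (x - v j)) \<le> 2 * \<epsilon> * absK (x - v j)"
proof -
  define L where "L = x - v j"
  define y where "y = (\<lambda>t. v j + of_R t * L)"
  define h where "h = (\<lambda>t. G (v(j := y t)) - d * (of_R t * L))"
  define C where "C = 2 * \<epsilon> * absK L"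
  have C: "0 \<le> C" using \<epsilon> by (simp add: C_def absK_nonneg)
  define D where "D = h 1 - h 0"
  have y01: "y 0 = v j" "y 1 = x" by (simp_all add: y_def L_def)
  have D: "D = G (v(j := x)) - G v - d * (x - v j)" unfolding D_def h_def y01 by (simp add: L_def)
  have near_y: "near p z \<delta> (v(j := y t))" if t: "0 \<le> t" "t \<le> 1" for t
  proof -
    have vz: "absK (v j - z j) < \<delta>" using v j by (simp add: near_def)
    have "y t - z j = of_R (1 - t) * (v j - z j) + of_R t * (x - z j)" by (simp add: y_def L_def algebra_simps)
    then have "absK (y t - z j) \<le> (1 - t) * absK (v j - z j) + t * absK (x - z j)"
      using absK_triangle[of "of_R (1 - t) * (v j - z j)" "of_R t * (x - z j)"] t by (simp add: absK_mult del: of_R_simps)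
    also have "\<dots> < \<delta>"
    proof (cases "t = 0")
      case False
      have "(1 - t) * absK (v j - z j) \<le> (1 - t) * \<delta>" using vz t by (intro mult_left_mono) auto
      moreover have "t * absK (x - z j) < t * \<delta>" using x t False by (intro mult_strict_left_mono) auto
      moreover have "(1 - t) * \<delta> + t * \<delta> = \<delta>" by (simp add: algebra_simps)
      ultimately show ?thesis by linarith
    qed (use vz in simp)
    finally show ?thesis using v by (auto simp: near_def)
  qed
  have loc: "\<exists>\<eta>>0. \<forall>s. \<bar>s - t\<bar> < \<eta> \<longrightarrow> absK (h s - h t) \<le> C * \<bar>s - t\<bar>" if t: "0 \<le> t" "t \<le> 1" for t
  proof -
    from K_holoD(4)[OF G j sub[OF near_y[OF t]]] obtain d' where d': "K_deriv (\<lambda>x. G ((v(j := y t))(j := x))) ((v(j := y t)) j) d'" by (elim exE)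
    have dd: "absK (d' - d) \<le> \<epsilon>" by (rule der[OF near_y[OF t] d'])
    have d'': "K_deriv (\<lambda>x. G (v(j := x))) (y t) d'" using d' by simp
    from K_deriv_approx[OF this \<epsilon>] obtain \<eta> where \<eta>: "\<eta> > 0"
      "\<forall>k. absK k < \<eta> \<longrightarrow> absK (G (v(j := y t + k)) - G (v(j := y t)) - d' * k) \<le> \<epsilon> * absK k" by (elim exE conjE)
    have L1: "absK L + 1 > 0" by (simp add: absK_nonneg add_nonneg_pos)
    have "absK (h s - h t) \<le> C * \<bar>s - t\<bar>" if s: "\<bar>s - t\<bar> < \<eta> / (absK L + 1)" for s
    proof -
      define k where "k = of_R (s - t) * L"
      have k: "absK k = \<bar>s - t\<bar> * absK L" by (simp add: k_def absK_mult del: of_R_simps)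
      have "\<bar>s - t\<bar> * (absK L + 1) < \<eta>" using s L1 by (simp only: pos_less_divide_eq)
      then have "absK k < \<eta>" unfolding k by (simp add: distrib_left)
      then have A: "absK (G (v(j := y t + k)) - G (v(j := y t)) - d' * k) \<le> \<epsilon> * absK k" using \<eta>(2) by blast
      have ys: "y s = y t + k" by (simp add: y_def k_def algebra_simps)
      have "h s - h t = (G (v(j := y t + k)) - G (v(j := y t)) - d' * k) + (d' - d) * k"
      proof -
        have "of_R s * L = of_R t * L + k" by (simp add: k_def algebra_simps)
        then have hs: "h s = G (v(j := y t + k)) - d * (of_R t * L + k)" by (simp only: h_def ys)
        have ht: "h t = G (v(j := y t)) - d * (of_R t * L)" by (simp only: h_def)
        show ?thesis unfolding hs ht by (simp add: algebra_simps)
      qed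
      then have "absK (h s - h t) \<le> absK (G (v(j := y t + k)) - G (v(j := y t)) - d' * k) + absK ((d' - d) * k)"
        using absK_triangle by (simp only:)
      moreover have "absK ((d' - d) * k) \<le> \<epsilon> * absK k" unfolding absK_mult using dd by (intro mult_right_mono absK_nonneg)
      moreover have "C * \<bar>s - t\<bar> = \<epsilon> * absK k + \<epsilon> * absK k" unfolding C_def k by (simp add: algebra_simps)
      ultimately show ?thesis using A by linarith
    qed
    moreover have "\<eta> / (absK L + 1) > 0" using \<eta>(1) L1 by simp
    ultimately show ?thesis by (intro exI[of _ "\<eta> / (absK L + 1)"]) blast
  qed
  show ?thesis
  proof (cases "D = 0")
    case True
    then show ?thesis using C unfolding D C_def L_def by simp
  next
    case False
    \<comment> \<open>A unit that turns the total change \<open>D\<close> into its absolute value,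
      so that \<open>growth_bound\<close> can be applied to the real function
      \<open>u\<close>.\<close>
    define b where "b = of_R (absK D) / D"
    have p: "absK D > 0" by (rule absK_pos[OF False])
    have bD: "b * D = of_R (absK D)" unfolding b_def by (rule divide_mult_cancel[OF False])
    have b1: "absK b = 1" unfolding b_def absK_divide absK_of_R abs_of_pos[OF p] using False by (intro divide_self) simp
    define u where "u = (\<lambda>t. re (b * h t))"
    have "dfunK (\<lambda>e. (v(j := v j + of_R (e 0) * L)) i)" for i
      by (cases "i = j") (auto intro!: dfunK_add dfunK_mult dfunK_of_R dfunK_const dfun_var)
    note dG = dfunVK_comp[OF K_holoD(1)[OF G], OF this]
    have du: "dfun1 u" unfolding dfun1_def u_def h_def y_def
      by (intro dfun_re dfunK_mult dfunK_diff dfunK_of_R dfunK_const dfun_var dG)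
    have lu: "\<bar>u s - u t\<bar> \<le> absK (h s - h t)" for s t
    proof -
      have "u s - u t = re (b * (h s - h t))" by (simp add: u_def algebra_simps)
      then show ?thesis using abs_re_le[of "b * (h s - h t)"] b1 by (simp only: absK_mult mult_1_left)
    qed
    have "u 1 \<le> u 0 + C * (1 - 0)"
    proof (rule growth_bound[OF du])
      fix t \<epsilon>' :: 'r assume t: "0 < t" "t \<le> 1" and e': "0 < \<epsilon>'"
      have t0: "0 \<le> t" using t(1) by simp
      from loc[OF t0 t(2)] obtain \<eta> where \<eta>: "\<eta> > 0" "\<forall>s. \<bar>s - t\<bar> < \<eta> \<longrightarrow> absK (h s - h t) \<le> C * \<bar>s - t\<bar>" by (elim exE conjE)
      from ex_small[OF e', of C] obtain \<tau> where \<tau>: "\<tau> > 0" "\<forall>s. 0 < s \<and> s \<le> \<tau> \<longrightarrow> s * C < \<epsilon>'" by (elim exE conjE)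
      have "u t < u s + \<epsilon>'" if s: "t - min \<eta> \<tau> < s \<and> s < t \<and> 0 \<le> s" for s
      proof -
        have st: "\<bar>s - t\<bar> = t - s" using s by simp
        have "\<bar>s - t\<bar> < \<eta>" "0 < t - s \<and> t - s \<le> \<tau>" using s st by (auto simp: min_def split: if_splits)
        then have "absK (h s - h t) \<le> C * \<bar>s - t\<bar>" "(t - s) * C < \<epsilon>'" using \<eta>(2) \<tau>(2) by blast+
        then have "\<bar>u s - u t\<bar> < \<epsilon>'" using lu[of s t] st by (simp add: mult.commute)
        then show ?thesis unfolding abs_less_iff by linarith
      qed
      moreover have "min \<eta> \<tau> > 0" using \<eta>(1) \<tau>(1) by simp
      ultimately show "\<exists>\<delta>>0. \<forall>s. t - \<delta> < s \<and> s < t \<and> 0 \<le> s \<longrightarrow> u t < u s + \<epsilon>'" by (intro exI[of _ "min \<eta> \<tau>"]) blast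
    next
      fix t :: 'r assume t: "0 \<le> t" "t < 1"
      have t1: "t \<le> 1" using t(2) by simp
      from loc[OF t(1) t1] obtain \<eta> where \<eta>: "\<eta> > 0" "\<forall>s. \<bar>s - t\<bar> < \<eta> \<longrightarrow> absK (h s - h t) \<le> C * \<bar>s - t\<bar>" by (elim exE conjE)
      have "u s \<le> u t + C * (s - t)" if s: "t < s \<and> s < t + \<eta>" for s
      proof -
        have st: "\<bar>s - t\<bar> = s - t" using s by simp
        then have "absK (h s - h t) \<le> C * (s - t)" using \<eta>(2)[rule_format, of s] s by simp
        then show ?thesis using lu[of s t] unfolding abs_le_iff by linarith
      qed
      then show "\<exists>\<delta>>0. \<forall>s. t < s \<and> s < t + \<delta> \<longrightarrow> u s \<le> u t + C * (s - t)" using \<eta>(1) by (intro exI[of _ \<eta>]) blast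
    qed simp
    moreover have "u 1 - u 0 = re (b * D)" unfolding u_def D_def by (simp add: algebra_simps)
    then have "u 1 - u 0 = absK D" unfolding bD by simp
    ultimately have "absK D \<le> C" by simp
    then show ?thesis unfolding D C_def L_def .
  qed
qed

lemma finite_uniform:
  fixes Q :: "nat \<Rightarrow> 'r \<Rightarrow> bool"
  assumes "\<And>j. j < p \<Longrightarrow> \<exists>\<delta>>0. Q j \<delta>" "\<And>j \<delta> \<delta>'. Q j \<delta> \<Longrightarrow> \<delta>' \<le> \<delta> \<Longrightarrow> Q j \<delta>'"
  shows "\<exists>\<delta>>0. \<forall>j<p. Q j \<delta>"
  using assms(1)
proof (induction p)
  case 0
  show ?case by (intro exI[of _ 1]) simp
next
  case (Suc p)
  have "\<exists>\<delta>>0. \<forall>j<p. Q j \<delta>" by (rule Suc.IH) (rule Suc.prems, simp)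
  then obtain \<delta>1 where 1: "\<delta>1 > 0" "\<forall>j<p. Q j \<delta>1" by (elim exE conjE)
  obtain \<delta>2 where 2: "\<delta>2 > 0" "Q p \<delta>2" using Suc.prems[of p] by auto
  have "Q j (min \<delta>1 \<delta>2)" if "j < Suc p" for j
    using assms(2)[of j \<delta>1] assms(2)[OF 2(2)] 1(2) that by (cases "j = p") auto
  then show ?case using 1(1) 2(1) by (intro exI[of _ "min \<delta>1 \<delta>2"]) simp
qed

text \<open>The coordinates of \<open>w\<close> are replaced by those of \<open>u\<close> one at a
  time, with \<open>m k\<close> as intermediate points. Each step is a segment in one coordinate,
  where the partial derivative is within \<open>\<epsilon> / 2\<close> of its value at
  \<open>z\<close>; \<open>segment_mean_value\<close> doubles this.\<close>

theorem strict_differentiability: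
  assumes G: "K_holo p c \<rho> G" and \<rho>: "0 < \<rho>" and z: "near p c \<rho> z"
    and d: "\<And>j. j < p \<Longrightarrow> K_deriv (\<lambda>x. G (z(j := x))) (z j) (d j)" and \<epsilon>: "0 < \<epsilon>"
  shows "\<exists>\<delta>>0. \<forall>u w. near p z \<delta> u \<and> near p z \<delta> w \<longrightarrow>
    absK (G u - G w - (\<Sum>j<p. d j * (u j - w j))) \<le> \<epsilon> * (\<Sum>j<p. absK (u j - w j))"
proof -
  have e2: "\<epsilon> / 2 > 0" using \<epsilon> by simp
  let ?Q = "\<lambda>j \<delta>. \<forall>w d'. near p z \<delta> w \<and> near p c \<rho> w \<and> K_deriv (\<lambda>x. G (w(j := x))) (w j) d' \<longrightarrow> absK (d' - d j) \<le> \<epsilon> / 2"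
  have "\<exists>\<delta>>0. \<forall>j<p. ?Q j \<delta>"
  proof (rule finite_uniform)
    show "\<exists>\<delta>>0. ?Q j \<delta>" if j: "j < p" for j by (rule partial_derivative_continuous[OF G z j e2 d[OF j]])
    show "?Q j \<delta>'" if "?Q j \<delta>" "\<delta>' \<le> \<delta>" for j \<delta> \<delta>' using that near_mono by blast
  qed
  then obtain \<delta>1 where \<delta>1: "\<delta>1 > 0" "\<forall>j<p. ?Q j \<delta>1" by (elim exE conjE)
  obtain \<eta> where \<eta>: "\<eta> > 0" "\<forall>i<p. absK (z i - c i) + \<eta> \<le> \<rho>" using near_open[OF z \<rho>] by (elim exE conjE)
  define \<delta> where "\<delta> = min \<delta>1 \<eta>"
  have \<delta>: "\<delta> > 0" using \<delta>1(1) \<eta>(1) by (simp add: \<delta>_def)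
  have sub: "near p c \<rho> w" if "near p z \<delta> w" for w
    using near_trans[OF \<eta>(2)] near_mono[OF that, of \<eta>] by (simp add: \<delta>_def)
  have der: "absK (d' - d j) \<le> \<epsilon> / 2" if "j < p" "near p z \<delta> w" "K_deriv (\<lambda>x. G (w(j := x))) (w j) d'" for j w d'
  proof -
    have "near p z \<delta>1 w" using near_mono[OF that(2), of \<delta>1] by (simp add: \<delta>_def)
    then show ?thesis using \<delta>1(2) that sub[OF that(2)] by blast
  qed
  have "absK (G u - G w - (\<Sum>j<p. d j * (u j - w j))) \<le> \<epsilon> * (\<Sum>j<p. absK (u j - w j))"
    if uw: "near p z \<delta> u" "near p z \<delta> w" for u w
  proof -
    define m where "m = (\<lambda>k i. if i < k then u i else w i)"
    have "absK (G (m k) - G w - (\<Sum>j<k. d j * (u j - w j))) \<le> \<epsilon> * (\<Sum>j<k. absK (u j - w j))" if "k \<le> p" for k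
      using that
    proof (induction k)
      case 0
      have "m 0 = w" by (simp add: m_def)
      then show ?case by simp
    next
      case (Suc k)
      then have k: "k < p" by simp
      have nk: "near p z \<delta> (m k)" using uw by (simp add: near_def m_def)
      have uk: "absK (u k - z k) < \<delta>" using uw(1) k by (simp add: near_def)
      have mk: "m (Suc k) = (m k)(k := u k)" "m k k = w k" by (auto simp: m_def fun_eq_iff)
      have S: "absK (G (m (Suc k)) - G (m k) - d k * (u k - w k)) \<le> \<epsilon> * absK (u k - w k)"
        using segment_mean_value[OF G nk uk k e2 sub der[OF k]] by (simp add: mk)
      have IH: "absK (G (m k) - G w - (\<Sum>j<k. d j * (u j - w j))) \<le> \<epsilon> * (\<Sum>j<k. absK (u j - w j))" using Suc by simp
      have "G (m (Suc k)) - G w - (\<Sum>j<Suc k. d j * (u j - w j)) =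
        (G (m k) - G w - (\<Sum>j<k. d j * (u j - w j))) + (G (m (Suc k)) - G (m k) - d k * (u k - w k))" by simp
      then have "absK (G (m (Suc k)) - G w - (\<Sum>j<Suc k. d j * (u j - w j))) \<le>
        absK (G (m k) - G w - (\<Sum>j<k. d j * (u j - w j))) + absK (G (m (Suc k)) - G (m k) - d k * (u k - w k))"
        using absK_triangle by (simp only:)
      then show ?case using IH S by (simp add: distrib_left)
    qed
    from this[of p] have "absK (G (m p) - G w - (\<Sum>j<p. d j * (u j - w j))) \<le> \<epsilon> * (\<Sum>j<p. absK (u j - w j))" by simp
    moreover have "G (m p) = G u" by (rule K_holoD(2)[OF G]) (simp add: m_def)
    ultimately show ?thesis by simp
  qed
  then show ?thesis using \<delta> by (intro exI[of _ \<delta>]) blast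
qed

end

section \<open>The implicit function theorem over \<open>K\<close>\<close>

lemma sum_lessThan_add: "(\<Sum>j<m + n. f j) = (\<Sum>j<m. f j) + (\<Sum>k<(n::nat). f (m + k :: nat))"
  for f :: "nat \<Rightarrow> 'a::comm_monoid_add"
  by (induction n) (simp_all add: add.assoc)

text \<open>Injectivity makes the determinant nonzero, and the adjugate matrix then writes down a
  solution.\<close>

lemma solvable_of_injective:
  fixes A :: "nat \<Rightarrow> nat \<Rightarrow> 'a::field"
  assumes inj: "\<And>v. (\<And>i. i < n \<Longrightarrow> (\<Sum>k<n. A i k * v k) = 0) \<Longrightarrow> \<forall>k<n. v k = 0"
  shows "\<exists>d. \<forall>i<n. (\<Sum>k<n. A i k * d k) = b i"
proof -
  define T where "T = mat n n (\<lambda>(i, k). A i k)"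
  have T: "T \<in> carrier_mat n n" by (simp add: T_def)
  have mv: "(T *\<^sub>v v) $ i = (\<Sum>k<n. A i k * v $ k)" if "i < n" "v \<in> carrier_vec n" for v i
    using that by (simp add: T_def scalar_prod_def lessThan_atLeast0)
  have "det T \<noteq> 0"
  proof
    assume "det T = 0"
    then obtain v where v: "v \<in> carrier_vec n" "v \<noteq> 0\<^sub>v n" "T *\<^sub>v v = 0\<^sub>v n"
      using det_0_iff_vec_prod_zero[OF T] by blast
    have "(\<Sum>k<n. A i k * v $ k) = 0" if "i < n" for i using mv[OF that v(1)] v(3) that by simp
    then have "\<forall>k<n. v $ k = 0" by (rule inj)
    then have "v = 0\<^sub>v n" using v(1) by (intro eq_vecI) auto
    then show False using v(2) by simp
  qed
  define w where "w = adj_mat T *\<^sub>v vec n b"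
  have adj: "adj_mat T \<in> carrier_mat n n" "T * adj_mat T = det T \<cdot>\<^sub>m 1\<^sub>m n" using adj_mat[OF T] by auto
  have w: "w \<in> carrier_vec n" using adj by (simp add: w_def)
  have "T *\<^sub>v w = (T * adj_mat T) *\<^sub>v vec n b" unfolding w_def using T adj by (intro assoc_mult_mat_vec[symmetric]) auto
  also have "\<dots> = det T \<cdot>\<^sub>v vec n b" unfolding adj
  proof (rule eq_vecI)
    fix i assume "i < dim_vec (det T \<cdot>\<^sub>v vec n b)"
    then have i: "i < n" by simp
    have "((det T \<cdot>\<^sub>m 1\<^sub>m n) *\<^sub>v vec n b) $ i = (\<Sum>k = 0..<n. det T * (if k = i then 1 else 0) * b k)"
      using i by (auto simp: scalar_prod_def intro!: sum.cong)
    also have "\<dots> = (\<Sum>k = 0..<n. if k = i then det T * b k else 0)" by (intro sum.cong) auto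
    also have "\<dots> = det T * b i" using i by simp
    finally show "((det T \<cdot>\<^sub>m 1\<^sub>m n) *\<^sub>v vec n b) $ i = (det T \<cdot>\<^sub>v vec n b) $ i" using i by simp
  qed simp
  finally have Tw: "T *\<^sub>v w = det T \<cdot>\<^sub>v vec n b" .
  have "(\<Sum>k<n. A i k * (w $ k / det T)) = b i" if i: "i < n" for i
  proof -
    have "(\<Sum>k<n. A i k * (w $ k / det T)) = (\<Sum>k<n. A i k * w $ k) / det T" by (simp add: sum_divide_distrib)
    also have "(\<Sum>k<n. A i k * w $ k) = det T * b i" using mv[OF i w] Tw i by simp
    finally show ?thesis using \<open>det T \<noteq> 0\<close> by simp
  qed
  then show ?thesis by (intro exI[of _ "\<lambda>k. w $ k / det T"]) simp
qed

definition cat :: "nat \<Rightarrow> (nat \<Rightarrow> 'a) \<Rightarrow> (nat \<Rightarrow> 'a) \<Rightarrow> nat \<Rightarrow> 'a" where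
  "cat m x y i = (if i < m then x i else y (i - m))"

lemma cat_simps [simp]: "i < m \<Longrightarrow> cat m x y i = x i" "cat m x y (m + k) = y k"
  by (simp_all add: cat_def)

lemma near_cat:
  "near (m + n) c \<delta> (cat m x y) \<longleftrightarrow> near m c \<delta> x \<and> near n (\<lambda>k. c (m + k)) \<delta> y"
proof
  assume A: "near (m + n) c \<delta> (cat m x y)"
  have "absK (x i - c i) < \<delta>" if "i < m" for i using A that unfolding near_def by (metis cat_simps(1) trans_less_add1)
  moreover have "absK (y k - c (m + k)) < \<delta>" if "k < n" for k using A that unfolding near_def by (metis cat_simps(2) nat_add_left_cancel_less)
  ultimately show "near m c \<delta> x \<and> near n (\<lambda>k. c (m + k)) \<delta> y" by (simp add: near_def)
next
  assume A: "near m c \<delta> x \<and> near n (\<lambda>k. c (m + k)) \<delta> y"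
  show "near (m + n) c \<delta> (cat m x y)" unfolding near_def
  proof (intro allI impI)
    fix i assume i: "i < m + n"
    show "absK (cat m x y i - c i) < \<delta>"
    proof (cases "i < m")
      case False
      then obtain k where "i = m + k" by (metis le_Suc_ex not_less)
      then show ?thesis using A i by (simp add: near_def)
    qed (use A in \<open>simp add: near_def\<close>)
  qed
qed

lemma near_of_sum_less:
  assumes "(\<Sum>k<n. absK (y k - b k)) < \<delta>" shows "near n b \<delta> y"
  unfolding near_def
proof (intro allI impI)
  fix k assume "k < n"
  then have "absK (y k - b k) \<le> (\<Sum>k<n. absK (y k - b k))" by (intro member_le_sum) (auto simp: absK_nonneg)
  then show "absK (y k - b k) < \<delta>" using assms by simp
qed

context o_minimal_expansion
begin

text \<open>Strict differentiability at \<open>c\<close>, summed over the equations. The derivatives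
  in \<open>y\<close> form the identity matrix there, which is the term subtracted on the left;
  those in \<open>x\<close> are collected in \<open>\<Lambda>\<close>.\<close>

lemma near_identity_estimate:
  assumes H: "\<And>i. i < n \<Longrightarrow> K_holo (m + n) c \<rho> (H i)" and \<rho>: "0 < \<rho>"
    and der: "\<And>i k. i < n \<Longrightarrow> k < n \<Longrightarrow> K_deriv (\<lambda>x. H i (c(m + k := x))) (c (m + k)) (if i = k then 1 else 0)"
  shows "\<exists>\<delta>0>0. \<exists>\<Lambda>\<ge>0. \<forall>u w. near (m + n) c \<delta>0 u \<and> near (m + n) c \<delta>0 w \<longrightarrow>
    (\<Sum>i<n. absK (H i u - H i w - (u (m + i) - w (m + i)))) \<le>
    \<Lambda> * (\<Sum>k<m. absK (u k - w k)) + 1/2 * (\<Sum>k<n. absK (u (m + k) - w (m + k)))"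
proof -
  define L where "L = (\<lambda>i j. SOME d. K_deriv (\<lambda>x. H i (c(j := x))) (c j) d)"
  have L: "K_deriv (\<lambda>x. H i (c(j := x))) (c j) (L i j)" if "i < n" "j < m" for i j
    unfolding L_def by (rule someI_ex, rule K_holoD(4)[OF H]) (use that near_self[OF \<rho>] in auto)
  define d where "d = (\<lambda>i j. if j < m then L i j else if j = m + i then 1 else 0)"
  \<comment> \<open>The \<open>n\<close> equations together contribute
    \<open>of_nat n * \<epsilon>\<close>, which has to be at most 1/2. With \<open>n + 1\<close> in
    the denominator the case \<open>n = 0\<close> is no exception.\<close>
  define \<epsilon> :: 'r where "\<epsilon> = 1 / (2 * (of_nat n + 1))"
  have n1: "(0::'r) < of_nat n + 1" by (simp add: add_nonneg_pos)
  have \<epsilon>: "0 < \<epsilon>" "of_nat n * \<epsilon> \<le> 1/2"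
  proof -
    show "0 < \<epsilon>" unfolding \<epsilon>_def using n1 by simp
    have "of_nat n * \<epsilon> = of_nat n / (2 * (of_nat n + 1))" by (simp add: \<epsilon>_def)
    also have "\<dots> \<le> 1/2" using n1 by (subst pos_divide_le_eq) (simp_all add: algebra_simps)
    finally show "of_nat n * \<epsilon> \<le> 1/2" .
  qed
  let ?Q = "\<lambda>i \<delta>. \<forall>u w. near (m + n) c \<delta> u \<and> near (m + n) c \<delta> w \<longrightarrow>
    absK (H i u - H i w - (\<Sum>j<m + n. d i j * (u j - w j))) \<le> \<epsilon> * (\<Sum>j<m + n. absK (u j - w j))"
  have "\<exists>\<delta>>0. \<forall>i<n. ?Q i \<delta>"
  proof (rule finite_uniform)
    fix i assume i: "i < n"
    have "K_deriv (\<lambda>x. H i (c(j := x))) (c j) (d i j)" if j: "j < m + n" for j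
    proof (cases "j < m")
      case False
      then obtain k where k: "j = m + k" "k < n" using j by (metis le_Suc_ex nat_add_left_cancel_less not_less)
      show ?thesis using der[OF i k(2)] k by (auto simp: d_def)
    qed (use L[OF i] in \<open>simp add: d_def\<close>)
    then show "\<exists>\<delta>>0. ?Q i \<delta>"
      by (intro strict_differentiability[OF H[OF i] \<rho> near_self[OF \<rho>] _ \<epsilon>(1)])
  next
    show "?Q i \<delta>'" if "?Q i \<delta>" "\<delta>' \<le> \<delta>" for i \<delta> \<delta>' using that near_mono by blast
  qed
  then obtain \<delta>0 where \<delta>0: "\<delta>0 > 0" "\<forall>i<n. ?Q i \<delta>0" by (elim exE conjE)
  \<comment> \<open>The summand 1 absorbs the part \<open>1/2 * X\<close> of the error.\<close>
  define \<Lambda> where "\<Lambda> = (\<Sum>i<n. \<Sum>j<m. absK (L i j)) + 1"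
  have L0: "0 \<le> \<Lambda>" by (simp add: \<Lambda>_def sum_nonneg absK_nonneg)
  have "(\<Sum>i<n. absK (H i u - H i w - (u (m + i) - w (m + i)))) \<le>
    \<Lambda> * (\<Sum>k<m. absK (u k - w k)) + 1/2 * (\<Sum>k<n. absK (u (m + k) - w (m + k)))"
    if uw: "near (m + n) c \<delta>0 u \<and> near (m + n) c \<delta>0 w" for u w
  proof -
    define X where "X = (\<Sum>k<m. absK (u k - w k))"
    define Y where "Y = (\<Sum>k<n. absK (u (m + k) - w (m + k)))"
    have X: "0 \<le> X" and Y: "0 \<le> Y" by (simp_all add: X_def Y_def sum_nonneg absK_nonneg)
    have "absK (H i u - H i w - (u (m + i) - w (m + i))) \<le> (\<Sum>j<m. absK (L i j)) * X + \<epsilon> * (X + Y)" if i: "i < n" for i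
    proof -
      have "(\<Sum>j<m + n. d i j * (u j - w j)) = (\<Sum>j<m. L i j * (u j - w j)) + (\<Sum>k<n. (if k = i then u (m + k) - w (m + k) else 0))"
        unfolding sum_lessThan_add by (intro arg_cong2[where f = "(+)"] sum.cong) (auto simp: d_def)
      also have "(\<Sum>k<n. (if k = i then u (m + k) - w (m + k) else 0)) = u (m + i) - w (m + i)" using i by simp
      finally have s: "(\<Sum>j<m + n. d i j * (u j - w j)) = (\<Sum>j<m. L i j * (u j - w j)) + (u (m + i) - w (m + i))" .
      have A: "absK (H i u - H i w - (\<Sum>j<m + n. d i j * (u j - w j))) \<le> \<epsilon> * (X + Y)"
        using \<delta>0(2)[rule_format, OF i uw] unfolding sum_lessThan_add[of "\<lambda>j. absK (u j - w j)"] X_def Y_def .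
      have "absK (\<Sum>j<m. L i j * (u j - w j)) \<le> (\<Sum>j<m. absK (L i j) * absK (u j - w j))"
        using absK_sum[of "\<lambda>j. L i j * (u j - w j)" "{..<m}"] by (simp only: absK_mult)
      also have "\<dots> \<le> (\<Sum>j<m. absK (L i j) * X)"
        by (intro sum_mono mult_left_mono absK_nonneg, unfold X_def, intro member_le_sum) (auto simp: absK_nonneg)
      finally have B: "absK (\<Sum>j<m. L i j * (u j - w j)) \<le> (\<Sum>j<m. absK (L i j)) * X" by (simp add: sum_distrib_right)
      have "H i u - H i w - (u (m + i) - w (m + i)) = (H i u - H i w - (\<Sum>j<m + n. d i j * (u j - w j))) + (\<Sum>j<m. L i j * (u j - w j))"
        unfolding s by simp
      then have "absK (H i u - H i w - (u (m + i) - w (m + i))) \<le> absK (H i u - H i w - (\<Sum>j<m + n. d i j * (u j - w j))) + absK (\<Sum>j<m. L i j * (u j - w j))"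
        using absK_triangle by (simp only:)
      then show ?thesis using A B by linarith
    qed
    then have "(\<Sum>i<n. absK (H i u - H i w - (u (m + i) - w (m + i)))) \<le> (\<Sum>i<n. (\<Sum>j<m. absK (L i j)) * X + \<epsilon> * (X + Y))"
      by (intro sum_mono) simp
    also have "\<dots> = (\<Sum>i<n. \<Sum>j<m. absK (L i j)) * X + of_nat n * \<epsilon> * (X + Y)" by (simp add: sum.distrib sum_distrib_right)
    also have "\<dots> \<le> (\<Sum>i<n. \<Sum>j<m. absK (L i j)) * X + 1/2 * (X + Y)"
      using mult_right_mono[OF \<epsilon>(2), of "X + Y"] X Y by simp
    also have "\<dots> \<le> \<Lambda> * X + 1/2 * Y" using X by (simp add: \<Lambda>_def algebra_simps)
    finally show ?thesis unfolding X_def Y_def .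
  qed
  then show ?thesis using \<delta>0(1) L0 by (intro exI[of _ \<delta>0] conjI exI[of _ \<Lambda>]) blast+
qed

text \<open>Newton's step decreases the norm of a nonzero value, so the minimum of the norm of the equation
  over the closed polydisc is zero. With \<open>rl\<close> set, everything is done inside the real points.\<close>

lemma solution_exists:
  assumes H: "\<And>i. i < n \<Longrightarrow> K_holo (m + n) c \<rho> (H i)"
    and x: "near m c \<delta> x" and \<delta>: "0 < \<delta>" "\<delta> < \<delta>0" "\<delta>0 \<le> \<rho>"
    and est: "\<And>y y'. near n (\<lambda>k. c (m + k)) \<delta>0 y \<Longrightarrow> near n (\<lambda>k. c (m + k)) \<delta>0 y' \<Longrightarrow>
      (\<Sum>i<n. absK (H i (cat m x y) - H i (cat m x y') - (y i - y' i))) \<le> 1/2 * (\<Sum>k<n. absK (y k - y' k))"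
    and small: "(\<Sum>i<n. absK (H i (cat m x (\<lambda>k. c (m + k))))) < \<delta> / 4"
    and real: "\<And>y i. rl \<Longrightarrow> near n (\<lambda>k. c (m + k)) \<delta>0 y \<Longrightarrow> \<forall>k<n. im (y k) = 0 \<Longrightarrow> i < n \<Longrightarrow> im (H i (cat m x y)) = 0"
    and realc: "\<And>k. rl \<Longrightarrow> k < n \<Longrightarrow> im (c (m + k)) = 0"
  shows "\<exists>y. (\<forall>k\<ge>n. y k = 0) \<and> near n (\<lambda>k. c (m + k)) \<delta> y \<and> (\<forall>i<n. H i (cat m x y) = 0) \<and> (rl \<longrightarrow> (\<forall>k<n. im (y k) = 0))"
proof -
  \<comment> \<open>The centre in \<open>y\<close>, cut off at \<open>n\<close>, since
    \<open>attains_minimum\<close> ranges over sequences that vanish from \<open>N\<close>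
    on.\<close>
  define b where "b = (\<lambda>k. if k < n then c (m + k) else 0)"
  have nb: "near n (\<lambda>k. c (m + k)) \<eta> y \<longleftrightarrow> near n b \<eta> y" for \<eta> y by (simp add: near_def b_def)
  define g where "g = (\<lambda>y. \<Sum>i<n. absK (H i (cat m x y)))"
  \<comment> \<open>Closed, as a minimum requires, and of radius
    \<open>\<delta> < \<delta>0\<close>, so that the estimates are valid up to its boundary.\<close>
  let ?S = "\<lambda>y. (\<forall>k<n. absK (y k - b k) \<le> \<delta>) \<and> (rl \<longrightarrow> (\<forall>k<n. im (y k) = 0))"
  have S0: "near n b \<delta>0 y" if "?S y" for y
    unfolding near_def
  proof (intro allI impI)
    fix i assume "i < n"
    then have "absK (y i - b i) \<le> \<delta>" using that by blast
    then show "absK (y i - b i) < \<delta>0" using \<delta>(2) by (rule le_less_trans)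
  qed
  have x0: "near m c \<delta>0 x" by (rule near_mono[OF x less_imp_le[OF \<delta>(2)]])
  have S\<rho>: "near (m + n) c \<rho> (cat m x y)" if "?S y" for y
    using S0[OF that] x0 near_mono[OF _ \<delta>(3)] unfolding near_cat nb by blast
  have catK: "dfunK (\<lambda>e. cat m x (\<lambda>i. Adjoin_I (e (2 * i)) (e (2 * i + 1))) k)" for k
    by (cases "k < m") (auto simp: cat_def intro!: dfunK_const dfunK_Adjoin_I dfun_var)
  have "\<exists>v. (\<forall>i\<ge>n. v i = 0) \<and> ?S v \<and> (\<forall>w. (\<forall>i\<ge>n. w i = 0) \<and> ?S w \<longrightarrow> g v \<le> g w)"
  proof (rule attains_minimum[where r = "(\<Sum>k<n. absK (b k)) + \<delta>" and ?v1.0 = b])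
    show "dpredV ?S" unfolding dpredV_def
      by (intro dpred_conj dpred_imp dpred_const dpred_finite_all dpred_le dpred_eq dfun_absK dfun_im dfunK_diff dfunK_const dfunK_Adjoin_I dfun_var dfun_const)
    show "dfunVR g" unfolding dfunVR_def g_def
      by (intro dfun_sum dfun_absK) (rule dfunVK_comp[OF K_holoD(1)[OF H], OF _ catK])
    show "absK (v i) \<le> (\<Sum>k<n. absK (b k)) + \<delta>" if v: "?S v" and i: "i < n" for v i
    proof -
      have "absK (v i) \<le> absK (v i - b i) + absK (b i)" using absK_triangle[of "v i - b i" "b i"] by simp
      moreover have "absK (b i) \<le> (\<Sum>k<n. absK (b k))" using i by (intro member_le_sum) (auto simp: absK_nonneg)
      ultimately show ?thesis using v i by force
    qed
    show "\<forall>i\<ge>n. b i = 0" by (simp add: b_def)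
    show "?S b" using \<delta>(1) realc by (simp add: b_def)
  next
    fix v0 :: "nat \<Rightarrow> 'r adjoin_i"
    assume cl: "\<forall>\<eta>>0. \<exists>v. ?S v \<and> (\<forall>i<n. absK (v i - v0 i) < \<eta>)"
    have "absK (v0 k - b k) \<le> \<delta>" if k: "k < n" for k
    proof (rule ccontr)
      assume "\<not> ?thesis"
      then have "0 < absK (v0 k - b k) - \<delta>" by simp
      from cl[rule_format, OF this] obtain v where v: "?S v" "\<forall>i<n. absK (v i - v0 i) < absK (v0 k - b k) - \<delta>" by (elim exE) (erule conjE)
      have "absK (v0 k - b k) \<le> absK (v0 k - v k) + absK (v k - b k)" by (rule absK_triangle_diff)
      moreover have "absK (v k - b k) \<le> \<delta>" using v(1) k by blast
      moreover have "absK (v k - v0 k) < absK (v0 k - b k) - \<delta>" using v(2) k by blast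
      ultimately show False using absK_minus_commute[of "v0 k" "v k"] by linarith
    qed
    moreover have "im (v0 k) = 0" if "rl" and k: "k < n" for k
    proof (rule ccontr)
      assume "im (v0 k) \<noteq> 0"
      then have "0 < \<bar>im (v0 k)\<bar>" by simp
      from cl[rule_format, OF this] obtain v where v: "?S v" "\<forall>i<n. absK (v i - v0 i) < \<bar>im (v0 k)\<bar>" by (elim exE) (erule conjE)
      have "im (v k) = 0" using v(1) that by blast
      then have "\<bar>im (v0 k)\<bar> \<le> absK (v k - v0 k)" using abs_im_le[of "v k - v0 k"] by simp
      moreover have "absK (v k - v0 k) < \<bar>im (v0 k)\<bar>" using v(2) k by blast
      ultimately show False by simp
    qed
    ultimately show "?S v0" by blast
  next
    fix v0 and \<epsilon> :: 'r assume v0: "?S v0" and \<epsilon>: "0 < \<epsilon>"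
    have n1: "(0::'r) < of_nat n + 1" by (simp add: add_nonneg_pos)
    define \<kappa> where "\<kappa> = \<epsilon> / (of_nat n + 1)"
    have \<kappa>: "0 < \<kappa>" "of_nat n * \<kappa> < \<epsilon>"
    proof -
      show "0 < \<kappa>" using \<epsilon> n1 by (simp add: \<kappa>_def)
      have "(of_nat n + 1) * \<kappa> = \<epsilon>" using n1 by (simp add: \<kappa>_def)
      then show "of_nat n * \<kappa> < \<epsilon>" using \<open>0 < \<kappa>\<close> by (simp add: distrib_right)
    qed
    let ?Q = "\<lambda>i \<eta>. \<forall>w. near (m + n) c \<rho> w \<and> near (m + n) (cat m x v0) \<eta> w \<longrightarrow> absK (H i w - H i (cat m x v0)) < \<kappa>"
    have "\<exists>\<eta>>0. \<forall>i<n. ?Q i \<eta>"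
    proof (rule finite_uniform)
      show "\<exists>\<eta>>0. ?Q i \<eta>" if i: "i < n" for i by (rule K_holoD(3)[OF H[OF i] S\<rho>[OF v0] \<kappa>(1)])
      show "?Q i \<eta>'" if "?Q i \<eta>" "\<eta>' \<le> \<eta>" for i \<eta> \<eta>' using that near_mono by blast
    qed
    then obtain \<eta> where \<eta>: "\<eta> > 0" "\<forall>i<n. ?Q i \<eta>" by (elim exE conjE)
    have "\<bar>g v - g v0\<bar> < \<epsilon>" if v: "?S v" and close: "\<forall>i<n. absK (v i - v0 i) < \<eta>" for v
    proof -
      have nn: "near (m + n) (cat m x v0) \<eta> (cat m x v)"
        unfolding near_cat using close \<eta>(1) by (simp add: near_def)
      have "\<bar>absK (H i (cat m x v)) - absK (H i (cat m x v0))\<bar> \<le> \<kappa>" if i: "i < n" for i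
      proof -
        have "absK (H i (cat m x v) - H i (cat m x v0)) < \<kappa>" using \<eta>(2) i S\<rho>[OF v] nn by blast
        then show ?thesis using absK_diff_ge[of "H i (cat m x v)" "H i (cat m x v0)"] absK_diff_ge[of "H i (cat m x v0)" "H i (cat m x v)"]
            absK_minus_commute[of "H i (cat m x v0)" "H i (cat m x v)"] by (simp add: abs_le_iff)
      qed
      then have "(\<Sum>i<n. \<bar>absK (H i (cat m x v)) - absK (H i (cat m x v0))\<bar>) \<le> (\<Sum>i<n. \<kappa>)" by (intro sum_mono) simp
      moreover have "\<bar>g v - g v0\<bar> \<le> (\<Sum>i<n. \<bar>absK (H i (cat m x v)) - absK (H i (cat m x v0))\<bar>)"
        unfolding g_def sum_subtractf[symmetric] by (rule sum_abs)
      ultimately show ?thesis using \<kappa>(2) by simp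
    qed
    then show "\<exists>\<eta>>0. \<forall>v. ?S v \<and> (\<forall>i\<ge>n. v i = 0) \<and> (\<forall>i<n. absK (v i - v0 i) < \<eta>) \<longrightarrow> \<bar>g v - g v0\<bar> < \<epsilon>"
      using \<eta>(1) by (intro exI[of _ \<eta>]) blast
  qed
  then obtain y where y0: "(\<forall>i\<ge>n. y i = 0) \<and> ?S y \<and> (\<forall>w. (\<forall>i\<ge>n. w i = 0) \<and> ?S w \<longrightarrow> g y \<le> g w)" by (rule exE)
  note y = y0[THEN conjunct1] y0[THEN conjunct2, THEN conjunct1] y0[THEN conjunct2, THEN conjunct2]
  have Sb: "?S b" using \<delta>(1) realc by (simp add: b_def)
  have est': "(\<Sum>i<n. absK (H i (cat m x u) - H i (cat m x w) - (u i - w i))) \<le> 1/2 * (\<Sum>k<n. absK (u k - w k))" if "?S u" "?S w" for u w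
    by (rule est) (use S0[OF that(1)] S0[OF that(2)] nb in blast)+
  have "cat m x b l = cat m x (\<lambda>k. c (m + k)) l" if "l < m + n" for l using that by (auto simp: cat_def b_def)
  then have Hb: "H i (cat m x b) = H i (cat m x (\<lambda>k. c (m + k)))" if "i < n" for i using K_holoD(2)[OF H[OF that]] by blast
  have gb: "g b < \<delta> / 4" using small unfolding g_def by (simp add: Hb)
  have gy: "g y \<le> g b" using y(3) Sb by (simp add: b_def)
  \<comment> \<open>The minimum must lie strictly inside, or Newton's step might leave the set. The
    estimate between \<open>y\<close> and \<open>b\<close> gives
    \<open>Y / 2 \<le> g y + g b \<le> 2 * g b < \<delta> / 2\<close>; this is the purpose of the
    bound \<open>\<delta> / 4\<close>.\<close>
  define Y where "Y = (\<Sum>k<n. absK (y k - b k))"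
  have "Y \<le> (\<Sum>i<n. absK (H i (cat m x y) - H i (cat m x b) - (y i - b i)) + absK (H i (cat m x y)) + absK (H i (cat m x b)))"
    unfolding Y_def
  proof (rule sum_mono)
    fix i
    define P Q R where "P = H i (cat m x y)" and "Q = H i (cat m x b)" and "R = y i - b i"
    have "absK R \<le> absK (R - (P - Q)) + absK (P - Q)" using absK_triangle[of "R - (P - Q)" "P - Q"] by simp
    moreover have "absK (P - Q) \<le> absK P + absK Q" using absK_triangle[of P "- Q"] by simp
    ultimately show "absK (y i - b i) \<le> absK (H i (cat m x y) - H i (cat m x b) - (y i - b i)) + absK (H i (cat m x y)) + absK (H i (cat m x b))"
      unfolding P_def[symmetric] Q_def[symmetric] R_def[symmetric] using absK_minus_commute[of R "P - Q"] by linarith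
  qed
  also have "\<dots> = (\<Sum>i<n. absK (H i (cat m x y) - H i (cat m x b) - (y i - b i))) + g y + g b" by (simp add: sum.distrib g_def)
  also have "\<dots> \<le> 1/2 * Y + g y + g b" using est'[OF y(2) Sb] by (simp add: Y_def)
  finally have "Y * (1/2) \<le> g y + g b" by (simp add: field_simps)
  then have "Y < \<delta>" using gy gb by simp
  have ny: "near n (\<lambda>k. c (m + k)) \<delta> y" unfolding nb by (rule near_of_sum_less) (use \<open>Y < \<delta>\<close> in \<open>simp add: Y_def\<close>)
  have g0: "g y = 0"
  proof (rule ccontr)
    assume "g y \<noteq> 0"
    moreover have "0 \<le> g y" by (simp add: g_def sum_nonneg absK_nonneg)
    ultimately have gp: "0 < g y" by simp
    define h where "h = (\<lambda>i. H i (cat m x y))"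
    have gh: "g y = (\<Sum>i<n. absK (h i))" by (simp add: g_def h_def)
    have "0 < \<delta> - Y" using \<open>Y < \<delta>\<close> by simp
    from ex_small[OF this, of "g y"] obtain \<tau>0 where \<tau>0: "\<tau>0 > 0" "\<forall>t. 0 < t \<and> t \<le> \<tau>0 \<longrightarrow> t * g y < \<delta> - Y" by (elim exE conjE)
    \<comment> \<open>A damping factor: small enough that the step, of length at most
      \<open>\<tau> * g y\<close>, stays in the polydisc, and at most 1 so that
      \<open>1 - \<tau>\<close> is not negative.\<close>
    define \<tau> where "\<tau> = min \<tau>0 1"
    have \<tau>: "0 < \<tau>" "\<tau> \<le> 1" "\<tau> * g y < \<delta> - Y" using \<tau>0 by (auto simp: \<tau>_def)
    define w where "w = (\<lambda>k. if k < n then y k - of_R \<tau> * h k else 0)"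
    have Sw: "?S w"
    proof (intro conjI allI impI)
      fix k assume k: "k < n"
      have "absK (w k - b k) \<le> absK (y k - b k) + absK (of_R \<tau> * h k)"
        using absK_triangle[of "y k - b k" "- (of_R \<tau> * h k)"] k by (simp add: w_def algebra_simps)
      moreover have "absK (y k - b k) \<le> Y" unfolding Y_def using k by (intro member_le_sum) (auto simp: absK_nonneg)
      moreover have "absK (h k) \<le> g y" unfolding gh using k by (intro member_le_sum) (auto simp: absK_nonneg)
      then have "\<tau> * absK (h k) \<le> \<tau> * g y" using \<tau>(1) by (intro mult_left_mono) auto
      moreover have "absK (of_R \<tau> * h k) = \<tau> * absK (h k)" using \<tau>(1) by (simp add: absK_mult)
      ultimately show "absK (w k - b k) \<le> \<delta>" using \<tau>(3) by linarith
    next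
      fix k assume r: "rl" and k: "k < n"
      have "im (h k) = 0" unfolding h_def by (rule real[OF r _ _ k]) (use S0[OF y(2)] nb y(2) r in blast)+
      moreover have "im (y k) = 0" using y(2) r k by blast
      ultimately show "im (w k) = 0" using k by (simp add: w_def)
    qed
    \<comment> \<open>Because the equation is close to the identity in \<open>y\<close>, the step is
      just \<open>- \<tau> * h\<close>, with no matrix to invert. It gives
      \<open>g w \<le> (1 - \<tau>) * g y + 1/2 * (\<tau> * g y)\<close>, which is less than
      \<open>g y\<close>.\<close>
    have "g y \<le> g w" using y(3) Sw by (simp add: w_def)
    also have "g w \<le> (\<Sum>i<n. absK (H i (cat m x w) - H i (cat m x y) - (w i - y i)) + (1 - \<tau>) * absK (h i))"
      unfolding g_def
    proof (rule sum_mono)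
      fix i assume "i \<in> {..<n}"
      then have "w i - y i = - (of_R \<tau> * h i)" by (simp add: w_def)
      then have "H i (cat m x w) = (H i (cat m x w) - H i (cat m x y) - (w i - y i)) + of_R (1 - \<tau>) * h i"
        by (simp add: h_def algebra_simps)
      then have "absK (H i (cat m x w)) \<le> absK (H i (cat m x w) - H i (cat m x y) - (w i - y i)) + absK (of_R (1 - \<tau>) * h i)"
        using absK_triangle[of "H i (cat m x w) - H i (cat m x y) - (w i - y i)" "of_R (1 - \<tau>) * h i"] by argo
      moreover have "absK (of_R (1 - \<tau>) * h i) = (1 - \<tau>) * absK (h i)" using \<tau>(2) by (simp add: absK_mult del: of_R_simps)
      ultimately show "absK (H i (cat m x w)) \<le> absK (H i (cat m x w) - H i (cat m x y) - (w i - y i)) + (1 - \<tau>) * absK (h i)" by linarith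
    qed
    also have "\<dots> = (\<Sum>i<n. absK (H i (cat m x w) - H i (cat m x y) - (w i - y i))) + (1 - \<tau>) * g y"
      by (simp add: sum.distrib gh sum_distrib_left)
    also have "\<dots> \<le> 1/2 * (\<Sum>k<n. absK (w k - y k)) + (1 - \<tau>) * g y" using est'[OF Sw y(2)] by simp
    also have "(\<Sum>k<n. absK (w k - y k)) = (\<Sum>k<n. \<tau> * absK (h k))" using \<tau>(1) by (intro sum.cong) (simp_all add: w_def absK_mult)
    also have "\<dots> = \<tau> * g y" by (simp add: gh sum_distrib_left)
    finally have "\<tau> * g y \<le> 1/2 * (\<tau> * g y)" by (simp add: algebra_simps)
    moreover have "0 < \<tau> * g y" using \<tau>(1) gp by simp
    ultimately show False by simp
  qed
  have "H i (cat m x y) = 0" if "i < n" for i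
  proof -
    have "absK (H i (cat m x y)) \<le> g y" unfolding g_def using that by (intro member_le_sum) (auto simp: absK_nonneg)
    then have "absK (H i (cat m x y)) = 0" using g0 absK_nonneg[of "H i (cat m x y)"] by simp
    then show ?thesis by simp
  qed
  then show ?thesis using y(1,2) ny by (intro exI[of _ y]) blast
qed

end

section \<open>Linear combinations, and the derivative of the implicit function\<close>

lemma K_deriv_zero: "K_deriv (\<lambda>_. 0) z 0"
  unfolding K_deriv_def by (auto intro!: exI[of _ 1])

lemma K_deriv_add_scaled:
  assumes "K_deriv f z d" "K_deriv g z e" shows "K_deriv (\<lambda>w. f w + b * g w) z (d + b * e)"
  unfolding K_deriv_def
proof (intro allI impI)
  fix \<epsilon> :: 'a assume "0 < \<epsilon>"
  then have e: "\<epsilon>/2 > 0" by simp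
  obtain \<eta> where \<eta>: "\<eta> > 0" "\<forall>t. 0 < t \<and> t \<le> \<eta> \<longrightarrow> t * absK b < \<epsilon>/2" using ex_small[OF e, of "absK b"] by (elim exE conjE)
  obtain \<delta>1 where 1: "\<delta>1 > 0" "\<forall>h. h \<noteq> 0 \<and> absK h < \<delta>1 \<longrightarrow> absK ((f (z + h) - f z) / h - d) < \<epsilon>/2"
    using assms(1) e unfolding K_deriv_def by blast
  obtain \<delta>2 where 2: "\<delta>2 > 0" "\<forall>h. h \<noteq> 0 \<and> absK h < \<delta>2 \<longrightarrow> absK ((g (z + h) - g z) / h - e) < \<eta>"
    using assms(2) \<eta>(1) unfolding K_deriv_def by blast
  have "absK ((f (z + h) + b * g (z + h) - (f z + b * g z)) / h - (d + b * e)) < \<epsilon>" if h: "h \<noteq> 0 \<and> absK h < min \<delta>1 \<delta>2" for h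
  proof -
    define A B where "A = (f (z + h) - f z) / h - d" and "B = (g (z + h) - g z) / h - e"
    have "f (z + h) + b * g (z + h) - (f z + b * g z) = (f (z + h) - f z) + b * (g (z + h) - g z)" by (simp add: algebra_simps)
    then have eq: "(f (z + h) + b * g (z + h) - (f z + b * g z)) / h - (d + b * e) = A + b * B"
      unfolding A_def B_def by (simp only: add_divide_distrib times_divide_eq_right[symmetric] right_diff_distrib) (simp add: algebra_simps)
    have "absK A < \<epsilon>/2" unfolding A_def using 1(2) h by simp
    moreover have "absK B < \<eta>" unfolding B_def using 2(2) h by simp
    then have "absK b * absK B \<le> absK b * \<eta>" by (intro mult_left_mono absK_nonneg) simp
    moreover have "\<eta> * absK b < \<epsilon>/2" using \<eta> by simp
    moreover have "absK (A + b * B) \<le> absK A + absK b * absK B" using absK_triangle[of A "b * B"] by (simp only: absK_mult)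
    ultimately show ?thesis unfolding eq using field_sum_of_halves[of \<epsilon>] by (simp add: mult.commute)
  qed
  moreover have "min \<delta>1 \<delta>2 > 0" using 1 2 by simp
  ultimately show "\<exists>\<delta>>0. \<forall>h. h \<noteq> 0 \<and> absK h < \<delta> \<longrightarrow> absK ((f (z + h) + b * g (z + h) - (f z + b * g z)) / h - (d + b * e)) < \<epsilon>"
    by (intro exI[of _ "min \<delta>1 \<delta>2"]) blast
qed

lemma K_deriv_lincomb:
  assumes "\<And>j. j < n \<Longrightarrow> K_deriv (F j) z (d j)"
  shows "K_deriv (\<lambda>x. \<Sum>j<n. b j * F j x) z (\<Sum>j<(n::nat). b j * d j)"
  using assms
proof (induction n)
  case (Suc n)
  have "K_deriv (\<lambda>x. \<Sum>j<n. b j * F j x) z (\<Sum>j<n. b j * d j)" by (rule Suc.IH) (rule Suc.prems, simp)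
  from K_deriv_add_scaled[OF this Suc.prems[of n], of "b n"] show ?case by simp
qed (simp add: K_deriv_zero)

context o_minimal_expansion
begin

lemma K_holo_add_scaled:
  assumes F: "K_holo p c \<rho> F" and G: "K_holo p c \<rho> G"
  shows "K_holo p c \<rho> (\<lambda>z. F z + b * G z)"
  unfolding K_holo_def
proof (intro conjI allI impI)
  show "dfunVK (\<lambda>z. F z + b * G z)" using K_holoD(1)[OF F] K_holoD(1)[OF G]
    unfolding dfunVK_def by (intro dfunK_add dfunK_mult dfunK_const)
  show "F z + b * G z = F w + b * G w" if "\<forall>i<p. z i = w i" for z w
  proof -
    have "F z = F w" "G z = G w" using K_holoD(2)[OF F, of z w] K_holoD(2)[OF G, of z w] that by auto
    then show ?thesis by simp
  qed
  show "\<exists>d. K_deriv (\<lambda>x. F (z(j := x)) + b * G (z(j := x))) (z j) d" if j: "j < p" and z: "near p c \<rho> z" for j z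
    using K_holoD(4)[OF F j z] K_holoD(4)[OF G j z] by (elim exE) (rule exI, rule K_deriv_add_scaled)
  fix z and \<epsilon> :: 'r assume z: "near p c \<rho> z \<and> 0 < \<epsilon>"
  then have e: "\<epsilon>/2 > 0" by simp
  obtain \<eta> where \<eta>: "\<eta> > 0" "\<forall>t. 0 < t \<and> t \<le> \<eta> \<longrightarrow> t * absK b < \<epsilon>/2" using ex_small[OF e, of "absK b"] by (elim exE conjE)
  obtain \<delta>1 where 1: "\<delta>1 > 0" "\<forall>w. near p c \<rho> w \<and> near p z \<delta>1 w \<longrightarrow> absK (F w - F z) < \<epsilon>/2"
    using K_holoD(3)[OF F conjunct1[OF z] e] by (elim exE conjE)
  obtain \<delta>2 where 2: "\<delta>2 > 0" "\<forall>w. near p c \<rho> w \<and> near p z \<delta>2 w \<longrightarrow> absK (G w - G z) < \<eta>"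
    using K_holoD(3)[OF G conjunct1[OF z] \<eta>(1)] by (elim exE conjE)
  have "absK (F w + b * G w - (F z + b * G z)) < \<epsilon>" if w: "near p c \<rho> w \<and> near p z (min \<delta>1 \<delta>2) w" for w
  proof -
    have n: "near p z \<delta>1 w" "near p z \<delta>2 w" using near_mono[OF conjunct2[OF w]] by simp_all
    have "absK (F w - F z) < \<epsilon>/2" using 1(2) w n by blast
    moreover have "absK (G w - G z) < \<eta>" using 2(2) w n by blast
    then have "absK b * absK (G w - G z) \<le> absK b * \<eta>" by (intro mult_left_mono absK_nonneg) simp
    moreover have "\<eta> * absK b < \<epsilon>/2" using \<eta> by simp
    moreover have "F w + b * G w - (F z + b * G z) = (F w - F z) + b * (G w - G z)" by (simp add: algebra_simps)
    moreover have "absK ((F w - F z) + b * (G w - G z)) \<le> absK (F w - F z) + absK b * absK (G w - G z)"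
      using absK_triangle[of "F w - F z" "b * (G w - G z)"] by (simp only: absK_mult)
    ultimately show ?thesis using field_sum_of_halves[of \<epsilon>] by (simp only: mult.commute[of \<eta>])
  qed
  moreover have "min \<delta>1 \<delta>2 > 0" using 1 2 by simp
  ultimately show "\<exists>\<delta>>0. \<forall>w. near p c \<rho> w \<and> near p z \<delta> w \<longrightarrow> absK (F w + b * G w - (F z + b * G z)) < \<epsilon>"
    by (intro exI[of _ "min \<delta>1 \<delta>2"]) blast
qed

lemma K_holo_lincomb:
  assumes "\<And>j. j < n \<Longrightarrow> K_holo p c \<rho> (F j)"
  shows "K_holo p c \<rho> (\<lambda>z. \<Sum>j<(n::nat). b j * F j z)"
  using assms
proof (induction n)
  case 0
  have "dfunVK (\<lambda>z. 0)" unfolding dfunVK_def by (rule dfunK_const)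
  moreover have "(0::'r) < 1" by simp
  ultimately show ?case unfolding K_holo_def using K_deriv_zero by auto
next
  case (Suc n)
  have "K_holo p c \<rho> (\<lambda>z. \<Sum>j<n. b j * F j z)" by (rule Suc.IH) (rule Suc.prems, simp)
  from K_holo_add_scaled[OF this Suc.prems[of n], of "b n"] show ?case by simp
qed

text \<open>At the solution \<open>z\<close> over \<open>x\<close> the matrix of
  \<open>y\<close>-derivatives is no longer the identity, but \<open>est\<close> keeps it close
  enough to be invertible. The derivative \<open>d\<close> is defined by the differentiated
  equation. Strict differentiability between two solutions, with \<open>lip\<close> bounding their
  distance by \<open>h\<close>, shows that the matrix sends \<open>q - h d\<close> to something
  small, and invertibility makes \<open>q - h d\<close> itself small.\<close>

lemma implicit_derivative:
  assumes H: "\<And>i. i < n \<Longrightarrow> K_holo (m + n) c \<rho> (H i)" and \<delta>: "0 < \<delta>1" "\<delta>1 \<le> \<delta>0" "\<delta>0 \<le> \<rho>"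
    and est: "\<forall>u w. near (m + n) c \<delta>0 u \<and> near (m + n) c \<delta>0 w \<longrightarrow>
      (\<Sum>i<n. absK (H i u - H i w - (u (m + i) - w (m + i)))) \<le>
      \<Lambda> * (\<Sum>k<m. absK (u k - w k)) + 1/2 * (\<Sum>k<n. absK (u (m + k) - w (m + k)))"
    and \<Lambda>: "0 \<le> \<Lambda>"
    and sol: "\<And>x. near m c \<delta>1 x \<Longrightarrow> near n (\<lambda>k. c (m + k)) \<delta>0 (\<Phi> x)"
      "\<And>x i. near m c \<delta>1 x \<Longrightarrow> i < n \<Longrightarrow> H i (cat m x (\<Phi> x)) = 0"
    and lip: "\<And>x x'. near m c \<delta>1 x \<Longrightarrow> near m c \<delta>1 x' \<Longrightarrow> (\<Sum>k<n. absK (\<Phi> x k - \<Phi> x' k)) \<le> 2 * \<Lambda> * (\<Sum>l<m. absK (x l - x' l))"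
    and x: "near m c \<delta>1 x" and l: "l < m"
  shows "\<exists>d. \<forall>k<n. K_deriv (\<lambda>t. \<Phi> (x(l := t)) k) (x l) (d k)"
proof -
  define z where "z = cat m x (\<Phi> x)"
  have z0: "near (m + n) c \<delta>0 z" unfolding z_def near_cat using near_mono[OF x \<delta>(2)] sol(1)[OF x] by blast
  have \<rho>: "0 < \<rho>" and \<delta>0: "0 < \<delta>0" using \<delta> by linarith+
  have z\<rho>: "near (m + n) c \<rho> z" by (rule near_mono[OF z0 \<delta>(3)])
  have Hz: "H i z = 0" if "i < n" for i unfolding z_def by (rule sol(2)[OF x that])
  define E where "E = (\<lambda>i j. SOME d. K_deriv (\<lambda>x. H i (z(j := x))) (z j) d)"
  have E: "K_deriv (\<lambda>x. H i (z(j := x))) (z j) (E i j)" if "i < n" "j < m + n" for i j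
    unfolding E_def by (rule someI_ex, rule K_holoD(4)[OF H]) (use that z\<rho> in auto)
  have strict: "\<exists>\<delta>>0. \<forall>i<n. \<forall>u w. near (m + n) z \<delta> u \<and> near (m + n) z \<delta> w \<longrightarrow>
    absK (H i u - H i w - (\<Sum>j<m + n. E i j * (u j - w j))) \<le> \<epsilon> * (\<Sum>j<m + n. absK (u j - w j))" if \<epsilon>: "0 < \<epsilon>" for \<epsilon>
  proof (rule finite_uniform)
    fix i assume i: "i < n"
    from E[OF i] show "\<exists>\<delta>>0. \<forall>u w. near (m + n) z \<delta> u \<and> near (m + n) z \<delta> w \<longrightarrow>
      absK (H i u - H i w - (\<Sum>j<m + n. E i j * (u j - w j))) \<le> \<epsilon> * (\<Sum>j<m + n. absK (u j - w j))"
      by (intro strict_differentiability[OF H[OF i] \<rho> z\<rho> _ \<epsilon>])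
  next
    fix i and \<delta> \<delta>' :: 'r
    assume "\<forall>u w. near (m + n) z \<delta> u \<and> near (m + n) z \<delta> w \<longrightarrow>
      absK (H i u - H i w - (\<Sum>j<m + n. E i j * (u j - w j))) \<le> \<epsilon> * (\<Sum>j<m + n. absK (u j - w j))" "\<delta>' \<le> \<delta>"
    then show "\<forall>u w. near (m + n) z \<delta>' u \<and> near (m + n) z \<delta>' w \<longrightarrow>
      absK (H i u - H i w - (\<Sum>j<m + n. E i j * (u j - w j))) \<le> \<epsilon> * (\<Sum>j<m + n. absK (u j - w j))"
      using near_mono by blast
  qed
  have n1: "(0::'r) < of_nat n + 1" by (simp add: add_nonneg_pos)
  \<comment> \<open>In the sum norm the matrix of \<open>y\<close>-derivatives at \<open>z\<close>
    differs from the identity by at most 3/4. Both estimates are tested on a short multiple of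
    \<open>v\<close>: \<open>est\<close> contributes 1/2, the error of strict differentiability
    1/4.\<close>
  have C: "(\<Sum>i<n. absK ((\<Sum>k<n. E i (m + k) * v k) - v i)) \<le> 3/4 * (\<Sum>k<n. absK (v k))" for v
  proof -
    define Nv where "Nv = (\<Sum>k<n. absK (v k))"
    have Nv: "0 \<le> Nv" by (simp add: Nv_def sum_nonneg absK_nonneg)
    have vN: "absK (v k) \<le> Nv" if "k < n" for k unfolding Nv_def using that by (intro member_le_sum) (auto simp: absK_nonneg)
    define \<epsilon> :: 'r where "\<epsilon> = 1 / (4 * (of_nat n + 1))"
    have \<epsilon>: "0 < \<epsilon>" "of_nat n * \<epsilon> \<le> 1/4"
    proof -
      show "0 < \<epsilon>" unfolding \<epsilon>_def using n1 by simp
      have "of_nat n * \<epsilon> = of_nat n / (4 * (of_nat n + 1))" by (simp add: \<epsilon>_def)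
      also have "\<dots> \<le> 1/4" using n1 by (subst pos_divide_le_eq) (simp_all add: algebra_simps)
      finally show "of_nat n * \<epsilon> \<le> 1/4" .
    qed
    obtain \<delta>s where \<delta>s: "\<delta>s > 0" "\<forall>i<n. \<forall>u w. near (m + n) z \<delta>s u \<and> near (m + n) z \<delta>s w \<longrightarrow>
      absK (H i u - H i w - (\<Sum>j<m + n. E i j * (u j - w j))) \<le> \<epsilon> * (\<Sum>j<m + n. absK (u j - w j))"
      using strict[OF \<epsilon>(1)] by (elim exE conjE)
    obtain \<eta> where \<eta>: "\<eta> > 0" "\<forall>i<m + n. absK (z i - c i) + \<eta> \<le> \<delta>0" using near_open[OF z0 \<delta>0] by (elim exE conjE)
    have "0 < min \<delta>s \<eta>" using \<delta>s(1) \<eta>(1) by simp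
    from ex_small[OF this, of Nv] obtain t where t0: "t > 0" "\<forall>s. 0 < s \<and> s \<le> t \<longrightarrow> s * Nv < min \<delta>s \<eta>" by (elim exE conjE)
    then have t: "t > 0" "t * Nv < min \<delta>s \<eta>" by simp_all
    define u where "u = cat m x (\<lambda>k. \<Phi> x k + of_R t * v k)"
    have nu: "near (m + n) z (min \<delta>s \<eta>) u" unfolding u_def near_cat z_def
    proof
      show "near m (cat m x (\<Phi> x)) (min \<delta>s \<eta>) x" using \<delta>s(1) \<eta>(1) by (simp add: near_def)
      show "near n (\<lambda>k. cat m x (\<Phi> x) (m + k)) (min \<delta>s \<eta>) (\<lambda>k. \<Phi> x k + of_R t * v k)"
        unfolding near_def
      proof (intro allI impI)
        fix k assume "k < n"
        then have "t * absK (v k) \<le> t * Nv" using vN t(1) by (intro mult_left_mono) auto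
        then have "t * absK (v k) < min \<delta>s \<eta>" using t(2) by linarith
        then show "absK (\<Phi> x k + of_R t * v k - cat m x (\<Phi> x) (m + k)) < min \<delta>s \<eta>" using t(1) by (simp add: absK_mult)
      qed
    qed
    have nus: "near (m + n) z \<delta>s u" and nu\<eta>: "near (m + n) z \<eta> u" using near_mono[OF nu] by simp_all
    have nuc: "near (m + n) c \<delta>0 u" by (rule near_trans[OF \<eta>(2) nu\<eta>])
    have ul: "u j - z j = 0" if "j < m" for j using that by (simp add: u_def z_def)
    have uk: "u (m + k) - z (m + k) = of_R t * v k" for k by (simp add: u_def z_def)
    have sN: "(\<Sum>k<n. absK (of_R t * v k)) = t * Nv" using t(1) by (simp add: absK_mult Nv_def sum_distrib_left)
    have e1: "(\<Sum>i<n. absK (H i u - H i z - of_R t * v i)) \<le> 1/2 * (t * Nv)"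
      using est[rule_format, of u z] nuc z0 by (simp add: ul uk sN)
    have sum0: "(\<Sum>j<m. absK (u j - z j)) = 0" "(\<Sum>j<m. E i j * (u j - z j)) = 0" for i by (simp_all add: ul)
    have e2: "absK (H i u - H i z - (\<Sum>k<n. E i (m + k) * (of_R t * v k))) \<le> \<epsilon> * (t * Nv)" if i: "i < n" for i
    proof -
      have "absK (H i u - H i z - (\<Sum>j<m + n. E i j * (u j - z j))) \<le> \<epsilon> * (\<Sum>j<m + n. absK (u j - z j))"
        using \<delta>s(2) i nus near_self[OF \<delta>s(1)] by blast
      then show ?thesis unfolding sum_lessThan_add sum0 uk sN by simp
    qed
    have "t * absK ((\<Sum>k<n. E i (m + k) * v k) - v i) \<le> absK (H i u - H i z - of_R t * v i) + \<epsilon> * (t * Nv)" if i: "i < n" for i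
    proof -
      define P Q where "P = H i u - H i z" and "Q = (\<Sum>k<n. E i (m + k) * (of_R t * v k))"
      have "of_R t * ((\<Sum>k<n. E i (m + k) * v k) - v i) = Q - of_R t * v i"
        by (simp add: Q_def right_diff_distrib sum_distrib_left mult.left_commute)
      also have "\<dots> = (P - of_R t * v i) + - (P - Q)" by simp
      finally have "absK (of_R t * ((\<Sum>k<n. E i (m + k) * v k) - v i)) \<le> absK (P - of_R t * v i) + absK (P - Q)"
        using absK_triangle[of "P - of_R t * v i" "- (P - Q)"] by (simp only: absK_minus)
      moreover have "absK (P - Q) \<le> \<epsilon> * (t * Nv)" using e2[OF i] by (simp add: P_def Q_def)
      moreover have "absK (of_R t * ((\<Sum>k<n. E i (m + k) * v k) - v i)) = t * absK ((\<Sum>k<n. E i (m + k) * v k) - v i)" using t(1) by (simp add: absK_mult)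
      ultimately show ?thesis unfolding P_def by linarith
    qed
    then have "(\<Sum>i<n. t * absK ((\<Sum>k<n. E i (m + k) * v k) - v i)) \<le> (\<Sum>i<n. absK (H i u - H i z - of_R t * v i) + \<epsilon> * (t * Nv))"
      by (intro sum_mono) simp
    also have "\<dots> = (\<Sum>i<n. absK (H i u - H i z - of_R t * v i)) + of_nat n * \<epsilon> * (t * Nv)" by (simp add: sum.distrib)
    also have "\<dots> \<le> 1/2 * (t * Nv) + 1/4 * (t * Nv)" using e1 mult_right_mono[OF \<epsilon>(2), of "t * Nv"] t(1) Nv by (intro add_mono) auto
    also have "\<dots> = t * (3/4 * Nv)" by simp
    finally have "t * (\<Sum>i<n. absK ((\<Sum>k<n. E i (m + k) * v k) - v i)) \<le> t * (3/4 * Nv)" by (simp only: sum_distrib_left)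
    then show ?thesis using t(1) unfolding Nv_def by (simp only: mult_le_cancel_left_pos)
  qed
  \<comment> \<open>A quantitative inverse: 3/4 of the norm may be lost, a quarter remains, hence
    the factor 4.\<close>
  have N4: "(\<Sum>k<n. absK (v k)) \<le> 4 * (\<Sum>i<n. absK (\<Sum>k<n. E i (m + k) * v k))" for v
  proof -
    have "(\<Sum>i<n. absK (v i)) \<le> (\<Sum>i<n. absK ((\<Sum>k<n. E i (m + k) * v k) - v i) + absK (\<Sum>k<n. E i (m + k) * v k))"
    proof (rule sum_mono)
      fix i
      show "absK (v i) \<le> absK ((\<Sum>k<n. E i (m + k) * v k) - v i) + absK (\<Sum>k<n. E i (m + k) * v k)"
        using absK_triangle[of "v i - (\<Sum>k<n. E i (m + k) * v k)" "\<Sum>k<n. E i (m + k) * v k"]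
          absK_minus_commute[of "v i" "\<Sum>k<n. E i (m + k) * v k"] by simp
    qed
    also have "\<dots> = (\<Sum>i<n. absK ((\<Sum>k<n. E i (m + k) * v k) - v i)) + (\<Sum>i<n. absK (\<Sum>k<n. E i (m + k) * v k))" by (rule sum.distrib)
    finally show ?thesis using C[of v] by simp
  qed
  have "\<exists>d. \<forall>i<n. (\<Sum>k<n. E i (m + k) * d k) = - E i l"
  proof (rule solvable_of_injective)
    fix v assume "\<And>i. i < n \<Longrightarrow> (\<Sum>k<n. E i (m + k) * v k) = 0"
    then have "(\<Sum>i<n. absK (\<Sum>k<n. E i (m + k) * v k)) = 0" by simp
    then have "(\<Sum>k<n. absK (v k)) \<le> 0" using N4[of v] by simp
    moreover have "absK (v k) \<le> (\<Sum>k<n. absK (v k))" if "k < n" for k using that by (intro member_le_sum) (auto simp: absK_nonneg)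
    ultimately have "absK (v k) = 0" if "k < n" for k using that absK_nonneg[of "v k"] by (meson order_antisym order_trans)
    then show "\<forall>k<n. v k = 0" by simp
  qed
  then obtain d where d: "\<forall>i<n. (\<Sum>k<n. E i (m + k) * d k) = - E i l" by (rule exE)
  have "K_deriv (\<lambda>t. \<Phi> (x(l := t)) k) (x l) (d k)" if k: "k < n" for k
    unfolding K_deriv_def
  proof (intro allI impI)
    fix \<epsilon> :: 'r assume \<epsilon>: "0 < \<epsilon>"
    \<comment> \<open>The factors between \<open>\<kappa>\<close> and the final error: 4 from
      \<open>N4\<close>, the number \<open>n\<close> of equations, and
      \<open>1 + 2 * \<Lambda>\<close> because the solution moves at most
      \<open>2 * \<Lambda>\<close> times as far as \<open>x\<close>.\<close>
    define W where "W = 4 * of_nat n * (1 + 2 * \<Lambda>)"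
    obtain \<kappa> where \<kappa>0: "\<kappa> > 0" "\<forall>t. 0 < t \<and> t \<le> \<kappa> \<longrightarrow> t * W < \<epsilon>" using ex_small[OF \<epsilon>, of W] by (elim exE conjE)
    then have \<kappa>: "0 < \<kappa>" "\<kappa> * W < \<epsilon>" by simp_all
    obtain \<delta>s where \<delta>s: "\<delta>s > 0" "\<forall>i<n. \<forall>u w. near (m + n) z \<delta>s u \<and> near (m + n) z \<delta>s w \<longrightarrow>
      absK (H i u - H i w - (\<Sum>j<m + n. E i j * (u j - w j))) \<le> \<kappa> * (\<Sum>j<m + n. absK (u j - w j))"
      using strict[OF \<kappa>(1)] by (elim exE conjE)
    obtain \<eta> where \<eta>: "\<eta> > 0" "\<forall>i<m. absK (x i - c i) + \<eta> \<le> \<delta>1" using near_open[OF x \<delta>(1)] by (elim exE conjE)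
    obtain \<tau> where \<tau>: "\<tau> > 0" "\<forall>t. 0 < t \<and> t \<le> \<tau> \<longrightarrow> t * (2 * \<Lambda>) < \<delta>s" using ex_small[OF \<delta>s(1), of "2 * \<Lambda>"] by (elim exE conjE)
    have "absK ((\<Phi> (x(l := x l + h)) k - \<Phi> (x(l := x l)) k) / h - d k) < \<epsilon>" if h: "h \<noteq> 0 \<and> absK h < min \<delta>s (min \<eta> \<tau>)" for h
    proof -
      have hp: "0 < absK h" using h absK_pos by blast
      define x' where "x' = x(l := x l + h)"
      have "near m x \<eta> x'" using h \<eta>(1) by (simp add: near_def x'_def)
      then have x': "near m c \<delta>1 x'" by (rule near_trans[OF \<eta>(2)])
      define q where "q = (\<lambda>k. \<Phi> x' k - \<Phi> x k)"
      have sx: "(\<Sum>j<m. absK (x' j - x j)) = absK h"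
      proof -
        have "(\<Sum>j<m. absK (x' j - x j)) = (\<Sum>j<m. if j = l then absK h else 0)" by (intro sum.cong) (auto simp: x'_def)
        then show ?thesis using l by simp
      qed
      define Nq where "Nq = (\<Sum>k<n. absK (q k))"
      have Nq: "Nq \<le> 2 * \<Lambda> * absK h" using lip[OF x' x] by (simp add: Nq_def q_def sx)
      define w where "w = cat m x' (\<Phi> x')"
      have nw: "near (m + n) z \<delta>s w" unfolding w_def near_cat
      proof
        show "near m z \<delta>s x'" using h \<delta>s(1) by (auto simp: near_def x'_def z_def)
        have "absK h * (2 * \<Lambda>) < \<delta>s" using \<tau>(2) h hp by simp
        then have "(\<Sum>k<n. absK (\<Phi> x' k - \<Phi> x k)) < \<delta>s" using Nq unfolding Nq_def q_def by (simp add: mult.commute)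
        then have "near n (\<Phi> x) \<delta>s (\<Phi> x')" by (rule near_of_sum_less)
        then show "near n (\<lambda>k. z (m + k)) \<delta>s (\<Phi> x')" by (simp add: near_def z_def)
      qed
      have Hw: "H i w = 0" if "i < n" for i unfolding w_def by (rule sol(2)[OF x' that])
      have wj: "w j - z j = x' j - x j" if "j < m" for j using that by (simp add: w_def z_def)
      have wk: "w (m + k) - z (m + k) = q k" for k by (simp add: w_def z_def q_def)
      have B: "absK (\<Sum>k<n. E i (m + k) * (q k - h * d k)) \<le> \<kappa> * (1 + 2 * \<Lambda>) * absK h" if i: "i < n" for i
      proof -
        have "(\<Sum>j<m. E i j * (w j - z j)) = (\<Sum>j<m. if j = l then E i l * h else 0)" by (intro sum.cong) (auto simp: wj x'_def)
        then have s1: "(\<Sum>j<m. E i j * (w j - z j)) = E i l * h" using l by simp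
        have s2: "(\<Sum>j<m. absK (w j - z j)) = absK h" using sx by (simp add: wj)
        have "absK (H i w - H i z - (\<Sum>j<m + n. E i j * (w j - z j))) \<le> \<kappa> * (\<Sum>j<m + n. absK (w j - z j))"
          using \<delta>s(2) i nw near_self[OF \<delta>s(1)] by blast
        then have a: "absK (E i l * h + (\<Sum>k<n. E i (m + k) * q k)) \<le> \<kappa> * (absK h + Nq)"
          unfolding sum_lessThan_add s1 s2 wk Hw[OF i] Hz[OF i] Nq_def[symmetric] using absK_minus[of "E i l * h + (\<Sum>k<n. E i (m + k) * q k)"] by simp
        have "(\<Sum>k<n. E i (m + k) * (q k - h * d k)) = (\<Sum>k<n. E i (m + k) * q k) - h * (\<Sum>k<n. E i (m + k) * d k)"
          by (simp add: right_diff_distrib sum_subtractf sum_distrib_left mult.left_commute)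
        also have "\<dots> = E i l * h + (\<Sum>k<n. E i (m + k) * q k)" using d i by (simp add: algebra_simps)
        finally have "absK (\<Sum>k<n. E i (m + k) * (q k - h * d k)) \<le> \<kappa> * (absK h + Nq)" using a by simp
        also have "\<dots> \<le> \<kappa> * (absK h + 2 * \<Lambda> * absK h)" using Nq \<kappa>(1) by (intro mult_left_mono) auto
        also have "\<dots> = \<kappa> * (1 + 2 * \<Lambda>) * absK h" by (simp add: algebra_simps)
        finally show ?thesis .
      qed
      have "absK (q k - h * d k) \<le> (\<Sum>k<n. absK (q k - h * d k))" using k by (intro member_le_sum) (auto simp: absK_nonneg)
      also have "\<dots> \<le> 4 * (\<Sum>i<n. absK (\<Sum>k<n. E i (m + k) * (q k - h * d k)))" by (rule N4)
      also have "\<dots> \<le> 4 * (\<Sum>i<n. \<kappa> * (1 + 2 * \<Lambda>) * absK h)" using B by (intro mult_left_mono sum_mono) auto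
      also have "\<dots> = (\<kappa> * W) * absK h" by (simp add: W_def algebra_simps)
      also have "\<dots> < \<epsilon> * absK h" using \<kappa>(2) hp by (rule mult_strict_right_mono)
      finally have "absK (q k - h * d k) / absK h < \<epsilon>" using hp by (simp only: pos_divide_less_eq)
      moreover have "(\<Phi> (x(l := x l + h)) k - \<Phi> (x(l := x l)) k) / h - d k = (q k - h * d k) / h"
        using h by (simp add: q_def x'_def diff_divide_distrib)
      ultimately show ?thesis by (simp only: absK_divide)
    qed
    moreover have "min \<delta>s (min \<eta> \<tau>) > 0" using \<delta>s(1) \<eta>(1) \<tau>(1) by simp
    ultimately show "\<exists>\<delta>>0. \<forall>h. h \<noteq> 0 \<and> absK h < \<delta> \<longrightarrow> absK ((\<Phi> (x(l := x l + h)) k - \<Phi> (x(l := x l)) k) / h - d k) < \<epsilon>"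
      by (intro exI[of _ "min \<delta>s (min \<eta> \<tau>)"]) blast
  qed
  then show ?thesis by blast
qed


text \<open>\<open>solution_exists\<close> provides a solution over each \<open>x\<close>, and the
  factor 1/2 in the estimate makes it unique. For varying \<open>x\<close> the same estimate gives
  the Lipschitz constant \<open>2 * \<Lambda>\<close>, hence continuity, and then
  \<open>implicit_derivative\<close> applies. Over a real \<open>x\<close> there is also a solution
  with real entries, which by uniqueness is the same one.\<close>

theorem implicit_function_K:
  fixes H :: "nat \<Rightarrow> (nat \<Rightarrow> 'r adjoin_i) \<Rightarrow> 'r adjoin_i"
  assumes H: "\<And>i. i < n \<Longrightarrow> K_holo (m + n) c \<rho> (H i)" and \<rho>: "0 < \<rho>"
    and der: "\<And>i k. i < n \<Longrightarrow> k < n \<Longrightarrow> K_deriv (\<lambda>x. H i (c(m + k := x))) (c (m + k)) (if i = k then 1 else 0)"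
    and H0: "\<And>i. i < n \<Longrightarrow> H i c = 0"
    and realH: "\<And>x y i. near m c \<rho> x \<Longrightarrow> near n (\<lambda>k. c (m + k)) \<rho> y \<Longrightarrow> \<forall>l<m. im (x l) = 0 \<Longrightarrow>
      \<forall>k<n. im (y k) = 0 \<Longrightarrow> i < n \<Longrightarrow> im (H i (cat m x y)) = 0"
    and realc: "\<And>k. k < n \<Longrightarrow> im (c (m + k)) = 0"
  shows "\<exists>\<delta>1 \<delta>2 \<Phi>. 0 < \<delta>1 \<and> \<delta>1 \<le> \<rho> \<and> 0 < \<delta>2 \<and> \<delta>2 \<le> \<rho> \<and> (\<forall>k<n. K_holo m c \<delta>1 (\<lambda>x. \<Phi> x k)) \<and>
    (\<forall>x. near m c \<delta>1 x \<longrightarrow> near n (\<lambda>k. c (m + k)) \<delta>2 (\<Phi> x) \<and>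
      (\<forall>y. near n (\<lambda>k. c (m + k)) \<delta>2 y \<longrightarrow> ((\<forall>i<n. H i (cat m x y) = 0) \<longleftrightarrow> (\<forall>k<n. y k = \<Phi> x k))) \<and>
      ((\<forall>l<m. im (x l) = 0) \<longrightarrow> (\<forall>k<n. im (\<Phi> x k) = 0)))"
proof -
  define b where "b = (\<lambda>k. c (m + k))"
  have "\<exists>\<delta>0>0. \<exists>\<Lambda>\<ge>0. \<forall>u w. near (m + n) c \<delta>0 u \<and> near (m + n) c \<delta>0 w \<longrightarrow>
    (\<Sum>i<n. absK (H i u - H i w - (u (m + i) - w (m + i)))) \<le>
    \<Lambda> * (\<Sum>k<m. absK (u k - w k)) + 1/2 * (\<Sum>k<n. absK (u (m + k) - w (m + k)))"
    using H \<rho> der by (rule near_identity_estimate)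
  then obtain \<delta>' \<Lambda> where \<delta>': "\<delta>' > 0" and \<Lambda>: "\<Lambda> \<ge> 0" and est': "\<forall>u w. near (m + n) c \<delta>' u \<and> near (m + n) c \<delta>' w \<longrightarrow>
    (\<Sum>i<n. absK (H i u - H i w - (u (m + i) - w (m + i)))) \<le>
    \<Lambda> * (\<Sum>k<m. absK (u k - w k)) + 1/2 * (\<Sum>k<n. absK (u (m + k) - w (m + k)))"
    by (elim exE conjE)
  define \<delta>0 where "\<delta>0 = min \<delta>' \<rho>"
  have \<delta>0: "0 < \<delta>0" "\<delta>0 \<le> \<rho>" "\<delta>0 \<le> \<delta>'" using \<delta>' \<rho> by (simp_all add: \<delta>0_def)
  have est: "\<forall>u w. near (m + n) c \<delta>0 u \<and> near (m + n) c \<delta>0 w \<longrightarrow>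
    (\<Sum>i<n. absK (H i u - H i w - (u (m + i) - w (m + i)))) \<le>
    \<Lambda> * (\<Sum>k<m. absK (u k - w k)) + 1/2 * (\<Sum>k<n. absK (u (m + k) - w (m + k)))"
    using est' near_mono[OF _ \<delta>0(3)] by blast
  define \<delta>2 where "\<delta>2 = \<delta>0 / 2"
  have \<delta>2: "0 < \<delta>2" "\<delta>2 < \<delta>0" using \<delta>0 by (simp_all add: \<delta>2_def)
  have n1: "(0::'r) < of_nat n + 1" by (simp add: add_nonneg_pos)
  \<comment> \<open>Bounds each of the \<open>n\<close> equations at the centre, so that their sum
    stays below the \<open>\<delta>2 / 4\<close> required by \<open>solution_exists\<close>.\<close>
  define \<kappa> where "\<kappa> = \<delta>2 / 4 / (of_nat n + 1)"
  have \<kappa>: "0 < \<kappa>" "of_nat n * \<kappa> < \<delta>2 / 4"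
  proof -
    show "0 < \<kappa>" using \<delta>2 n1 by (simp add: \<kappa>_def)
    have "\<kappa> * (of_nat n + 1) = \<delta>2 / 4" unfolding \<kappa>_def by (rule divide_mult_cancel) (use n1 in simp)
    then show "of_nat n * \<kappa> < \<delta>2 / 4" using \<open>0 < \<kappa>\<close> by (simp add: distrib_left mult.commute)
  qed
  have nc: "near (m + n) c \<rho> c" by (rule near_self[OF \<rho>])
  have "\<exists>\<eta>>0. \<forall>i<n. \<forall>w. near (m + n) c \<rho> w \<and> near (m + n) c \<eta> w \<longrightarrow> absK (H i w - H i c) < \<kappa>"
  proof (rule finite_uniform)
    show "\<exists>\<eta>>0. \<forall>w. near (m + n) c \<rho> w \<and> near (m + n) c \<eta> w \<longrightarrow> absK (H i w - H i c) < \<kappa>" if i: "i < n" for i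
      by (rule K_holoD(3)[OF H[OF i] nc \<kappa>(1)])
    show "\<forall>w. near (m + n) c \<rho> w \<and> near (m + n) c \<eta>' w \<longrightarrow> absK (H i w - H i c) < \<kappa>"
      if "\<forall>w. near (m + n) c \<rho> w \<and> near (m + n) c \<eta> w \<longrightarrow> absK (H i w - H i c) < \<kappa>" "\<eta>' \<le> \<eta>" for i \<eta> \<eta>'
      using that near_mono by blast
  qed
  then obtain \<eta> where \<eta>: "\<eta> > 0" "\<forall>i<n. \<forall>w. near (m + n) c \<rho> w \<and> near (m + n) c \<eta> w \<longrightarrow> absK (H i w - H i c) < \<kappa>" by (elim exE conjE)
  define \<delta>1 where "\<delta>1 = min \<eta> \<delta>2"
  have \<delta>1: "0 < \<delta>1" "\<delta>1 \<le> \<delta>2" "\<delta>1 \<le> \<delta>0" "\<delta>1 \<le> \<rho>" "\<delta>1 \<le> \<eta>" using \<eta>(1) \<delta>2 \<delta>0 by (auto simp: \<delta>1_def min_def)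
  \<comment> \<open>Vanishing from \<open>n\<close> on makes the solution unique as a sequence, so
    that \<open>THE\<close> may be used.\<close>
  define P where "P = (\<lambda>x y. (\<forall>k\<ge>n. y k = 0) \<and> near n b \<delta>2 y \<and> (\<forall>i<n. H i (cat m x y) = 0))"
  define \<Phi> where "\<Phi> = (\<lambda>x. if near m c \<delta>1 x then (THE y. P x y) else (\<lambda>_. 0))"
  have estx: "(\<Sum>i<n. absK (H i (cat m x y) - H i (cat m x y') - (y i - y' i))) \<le> 1/2 * (\<Sum>k<n. absK (y k - y' k))"
    if x: "near m c \<delta>1 x" and y: "near n b \<delta>0 y" "near n b \<delta>0 y'" for x y y'
  proof -
    have "near (m + n) c \<delta>0 (cat m x y) \<and> near (m + n) c \<delta>0 (cat m x y')"
      unfolding near_cat using near_mono[OF x \<delta>1(3)] y by (simp add: b_def)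
    from est[rule_format, OF this] show ?thesis by simp
  qed
  \<comment> \<open>\<open>rl\<close> is an arbitrary proposition: \<open>False\<close> gives mere
    existence, \<open>True\<close> a solution with real entries.\<close>
  have exP: "\<exists>y. P x y \<and> (rl \<longrightarrow> (\<forall>k<n. im (y k) = 0))" if x: "near m c \<delta>1 x" and rl: "rl \<Longrightarrow> \<forall>l<m. im (x l) = 0" for x rl
  proof -
    have "\<exists>y. (\<forall>k\<ge>n. y k = 0) \<and> near n (\<lambda>k. c (m + k)) \<delta>2 y \<and> (\<forall>i<n. H i (cat m x y) = 0) \<and> (rl \<longrightarrow> (\<forall>k<n. im (y k) = 0))"
    proof (rule solution_exists[OF H near_mono[OF x \<delta>1(2)] \<delta>2 \<delta>0(2)])
      show "(\<Sum>i<n. absK (H i (cat m x y) - H i (cat m x y') - (y i - y' i))) \<le> 1/2 * (\<Sum>k<n. absK (y k - y' k))"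
        if "near n (\<lambda>k. c (m + k)) \<delta>0 y" "near n (\<lambda>k. c (m + k)) \<delta>0 y'" for y y'
        by (rule estx[OF x]) (use that in \<open>simp_all add: b_def\<close>)
      have nb: "near n (\<lambda>k. c (m + k)) \<theta> (\<lambda>k. c (m + k))" if "0 < \<theta>" for \<theta> by (rule near_self[OF that])
      have "absK (H i (cat m x (\<lambda>k. c (m + k)))) \<le> \<kappa>" if i: "i < n" for i
      proof -
        have "near (m + n) c \<rho> (cat m x (\<lambda>k. c (m + k)))" "near (m + n) c \<eta> (cat m x (\<lambda>k. c (m + k)))"
          unfolding near_cat using near_mono[OF x \<delta>1(4)] near_mono[OF x \<delta>1(5)] nb[OF \<rho>] nb[OF \<eta>(1)] by blast+
        then have "absK (H i (cat m x (\<lambda>k. c (m + k))) - H i c) < \<kappa>" using \<eta>(2) i by blast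
        then show ?thesis using H0[OF i] by simp
      qed
      then have "(\<Sum>i<n. absK (H i (cat m x (\<lambda>k. c (m + k))))) \<le> (\<Sum>i<n. \<kappa>)" by (intro sum_mono) simp
      then show "(\<Sum>i<n. absK (H i (cat m x (\<lambda>k. c (m + k))))) < \<delta>2 / 4" using \<kappa>(2) by simp
      show "im (H i (cat m x y)) = 0" if "rl" "near n (\<lambda>k. c (m + k)) \<delta>0 y" "\<forall>k<n. im (y k) = 0" "i < n" for y i
        by (rule realH[OF near_mono[OF x \<delta>1(4)] near_mono[OF that(2) \<delta>0(2)] rl[OF that(1)] that(3,4)])
    qed (use realc in auto)
    then show ?thesis unfolding P_def b_def by (elim exE conjE) (intro exI conjI)
  qed
  have near20: "near n b \<delta>0 y" if "near n b \<delta>2 y" for y by (rule near_mono[OF that less_imp_le[OF \<delta>2(2)]])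
  have uniq: "y k = y' k" if x: "near m c \<delta>1 x" and y: "near n b \<delta>2 y" "\<forall>i<n. H i (cat m x y) = 0"
    and y': "near n b \<delta>2 y'" "\<forall>i<n. H i (cat m x y') = 0" and k: "k < n" for x y y' k
  proof -
    have "(\<Sum>i<n. absK (H i (cat m x y) - H i (cat m x y') - (y i - y' i))) = (\<Sum>i<n. absK (y i - y' i))"
      using y(2) y'(2) by (intro sum.cong) (simp_all add: absK_minus_commute)
    then have "(\<Sum>k<n. absK (y k - y' k)) \<le> 0" using estx[OF x near20[OF y(1)] near20[OF y'(1)]] by simp
    moreover have "absK (y k - y' k) \<le> (\<Sum>k<n. absK (y k - y' k))" using k by (intro member_le_sum) (auto simp: absK_nonneg)
    ultimately have "absK (y k - y' k) = 0" using absK_nonneg[of "y k - y' k"] by linarith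
    then show ?thesis by simp
  qed
  have \<Phi>P: "P x (\<Phi> x)" if x: "near m c \<delta>1 x" for x
  proof -
    have "\<exists>y. P x y \<and> (False \<longrightarrow> (\<forall>k<n. im (y k) = 0))" by (rule exP[OF x]) simp
    then obtain y where y: "P x y" by blast
    have "y' = y" if "P x y'" for y'
    proof
      fix k
      show "y' k = y k"
      proof (cases "k < n")
        case True
        show ?thesis by (rule uniq[OF x _ _ _ _ True]) (use that y in \<open>simp_all add: P_def\<close>)
      next
        case False
        then show ?thesis using that y by (simp add: P_def)
      qed
    qed
    with y have "P x (THE y. P x y)" by (rule theI)
    then show ?thesis using x by (simp add: \<Phi>_def)
  qed
  have \<Phi>dep: "\<Phi> x = \<Phi> x'" if eq: "\<And>i. i < m \<Longrightarrow> x i = x' i" for x x'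
  proof -
    have "H i (cat m x y) = H i (cat m x' y)" if "i < n" for i y
      by (rule K_holoD(2)[OF H[OF that]]) (use eq in \<open>simp add: cat_def\<close>)
    then have "P x = P x'" by (intro ext) (auto simp: P_def)
    moreover have "near m c \<delta>1 x = near m c \<delta>1 x'" using eq by (simp add: near_def)
    ultimately show ?thesis by (simp add: \<Phi>_def)
  qed
  have lip: "(\<Sum>k<n. absK (\<Phi> x k - \<Phi> x' k)) \<le> 2 * \<Lambda> * (\<Sum>l<m. absK (x l - x' l))" if x: "near m c \<delta>1 x" "near m c \<delta>1 x'" for x x'
  proof -
    have "near (m + n) c \<delta>0 (cat m x (\<Phi> x)) \<and> near (m + n) c \<delta>0 (cat m x' (\<Phi> x'))"
      unfolding near_cat using near_mono[OF x(1) \<delta>1(3)] near_mono[OF x(2) \<delta>1(3)] \<Phi>P[OF x(1)] \<Phi>P[OF x(2)] near20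
      unfolding P_def b_def by blast
    note e = est[rule_format, OF this]
    have "(\<Sum>i<n. absK (H i (cat m x (\<Phi> x)) - H i (cat m x' (\<Phi> x')) - (cat m x (\<Phi> x) (m + i) - cat m x' (\<Phi> x') (m + i)))) = (\<Sum>i<n. absK (\<Phi> x i - \<Phi> x' i))"
      using \<Phi>P[OF x(1)] \<Phi>P[OF x(2)] unfolding P_def by (intro sum.cong) (simp_all add: absK_minus_commute)
    with e have "(\<Sum>i<n. absK (\<Phi> x i - \<Phi> x' i)) \<le> \<Lambda> * (\<Sum>k<m. absK (x k - x' k)) + 1/2 * (\<Sum>k<n. absK (\<Phi> x k - \<Phi> x' k))" by simp
    then show ?thesis by simp
  qed
  have deriv: "\<exists>d. \<forall>k<n. K_deriv (\<lambda>t. \<Phi> (x(l := t)) k) (x l) (d k)" if x: "near m c \<delta>1 x" and l: "l < m" for x l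
  proof (rule implicit_derivative[OF H \<delta>1(1,3) \<delta>0(2) est \<Lambda> _ _ lip x l])
    show "near n (\<lambda>k. c (m + k)) \<delta>0 (\<Phi> x)" if "near m c \<delta>1 x" for x
      using \<Phi>P[OF that] near20 unfolding P_def b_def by blast
    show "H i (cat m x (\<Phi> x)) = 0" if "near m c \<delta>1 x" "i < n" for x i
      using \<Phi>P[OF that(1)] that(2) unfolding P_def by blast
  qed
  have cont: "\<exists>\<delta>>0. \<forall>w. near m c \<delta>1 w \<and> near m x \<delta> w \<longrightarrow> absK (\<Phi> w k - \<Phi> x k) < \<epsilon>" if x: "near m c \<delta>1 x" and \<epsilon>: "0 < \<epsilon>" and k: "k < n" for x k \<epsilon>
  proof -
    obtain \<tau> where \<tau>0: "\<tau> > 0" "\<forall>t. 0 < t \<and> t \<le> \<tau> \<longrightarrow> t * (2 * \<Lambda> * of_nat m) < \<epsilon>" using ex_small[OF \<epsilon>, of "2 * \<Lambda> * of_nat m"] by (elim exE conjE)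
    have "absK (\<Phi> w k - \<Phi> x k) < \<epsilon>" if w: "near m c \<delta>1 w \<and> near m x \<tau> w" for w
    proof -
      have "absK (\<Phi> w k - \<Phi> x k) \<le> (\<Sum>k<n. absK (\<Phi> w k - \<Phi> x k))" using k by (intro member_le_sum) (auto simp: absK_nonneg)
      also have "\<dots> \<le> 2 * \<Lambda> * (\<Sum>l<m. absK (w l - x l))" using lip[of w x] w x by blast
      also have "\<dots> \<le> 2 * \<Lambda> * (\<Sum>l<m. \<tau>)" using w \<Lambda> by (intro mult_left_mono sum_mono) (auto simp: near_def less_imp_le)
      also have "\<dots> = \<tau> * (2 * \<Lambda> * of_nat m)" by simp
      also have "\<dots> < \<epsilon>" using \<tau>0 by simp
      finally show ?thesis .
    qed
    then show ?thesis using \<tau>0(1) by (intro exI[of _ \<tau>]) blast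
  qed
  have dfn: "dfunVK (\<lambda>x. \<Phi> x k)" if k: "k < n" for k
  proof -
    \<comment> \<open>\<open>\<pi>\<close> is the real or the imaginary part. The condition
      \<open>\<pi> 0 = 0\<close> matches the default value of \<open>\<Phi>\<close> off the
      polydisc.\<close>
    have part: "dfun (\<lambda>e. \<pi> (\<Phi> (\<lambda>i. Adjoin_I (e (2 * i)) (e (2 * i + 1))) k))"
      if \<pi>: "\<And>t. dfunK t \<Longrightarrow> dfun (\<lambda>e. \<pi> (t e))" and \<pi>0: "\<pi> 0 = 0" for \<pi> :: "'r adjoin_i \<Rightarrow> 'r"
    proof -
      define X where "X = (\<lambda>(e :: nat \<Rightarrow> 'r) i. Adjoin_I (e (2 * i)) (e (2 * i + 1)))"
      \<comment> \<open>\<open>dpredRV_ex\<close> quantifies over initial coordinates, so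
        \<open>w\<close> holds the \<open>n\<close> unknowns first and the argument \<open>x\<close>
        behind them. The equations expect the two blocks in the opposite order.\<close>
      define Q where "Q = (\<lambda>v w. (\<forall>k<n. absK (w k - b k) < \<delta>2) \<and> (\<forall>i<n. H i (\<lambda>j. if j < m then w (n + j) else w (j - m)) = 0) \<and> \<pi> (w k) = v)"
      define R where "R = (\<lambda>v u. \<exists>w. (\<forall>i\<ge>n. w i = u i) \<and> Q v w)"
      have t: "dfunK (\<lambda>e. if j < m then Adjoin_I (e (2 * (n + j) + 1)) (e (2 * (n + j) + 2)) else Adjoin_I (e (2 * (j - m) + 1)) (e (2 * (j - m) + 2)))" for j
        by (cases "j < m") (auto intro!: dfunK_Adjoin_I dfun_var)
      have "dpredRV Q" unfolding dpredRV_def Q_def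
        by (intro dpred_conj dpred_finite_all dpred_less dpred_eq dpred_eqK dfun_absK \<pi> dfunK_diff dfunK_const dfunK_Adjoin_I dfun_var dfun_const)
          (rule dfunVK_comp[OF K_holoD(1)[OF H], OF _ t])
      then have R: "dpredRV R" unfolding R_def by (rule dpredRV_ex)
      have "dfun (\<lambda>e. \<pi> (\<Phi> (X e) k))"
      proof (rule dfunI[where P = "\<lambda>e v. (near m c \<delta>1 (X e) \<and> R v (\<lambda>i. if i < n then 0 else X e (i - n))) \<or> (\<not> near m c \<delta>1 (X e) \<and> v = 0)"])
        let ?X = "\<lambda>(e :: nat \<Rightarrow> 'r) i. Adjoin_I (e (Suc (2 * i))) (e (Suc (2 * i + 1)))"
        have s: "dfunK (\<lambda>e. if i < n then 0 else ?X e (i - n))" for i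
          by (cases "i < n") (auto intro!: dfunK_Adjoin_I dfun_var dfunK_const)
        have "dpred (\<lambda>e. R (e 0) (\<lambda>i. if i < n then 0 else ?X e (i - n)))" by (rule dpredRV_comp[OF R dfun_var s])
        moreover have "dpred (\<lambda>e. near m c \<delta>1 (?X e))" unfolding near_def
          by (intro dpred_finite_all dpred_less dfun_absK dfunK_diff dfunK_const dfunK_Adjoin_I dfun_var dfun_const)
        ultimately show "dpred (\<lambda>e. (near m c \<delta>1 (X (\<lambda>i. e (Suc i))) \<and> R (e 0) (\<lambda>i. if i < n then 0 else X (\<lambda>i. e (Suc i)) (i - n))) \<or> (\<not> near m c \<delta>1 (X (\<lambda>i. e (Suc i))) \<and> e 0 = 0))"
          unfolding X_def by (intro dpred_disj dpred_conj dpred_not dpred_eq dfun_var dfun_const)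
      next
        fix e :: "nat \<Rightarrow> 'r" and v
        define x where "x = X e"
        define u where "u = (\<lambda>i. if i < n then 0 else x (i - n))"
        have "R v u \<longleftrightarrow> v = \<pi> (\<Phi> x k)" if x: "near m c \<delta>1 x"
        proof
          assume "R v u"
          then obtain w where w: "\<forall>i\<ge>n. w i = u i" "Q v w" unfolding R_def by blast
          have w': "near n b \<delta>2 w" using w(2) by (simp add: Q_def near_def)
          have "H i (cat m x w) = 0" if i: "i < n" for i
          proof -
            have "H i (cat m x w) = H i (\<lambda>j. if j < m then w (n + j) else w (j - m))"
              by (rule K_holoD(2)[OF H[OF i]]) (use w(1) in \<open>simp add: cat_def u_def\<close>)
            then show ?thesis using w(2) i by (simp add: Q_def)
          qed
          then have "w k = \<Phi> x k" using uniq[OF x w' _ _ _ k] \<Phi>P[OF x] unfolding P_def by blast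
          then show "v = \<pi> (\<Phi> x k)" using w(2) by (simp add: Q_def)
        next
          assume v: "v = \<pi> (\<Phi> x k)"
          define w where "w = (\<lambda>i. if i < n then \<Phi> x i else x (i - n))"
          have "H i (\<lambda>j. if j < m then w (n + j) else w (j - m)) = H i (cat m x (\<Phi> x))" if i: "i < n" for i
            by (rule K_holoD(2)[OF H[OF i]]) (auto simp: cat_def w_def)
          then have "Q v w" using \<Phi>P[OF x] k v unfolding Q_def P_def near_def by (simp add: w_def)
          moreover have "\<forall>i\<ge>n. w i = u i" by (simp add: w_def u_def)
          ultimately show "R v u" unfolding R_def by blast
        qed
        moreover have "\<pi> (\<Phi> x k) = 0" if "\<not> near m c \<delta>1 x" using that by (simp add: \<Phi>_def \<pi>0)
        ultimately show "((near m c \<delta>1 (X e) \<and> R v (\<lambda>i. if i < n then 0 else X e (i - n))) \<or> (\<not> near m c \<delta>1 (X e) \<and> v = 0)) = (v = \<pi> (\<Phi> (X e) k))"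
          unfolding x_def u_def by (cases "near m c \<delta>1 (X e)") simp_all
      qed
      then show ?thesis unfolding X_def .
    qed
    show ?thesis unfolding dfunVK_def dfunK_def by (intro conjI part dfun_re dfun_im) simp_all
  qed
  have c1: "K_holo m c \<delta>1 (\<lambda>x. \<Phi> x k)" if k: "k < n" for k
    unfolding K_holo_def
  proof (intro conjI allI impI)
    show "\<Phi> z k = \<Phi> w k" if "\<forall>i<m. z i = w i" for z w using \<Phi>dep[of z w] that by simp
    show "\<exists>\<delta>>0. \<forall>w. near m c \<delta>1 w \<and> near m z \<delta> w \<longrightarrow> absK (\<Phi> w k - \<Phi> z k) < \<epsilon>" if "near m c \<delta>1 z \<and> 0 < \<epsilon>" for z \<epsilon>
      using cont[of z \<epsilon> k] that k by blast
    show "\<exists>d. K_deriv (\<lambda>x. \<Phi> (z(j := x)) k) (z j) d" if "j < m" "near m c \<delta>1 z" for j z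
      using deriv[OF that(2,1)] k by blast
  qed (rule dfn[OF k])
  have c2: "near n (\<lambda>k. c (m + k)) \<delta>2 (\<Phi> x)" if "near m c \<delta>1 x" for x
    using \<Phi>P[OF that] unfolding P_def b_def by blast
  have c3: "(\<forall>i<n. H i (cat m x y) = 0) \<longleftrightarrow> (\<forall>k<n. y k = \<Phi> x k)" if x: "near m c \<delta>1 x" and y: "near n (\<lambda>k. c (m + k)) \<delta>2 y" for x y
  proof
    assume "\<forall>i<n. H i (cat m x y) = 0"
    then show "\<forall>k<n. y k = \<Phi> x k" using uniq[OF x _ _ _ _] \<Phi>P[OF x] y unfolding P_def b_def by blast
  next
    assume eq: "\<forall>k<n. y k = \<Phi> x k"
    have "H i (cat m x y) = H i (cat m x (\<Phi> x))" if i: "i < n" for i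
      by (rule K_holoD(2)[OF H[OF i]]) (use eq in \<open>auto simp: cat_def\<close>)
    then show "\<forall>i<n. H i (cat m x y) = 0" using \<Phi>P[OF x] unfolding P_def by simp
  qed
  have c4: "\<forall>k<n. im (\<Phi> x k) = 0" if x: "near m c \<delta>1 x" and r: "\<forall>l<m. im (x l) = 0" for x
  proof -
    have "\<exists>y. P x y \<and> (True \<longrightarrow> (\<forall>k<n. im (y k) = 0))" by (rule exP[OF x]) (rule r)
    then obtain y where y: "P x y" "\<forall>k<n. im (y k) = 0" by blast
    have "\<Phi> x k = y k" if "k < n" for k
      using uniq[OF x _ _ _ _ that] \<Phi>P[OF x] y(1) unfolding P_def by blast
    then show ?thesis using y(2) by simp
  qed
  have c5: "\<delta>2 \<le> \<rho>" using \<delta>2 \<delta>0 by linarith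
  show ?thesis
  proof (rule exI[of _ \<delta>1], rule exI[of _ \<delta>2], rule exI[of _ \<Phi>], intro conjI allI impI)
    show "im (\<Phi> x k) = 0" if "near m c \<delta>1 x" "\<forall>l<m. im (x l) = 0" "k < n" for x k
      using c4[OF that(1,2)] that(3) by simp
  qed (fact \<delta>1(1) \<delta>1(4) \<delta>2(1) c5 | rule c1 c2 c3, assumption+)+
qed


section \<open>\<open>R\<close>-analytic functions and their extensions to \<open>K\<close>\<close>

lemma realified_graph_iff:
  fixes e :: "nat \<Rightarrow> 'r"
  assumes V: "V \<subseteq> carrier_vec p"
  defines "Z \<equiv> vec p (\<lambda>i. Adjoin_I (e (2 * i)) (e (2 * i + 1)))"
  shows "vec (2 * (p + 1)) e \<in> realify ` graph_on V F \<longleftrightarrow> Z \<in> V \<and> Adjoin_I (e (2 * p)) (e (2 * p + 1)) = F Z"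
proof
  assume "vec (2 * (p + 1)) e \<in> realify ` graph_on V F"
  then obtain z where z: "z \<in> V" and eq: "vec (2 * (p + 1)) e = realify (z @\<^sub>v vec 1 (\<lambda>_. F z))" by (auto simp: graph_on_def)
  have d: "dim_vec z = p" using z V by auto
  have e: "e i = (if even i then re else im) ((z @\<^sub>v vec 1 (\<lambda>_. F z)) $ (i div 2))" if "i < 2 * (p + 1)" for i
    using arg_cong[OF eq, of "\<lambda>v. v $ i"] that by (simp add: realify_def d)
  have "Z = z"
  proof (rule eq_vecI)
    fix i assume "i < dim_vec z"
    then show "Z $ i = z $ i" using e[of "2 * i"] e[of "2 * i + 1"] d by (simp add: Z_def)
  qed (simp add: Z_def d)
  moreover have "Adjoin_I (e (2 * p)) (e (2 * p + 1)) = F z" using e[of "2 * p"] e[of "2 * p + 1"] d by simp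
  ultimately show "Z \<in> V \<and> Adjoin_I (e (2 * p)) (e (2 * p + 1)) = F Z" using z by simp
next
  assume A: "Z \<in> V \<and> Adjoin_I (e (2 * p)) (e (2 * p + 1)) = F Z"
  have d: "dim_vec Z = p" by (simp add: Z_def)
  have "vec (2 * (p + 1)) e = realify (Z @\<^sub>v vec 1 (\<lambda>_. F Z))"
  proof (rule eq_vecI)
    fix i assume "i < dim_vec (realify (Z @\<^sub>v vec 1 (\<lambda>_. F Z)))"
    then have i: "i < 2 * (p + 1)" by (simp add: realify_def d)
    have r: "realify (Z @\<^sub>v vec 1 (\<lambda>_. F Z)) $ i = (if even i then re else im) ((Z @\<^sub>v vec 1 (\<lambda>_. F Z)) $ (i div 2))"
      using i by (simp add: realify_def d)
    have ip: "i div 2 < p + 1" using i by simp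
    have "(Z @\<^sub>v vec 1 (\<lambda>_. F Z)) $ (i div 2) = Adjoin_I (e (2 * (i div 2))) (e (2 * (i div 2) + 1))"
    proof (cases "i div 2 < p")
      case True
      then show ?thesis by (simp add: d) (simp add: Z_def)
    next
      case False
      then have "i div 2 = p" using ip by simp
      then show ?thesis using A by (simp add: d)
    qed
    then show "vec (2 * (p + 1)) e $ i = realify (Z @\<^sub>v vec 1 (\<lambda>_. F Z)) $ i"
      unfolding r using i by (cases "even i") (simp_all add: odd_two_times_div_two_succ)
  qed (simp add: realify_def d)
  then show "vec (2 * (p + 1)) e \<in> realify ` graph_on V F" using A unfolding graph_on_def by blast
qed

text \<open>Extension by 0 makes \<open>F\<close> total. The case distinction is definable because
  \<open>V\<close> is the projection of the graph.\<close>

lemma dfunVK_of_definable: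
  assumes def: "definable M (2 * (p + 1)) (realify ` graph_on V F)" and V: "V \<subseteq> carrier_vec p"
  shows "dfunVK (\<lambda>z. if vec p z \<in> V then F (vec p z) else 0)"
proof -
  define Z where "Z = (\<lambda>(e :: nat \<Rightarrow> 'r). vec p (\<lambda>i. Adjoin_I (e (2 * i)) (e (2 * i + 1))))"
  define G where "G = (\<lambda>e. Z e \<in> V \<and> Adjoin_I (e (2 * p)) (e (2 * p + 1)) = F (Z e))"
  have "dpred (\<lambda>e. vec (2 * (p + 1)) e \<in> realify ` graph_on V F)" using def by (simp add: definable_iff_dpred)
  then have G: "dpred G" unfolding G_def Z_def realified_graph_iff[OF V] .
  \<comment> \<open>Places \<open>2 * p\<close> and \<open>2 * p + 1\<close> of the environment
    carry the value of \<open>F\<close>. They are filled with arbitrary definable functions, while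
    \<open>\<sigma>\<close> moves the argument out of the way of quantifiers.\<close>
  have subst: "dpred (\<lambda>e. G (\<lambda>i. if i = 2 * p then s e else if i = 2 * p + 1 then t e else e (\<sigma> i)))"
    if "dfun s" "dfun t" for s t \<sigma>
  proof -
    have "dfun (\<lambda>e. if i = 2 * p then s e else if i = 2 * p + 1 then t e else e (\<sigma> i))" for i
      using that dfun_var by (cases "i = 2 * p"; cases "i = 2 * p + 1") simp_all
    from dpred_subst[OF G this] show ?thesis .
  qed
  have Geq: "G (\<lambda>i. if i = 2 * p then s else if i = 2 * p + 1 then t else e i) \<longleftrightarrow> Z e \<in> V \<and> Adjoin_I s t = F (Z e)" for s t e
  proof -
    have "Z (\<lambda>i. if i = 2 * p then s else if i = 2 * p + 1 then t else e i) = Z e"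
      unfolding Z_def by (rule eq_vecI) auto
    then show ?thesis by (simp add: G_def)
  qed
  have subst': "dpred (\<lambda>e. Z (\<lambda>i. e (\<sigma> i)) \<in> V \<and> Adjoin_I (s e) (t e) = F (Z (\<lambda>i. e (\<sigma> i))))" if "dfun s" "dfun t" for s t \<sigma>
    using subst[OF that, of \<sigma>] unfolding Geq .
  define g where "g = (\<lambda>e. if Z e \<in> V then F (Z e) else 0)"
  have inV: "dpred (\<lambda>e. Z e \<in> V)"
  proof -
    have "dpred (\<lambda>e. \<exists>s t. Z e \<in> V \<and> Adjoin_I s t = F (Z e))"
    proof (rule dpred_ex, rule dpred_ex)
      show "dpred (\<lambda>e. Z (\<lambda>i. e (Suc (Suc i))) \<in> V \<and> Adjoin_I (e (Suc 0)) (e 0) = F (Z (\<lambda>i. e (Suc (Suc i)))))"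
        by (rule subst') (rule dfun_var)+
    qed
    moreover have "(\<exists>s t. Z e \<in> V \<and> Adjoin_I s t = F (Z e)) \<longleftrightarrow> Z e \<in> V" for e
      using adjoin_i.collapse[of "F (Z e)"] by blast
    ultimately show ?thesis by simp
  qed
  have "dfun (\<lambda>e. re (g e))"
  proof (rule dfunI[where P = "\<lambda>e x. (\<exists>t. Z e \<in> V \<and> Adjoin_I x t = F (Z e)) \<or> (Z e \<notin> V \<and> x = 0)"])
    have "dpred (\<lambda>e. \<exists>t. Z (\<lambda>i. e (Suc i)) \<in> V \<and> Adjoin_I (e 0) t = F (Z (\<lambda>i. e (Suc i))))"
    proof (rule dpred_ex)
      show "dpred (\<lambda>e. Z (\<lambda>i. e (Suc (Suc i))) \<in> V \<and> Adjoin_I (e (Suc 0)) (e 0) = F (Z (\<lambda>i. e (Suc (Suc i)))))"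
        by (rule subst') (rule dfun_var)+
    qed
    moreover have "dpred (\<lambda>e. Z (\<lambda>i. e (Suc i)) \<in> V)" using dpred_subst[OF inV, of "\<lambda>i e. e (Suc i)"] dfun_var by simp
    ultimately show "dpred (\<lambda>e. (\<exists>t. Z (\<lambda>i. e (Suc i)) \<in> V \<and> Adjoin_I (e 0) t = F (Z (\<lambda>i. e (Suc i)))) \<or> (Z (\<lambda>i. e (Suc i)) \<notin> V \<and> e 0 = 0))"
      by (intro dpred_disj dpred_conj dpred_not dpred_eq dfun_var dfun_const)
    show "((\<exists>t. Z e \<in> V \<and> Adjoin_I x t = F (Z e)) \<or> (Z e \<notin> V \<and> x = 0)) = (x = re (g e))" for e x
      by (cases "F (Z e)") (auto simp: g_def)
  qed
  moreover have "dfun (\<lambda>e. im (g e))"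
  proof (rule dfunI[where P = "\<lambda>e x. (\<exists>t. Z e \<in> V \<and> Adjoin_I t x = F (Z e)) \<or> (Z e \<notin> V \<and> x = 0)"])
    have "dpred (\<lambda>e. \<exists>t. Z (\<lambda>i. e (Suc i)) \<in> V \<and> Adjoin_I t (e 0) = F (Z (\<lambda>i. e (Suc i))))"
    proof (rule dpred_ex)
      show "dpred (\<lambda>e. Z (\<lambda>i. e (Suc (Suc i))) \<in> V \<and> Adjoin_I (e 0) (e (Suc 0)) = F (Z (\<lambda>i. e (Suc (Suc i)))))"
        by (rule subst') (rule dfun_var)+
    qed
    moreover have "dpred (\<lambda>e. Z (\<lambda>i. e (Suc i)) \<in> V)" using dpred_subst[OF inV, of "\<lambda>i e. e (Suc i)"] dfun_var by simp
    ultimately show "dpred (\<lambda>e. (\<exists>t. Z (\<lambda>i. e (Suc i)) \<in> V \<and> Adjoin_I t (e 0) = F (Z (\<lambda>i. e (Suc i)))) \<or> (Z (\<lambda>i. e (Suc i)) \<notin> V \<and> e 0 = 0))"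
      by (intro dpred_disj dpred_conj dpred_not dpred_eq dfun_var dfun_const)
    show "((\<exists>t. Z e \<in> V \<and> Adjoin_I t x = F (Z e)) \<or> (Z e \<notin> V \<and> x = 0)) = (x = im (g e))" for e x
      by (cases "F (Z e)") (auto simp: g_def)
  qed
  ultimately show ?thesis unfolding dfunVK_def dfunK_def g_def Z_def by blast
qed

lemma K_holo_of_K_differentiable:
  assumes F: "K_differentiable M p V F" and \<rho>: "0 < \<rho>" and sub: "polydisc absK p (vec p c) \<rho> \<subseteq> V"
  shows "K_holo p c \<rho> (\<lambda>z. if vec p z \<in> V then F (vec p z) else 0)" (is "K_holo p c \<rho> ?G")
proof -
  have V: "V \<subseteq> carrier_vec p" and def: "definable M (2 * (p + 1)) (realify ` graph_on V F)"
    and cont: "continuousV absK p V F" and der: "\<forall>j<p. \<forall>z\<in>V. \<exists>d. has_partial_deriv absK p F j z d"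
    using F by (auto simp: K_differentiable_def openV_def)
  have inV: "vec p z \<in> V" if "near p c \<rho> z" for z
    using sub that by (auto simp: polydisc_def near_def)
  have G: "?G z = F (vec p z)" if "near p c \<rho> z" for z using inV[OF that] by simp
  show ?thesis unfolding K_holo_def
  proof (intro conjI allI impI)
    show "dfunVK ?G" by (rule dfunVK_of_definable[OF def V])
  next
    fix z w :: "nat \<Rightarrow> 'r adjoin_i" assume "\<forall>i<p. z i = w i"
    then have "vec p z = vec p w" by auto
    then show "?G z = ?G w" by simp
  next
    fix z and \<epsilon> :: 'r assume z: "near p c \<rho> z \<and> 0 < \<epsilon>"
    then obtain \<delta> where \<delta>: "\<delta> > 0" "\<forall>x \<in> V \<inter> polydisc absK p (vec p z) \<delta>. absK (F x - F (vec p z)) < \<epsilon>"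
      using cont inV unfolding continuousV_def by meson
    have "absK (?G w - ?G z) < \<epsilon>" if w: "near p c \<rho> w \<and> near p z \<delta> w" for w
    proof -
      have "vec p w \<in> V \<inter> polydisc absK p (vec p z) \<delta>" using inV w by (auto simp: polydisc_def near_def)
      then have "absK (F (vec p w) - F (vec p z)) < \<epsilon>" using \<delta>(2) by blast
      then show ?thesis using G w z by simp
    qed
    then show "\<exists>\<delta>>0. \<forall>w. near p c \<rho> w \<and> near p z \<delta> w \<longrightarrow> absK (?G w - ?G z) < \<epsilon>"
      using \<delta>(1) by (intro exI[of _ \<delta>]) blast
  next
    fix j z assume j: "j < p" and z: "near p c \<rho> z"
    obtain d where d: "has_partial_deriv absK p F j (vec p z) d" using der j inV[OF z] by blast
    obtain \<eta> where \<eta>: "\<eta> > 0" "\<forall>i<p. absK (z i - c i) + \<eta> \<le> \<rho>" using near_open[OF z \<rho>] by blast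
    have "K_deriv (\<lambda>x. ?G (z(j := x))) (z j) d" unfolding K_deriv_def
    proof (intro allI impI)
      fix \<epsilon> :: 'r assume "0 < \<epsilon>"
      then obtain \<delta> where \<delta>: "\<delta> > 0" "\<forall>h. h \<noteq> 0 \<and> absK h < \<delta> \<longrightarrow>
        absK ((F (vec p z + h \<cdot>\<^sub>v unit_vec p j) - F (vec p z)) / h - d) < \<epsilon>" using d unfolding has_partial_deriv_def by meson
      have "absK ((?G (z(j := z j + h)) - ?G (z(j := z j))) / h - d) < \<epsilon>" if h: "h \<noteq> 0 \<and> absK h < min \<delta> \<eta>" for h
      proof -
        have "near p z \<eta> (z(j := z j + h))" using h \<eta>(1) by (simp add: near_def)
        then have "near p c \<rho> (z(j := z j + h))" by (rule near_trans[OF \<eta>(2)])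
        then have v: "vec p (z(j := z j + h)) \<in> V" by (rule inV)
        have "vec p (z(j := z j + h)) = vec p z + h \<cdot>\<^sub>v unit_vec p j" using j by (intro eq_vecI) auto
        then have e1: "?G (z(j := z j + h)) = F (vec p z + h \<cdot>\<^sub>v unit_vec p j)" using v by simp
        have e2: "?G (z(j := z j)) = F (vec p z)" using inV[OF z] by simp
        show ?thesis unfolding e1 e2 using \<delta>(2) h by simp
      qed
      then show "\<exists>\<delta>>0. \<forall>h. h \<noteq> 0 \<and> absK h < \<delta> \<longrightarrow> absK ((?G (z(j := z j + h)) - ?G (z(j := z j))) / h - d) < \<epsilon>"
        using \<delta>(1) \<eta>(1) by (intro exI[of _ "min \<delta> \<eta>"]) simp
    qed
    then show "\<exists>d. K_deriv (\<lambda>x. ?G (z(j := x))) (z j) d" ..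
  qed
qed

lemma K_differentiable_of_K_holo:
  assumes G: "K_holo p c \<rho> G" and \<rho>: "0 < \<rho>"
  shows "K_differentiable M p (polydisc absK p (vec p c) \<rho>) (\<lambda>z. G (\<lambda>i. z $ i))" (is "K_differentiable M p ?V ?F")
proof -
  have V: "?V \<subseteq> carrier_vec p" by (auto simp: polydisc_def)
  have nearV: "z \<in> ?V \<longleftrightarrow> z \<in> carrier_vec p \<and> near p c \<rho> (\<lambda>i. z $ i)" for z by (auto simp: polydisc_def near_def)
  have "openV absK p ?V" unfolding openV_def
  proof (intro conjI ballI V)
    fix z assume z: "z \<in> ?V"
    then obtain \<eta> where \<eta>: "\<eta> > 0" "\<forall>i<p. absK (z $ i - c i) + \<eta> \<le> \<rho>" using near_open[OF _ \<rho>, of p c "\<lambda>i. z $ i"] nearV by blast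
    have "polydisc absK p z \<eta> \<subseteq> ?V"
    proof
      fix w assume w: "w \<in> polydisc absK p z \<eta>"
      then have "near p (\<lambda>i. z $ i) \<eta> (\<lambda>i. w $ i)" by (simp add: polydisc_def near_def)
      then have "near p c \<rho> (\<lambda>i. w $ i)" by (rule near_trans[OF \<eta>(2)])
      then show "w \<in> ?V" using w unfolding nearV by (simp add: polydisc_def)
    qed
    then show "\<exists>\<epsilon>>0. polydisc absK p z \<epsilon> \<subseteq> ?V" using \<eta>(1) by blast
  qed
  moreover have "definable M (2 * (p + 1)) (realify ` graph_on ?V ?F)" unfolding definable_iff_dpred
  proof
    show "realify ` graph_on ?V ?F \<subseteq> carrier_vec (2 * (p + 1))"
    proof
      fix v assume "v \<in> realify ` graph_on ?V ?F"
      then obtain z where "z \<in> ?V" "v = realify (z @\<^sub>v vec 1 (\<lambda>_. ?F z))" by (auto simp: graph_on_def)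
      then show "v \<in> carrier_vec (2 * (p + 1))" using V by (auto simp: realify_def)
    qed
    let ?z = "\<lambda>(e :: nat \<Rightarrow> 'r) i. Adjoin_I (e (2 * i)) (e (2 * i + 1))"
    have "vec p (?z e) \<in> ?V \<longleftrightarrow> near p c \<rho> (?z e)" for e by (simp add: nearV near_def)
    moreover have "?F (vec p (?z e)) = G (?z e)" for e by (rule K_holoD(2)[OF G]) simp
    moreover have "dpred (\<lambda>e. near p c \<rho> (?z e) \<and> Adjoin_I (e (2 * p)) (e (2 * p + 1)) = G (?z e))"
      unfolding near_def
      by (intro dpred_conj dpred_finite_all dpred_less dfun_absK dfunK_diff dfunK_const dfunK_Adjoin_I dfun_var dfun_const
          dpred_eqK K_holoD(1)[OF G, unfolded dfunVK_def])
    ultimately show "dpred (\<lambda>e. vec (2 * (p + 1)) e \<in> realify ` graph_on ?V ?F)"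
      unfolding realified_graph_iff[OF V] by simp
  qed
  moreover have "continuousV absK p ?V ?F" unfolding continuousV_def
  proof (intro ballI allI impI)
    fix z and \<epsilon> :: 'r assume z: "z \<in> ?V" and \<epsilon>: "0 < \<epsilon>"
    have "near p c \<rho> (\<lambda>i. z $ i)" using z nearV by blast
    then obtain \<delta> where \<delta>: "\<delta> > 0" "\<forall>w. near p c \<rho> w \<and> near p (\<lambda>i. z $ i) \<delta> w \<longrightarrow> absK (G w - G (\<lambda>i. z $ i)) < \<epsilon>"
      using K_holoD(3)[OF G _ \<epsilon>] by meson
    have "absK (?F w - ?F z) < \<epsilon>" if w: "w \<in> ?V \<inter> polydisc absK p z \<delta>" for w
    proof -
      have "near p c \<rho> (\<lambda>i. w $ i) \<and> near p (\<lambda>i. z $ i) \<delta> (\<lambda>i. w $ i)" using w by (simp add: polydisc_def near_def)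
      then show ?thesis by (rule \<delta>(2)[rule_format])
    qed
    then show "\<exists>\<delta>>0. \<forall>w \<in> ?V \<inter> polydisc absK p z \<delta>. absK (?F w - ?F z) < \<epsilon>"
      using \<delta>(1) by (intro exI[of _ \<delta>]) blast
  qed
  moreover have "\<exists>d. has_partial_deriv absK p ?F j z d" if j: "j < p" and z: "z \<in> ?V" for j z
  proof -
    obtain d where d: "K_deriv (\<lambda>x. G ((\<lambda>i. z $ i)(j := x))) (z $ j) d"
      using K_holoD(4)[OF G j, of "\<lambda>i. z $ i"] z nearV by blast
    have dz: "dim_vec z = p" using z V by auto
    have "?F (z + h \<cdot>\<^sub>v unit_vec p j) = G ((\<lambda>i. z $ i)(j := z $ j + h))" for h
      by (rule K_holoD(2)[OF G]) (use j dz in auto)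
    moreover have "?F z = G ((\<lambda>i. z $ i)(j := z $ j))" by (rule K_holoD(2)[OF G]) auto
    ultimately have "has_partial_deriv absK p ?F j z d" using d unfolding K_deriv_def has_partial_deriv_def by simp
    then show ?thesis ..
  qed
  ultimately show ?thesis unfolding K_differentiable_def by blast
qed

end

lemma of_R_divide: "of_R (x / y) = of_R x / of_R y"
proof (cases "y = 0")
  case False
  have "of_R (x / y) * of_R y = of_R x" using False by (simp flip: of_R_simps(5))
  then show ?thesis using False by (simp add: nonzero_eq_divide_eq)
qed simp

lemma has_partial_deriv_abs_unique:
  assumes d: "has_partial_deriv abs p f j a d" and d': "has_partial_deriv abs p f j a d'"
  shows "d = d'"
proof (rule ccontr)
  assume "d \<noteq> d'"
  then have \<epsilon>: "0 < \<bar>d - d'\<bar> / 2" by simp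
  define q where "q = (\<lambda>h. (f (a + h \<cdot>\<^sub>v unit_vec p j) - f a) / h)"
  obtain \<delta> where \<delta>: "\<delta> > 0" "\<forall>h. h \<noteq> 0 \<and> \<bar>h\<bar> < \<delta> \<longrightarrow> \<bar>q h - d\<bar> < \<bar>d - d'\<bar> / 2"
    using d \<epsilon> unfolding has_partial_deriv_def q_def by meson
  obtain \<delta>' where \<delta>': "\<delta>' > 0" "\<forall>h. h \<noteq> 0 \<and> \<bar>h\<bar> < \<delta>' \<longrightarrow> \<bar>q h - d'\<bar> < \<bar>d - d'\<bar> / 2"
    using d' \<epsilon> unfolding has_partial_deriv_def q_def by meson
  have "0 < min \<delta> \<delta>'" using \<delta>(1) \<delta>'(1) by simp
  then obtain h where h: "0 < h" "h < min \<delta> \<delta>'" using dense by blast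
  then have "\<bar>q h - d\<bar> < \<bar>d - d'\<bar> / 2" "\<bar>q h - d'\<bar> < \<bar>d - d'\<bar> / 2" using \<delta>(2) \<delta>'(2) by simp_all
  moreover have "\<bar>d - d'\<bar> \<le> \<bar>q h - d\<bar> + \<bar>q h - d'\<bar>" by linarith
  ultimately show False using field_sum_of_halves[of "\<bar>d - d'\<bar>"] by linarith
qed

text \<open>For real increments the difference quotients of \<open>g\<close> are those of
  \<open>f\<close>, so \<open>D\<close> is a limit of real numbers. A nonzero imaginary part would
  keep it at a fixed distance from all of them.\<close>

lemma K_deriv_eq_partial_deriv:
  fixes f :: "'r::real_closed_field vec \<Rightarrow> 'r"
  assumes D: "K_deriv g z D" and \<rho>: "0 < \<rho>"
    and g: "\<And>h. \<bar>h\<bar> < \<rho> \<Longrightarrow> g (z + of_R h) = of_R (f (a + h \<cdot>\<^sub>v unit_vec p j))"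
    and g0: "g z = of_R (f a)"
  shows "D = of_R (partial_deriv p f j a)"
proof -
  define q where "q = (\<lambda>h. (f (a + h \<cdot>\<^sub>v unit_vec p j) - f a) / h)"
  have lim: "\<exists>\<delta>>0. \<forall>h. h \<noteq> 0 \<and> \<bar>h\<bar> < \<delta> \<longrightarrow> absK (of_R (q h) - D) < \<epsilon>" if \<epsilon>: "0 < \<epsilon>" for \<epsilon>
  proof -
    obtain \<delta> where \<delta>: "\<delta> > 0" "\<forall>h. h \<noteq> 0 \<and> absK h < \<delta> \<longrightarrow> absK ((g (z + h) - g z) / h - D) < \<epsilon>"
      using D \<epsilon> unfolding K_deriv_def by meson
    have "absK (of_R (q h) - D) < \<epsilon>" if h: "h \<noteq> 0 \<and> \<bar>h\<bar> < min \<delta> \<rho>" for h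
    proof -
      have "(g (z + of_R h) - g z) / of_R h = of_R (q h)" using g[of h] g0 h by (simp add: q_def of_R_divide)
      then show ?thesis using \<delta>(2)[rule_format, of "of_R h"] h by simp
    qed
    then show ?thesis using \<delta>(1) \<rho> by (intro exI[of _ "min \<delta> \<rho>"]) simp
  qed
  have "has_partial_deriv abs p f j a (re D)" unfolding has_partial_deriv_def
  proof (intro allI impI)
    fix \<epsilon> :: 'r assume "0 < \<epsilon>"
    then obtain \<delta> where \<delta>: "\<delta> > 0" "\<forall>h. h \<noteq> 0 \<and> \<bar>h\<bar> < \<delta> \<longrightarrow> absK (of_R (q h) - D) < \<epsilon>" using lim by blast
    have "\<bar>q h - re D\<bar> < \<epsilon>" if "h \<noteq> 0 \<and> \<bar>h\<bar> < \<delta>" for h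
      using \<delta>(2)[rule_format, OF that] abs_re_le[of "of_R (q h) - D"] by simp
    then show "\<exists>\<delta>>0. \<forall>h. h \<noteq> 0 \<and> \<bar>h\<bar> < \<delta> \<longrightarrow> \<bar>(f (a + h \<cdot>\<^sub>v unit_vec p j) - f a) / h - re D\<bar> < \<epsilon>"
      using \<delta>(1) unfolding q_def by blast
  qed
  then have "partial_deriv p f j a = re D"
    unfolding partial_deriv_def using has_partial_deriv_abs_unique by (intro the_equality) blast+
  moreover have "im D = 0"
  proof (rule ccontr)
    assume "im D \<noteq> 0"
    then obtain \<delta> where \<delta>: "\<delta> > 0" "\<forall>h. h \<noteq> 0 \<and> \<bar>h\<bar> < \<delta> \<longrightarrow> absK (of_R (q h) - D) < \<bar>im D\<bar>" using lim[of "\<bar>im D\<bar>"] by auto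
    obtain h where "0 < h" "h < \<delta>" using dense[OF \<delta>(1)] by blast
    then have "absK (of_R (q h) - D) < \<bar>im D\<bar>" using \<delta>(2) by simp
    then show False using abs_im_le[of "of_R (q h) - D"] by simp
  qed
  ultimately show ?thesis by (simp add: K_eqI)
qed

context o_minimal_expansion
begin

lemma K_holo_mono:
  assumes G: "K_holo p c \<rho> G" and le: "\<rho>' \<le> \<rho>"
  shows "K_holo p c \<rho>' G"
  unfolding K_holo_def
proof (intro conjI allI impI)
  show "dfunVK G" by (rule K_holoD(1)[OF G])
  show "G z = G w" if "\<forall>i<p. z i = w i" for z w by (rule K_holoD(2)[OF G]) (use that in simp)
  show "\<exists>d. K_deriv (\<lambda>x. G (z(j := x))) (z j) d" if "j < p" "near p c \<rho>' z" for j z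
    by (rule K_holoD(4)[OF G that(1) near_mono[OF that(2) le]])
  show "\<exists>\<delta>>0. \<forall>w. near p c \<rho>' w \<and> near p z \<delta> w \<longrightarrow> absK (G w - G z) < \<epsilon>" if z: "near p c \<rho>' z \<and> 0 < \<epsilon>" for z \<epsilon>
  proof -
    obtain \<delta> where \<delta>: "\<delta> > 0" "\<forall>w. near p c \<rho> w \<and> near p z \<delta> w \<longrightarrow> absK (G w - G z) < \<epsilon>"
      using K_holoD(3)[OF G near_mono[OF _ le], of z \<epsilon>] z by blast
    then show ?thesis using near_mono[OF _ le] by (intro exI[of _ \<delta>]) blast
  qed
qed

lemma K_holo_of_R_analytic:
  assumes f: "R_analytic M p U f" and q: "q \<in> U" "q \<in> carrier_vec p"
  shows "\<exists>\<rho>>0. \<exists>G. K_holo p (\<lambda>i. of_R (q $ i)) \<rho> G \<and> (\<forall>x\<in>polydisc abs p q \<rho>. G (\<lambda>i. of_R (x $ i)) = of_R (f x))"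
proof -
  obtain Ua Va F where U: "openV abs p Ua" "q \<in> Ua" and V: "openV absK p Va" "map_vec of_R ` Ua \<subseteq> Va"
    and F: "K_differentiable M p Va F" "\<forall>x\<in>Ua. F (map_vec of_R x) = of_R (f x)"
    using f q(1) unfolding R_analytic_def by blast
  have vec: "vec p (\<lambda>i. of_R (x $ i)) = map_vec of_R x" if "x \<in> carrier_vec p" for x :: "'r vec"
    using that by (intro eq_vecI) auto
  obtain \<rho>1 where \<rho>1: "\<rho>1 > 0" "polydisc abs p q \<rho>1 \<subseteq> Ua" using U unfolding openV_def by blast
  have "map_vec of_R q \<in> Va" using U(2) V(2) by blast
  then obtain \<rho>2 where \<rho>2: "\<rho>2 > 0" "polydisc absK p (map_vec of_R q) \<rho>2 \<subseteq> Va" using V(1) unfolding openV_def by blast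
  define \<rho> where "\<rho> = min \<rho>1 \<rho>2"
  have \<rho>: "0 < \<rho>" using \<rho>1 \<rho>2 by (simp add: \<rho>_def)
  define G where "G = (\<lambda>z. if vec p z \<in> Va then F (vec p z) else 0)"
  have "polydisc absK p (vec p (\<lambda>i. of_R (q $ i))) \<rho> \<subseteq> Va"
    unfolding vec[OF q(2)] using \<rho>2(2) by (auto simp: polydisc_def \<rho>_def)
  from K_holo_of_K_differentiable[OF F(1) \<rho> this] have "K_holo p (\<lambda>i. of_R (q $ i)) \<rho> G" unfolding G_def .
  moreover have "G (\<lambda>i. of_R (x $ i)) = of_R (f x)" if x: "x \<in> polydisc abs p q \<rho>" for x
  proof -
    have "x \<in> polydisc abs p q \<rho>1" using x by (simp add: polydisc_def \<rho>_def)
    then have xU: "x \<in> Ua" using \<rho>1(2) by blast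
    then have "map_vec of_R x \<in> Va" using V(2) by blast
    moreover have "x \<in> carrier_vec p" using x by (simp add: polydisc_def)
    ultimately show ?thesis using F(2)[rule_format, OF xU] unfolding G_def by (simp only: vec if_True)
  qed
  ultimately show ?thesis using \<rho> by (intro exI[of _ \<rho>] conjI exI[of _ G] ballI)
qed

lemma openV_polydisc:
  assumes \<delta>: "0 < \<delta>"
  shows "openV abs p (polydisc abs p (a :: 'r vec) \<delta>)"
  unfolding openV_def
proof (intro conjI ballI)
  show "polydisc abs p a \<delta> \<subseteq> carrier_vec p" by (auto simp: polydisc_def)
  fix x assume x: "x \<in> polydisc abs p a \<delta>"
  \<comment> \<open>A real polydisc consists of the real points of a complex one, which makes the
    facts about \<open>near\<close> available.\<close>
  have n: "near p (\<lambda>i. of_R (u $ i)) r (\<lambda>i. of_R (v $ i)) \<longleftrightarrow> (\<forall>i<p. \<bar>v $ i - u $ i\<bar> < r)" for u v :: "'r vec" and r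
    by (simp add: near_def flip: of_R_simps(4))
  have "near p (\<lambda>i. of_R (a $ i)) \<delta> (\<lambda>i. of_R (x $ i))" using x by (simp add: n polydisc_def)
  then obtain \<eta> where \<eta>: "\<eta> > 0" "\<forall>i<p. absK (of_R (x $ i) - of_R (a $ i)) + \<eta> \<le> \<delta>" using near_open[OF _ \<delta>] by blast
  have "polydisc abs p x \<eta> \<subseteq> polydisc abs p a \<delta>"
  proof
    fix y assume y: "y \<in> polydisc abs p x \<eta>"
    then have "near p (\<lambda>i. of_R (x $ i)) \<eta> (\<lambda>i. of_R (y $ i))" by (simp add: n polydisc_def)
    from near_trans[OF \<eta>(2) this] y show "y \<in> polydisc abs p a \<delta>" by (simp add: n polydisc_def)
  qed
  then show "\<exists>\<epsilon>>0. polydisc abs p x \<epsilon> \<subseteq> polydisc abs p a \<delta>" using \<eta>(1) by blast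
qed

lemma dpred_polydisc: "dpred (\<lambda>e. vec p e \<in> polydisc abs p a \<delta>)"
proof -
  have "dpred (\<lambda>e. \<forall>i<p. absK (Adjoin_I (e i) 0 - of_R (a $ i)) < \<delta>)"
    by (intro dpred_finite_all dpred_less dfun_absK dfunK_diff dfunK_const dfunK_Adjoin_I dfun_var dfun_const)
  then show ?thesis by (simp add: polydisc_def flip: of_R_def of_R_simps(4))
qed

text \<open>One extension, \<open>G\<close> on the complex polydisc, serves at every point of the
  real one: by \<open>real\<close> its values at real points are those of its real part.\<close>

lemma C_omega_of_K_holo:
  assumes G: "K_holo p c \<delta> G" and \<delta>: "0 < \<delta>" and a: "a \<in> carrier_vec p" and c: "\<And>i. i < p \<Longrightarrow> c i = of_R (a $ i)"
    and real: "\<And>x. x \<in> polydisc abs p a \<delta> \<Longrightarrow> im (G (\<lambda>i. of_R (x $ i))) = 0"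
  shows "(\<lambda>x. re (G (\<lambda>i. of_R (x $ i)))) \<in> C_omega M p (polydisc abs p a \<delta>)" (is "?g \<in> C_omega M p ?V")
proof -
  have V: "?V \<subseteq> carrier_vec p" by (auto simp: polydisc_def)
  have vc: "vec p c = map_vec of_R a" using a c by (intro eq_vecI) auto
  have graph: "vec (p + 1) e \<in> graph_on ?V ?g \<longleftrightarrow> vec p e \<in> ?V \<and> e p = re (G (\<lambda>i. Adjoin_I (e i) 0))" for e
  proof -
    have g: "G (\<lambda>i. of_R (vec p e $ i)) = G (\<lambda>i. Adjoin_I (e i) 0)" by (rule K_holoD(2)[OF G]) (simp add: of_R_def)
    have "vec (p + 1) e = x @\<^sub>v vec 1 (\<lambda>_. ?g x) \<longleftrightarrow> x = vec p e \<and> e p = ?g x" if x: "x \<in> ?V" for x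
    proof
      have d: "dim_vec x = p" using x V by auto
      assume eq: "vec (p + 1) e = x @\<^sub>v vec 1 (\<lambda>_. ?g x)"
      have e: "e i = (x @\<^sub>v vec 1 (\<lambda>_. ?g x)) $ i" if "i < p + 1" for i
        using arg_cong[OF eq, of "\<lambda>v. v $ i"] that by simp
      have "x = vec p e" using e d by (intro eq_vecI) auto
      moreover have "e p = ?g x" using e[of p] d by simp
      ultimately show "x = vec p e \<and> e p = ?g x" ..
    next
      assume A: "x = vec p e \<and> e p = ?g x"
      then have d: "dim_vec x = p" by simp
      show "vec (p + 1) e = x @\<^sub>v vec 1 (\<lambda>_. ?g x)"
      proof (rule eq_vecI)
        fix i assume "i < dim_vec (x @\<^sub>v vec 1 (\<lambda>_. ?g x))"
        then have i: "i < p + 1" using d by simp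
        show "vec (p + 1) e $ i = (x @\<^sub>v vec 1 (\<lambda>_. ?g x)) $ i"
        proof (cases "i < p")
          case True
          have "x $ i = e i" using A True by simp
          then show ?thesis using True d by simp
        next
          case False
          then have "i = p" using i by simp
          then show ?thesis using A[THEN conjunct2] d by simp
        qed
      qed (simp add: d)
    qed
    then have "vec (p + 1) e \<in> graph_on ?V ?g \<longleftrightarrow> (\<exists>x\<in>?V. x = vec p e \<and> e p = ?g x)" unfolding graph_on_def by blast
    also have "\<dots> \<longleftrightarrow> vec p e \<in> ?V \<and> e p = ?g (vec p e)" by blast
    finally show ?thesis unfolding g .
  qed
  have "definable M (p + 1) (graph_on ?V ?g)" unfolding definable_iff_dpred
  proof
    have "x @\<^sub>v vec 1 (\<lambda>_. ?g x) \<in> carrier_vec (p + 1)" if "x \<in> ?V" for x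
      by (rule append_carrier_vec[OF subsetD[OF V that] vec_carrier])
    then show "graph_on ?V ?g \<subseteq> carrier_vec (p + 1)" unfolding graph_on_def by (rule image_subsetI)
    have "dfunK (\<lambda>e. G (\<lambda>i. Adjoin_I (e i) 0))"
      by (rule dfunVK_comp[OF K_holoD(1)[OF G]]) (intro dfunK_Adjoin_I dfun_var dfun_const)
    then show "dpred (\<lambda>e. vec (p + 1) e \<in> graph_on ?V ?g)" unfolding graph
      by (intro dpred_conj dpred_polydisc dpred_eq dfun_var dfun_re)
  qed
  moreover have "R_analytic M p ?V ?g" unfolding R_analytic_def
  proof (intro ballI exI conjI)
    fix x assume "x \<in> ?V" then show "x \<in> ?V" .
    have K: "K_differentiable M p (polydisc absK p (vec p c) \<delta>) (\<lambda>z. G (\<lambda>i. z $ i))"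
      by (rule K_differentiable_of_K_holo[OF G \<delta>])
    then show "K_differentiable M p (polydisc absK p (vec p c) \<delta>) (\<lambda>z. G (\<lambda>i. z $ i))" "openV absK p (polydisc absK p (vec p c) \<delta>)"
      by (simp_all add: K_differentiable_def)
    show "map_vec of_R ` ?V \<subseteq> polydisc absK p (vec p c) \<delta>"
      using a unfolding vc by (auto simp: polydisc_def simp flip: of_R_simps(4))
  next
    fix x y assume y: "y \<in> ?V"
    have "G (\<lambda>i. map_vec of_R y $ i) = G (\<lambda>i. of_R (y $ i))" by (rule K_holoD(2)[OF G]) (use y V in auto)
    then show "G (\<lambda>i. map_vec of_R y $ i) = of_R (?g y)" using real[OF y] by (simp add: K_eqI)
  qed (auto intro: openV_polydisc[OF \<delta>])
  ultimately show ?thesis using openV_polydisc[OF \<delta>] unfolding C_omega_def by blast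
qed

end

section \<open>The implicit function theorem over \<open>R\<close>\<close>

lemma inverse_mat_sums:
  fixes J :: "'a::field mat"
  assumes J: "J \<in> carrier_mat n n" and inv: "invertible_mat J"
  shows "\<exists>B. (\<forall>i<n. \<forall>k<n. (\<Sum>j<n. B $$ (i, j) * J $$ (j, k)) = (if i = k then 1 else 0)) \<and>
    (\<forall>i<n. \<forall>k<n. (\<Sum>j<n. J $$ (i, j) * B $$ (j, k)) = (if i = k then 1 else 0))"
proof -
  obtain B where B: "J * B = 1\<^sub>m (dim_row J)" "B * J = 1\<^sub>m (dim_row B)"
    using inv unfolding invertible_mat_def inverts_mat_def by blast
  have dc: "dim_col B = n" using arg_cong[OF B(1), of dim_col] J by simp
  have dr: "dim_row B = n" using arg_cong[OF B(2), of dim_col] J by simp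
  have prod: "(\<Sum>j<n. C $$ (i, j) * D $$ (j, k)) = (if i = k then 1 else 0)"
    if "C \<in> carrier_mat n n" "D \<in> carrier_mat n n" "C * D = 1\<^sub>m n" "i < n" "k < n" for C D :: "'a mat" and i k
  proof -
    have "(C * D) $$ (i, k) = (\<Sum>j<n. C $$ (i, j) * D $$ (j, k))"
      using that(1,2,4,5) by (simp add: scalar_prod_def atLeast0LessThan)
    then show ?thesis using that(3-5) by simp
  qed
  have Bc: "B \<in> carrier_mat n n" using dc dr by blast
  have "J * B = 1\<^sub>m n" "B * J = 1\<^sub>m n" using B J dr by auto
  then show ?thesis using prod[OF Bc J] prod[OF J Bc] by (intro exI[of _ B] conjI allI impI)
qed

context o_minimal_expansion
begin

text \<open>Over real \<open>x\<close> the solution \<open>\<Phi>\<close> is real, so taking real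
  parts in \<open>\<phi>\<close> loses nothing, and the zeros of \<open>f\<close> in the product of
  \<open>V\<close> and \<open>W\<close> are the real zeros of the extended equations.\<close>

theorem implicit_function:
  assumes U: "openV abs (m + n) U" and f: "f \<in> C_omega_map M (m + n) n U"
    and a: "a \<in> carrier_vec m" and b: "b \<in> carrier_vec n" and ab: "a @\<^sub>v b \<in> U" and f0: "f (a @\<^sub>v b) = 0\<^sub>v n"
    and inv: "invertible_mat (mat n n (\<lambda>(j, k). partial_deriv (m + n) (\<lambda>z. f z $ j) (m + k) (a @\<^sub>v b)))"
  shows "\<exists>V W \<phi>.
           definable M m V \<and> openV abs m V \<and> a \<in> V \<and>
           definable M n W \<and> openV abs n W \<and> b \<in> W \<and>
           (\<forall>x\<in>V. \<forall>y\<in>W. x @\<^sub>v y \<in> U) \<and>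
           \<phi> \<in> C_omega_map M m n V \<and> \<phi> ` V \<subseteq> W \<and>
           (\<forall>x\<in>V. \<forall>y\<in>W. f (x @\<^sub>v y) = 0\<^sub>v n \<longleftrightarrow> y = \<phi> x)"
proof -
  define p where "p = m + n"
  define q where "q = a @\<^sub>v b"
  define c where "c = (\<lambda>i. of_R (q $ i))"
  have q: "q \<in> U" "q \<in> carrier_vec p" using ab a b by (simp_all add: q_def p_def)
  have ca: "c i = of_R (a $ i)" if "i < m" for i using that a b by (simp add: c_def q_def)
  have cb: "c (m + k) = of_R (b $ k)" if "k < n" for k using that a b by (simp add: c_def q_def)
  \<comment> \<open>Each component has an extension with a radius of its own. The property survives
    shrinking, so one radius serves all components.\<close>
  let ?Q = "\<lambda>j \<rho>. \<exists>G. K_holo p c \<rho> G \<and> (\<forall>x\<in>polydisc abs p q \<rho>. G (\<lambda>i. of_R (x $ i)) = of_R (f x $ j))"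
  have "\<exists>\<rho>>0. \<forall>j<n. ?Q j \<rho>"
  proof (rule finite_uniform)
    show "\<exists>\<rho>>0. ?Q j \<rho>" if j: "j < n" for j
    proof -
      have "R_analytic M p U (\<lambda>x. f x $ j)" using f j by (simp add: C_omega_map_def C_omega_def p_def)
      from K_holo_of_R_analytic[OF this q] show ?thesis unfolding c_def .
    qed
    show "?Q j \<rho>'" if A: "?Q j \<rho>" "\<rho>' \<le> \<rho>" for j \<rho> \<rho>'
    proof -
      obtain G where G: "K_holo p c \<rho> G" "\<forall>x\<in>polydisc abs p q \<rho>. G (\<lambda>i. of_R (x $ i)) = of_R (f x $ j)" using A(1) by (elim exE conjE)
      have "polydisc abs p q \<rho>' \<subseteq> polydisc abs p q \<rho>" using A(2) by (auto simp: polydisc_def less_le_trans)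
      then show ?thesis using K_holo_mono[OF G(1) A(2)] G(2) by (intro exI[of _ G] conjI ballI) (simp_all add: subset_iff)
    qed
  qed
  then obtain \<rho>1 where \<rho>1: "\<rho>1 > 0" "\<forall>j<n. ?Q j \<rho>1" by (elim exE conjE)
  obtain \<rho>2 where \<rho>2: "\<rho>2 > 0" "polydisc abs p q \<rho>2 \<subseteq> U" using U q(1) unfolding openV_def p_def by blast
  define \<rho> where "\<rho> = min \<rho>1 \<rho>2"
  have \<rho>: "0 < \<rho>" "\<rho> \<le> \<rho>1" "\<rho> \<le> \<rho>2" using \<rho>1(1) \<rho>2(1) by (simp_all add: \<rho>_def)
  have mono: "x \<in> polydisc abs p q r'" if "x \<in> polydisc abs p q r" "r \<le> r'" for x r r'
    using that by (auto simp: polydisc_def less_le_trans)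
  define G where "G = (\<lambda>j. SOME G. K_holo p c \<rho>1 G \<and> (\<forall>x\<in>polydisc abs p q \<rho>1. G (\<lambda>i. of_R (x $ i)) = of_R (f x $ j)))"
  have Gj: "K_holo p c \<rho>1 (G j) \<and> (\<forall>x\<in>polydisc abs p q \<rho>1. G j (\<lambda>i. of_R (x $ i)) = of_R (f x $ j))" if "j < n" for j
    using someI_ex[OF \<rho>1(2)[rule_format, OF that]] unfolding G_def .
  have G: "K_holo p c \<rho> (G j)" if "j < n" for j by (rule K_holo_mono[OF Gj[OF that, THEN conjunct1] \<rho>(2)])
  have Gf: "G j (\<lambda>i. of_R (x $ i)) = of_R (f x $ j)" if "j < n" "x \<in> polydisc abs p q \<rho>" for j x
    by (rule Gj[OF that(1), THEN conjunct2, rule_format]) (rule mono[OF that(2) \<rho>(2)])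
  have inU: "x \<in> U" if "x \<in> polydisc abs p q \<rho>" for x using mono[OF that \<rho>(3)] \<rho>2(2) by blast
  have qq: "q \<in> polydisc abs p q \<rho>" using q(2) \<rho>(1) by (simp add: polydisc_def)
  have Gc: "G j c = of_R (f q $ j)" if "j < n" for j unfolding c_def by (rule Gf[OF that qq])
  define J where "J = mat n n (\<lambda>(j, k). partial_deriv p (\<lambda>z. f z $ j) (m + k) q)"
  have Jc: "J \<in> carrier_mat n n" by (simp add: J_def)
  have "invertible_mat J" using inv by (simp add: J_def p_def q_def)
  from inverse_mat_sums[OF Jc this] obtain B where
    B: "\<forall>i<n. \<forall>k<n. (\<Sum>j<n. B $$ (i, j) * J $$ (j, k)) = (if i = k then 1 else 0)"
      "\<forall>i<n. \<forall>k<n. (\<Sum>j<n. J $$ (i, j) * B $$ (j, k)) = (if i = k then 1 else 0)" by (elim exE conjE)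
  note BJ = B(1)[rule_format] and JB = B(2)[rule_format]
  have Gder: "K_deriv (\<lambda>x. G j (c(m + k := x))) (c (m + k)) (of_R (J $$ (j, k)))" if j: "j < n" and k: "k < n" for j k
  proof -
    have kp: "m + k < p" using k by (simp add: p_def)
    obtain d where d: "K_deriv (\<lambda>x. G j (c(m + k := x))) (c (m + k)) d"
      using K_holoD(4)[OF G[OF j] kp near_self[OF \<rho>(1)]] by blast
    have "d = of_R (partial_deriv p (\<lambda>z. f z $ j) (m + k) q)"
    proof (rule K_deriv_eq_partial_deriv[OF d \<rho>(1)])
      fix h :: 'r assume h: "\<bar>h\<bar> < \<rho>"
      let ?x = "q + h \<cdot>\<^sub>v unit_vec p (m + k)"
      have "?x \<in> polydisc abs p q \<rho>" using q(2) h \<rho>(1) kp by (auto simp: polydisc_def)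
      then have "G j (\<lambda>i. of_R (?x $ i)) = of_R (f ?x $ j)" by (rule Gf[OF j])
      moreover have "G j (c(m + k := c (m + k) + of_R h)) = G j (\<lambda>i. of_R (?x $ i))"
        by (rule K_holoD(2)[OF G[OF j]]) (use q(2) kp in \<open>auto simp: c_def\<close>)
      ultimately show "G j (c(m + k := c (m + k) + of_R h)) = of_R (f ?x $ j)" by simp
    next
      show "G j (c(m + k := c (m + k))) = of_R (f q $ j)" using Gc[OF j] by simp
    qed
    then show ?thesis using d j k by (simp add: J_def)
  qed
  \<comment> \<open>Both products with the inverse matter: \<open>BJ\<close> normalises the
    \<open>y\<close>-derivatives at \<open>c\<close>, and \<open>JB\<close> recovers
    \<open>G\<close> from \<open>H\<close>, so that the zeros remain the same.\<close>
  define H where "H = (\<lambda>i z. \<Sum>j<n. of_R (B $$ (i, j)) * G j z)"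
  have HG: "(\<forall>i<n. H i z = 0) \<longleftrightarrow> (\<forall>j<n. G j z = 0)" for z
  proof
    assume H0: "\<forall>i<n. H i z = 0"
    show "\<forall>j<n. G j z = 0"
    proof (intro allI impI)
      fix j assume j: "j < n"
      have "(\<Sum>i<n. of_R (J $$ (j, i)) * H i z) = (\<Sum>i<n. \<Sum>l<n. of_R (J $$ (j, i) * B $$ (i, l)) * G l z)"
        by (simp add: H_def sum_distrib_left mult.assoc)
      also have "\<dots> = (\<Sum>l<n. \<Sum>i<n. of_R (J $$ (j, i) * B $$ (i, l)) * G l z)" by (rule sum.swap)
      also have "\<dots> = (\<Sum>l<n. of_R (\<Sum>i<n. J $$ (j, i) * B $$ (i, l)) * G l z)" by (simp only: of_R_sum sum_distrib_right)
      also have "\<dots> = (\<Sum>l<n. if j = l then G l z else 0)" by (intro sum.cong) (simp_all add: JB[OF j])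
      also have "\<dots> = G j z" using j by simp
      finally show "G j z = 0" using H0 by simp
    qed
  qed (simp add: H_def)
  have "\<exists>\<delta>1 \<delta>2 \<Phi>. 0 < \<delta>1 \<and> \<delta>1 \<le> \<rho> \<and> 0 < \<delta>2 \<and> \<delta>2 \<le> \<rho> \<and> (\<forall>k<n. K_holo m c \<delta>1 (\<lambda>x. \<Phi> x k)) \<and>
    (\<forall>x. near m c \<delta>1 x \<longrightarrow> near n (\<lambda>k. c (m + k)) \<delta>2 (\<Phi> x) \<and>
      (\<forall>y. near n (\<lambda>k. c (m + k)) \<delta>2 y \<longrightarrow> ((\<forall>i<n. H i (cat m x y) = 0) \<longleftrightarrow> (\<forall>k<n. y k = \<Phi> x k))) \<and>
      ((\<forall>l<m. im (x l) = 0) \<longrightarrow> (\<forall>k<n. im (\<Phi> x k) = 0)))"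
  proof (rule implicit_function_K)
    show "K_holo (m + n) c \<rho> (H i)" for i
      unfolding H_def by (rule K_holo_lincomb) (use G in \<open>simp add: p_def\<close>)
    show "K_deriv (\<lambda>x. H i (c(m + k := x))) (c (m + k)) (if i = k then 1 else 0)" if ik: "i < n" "k < n" for i k
    proof -
      have "K_deriv (\<lambda>x. H i (c(m + k := x))) (c (m + k)) (\<Sum>j<n. of_R (B $$ (i, j)) * of_R (J $$ (j, k)))"
        unfolding H_def by (rule K_deriv_lincomb) (rule Gder[OF _ ik(2)])
      moreover have "(\<Sum>j<n. of_R (B $$ (i, j)) * of_R (J $$ (j, k))) = (if i = k then 1 else 0)"
        using arg_cong[OF BJ[OF ik], of of_R] by (simp add: of_R_sum)
      ultimately show ?thesis by simp
    qed
    show "H i c = 0" if "i < n" for i using Gc f0 by (simp add: H_def q_def)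
    show "im (c (m + k)) = 0" if "k < n" for k by (simp add: c_def)
    show "im (H i (cat m x y)) = 0"
      if x: "near m c \<rho> x" and y: "near n (\<lambda>k. c (m + k)) \<rho> y" and xr: "\<forall>l<m. im (x l) = 0" and yr: "\<forall>k<n. im (y k) = 0" for x y i
    proof -
      have n: "near p c \<rho> (cat m x y)" using x y by (simp add: p_def near_cat)
      \<comment> \<open>The real point behind \<open>cat m x y\<close>. There each
        \<open>G j\<close> takes a value of \<open>f\<close>, and since \<open>B\<close> has real
        entries, \<open>H i\<close> is real as well.\<close>
      define X where "X = vec p (\<lambda>i. re (cat m x y i))"
      have X: "of_R (X $ i) = cat m x y i" if "i < p" for i
        using that xr yr by (intro K_eqI) (auto simp: X_def cat_def p_def)
      have "\<bar>X $ i - q $ i\<bar> < \<rho>" if "i < p" for i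
        using n X[OF that] that by (simp add: near_def c_def flip: absK_of_R)
      then have "X \<in> polydisc abs p q \<rho>" by (simp add: polydisc_def X_def)
      then have Gr: "G j (\<lambda>i. of_R (X $ i)) = of_R (f X $ j)" if "j < n" for j by (rule Gf[OF that])
      have "G j (cat m x y) = of_R (f X $ j)" if j: "j < n" for j
        using K_holoD(2)[OF G[OF j], of "cat m x y" "\<lambda>i. of_R (X $ i)"] X Gr[OF j] by simp
      then show ?thesis by (simp add: H_def im_sum)
    qed
  qed (rule \<rho>(1))
  then obtain \<delta>1 \<delta>2 \<Phi> where \<delta>: "0 < \<delta>1" "\<delta>1 \<le> \<rho>" "0 < \<delta>2" "\<delta>2 \<le> \<rho>"
    and \<Phi>: "\<forall>k<n. K_holo m c \<delta>1 (\<lambda>x. \<Phi> x k)"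
    and sol: "\<forall>x. near m c \<delta>1 x \<longrightarrow> near n (\<lambda>k. c (m + k)) \<delta>2 (\<Phi> x) \<and>
      (\<forall>y. near n (\<lambda>k. c (m + k)) \<delta>2 y \<longrightarrow> ((\<forall>i<n. H i (cat m x y) = 0) \<longleftrightarrow> (\<forall>k<n. y k = \<Phi> x k))) \<and>
      ((\<forall>l<m. im (x l) = 0) \<longrightarrow> (\<forall>k<n. im (\<Phi> x k) = 0))"
    by (elim exE conjE)
  define V where "V = polydisc abs m a \<delta>1"
  define W where "W = polydisc abs n b \<delta>2"
  define \<iota> where "\<iota> = (\<lambda>(x :: 'r vec) i. of_R (x $ i))"
  define \<phi> where "\<phi> = (\<lambda>x. vec n (\<lambda>k. re (\<Phi> (\<iota> x) k)))"
  have nearV: "near m c \<delta>1 (\<iota> x)" if "x \<in> V" for x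
    using that by (simp add: V_def polydisc_def near_def \<iota>_def ca flip: of_R_simps(4))
  have nearW: "near n (\<lambda>k. c (m + k)) \<delta>2 (\<iota> y)" if "y \<in> W" for y
    using that by (simp add: W_def polydisc_def near_def \<iota>_def cb flip: of_R_simps(4))
  have real: "im (\<Phi> (\<iota> x) k) = 0" if "x \<in> V" "k < n" for x k
    using sol[rule_format, OF nearV[OF that(1)]] that(2) by (simp add: \<iota>_def)
  have inball: "x @\<^sub>v y \<in> polydisc abs p q \<rho>" if x: "x \<in> V" and y: "y \<in> W" for x y
  proof -
    have xa: "\<bar>x $ i - a $ i\<bar> < \<rho>" if "i < m" for i using x that \<delta>(2) by (auto simp: V_def polydisc_def less_le_trans)
    have yb: "\<bar>y $ i - b $ i\<bar> < \<rho>" if "i < n" for i using y that \<delta>(4) by (auto simp: W_def polydisc_def less_le_trans)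
    have xy: "x \<in> carrier_vec m" "y \<in> carrier_vec n" using x y by (simp_all add: V_def W_def polydisc_def)
    have "\<bar>(x @\<^sub>v y) $ i - q $ i\<bar> < \<rho>" if i: "i < p" for i
    proof (cases "i < m")
      case True
      then show ?thesis using xa xy a b by (simp add: q_def)
    next
      case False
      then show ?thesis using yb[of "i - m"] xy a b i by (simp add: q_def p_def less_diff_conv2)
    qed
    then show ?thesis using xy by (simp add: polydisc_def p_def)
  qed
  have "polydisc abs k u r \<subseteq> carrier_vec k" for k r and u :: "'r vec" by (auto simp: polydisc_def)
  then have "definable M m V" "definable M n W" unfolding definable_iff_dpred V_def W_def
    using dpred_polydisc by blast+
  moreover have "openV abs m V" "openV abs n W" unfolding V_def W_def using openV_polydisc \<delta> by blast+
  moreover have "a \<in> V" "b \<in> W" using a b \<delta> by (simp_all add: V_def W_def polydisc_def)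
  moreover have "\<forall>x\<in>V. \<forall>y\<in>W. x @\<^sub>v y \<in> U" using inball inU by blast
  moreover have "\<phi> \<in> C_omega_map M m n V"
  proof -
    have "(\<lambda>x. \<phi> x $ j) \<in> C_omega M m V" if j: "j < n" for j
    proof -
      have "(\<lambda>x. re (\<Phi> (\<lambda>i. of_R (x $ i)) j)) \<in> C_omega M m V" unfolding V_def
        by (rule C_omega_of_K_holo[OF \<Phi>[rule_format, OF j] \<delta>(1) a])
          (simp add: ca, rule real[unfolded \<iota>_def V_def, OF _ j])
      moreover have "(\<lambda>x. \<phi> x $ j) = (\<lambda>x. re (\<Phi> (\<lambda>i. of_R (x $ i)) j))" using j by (simp add: \<phi>_def \<iota>_def)
      ultimately show ?thesis by simp
    qed
    then show ?thesis by (simp add: C_omega_map_def \<phi>_def)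
  qed
  moreover have "\<phi> ` V \<subseteq> W"
  proof clarify
    fix x assume x: "x \<in> V"
    have n: "near n (\<lambda>k. c (m + k)) \<delta>2 (\<Phi> (\<iota> x))" using sol[rule_format, OF nearV[OF x]] by blast
    have "\<bar>re (\<Phi> (\<iota> x) k) - b $ k\<bar> < \<delta>2" if k: "k < n" for k
      using n k abs_re_le[of "\<Phi> (\<iota> x) k - c (m + k)"] by (fastforce simp: near_def cb)
    then show "\<phi> x \<in> W" by (simp add: W_def polydisc_def \<phi>_def)
  qed
  moreover have "\<forall>x\<in>V. \<forall>y\<in>W. f (x @\<^sub>v y) = 0\<^sub>v n \<longleftrightarrow> y = \<phi> x"
  proof (intro ballI)
    fix x y assume x: "x \<in> V" and y: "y \<in> W"
    have d: "dim_vec x = m" "dim_vec y = n" using x y by (auto simp: V_def W_def polydisc_def)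
    have "f (x @\<^sub>v y) \<in> carrier_vec n" using f inU[OF inball[OF x y]] by (simp add: C_omega_map_def)
    then have "f (x @\<^sub>v y) = 0\<^sub>v n \<longleftrightarrow> (\<forall>j<n. f (x @\<^sub>v y) $ j = 0)" by (auto intro: eq_vecI)
    also have "\<dots> \<longleftrightarrow> (\<forall>j<n. G j (cat m (\<iota> x) (\<iota> y)) = 0)"
    proof -
      have "G j (cat m (\<iota> x) (\<iota> y)) = of_R (f (x @\<^sub>v y) $ j)" if j: "j < n" for j
      proof -
        have "G j (cat m (\<iota> x) (\<iota> y)) = G j (\<lambda>i. of_R ((x @\<^sub>v y) $ i))"
          by (rule K_holoD(2)[OF G[OF j]]) (auto simp: cat_def \<iota>_def d p_def)
        then show ?thesis using Gf[OF j inball[OF x y]] by simp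
      qed
      then show ?thesis by simp
    qed
    also have "\<dots> \<longleftrightarrow> (\<forall>i<n. H i (cat m (\<iota> x) (\<iota> y)) = 0)" by (rule HG[symmetric])
    also have "\<dots> \<longleftrightarrow> (\<forall>k<n. \<iota> y k = \<Phi> (\<iota> x) k)" using sol[rule_format, OF nearV[OF x]] nearW[OF y] by blast
    also have "\<dots> \<longleftrightarrow> (\<forall>k<n. y $ k = re (\<Phi> (\<iota> x) k))"
    proof -
      have "\<iota> y k = \<Phi> (\<iota> x) k \<longleftrightarrow> y $ k = re (\<Phi> (\<iota> x) k)" if "k < n" for k
        using real[OF x that] by (cases "\<Phi> (\<iota> x) k") (simp add: \<iota>_def of_R_def)
      then show ?thesis by simp
    qed
    also have "\<dots> \<longleftrightarrow> y = \<phi> x"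
    proof
      assume "\<forall>k<n. y $ k = re (\<Phi> (\<iota> x) k)"
      then show "y = \<phi> x" unfolding \<phi>_def using d by (intro eq_vecI) auto
    next
      assume "y = \<phi> x"
      then have "y $ k = \<phi> x $ k" for k by simp
      then show "\<forall>k<n. y $ k = re (\<Phi> (\<iota> x) k)" by (simp add: \<phi>_def)
    qed
    finally show "f (x @\<^sub>v y) = 0\<^sub>v n \<longleftrightarrow> y = \<phi> x" .
  qed
  ultimately show ?thesis by - (rule exI[of _ V], rule exI[of _ W], rule exI[of _ \<phi>], intro conjI)
qed

end

theorem theorem1p14:
  fixes M :: "('f, 'p, 'r::real_closed_field) expansion"
    and m n :: nat
    and U :: "'r vec set"
    and f :: "'r vec \<Rightarrow> 'r vec"
    and a b :: "'r vec"
  assumes "o_minimal M"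
    and "openV abs (m + n) U"
    and "f \<in> C_omega_map M (m + n) n U"
    and "a \<in> carrier_vec m" and "b \<in> carrier_vec n" and "a @\<^sub>v b \<in> U"
    and "f (a @\<^sub>v b) = 0\<^sub>v n"
    and "invertible_mat
           (mat n n (\<lambda>(j, k). partial_deriv (m + n) (\<lambda>z. f z $ j) (m + k) (a @\<^sub>v b)))"
  shows "\<exists>V W \<phi>.
           definable M m V \<and> openV abs m V \<and> a \<in> V \<and>
           definable M n W \<and> openV abs n W \<and> b \<in> W \<and>
           (\<forall>x\<in>V. \<forall>y\<in>W. x @\<^sub>v y \<in> U) \<and>
           \<phi> \<in> C_omega_map M m n V \<and> \<phi> ` V \<subseteq> W \<and>
           (\<forall>x\<in>V. \<forall>y\<in>W. f (x @\<^sub>v y) = 0\<^sub>v n \<longleftrightarrow> y = \<phi> x)"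
proof -
  interpret o_minimal_expansion M by unfold_locales (rule assms(1))
  show ?thesis by (rule implicit_function[OF assms(2-8)])
qed

end
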